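(* Let $K$ be an algebraically closed field of characteristic $p>0$ and let $n\ge 1$. Then, up to right equivalence, there are only finitely many right simple singularities $f\in\mathfrak m^2\subset K[[x_1,\dots,x_n]]$ (with $\mu(f)<\infty$). For $p=2$, up to right equivalence, either no or exactly one right simple singularity $f\in\mathfrak m^2\subset K[[x_1,\dots,x_n]]$ exists.
   Context: $K[[\mathbf x]]=K[[x_1,\dots,x_n]]$, with maximal ideal $\mathfrak m$. The Milnor number is $\mu(f)=\dim_K K[[\mathbf x]]/j(f)$, with $j(f)$ the ideal generated by all partial derivatives of $f$. The right group is $\mathcal R=\mathrm{Aut}_K(K[[\mathbf x]])$; $f\sim_r g$ (right equivalent) means $g=\Phi(f)$ for some $\Phi\in\mathcal R$. Let $J_k:=\mathfrak m/\mathfrak m^{k+1}$ (an affine space), $j^k f$ the class of $f\in\mathfrak m$ in $J_k$, and $\mathcal R_k$ the affine algebraic group of $k$-jets $\Phi_k=(j^k\Phi(x_1),\dots,j^k\Phi(x_n))$ of elements $\Phi\in\mathcal R$, acting algebraically on $J_k$ by $\Phi_k\cdot j^kf=j^k(\Phi(f))$. Varieties are separated schemes of finite type over $K$, points are closed points. For an algebraic group $H$ acting on a variety $X$, a Rosenlicht stratification is a finite disjoint decomposition $X=X_1\cup\dots\cup X_s$ into $H$-invariant locally closed subvarieties, $X_i$ open dense in $X\setminus(X_1\cup\dots\cup X_{i-1})$, such that each $X_i$ has a geometric quotient $p_i:X_i\to X_i/H$ which is a variety (it always exists). For $U\subset X$ open put $H\text{-}\mathrm{mod}(U)=\max_i\dim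 p_i(U\cap X_i)$, and for $x\in X$ put $H\text{-}\mathrm{mod}(x)=\min\{H\text{-}\mathrm{mod}(U): U \text{ an open neighbourhood of }x\}$; these are independent of the stratification. A series $g\in\mathfrak m$ is right $k$-determined if every $h\in\mathfrak m$ with $j^kh=j^kg$ satisfies $h\sim_r g$. An integer $k$ is sufficiently large for $f$ w.r.t. $\mathcal R$ if there is a neighbourhood $U$ of $j^kf$ in $J_k$ such that every $g\in\mathfrak m$ with $j^kg\in U$ is right $k$-determined. For $f\in\mathfrak m$ with $\mu(f)<\infty$, the right modality $\mathcal R\text{-}\mathrm{mod}(f)$ is the $\mathcal R_k$-modality of the point $j^kf$ in $J_k$ for $k$ sufficiently large (such $k$ exist and the value is independent of $k$). $f$ is right simple if $\mathcal R\text{-}\mathrm{mod}(f)=0$. *)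

theory Defs
  imports
    "HOL-Library.FuncSet"
    "HOL-Analysis.Abstract_Topology"
    "HOL-Library.Poly_Mapping"
    "HOL-Library.Extended_Nat"
    "HOL-Computational_Algebra.Polynomial"
begin

section \<open>Formal power series in finitely many variables\<close>

text \<open>
  The variables are indexed by a finite type \<open>'n\<close>, so \<open>n = CARD('n) \<ge> 1\<close>; a monomial is
  its exponent vector in \<open>'n \<Rightarrow>\<^sub>0 nat\<close>.
\<close>

typedef ('n, 'k) mfps = "UNIV :: (('n \<Rightarrow>\<^sub>0 nat) \<Rightarrow> 'k) set"
  morphisms mfps_nth Abs_mfps ..

declare Abs_mfps_inverse [simplified, simp]

lemma mfps_eqI: "(\<And>a. mfps_nth f a = mfps_nth g a) \<Longrightarrow> f = g"
  by (rule iffD1[OF mfps_nth_inject]) (rule ext)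

definition splittings :: "('n \<Rightarrow>\<^sub>0 nat) \<Rightarrow> (('n \<Rightarrow>\<^sub>0 nat) \<times> ('n \<Rightarrow>\<^sub>0 nat)) set" where
  "splittings a = {(b, c). b + c = a}"

lemma finite_splittings: "finite (splittings (a :: 'n::finite \<Rightarrow>\<^sub>0 nat))"
proof -
  let ?B = "{b :: 'n \<Rightarrow>\<^sub>0 nat. \<forall>i. Poly_Mapping.lookup b i \<le> Poly_Mapping.lookup a i}"
  have "Poly_Mapping.lookup ` ?B \<subseteq> (\<Pi>\<^sub>E i\<in>UNIV. {..Poly_Mapping.lookup a i})"
    by (rule image_subsetI, rule PiE_I) simp_all
  moreover have "finite (\<Pi>\<^sub>E i\<in>(UNIV::'n set). {..Poly_Mapping.lookup a i})"
    by (intro finite_PiE) auto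
  ultimately have "finite (Poly_Mapping.lookup ` ?B)"
    by (rule finite_subset)
  then have fin: "finite ?B"
    by (rule finite_imageD) (simp add: inj_on_def lookup_inject)
  have "b \<in> ?B \<and> c \<in> ?B" if "b + c = a" for b c
    unfolding that[symmetric] by (simp add: lookup_add)
  then have "splittings a \<subseteq> ?B \<times> ?B"
    unfolding splittings_def by blast
  then show ?thesis
    using finite_subset[OF _ finite_cartesian_product[OF fin fin]] by simp
qed

instantiation mfps :: (finite, comm_ring_1) comm_ring_1
begin

definition "0 = Abs_mfps (\<lambda>a. 0)"
definition "1 = Abs_mfps (\<lambda>a. if a = 0 then 1 else 0)"
definition "f + g = Abs_mfps (\<lambda>a. mfps_nth f a + mfps_nth g a)"
definition "f - g = Abs_mfps (\<lambda>a. mfps_nth f a - mfps_nth g a)"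
definition "- f = Abs_mfps (\<lambda>a. - mfps_nth f a)"
definition "f * g = Abs_mfps (\<lambda>a. \<Sum>(b, c)\<in>splittings a. mfps_nth f b * mfps_nth g c)"

instance
proof
  fix f g h :: "('a, 'b) mfps"
  show "f * g * h = f * (g * h)"
  proof (rule mfps_eqI)
    fix a
    let ?F = "mfps_nth f" and ?G = "mfps_nth g" and ?H = "mfps_nth h"
    have "mfps_nth (f * g * h) a =
        (\<Sum>x\<in>splittings a. \<Sum>y\<in>splittings (fst x). ?F (fst y) * ?G (snd y) * ?H (snd x))"
      by (simp add: times_mfps_def case_prod_beta sum_distrib_right)
    also have "\<dots> = (\<Sum>(x, y)\<in>(SIGMA x:splittings a. splittings (fst x)).
        ?F (fst y) * ?G (snd y) * ?H (snd x))"
      by (intro sum.Sigma) (auto simp: finite_splittings)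
    also have "\<dots> = (\<Sum>(x, y)\<in>(SIGMA x:splittings a. splittings (snd x)).
        ?F (fst x) * (?G (fst y) * ?H (snd y)))"
      by (rule sum.reindex_bij_witness[where
            i = "\<lambda>((b, d), (e, c)). ((b + e, c), (b, e))" and
            j = "\<lambda>((d, c), (b, e)). ((b, e + c), (e, c))"])
        (auto simp: splittings_def add.assoc mult.assoc)
    also have "\<dots> = (\<Sum>x\<in>splittings a. \<Sum>y\<in>splittings (snd x). ?F (fst x) * (?G (fst y) * ?H (snd y)))"
      by (intro sum.Sigma[symmetric]) (auto simp: finite_splittings)
    also have "\<dots> = mfps_nth (f * (g * h)) a"
      by (simp add: times_mfps_def case_prod_beta sum_distrib_left)
    finally show "mfps_nth (f * g * h) a = mfps_nth (f * (g * h)) a" .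
  qed
  show "f * g = g * f"
  proof (rule mfps_eqI)
    fix a
    show "mfps_nth (f * g) a = mfps_nth (g * f) a"
      unfolding times_mfps_def Abs_mfps_inverse[OF UNIV_I]
      by (rule sum.reindex_bij_witness[where i = prod.swap and j = prod.swap])
        (auto simp: splittings_def add.commute mult.commute)
  qed
  show "1 * f = f"
  proof (rule mfps_eqI)
    fix a
    have "mfps_nth (1 * f) a =
        (\<Sum>x\<in>splittings a. if x = (0, a) then mfps_nth f a else 0)"
      unfolding times_mfps_def one_mfps_def Abs_mfps_inverse[OF UNIV_I]
    proof (rule sum.cong)
      fix x assume "x \<in> splittings a"
      then show "(case x of (b, c) \<Rightarrow> (if b = 0 then 1 else 0) * mfps_nth f c) =
          (if x = (0, a) then mfps_nth f a else 0)"
        by (cases "fst x = 0") (auto simp: splittings_def)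
    qed simp
    also have "\<dots> = mfps_nth f a"
      by (simp add: finite_splittings) (simp add: splittings_def)
    finally show "mfps_nth (1 * f) a = mfps_nth f a" .
  qed
  show "(f + g) * h = f * h + g * h"
    by (rule mfps_eqI)
      (simp add: times_mfps_def plus_mfps_def case_prod_beta distrib_right sum.distrib)
  show "(0 :: ('a, 'b) mfps) \<noteq> 1"
  proof
    assume "(0 :: ('a, 'b) mfps) = 1"
    then have "mfps_nth (0 :: ('a, 'b) mfps) 0 = mfps_nth 1 0" by simp
    then show False by (simp add: zero_mfps_def one_mfps_def)
  qed
qed (rule mfps_eqI,
      simp add: plus_mfps_def minus_mfps_def uminus_mfps_def zero_mfps_def algebra_simps)+

end

definition mfps_scale :: "'k \<Rightarrow> ('n, 'k) mfps \<Rightarrow> ('n, 'k::comm_ring_1) mfps" where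
  "mfps_scale c f = Abs_mfps (\<lambda>a. c * mfps_nth f a)"

definition mfps_var :: "'n \<Rightarrow> ('n, 'k::comm_ring_1) mfps" where
  "mfps_var i = Abs_mfps (\<lambda>a. if a = Poly_Mapping.single i 1 then 1 else 0)"

definition mfps_pderiv :: "'n \<Rightarrow> ('n, 'k) mfps \<Rightarrow> ('n, 'k::comm_ring_1) mfps" where
  "mfps_pderiv i f =
     Abs_mfps (\<lambda>a. of_nat (Poly_Mapping.lookup a i + 1) * mfps_nth f (a + Poly_Mapping.single i 1))"

global_interpretation mfps_vs: vector_space
    "mfps_scale :: 'k::field \<Rightarrow> ('n::finite, 'k) mfps \<Rightarrow> ('n, 'k) mfps"
  defines mfps_span = mfps_vs.span
  by unfold_locales
    (auto intro!: mfps_eqI simp: mfps_scale_def plus_mfps_def distrib_left distrib_right)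

global_interpretation mfps_ideal: module
    "(*) :: ('n::finite, 'k::field) mfps \<Rightarrow> ('n, 'k) mfps \<Rightarrow> ('n, 'k) mfps"
  defines mfps_ideal_gen = mfps_ideal.span
  by unfold_locales (auto simp: algebra_simps)

definition max_ideal :: "('n, 'k::comm_ring_1) mfps set" ("\<mm>") where
  "\<mm> = {f. mfps_nth f 0 = 0}"

definition max_ideal_sq :: "('n::finite, 'k::field) mfps set" where
  "max_ideal_sq = mfps_ideal_gen {f * g | f g. f \<in> \<mm> \<and> g \<in> \<mm>}"

text \<open>\<open>codim W\<close> is the dimension of the quotient by \<open>W\<close>, as the least number of elements
  whose classes span the quotient (\<open>\<infinity>\<close> if there is no finite spanning set).\<close>

definition codim :: "('n::finite, 'k::field) mfps set \<Rightarrow> enat" where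
  "codim W = (INF B\<in>{B. finite B \<and> mfps_span (B \<union> W) = UNIV}. enat (card B))"

definition jacobian_ideal :: "('n::finite, 'k::field) mfps \<Rightarrow> ('n, 'k) mfps set" where
  "jacobian_ideal f = mfps_ideal_gen (range (\<lambda>i. mfps_pderiv i f))"

definition milnor_number :: "('n::finite, 'k::field) mfps \<Rightarrow> enat" where
  "milnor_number f = codim (jacobian_ideal f)"

definition right_group :: "(('n::finite, 'k::field) mfps \<Rightarrow> ('n, 'k) mfps) set" where
  "right_group = {\<Phi>. bij \<Phi> \<and> \<Phi> 1 = 1 \<and> (\<forall>f g. \<Phi> (f + g) = \<Phi> f + \<Phi> g) \<and>
     (\<forall>f g. \<Phi> (f * g) = \<Phi> f * \<Phi> g) \<and> (\<forall>c f. \<Phi> (mfps_scale c f) = mfps_scale c (\<Phi> f))}"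

definition right_equiv :: "('n::finite, 'k::field) mfps \<Rightarrow> ('n, 'k) mfps \<Rightarrow> bool"
    (infix "\<sim>\<^sub>r" 50) where
  "f \<sim>\<^sub>r g \<longleftrightarrow> (\<exists>\<Phi>\<in>right_group. g = \<Phi> f)"

section \<open>Varieties as spaces with functions\<close>

text \<open>
  Varieties are taken in the classical sense: the topological space of closed points together
  with, for each open set \<open>V\<close>, the regular functions on \<open>V\<close>.  Regular functions
  are represented by total HOL functions, of which only the values on \<open>V\<close> matter.
\<close>

record ('x, 'k) fspace =
  fs_top :: "'x topology"
  reg_on :: "'x set \<Rightarrow> ('x \<Rightarrow> 'k) \<Rightarrow> bool"

abbreviation points :: "('x, 'k) fspace \<Rightarrow> 'x set" where
  "points A \<equiv> topspace (fs_top A)"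

definition sheaf_of_functions :: "('x, 'k) fspace \<Rightarrow> bool" where
  "sheaf_of_functions A \<longleftrightarrow>
     (\<forall>V \<phi>. reg_on A V \<phi> \<longrightarrow> openin (fs_top A) V) \<and>
     (\<forall>V \<phi> \<psi>. (\<forall>x\<in>V. \<phi> x = \<psi> x) \<longrightarrow> reg_on A V \<phi> \<longrightarrow> reg_on A V \<psi>) \<and>
     (\<forall>\<W> \<phi>. (\<forall>W\<in>\<W>. openin (fs_top A) W) \<longrightarrow>
        (reg_on A (\<Union>\<W>) \<phi> \<longleftrightarrow> (\<forall>W\<in>\<W>. reg_on A W \<phi>)))"

text \<open>The reduced structure induced on a subset (in practice, a locally closed one).\<close>

definition induced :: "('x, 'k) fspace \<Rightarrow> 'x set \<Rightarrow> ('x, 'k) fspace" where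
  "induced A S =
     \<lparr>fs_top = subtopology (fs_top A) S,
      reg_on = (\<lambda>V \<phi>. openin (subtopology (fs_top A) S) V \<and>
        (\<forall>x\<in>V. \<exists>W \<psi>. x \<in> W \<and> openin (fs_top A) W \<and> W \<inter> S \<subseteq> V \<and> reg_on A W \<psi> \<and>
           (\<forall>y\<in>W \<inter> S. \<phi> y = \<psi> y)))\<rparr>"

definition fspace_iso :: "('x, 'k) fspace \<Rightarrow> ('y, 'k) fspace \<Rightarrow> ('x \<Rightarrow> 'y) \<Rightarrow> bool" where
  "fspace_iso A B h \<longleftrightarrow> homeomorphic_map (fs_top A) (fs_top B) h \<and>
     (\<forall>V \<phi>. openin (fs_top B) V \<longrightarrow>
        (reg_on B V \<phi> \<longleftrightarrow> reg_on A {x \<in> points A. h x \<in> V} (\<phi> \<circ> h)))"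

text \<open>
  For a finite set \<open>D\<close> of coordinates, affine space \<open>K\<^sup>D\<close> is the set of vectors vanishing
  outside \<open>D\<close>.
\<close>

definition affine_space :: "'i set \<Rightarrow> ('i \<Rightarrow> 'k::field) set" where
  "affine_space D = {v. \<forall>i. i \<notin> D \<longrightarrow> v i = 0}"

inductive_set polyfun :: "(('i \<Rightarrow> 'k::field) \<Rightarrow> 'k) set" where
  const: "(\<lambda>v. c) \<in> polyfun"
| coord: "(\<lambda>v. v i) \<in> polyfun"
| add: "P \<in> polyfun \<Longrightarrow> Q \<in> polyfun \<Longrightarrow> (\<lambda>v. P v + Q v) \<in> polyfun"
| mult: "P \<in> polyfun \<Longrightarrow> Q \<in> polyfun \<Longrightarrow> (\<lambda>v. P v * Q v) \<in> polyfun"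

definition zero_locus :: "'i set \<Rightarrow> (('i \<Rightarrow> 'k::field) \<Rightarrow> 'k) set \<Rightarrow> ('i \<Rightarrow> 'k) set" where
  "zero_locus D F = {v \<in> affine_space D. \<forall>P\<in>F. P v = 0}"

definition zariski :: "'i set \<Rightarrow> ('i \<Rightarrow> 'k::field) topology" where
  "zariski D = topology (\<lambda>U. \<exists>F\<subseteq>polyfun. U = affine_space D - zero_locus D F)"

lemma openin_zariski:
  "openin (zariski D) U \<longleftrightarrow> (\<exists>F\<subseteq>polyfun. U = affine_space D - zero_locus D F)"
proof -
  have "istopology (\<lambda>U :: ('a \<Rightarrow> 'b) set. \<exists>F\<subseteq>polyfun. U = affine_space D - zero_locus D F)"
    unfolding istopology_def
  proof safe
    fix F G :: "(('a \<Rightarrow> 'b) \<Rightarrow> 'b) set"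
    assume "F \<subseteq> polyfun" "G \<subseteq> polyfun"
    then show "\<exists>E\<subseteq>polyfun. (affine_space D - zero_locus D F) \<inter> (affine_space D - zero_locus D G) =
        affine_space D - zero_locus D E"
    proof (intro exI conjI)
      let ?E = "(\<lambda>(P, Q) v. P v * Q v) ` (F \<times> G)"
      show "?E \<subseteq> polyfun"
        using \<open>F \<subseteq> polyfun\<close> \<open>G \<subseteq> polyfun\<close> by (auto intro!: polyfun.mult)
      show "(affine_space D - zero_locus D F) \<inter> (affine_space D - zero_locus D G) =
          affine_space D - zero_locus D ?E"
        by (auto simp: zero_locus_def)
    qed
  next
    fix \<U> :: "('a \<Rightarrow> 'b) set set"
    assume "\<forall>U\<in>\<U>. \<exists>F\<subseteq>polyfun. U = affine_space D - zero_locus D F"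
    then obtain F where F: "\<And>U. U \<in> \<U> \<Longrightarrow> F U \<subseteq> polyfun \<and> U = affine_space D - zero_locus D (F U)"
      by metis
    have "\<Union>\<U> = affine_space D - zero_locus D (\<Union>U\<in>\<U>. F U)"
    proof (intro equalityI subsetI)
      fix v assume "v \<in> \<Union>\<U>"
      then obtain U where U: "U \<in> \<U>" "v \<in> U" by blast
      then have "v \<in> affine_space D - zero_locus D (F U)" using F by blast
      then show "v \<in> affine_space D - zero_locus D (\<Union>U\<in>\<U>. F U)"
        using U by (auto simp: zero_locus_def)
    next
      fix v assume "v \<in> affine_space D - zero_locus D (\<Union>U\<in>\<U>. F U)"
      then obtain U where U: "U \<in> \<U>" "v \<in> affine_space D - zero_locus D (F U)"
        by (auto simp: zero_locus_def)
      then show "v \<in> \<Union>\<U>" using F by blast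
    qed
    moreover have "(\<Union>U\<in>\<U>. F U) \<subseteq> polyfun" using F by blast
    ultimately show "\<exists>F\<subseteq>polyfun. \<Union>\<U> = affine_space D - zero_locus D F" by blast
  qed
  then show ?thesis
    by (simp add: zariski_def topology_inverse')
qed

definition affine_fspace :: "'i set \<Rightarrow> ('i \<Rightarrow> 'k::field, 'k) fspace" where
  "affine_fspace D =
     \<lparr>fs_top = zariski D,
      reg_on = (\<lambda>V \<phi>. openin (zariski D) V \<and>
        (\<forall>x\<in>V. \<exists>W P Q. x \<in> W \<and> openin (zariski D) W \<and> W \<subseteq> V \<and> P \<in> polyfun \<and> Q \<in> polyfun \<and>
           (\<forall>y\<in>W. Q y \<noteq> 0 \<and> \<phi> y = P y / Q y)))\<rparr>"

definition affine_chart ::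
    "('x, 'k::field) fspace \<Rightarrow> 'x set \<Rightarrow> nat \<Rightarrow> ('x \<Rightarrow> nat \<Rightarrow> 'k) \<Rightarrow> bool" where
  "affine_chart Y U m h \<longleftrightarrow> openin (fs_top Y) U \<and>
     (\<exists>C. closedin (zariski {..<m}) C \<and>
        fspace_iso (induced Y U) (induced (affine_fspace {..<m}) C) h)"

text \<open>
  Separatedness says that the diagonal is closed in \<open>Y \<times> Y\<close>, tested on the open cover of
  \<open>Y \<times> Y\<close> by products \<open>U \<times> V\<close> of affine opens, whose topology is that of a
  closed subset of \<open>K\<^sup>m \<times> K\<^sup>l\<close>.
\<close>

definition separated :: "('x, 'k::field) fspace \<Rightarrow> bool" where
  "separated Y \<longleftrightarrow>
     (\<forall>U m h V l g. affine_chart Y U m h \<longrightarrow> affine_chart Y V l g \<longrightarrow>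
        closedin
          (subtopology (zariski ({..<m} <+> {..<l})) {case_sum a b | a b. a \<in> h ` U \<and> b \<in> g ` V})
          ((\<lambda>y. case_sum (h y) (g y)) ` (U \<inter> V)))"

definition is_variety :: "('x, 'k::field) fspace \<Rightarrow> bool" where
  "is_variety Y \<longleftrightarrow> sheaf_of_functions Y \<and>
     (\<exists>\<U>. finite \<U> \<and> \<Union>\<U> = points Y \<and> (\<forall>U\<in>\<U>. \<exists>m h. affine_chart Y U m h)) \<and>
     separated Y"

definition irreducible_set :: "'x topology \<Rightarrow> 'x set \<Rightarrow> bool" where
  "irreducible_set T C \<longleftrightarrow> C \<subseteq> topspace T \<and> C \<noteq> {} \<and>
     (\<forall>A B. closedin T A \<longrightarrow> closedin T B \<longrightarrow> C \<subseteq> A \<union> B \<longrightarrow> C \<subseteq> A \<or> C \<subseteq> B)"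

text \<open>Krull dimension; the empty space gets dimension \<open>0\<close>, which does not affect
  the maxima below: a neighbourhood of a point meets some stratum.\<close>

definition krull_dim :: "'x topology \<Rightarrow> enat" where
  "krull_dim T = (SUP r\<in>{r. \<exists>C :: nat \<Rightarrow> 'x set.
      (\<forall>i\<le>r. closedin T (C i) \<and> irreducible_set T (C i)) \<and> (\<forall>i<r. C i \<subset> C (Suc i))}. enat r)"

section \<open>Modality of a group action\<close>

text \<open>
  An action is given by the set \<open>H\<close> of group elements and the map \<open>act\<close>.
  The last clause of the definition says \<open>O\<^sub>Y = (p\<^sub>* O\<^sub>X)\<^sup>H\<close>: an invariant function on the
  saturated set \<open>p\<^sup>-\<^sup>1(V)\<close> is one of the form \<open>\<phi> \<circ> p\<close>.
\<close>

definition geometric_quotient ::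
    "'h set \<Rightarrow> ('h \<Rightarrow> 'x \<Rightarrow> 'x) \<Rightarrow> ('x, 'k) fspace \<Rightarrow> ('y, 'k) fspace \<Rightarrow> ('x \<Rightarrow> 'y) \<Rightarrow> bool" where
  "geometric_quotient H act X Y p \<longleftrightarrow>
     quotient_map (fs_top X) (fs_top Y) p \<and>
     (\<forall>x\<in>points X. \<forall>y\<in>points X. p x = p y \<longleftrightarrow> (\<exists>h\<in>H. act h x = y)) \<and>
     (\<forall>V \<phi>. openin (fs_top Y) V \<longrightarrow>
        (reg_on Y V \<phi> \<longleftrightarrow> reg_on X {x \<in> points X. p x \<in> V} (\<phi> \<circ> p)))"

definition locally_closed_in :: "'x topology \<Rightarrow> 'x set \<Rightarrow> bool" where
  "locally_closed_in T S \<longleftrightarrow> (\<exists>U C. openin T U \<and> closedin T C \<and> S = U \<inter> C)"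

text \<open>
  A stratum is a triple \<open>(X\<^sub>i, X\<^sub>i/H, p\<^sub>i)\<close>.  The points of the quotient are taken in the type
  \<open>'x set\<close>, which is no restriction since they correspond to orbits.
\<close>

type_synonym ('x, 'k) stratum = "'x set \<times> ('x set, 'k) fspace \<times> ('x \<Rightarrow> 'x set)"

definition rosenlicht_stratification ::
    "'h set \<Rightarrow> ('h \<Rightarrow> 'x \<Rightarrow> 'x) \<Rightarrow> ('x, 'k::field) fspace \<Rightarrow> ('x, 'k) stratum list \<Rightarrow> bool" where
  "rosenlicht_stratification H act X S \<longleftrightarrow>
     (\<Union>(Xi, Yi, q)\<in>set S. Xi) = points X \<and>
     (\<forall>i<length S. case S ! i of (Xi, Yi, q) \<Rightarrow>
        let R = points X - (\<Union>j<i. fst (S ! j)) in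
          Xi \<subseteq> R \<and>
          locally_closed_in (fs_top X) Xi \<and>
          (\<forall>h\<in>H. \<forall>x\<in>Xi. act h x \<in> Xi) \<and>
          openin (subtopology (fs_top X) R) Xi \<and>
          (subtopology (fs_top X) R) closure_of Xi = R \<and>
          is_variety Yi \<and>
          geometric_quotient H act (induced X Xi) Yi q)"

definition stratified_modality :: "('x, 'k) stratum list \<Rightarrow> 'x set \<Rightarrow> enat" where
  "stratified_modality S U =
     (SUP (Xi, Yi, q)\<in>set S. krull_dim (subtopology (fs_top Yi) (q ` (U \<inter> Xi))))"

text \<open>
  The value of \<open>stratified_modality S U\<close> does not depend on the stratification \<open>S\<close>; the
  infimum picks out this common value (and is \<open>\<infinity>\<close> if there is no stratification).
\<close>

definition open_modality ::
    "'h set \<Rightarrow> ('h \<Rightarrow> 'x \<Rightarrow> 'x) \<Rightarrow> ('x, 'k::field) fspace \<Rightarrow> 'x set \<Rightarrow> enat" where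
  "open_modality H act X U =
     (INF S\<in>{S. rosenlicht_stratification H act X S}. stratified_modality S U)"

definition point_modality ::
    "'h set \<Rightarrow> ('h \<Rightarrow> 'x \<Rightarrow> 'x) \<Rightarrow> ('x, 'k::field) fspace \<Rightarrow> 'x \<Rightarrow> enat" where
  "point_modality H act X x = (INF U\<in>{U. openin (fs_top X) U \<and> x \<in> U}. open_modality H act X U)"

section \<open>Jets and right modality\<close>

text \<open>
  The class of \<open>f \<in> \<mm>\<close> in \<open>J\<^sub>k = \<mm> / \<mm>\<^sup>k\<^sup>+\<^sup>1\<close> is represented by the
  coefficients of \<open>f\<close> in degrees \<open>1, \<dots>, k\<close>, so that \<open>J\<^sub>k\<close> is the affine space with
  coordinates \<open>jet_index k\<close>.
\<close>

definition mdeg :: "('n::finite \<Rightarrow>\<^sub>0 nat) \<Rightarrow> nat" where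
  "mdeg a = (\<Sum>i\<in>UNIV. Poly_Mapping.lookup a i)"

definition jet_index :: "nat \<Rightarrow> ('n::finite \<Rightarrow>\<^sub>0 nat) set" where
  "jet_index k = {a. 1 \<le> mdeg a \<and> mdeg a \<le> k}"

definition jet :: "nat \<Rightarrow> ('n::finite, 'k::field) mfps \<Rightarrow> ('n \<Rightarrow>\<^sub>0 nat) \<Rightarrow> 'k" where
  "jet k f = (\<lambda>a. if a \<in> jet_index k then mfps_nth f a else 0)"

definition jet_space :: "nat \<Rightarrow> (('n::finite \<Rightarrow>\<^sub>0 nat) \<Rightarrow> 'k::field, 'k) fspace" where
  "jet_space k = affine_fspace (jet_index k)"

definition aut_jet ::
    "nat \<Rightarrow> (('n::finite, 'k::field) mfps \<Rightarrow> ('n, 'k) mfps) \<Rightarrow> 'n \<Rightarrow> ('n \<Rightarrow>\<^sub>0 nat) \<Rightarrow> 'k" where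
  "aut_jet k \<Phi> = (\<lambda>i. jet k (\<Phi> (mfps_var i)))"

definition right_group_jets :: "nat \<Rightarrow> ('n::finite \<Rightarrow> ('n \<Rightarrow>\<^sub>0 nat) \<Rightarrow> 'k::field) set" where
  "right_group_jets k = aut_jet k ` right_group"

text \<open>
  The action \<open>\<Phi>\<^sub>k \<cdot> j\<^sup>k f = j\<^sup>k (\<Phi> f)\<close>.  A jet \<open>v\<close> is its own polynomial representative,
  and the result depends only on the \<open>k\<close>-jet of the automorphism that is chosen.
\<close>

definition jet_act ::
    "nat \<Rightarrow> ('n::finite \<Rightarrow> ('n \<Rightarrow>\<^sub>0 nat) \<Rightarrow> 'k::field) \<Rightarrow>
      (('n \<Rightarrow>\<^sub>0 nat) \<Rightarrow> 'k) \<Rightarrow> ('n \<Rightarrow>\<^sub>0 nat) \<Rightarrow> 'k" where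
  "jet_act k T v = jet k ((SOME \<Phi>. \<Phi> \<in> right_group \<and> aut_jet k \<Phi> = T) (Abs_mfps v))"

definition right_determined :: "nat \<Rightarrow> ('n::finite, 'k::field) mfps \<Rightarrow> bool" where
  "right_determined k g \<longleftrightarrow> (\<forall>h\<in>\<mm>. jet k h = jet k g \<longrightarrow> h \<sim>\<^sub>r g)"

definition sufficiently_large :: "nat \<Rightarrow> ('n::finite, 'k::field) mfps \<Rightarrow> bool" where
  "sufficiently_large k f \<longleftrightarrow>
     (\<exists>U. openin (fs_top (jet_space k)) U \<and> jet k f \<in> U \<and>
        (\<forall>g\<in>\<mm>. jet k g \<in> U \<longrightarrow> right_determined k g))"

text \<open>
  For \<open>f \<in> \<mm>\<close> with finite Milnor number, the modality of \<open>jet k f\<close> is the same for all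
  sufficiently large \<open>k\<close>; again the infimum picks out the common value.
\<close>

definition right_modality :: "('n::finite, 'k::field) mfps \<Rightarrow> enat" where
  "right_modality f =
     (INF k\<in>{k. sufficiently_large k f}.
        point_modality (right_group_jets k) (jet_act k) (jet_space k) (jet k f))"

definition right_simple :: "('n::finite, 'k::field) mfps \<Rightarrow> bool" where
  "right_simple f \<longleftrightarrow> right_modality f = 0"

definition right_simple_singularities :: "('n::finite, 'k::field) mfps set" where
  "right_simple_singularities = {f \<in> max_ideal_sq. milnor_number f < \<infinity> \<and> right_simple f}"

definition right_simple_classes :: "('n::finite, 'k::field) mfps set set" where
  "right_simple_classes = right_simple_singularities // {(f, g). f \<sim>\<^sub>r g}"

end

theory Submission
  imports Defs "HOL-Library.Function_Algebras" "HOL-Analysis.T1_Spaces"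
begin

text \<open>
  A right simple series has a Zariski neighbourhood that meets only finitely many classes. On the
  other hand, a polynomial family of series whose number of parameters exceeds the dimension of the
  group of graded automorphisms acting on it cannot be covered by finitely many classes. Since
  being near finitely many classes is an open condition, a suspected simple singularity may be
  perturbed until such a family appears. In characteristic \<open>p > 2\<close> this excludes all normal forms
  except those whose Jacobian ideal contains \<open>\<mm>\<^bsup>p + 9\<^esup>\<close>; those are
  determined by their jets of order \<open>2 (p + 9)\<close>, and the jet space is quasi-compact. In
  characteristic \<open>2\<close> the Hessian is alternating, and only a nondegenerate one survives; then the
  series is equivalent to \<open>x\<^sub>1 x\<^sub>2 + x\<^sub>3 x\<^sub>4 + \<dots>\<close>.
\<close>

text \<open>Parameters cannot be counted for the whole right group, whose jets have ever more of
  them as the order grows. The count is made for leading parts instead: an automorphism that carries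
  one member of the family to another is shown to respect a weight filtration, and then only its
  graded part acts on the coefficients in question. The peculiarity of characteristic p is that a
  pure power x^p has zero derivative and that, by Frobenius, its image depends on the graded part
  alone up to high weight; it is an additional parameter of unusually low degree. This keeps the
  orders of the one-variable parts in the A and D forms below p and, in characteristic 2, sets six
  parameters against the four of GL_2. The other obstacle is uniformity: simplicity gives each
  series some order of determinacy, but one jet space must serve all. The number p + 9 provides the
  common bound: p covers A and D, while for an E form x^4 and y^5 lie in the Jacobian ideal up to
  higher order, so that degree 8 suffices there. The individual order of determinacy, however large,
  makes the removal of higher terms a finite induction, and no limit of automorphisms is
  formed.\<close>

declare One_nat_def [simp del]

abbreviation single :: "'n \<Rightarrow> nat \<Rightarrow> 'n \<Rightarrow>\<^sub>0 nat" where "single \<equiv> Poly_Mapping.single"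
abbreviation lookup :: "('n \<Rightarrow>\<^sub>0 nat) \<Rightarrow> 'n \<Rightarrow> nat" where "lookup \<equiv> Poly_Mapping.lookup"


section \<open>Coefficients, monomials and filtrations\<close>

lemma nth_Abs [simp]: "mfps_nth (Abs_mfps f) = f" by simp

lemma nth_zero [simp]: "mfps_nth (0 :: ('n::finite, 'k::comm_ring_1) mfps) a = 0"
  by (simp add: zero_mfps_def)

lemma nth_one: "mfps_nth (1 :: ('n::finite, 'k::comm_ring_1) mfps) a = (if a = 0 then 1 else 0)"
  by (simp add: one_mfps_def)

lemma nth_add [simp]: "mfps_nth (f + g :: ('n::finite, 'k::comm_ring_1) mfps) a = mfps_nth f a + mfps_nth g a"
  by (simp add: plus_mfps_def)

lemma nth_diff [simp]: "mfps_nth (f - g :: ('n::finite, 'k::comm_ring_1) mfps) a = mfps_nth f a - mfps_nth g a"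
  by (simp add: minus_mfps_def)

lemma nth_uminus [simp]: "mfps_nth (- f :: ('n::finite, 'k::comm_ring_1) mfps) a = - mfps_nth f a"
  by (simp add: uminus_mfps_def)

lemma nth_scale [simp]: "mfps_nth (mfps_scale c f :: ('n::finite, 'k::comm_ring_1) mfps) a = c * mfps_nth f a"
  by (simp add: mfps_scale_def)

lemma nth_pderiv: "mfps_nth (mfps_pderiv i f :: ('n::finite, 'k::comm_ring_1) mfps) a =
    of_nat (lookup a i + 1) * mfps_nth f (a + single i 1)"
  by (simp add: mfps_pderiv_def)

lemma nth_mult: "mfps_nth (f * g :: ('n::finite, 'k::comm_ring_1) mfps) a =
    (\<Sum>(b, c)\<in>splittings a. mfps_nth f b * mfps_nth g c)"
  by (simp add: times_mfps_def)

lemma nth_sum [simp]: "mfps_nth (sum f A :: ('n::finite, 'k::comm_ring_1) mfps) a = (\<Sum>x\<in>A. mfps_nth (f x) a)"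
  by (induction A rule: infinite_finite_induct) auto

section \<open>Monomials, scalars, weighted degrees and orders of vanishing\<close>

definition mon :: "('n::finite \<Rightarrow>\<^sub>0 nat) \<Rightarrow> ('n, 'k::comm_ring_1) mfps" where
  "mon a = Abs_mfps (\<lambda>b. if b = a then 1 else 0)"

lemma nth_mon: "mfps_nth (mon a) b = (if b = a then 1 else 0)"
  by (simp add: mon_def)

lemma mon_zero: "mon 0 = 1"
  by (rule mfps_eqI) (simp add: nth_mon nth_one)

lemma var_eq_mon: "mfps_var i = mon (single i 1)"
  by (simp add: mfps_var_def mon_def)

lemma nth_mon_mult: "mfps_nth (mon a * f) (a + b) = mfps_nth (f :: ('n::finite, 'k::comm_ring_1) mfps) b"
proof -
  have "mfps_nth (mon a * f) (a + b) = (\<Sum>x\<in>splittings (a + b). if x = (a, b) then mfps_nth f b else 0)"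
    unfolding nth_mult by (rule sum.cong) (auto simp: nth_mon splittings_def split: if_splits)
  also have "\<dots> = mfps_nth f b"
    by (simp add: finite_splittings) (simp add: splittings_def)
  finally show ?thesis .
qed

lemma nth_mon_mult_0:
  assumes "\<nexists>b. c = a + b"
  shows "mfps_nth (mon a * (f :: ('n::finite, 'k::comm_ring_1) mfps)) c = 0"
  unfolding nth_mult using assms by (intro sum.neutral) (auto simp: nth_mon splittings_def)

lemma mon_mult: "mon a * mon b = (mon (a + b) :: ('n::finite, 'k::comm_ring_1) mfps)"
proof (rule mfps_eqI)
  fix c
  show "mfps_nth (mon a * mon b) c = mfps_nth (mon (a + b) :: ('n, 'k) mfps) c"
    by (cases "\<exists>d. c = a + d") (auto simp: nth_mon_mult nth_mon_mult_0 nth_mon)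
qed

lemma scale_mult_left: "mfps_scale c f * g = mfps_scale c (f * g :: ('n::finite, 'k::comm_ring_1) mfps)"
  by (rule mfps_eqI) (simp add: nth_mult sum_distrib_left case_prod_beta mult.assoc)

lemma scale_mult_right: "f * mfps_scale c g = mfps_scale c (f * g :: ('n::finite, 'k::comm_ring_1) mfps)"
  using scale_mult_left[of c g f] by (simp add: mult.commute)

lemma scale_add: "mfps_scale c (f + g :: ('n::finite, 'k::comm_ring_1) mfps) = mfps_scale c f + mfps_scale c g"
  by (rule mfps_eqI) (simp add: algebra_simps)

lemma scale_scale: "mfps_scale c (mfps_scale d f :: ('n::finite, 'k::comm_ring_1) mfps) = mfps_scale (c * d) f"
  by (rule mfps_eqI) (simp add: algebra_simps)

lemma scale_one [simp]: "mfps_scale 1 (f :: ('n::finite, 'k::comm_ring_1) mfps) = f"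
  by (rule mfps_eqI) simp

lemma scale_zero [simp]: "mfps_scale 0 (f :: ('n::finite, 'k::comm_ring_1) mfps) = 0"
  by (rule mfps_eqI) simp

lemma scale_zero_right [simp]: "mfps_scale c (0 :: ('n::finite, 'k::comm_ring_1) mfps) = 0"
  by (rule mfps_eqI) simp

lemma scale_eq_mult: "mfps_scale c f = mfps_scale c 1 * (f :: ('n::finite, 'k::comm_ring_1) mfps)"
  by (simp add: scale_mult_left)

text \<open>Arbitrary weights are allowed, because the criterion for infinitely many classes works
  with weights adapted to a set of distinguished variables; constant weight 1 gives the ordinary
  degree.\<close>

definition wt :: "('n::finite \<Rightarrow> nat) \<Rightarrow> ('n \<Rightarrow>\<^sub>0 nat) \<Rightarrow> nat" where
  "wt w a = (\<Sum>i\<in>UNIV. w i * lookup a i)"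

lemma wt_add [simp]: "wt w (a + b) = wt w a + wt w b"
  by (simp add: wt_def lookup_add algebra_simps sum.distrib)

lemma wt_zero [simp]: "wt w 0 = 0" by (simp add: wt_def)

lemma wt_single [simp]: "wt w (single i m) = w i * m"
proof -
  have "wt w (single i m) = (\<Sum>j\<in>UNIV. if j = i then w i * m else 0)"
    unfolding wt_def by (rule sum.cong) (auto simp: lookup_single)
  then show ?thesis by simp
qed

lemma mdeg_eq_wt: "mdeg a = wt (\<lambda>_. 1) a"
  by (simp add: mdeg_def wt_def)

lemma mdeg_add [simp]: "mdeg (a + b) = mdeg a + mdeg b" by (simp add: mdeg_eq_wt)
lemma mdeg_zero [simp]: "mdeg 0 = 0" by (simp add: mdeg_eq_wt)
lemma mdeg_single [simp]: "mdeg (single i m) = m" by (simp add: mdeg_eq_wt)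

lemma lookup_le_mdeg: "lookup a i \<le> mdeg (a :: 'n::finite \<Rightarrow>\<^sub>0 nat)"
  unfolding mdeg_def by (rule member_le_sum) auto

lemma finite_mdeg_le: "finite {a :: 'n::finite \<Rightarrow>\<^sub>0 nat. mdeg a \<le> N}"
proof -
  have "lookup ` {a :: 'n \<Rightarrow>\<^sub>0 nat. mdeg a \<le> N} \<subseteq> (\<Pi>\<^sub>E i\<in>UNIV. {..N})"
    using lookup_le_mdeg le_trans by (fastforce intro!: PiE_I)
  moreover have "finite (\<Pi>\<^sub>E i\<in>(UNIV::'n set). {..N})"
    by (intro finite_PiE) auto
  ultimately have "finite (lookup ` {a :: 'n \<Rightarrow>\<^sub>0 nat. mdeg a \<le> N})"
    by (rule finite_subset)
  then show ?thesis by (rule finite_imageD) (simp add: inj_on_def lookup_inject)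
qed

lemma finite_mdeg_less: "finite {a :: 'n::finite \<Rightarrow>\<^sub>0 nat. mdeg a < N}"
  by (rule finite_subset[OF _ finite_mdeg_le[of N]]) auto

lemma finite_jet_index: "finite (jet_index k)"
  unfolding jet_index_def by (rule finite_subset[OF _ finite_mdeg_le[of k]]) auto

lemma mdeg_eq_0_iff: "mdeg a = 0 \<longleftrightarrow> a = (0 :: 'n::finite \<Rightarrow>\<^sub>0 nat)"
  by (auto simp: mdeg_def poly_mapping_eq_iff fun_eq_iff)

lemma exists_single_add:
  assumes "lookup (a :: 'n \<Rightarrow>\<^sub>0 nat) i > 0"
  shows "\<exists>b. a = b + single i 1"
proof
  show "a = (a - single i 1) + single i 1"
    using assms by (intro poly_mapping_eqI) (auto simp: lookup_add lookup_minus lookup_single when_def)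
qed

lemma mdeg_induct [case_names zero add]:
  assumes "P 0" and "\<And>a i. P a \<Longrightarrow> P (a + single i 1)"
  shows "P (a :: 'n::finite \<Rightarrow>\<^sub>0 nat)"
proof (induction "mdeg a" arbitrary: a)
  case 0
  then show ?case using assms(1) mdeg_eq_0_iff by metis
next
  case (Suc n)
  then have "a \<noteq> 0" by auto
  then obtain i where "lookup a i > 0"
    by (metis gr0I poly_mapping_eqI lookup_zero)
  then obtain b where b: "a = b + single i 1" using exists_single_add[of a i] by blast
  then have "n = mdeg b" using Suc(2) by simp
  then show ?case using Suc(1) assms(2) b by blast
qed

text \<open>Weight \<open>1\<close> gives the powers of the maximal ideal.\<close>

definition filt :: "('n::finite \<Rightarrow> nat) \<Rightarrow> nat \<Rightarrow> ('n, 'k::comm_ring_1) mfps set" where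
  "filt w s = {f. \<forall>a. mfps_nth f a \<noteq> 0 \<longrightarrow> s \<le> wt w a}"

abbreviation mpower :: "nat \<Rightarrow> ('n::finite, 'k::comm_ring_1) mfps set" where
  "mpower \<equiv> filt (\<lambda>_. 1)"

lemma filtI: "(\<And>a. wt w a < s \<Longrightarrow> mfps_nth f a = 0) \<Longrightarrow> f \<in> filt w s"
  by (force simp: filt_def)

lemma filtD: "f \<in> filt w s \<Longrightarrow> wt w a < s \<Longrightarrow> mfps_nth f a = 0"
  by (force simp: filt_def)

lemma mpowerD: "f \<in> mpower s \<Longrightarrow> mdeg a < s \<Longrightarrow> mfps_nth f a = 0"
  by (auto simp: mdeg_eq_wt intro: filtD)

lemma mpowerI: "(\<And>a. mdeg a < s \<Longrightarrow> mfps_nth f a = 0) \<Longrightarrow> f \<in> mpower s"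
  by (auto simp: mdeg_eq_wt intro: filtI)

lemma filt_zero [simp]: "0 \<in> filt w s" by (simp add: filt_def)
lemma filt_0 [simp]: "f \<in> filt w 0" by (simp add: filt_def)

lemma filt_add: "f \<in> filt w s \<Longrightarrow> g \<in> filt w s \<Longrightarrow> f + g \<in> filt w s"
  by (rule filtI) (simp add: filtD)

lemma filt_diff: "f \<in> filt w s \<Longrightarrow> g \<in> filt w s \<Longrightarrow> f - g \<in> filt w s"
  by (rule filtI) (simp add: filtD)

lemma filt_uminus: "f \<in> filt w s \<Longrightarrow> - f \<in> filt w s"
  by (rule filtI) (simp add: filtD)

lemma filt_scale: "f \<in> filt w s \<Longrightarrow> mfps_scale c f \<in> filt w s"
  by (rule filtI) (simp add: filtD)

lemma filt_sum: "(\<And>x. x \<in> A \<Longrightarrow> f x \<in> filt w s) \<Longrightarrow> sum f A \<in> filt w s"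
  by (induction A rule: infinite_finite_induct) (auto intro: filt_add)

lemma filt_mono: "f \<in> filt w s \<Longrightarrow> t \<le> s \<Longrightarrow> f \<in> filt w t"
  by (rule filtI) (simp add: filtD)

lemma filt_mult:
  assumes "f \<in> filt w s" "g \<in> filt w t"
  shows "f * g \<in> filt w (s + t)"
proof (rule filtI)
  fix a assume a: "wt w a < s + t"
  have "mfps_nth f b * mfps_nth g c = 0" if "b + c = a" for b c
  proof (cases "wt w b < s")
    case True then show ?thesis using filtD[OF assms(1)] by simp
  next
    case False
    then have "wt w c < t" using a that[symmetric] by simp
    then show ?thesis using filtD[OF assms(2)] by simp
  qed
  then show "mfps_nth (f * g) a = 0"
    unfolding nth_mult by (intro sum.neutral) (auto simp: splittings_def)
qed

lemma filt_mult_right: "f \<in> filt w s \<Longrightarrow> f * g \<in> filt w s"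
  using filt_mult[of f w s g 0] by simp

lemma filt_mult_left: "g \<in> filt w s \<Longrightarrow> f * g \<in> filt w s"
  using filt_mult[of f w 0 g s] by simp

lemma filt_mult_le: "f \<in> filt w s \<Longrightarrow> g \<in> filt w t \<Longrightarrow> u \<le> s + t \<Longrightarrow> f * g \<in> filt w u"
  using filt_mult filt_mono by blast

lemma filt_power: "f \<in> filt w s \<Longrightarrow> f ^ m \<in> filt w (m * s)"
  by (induction m) (auto intro: filt_mult)

lemma filt_prod: "(\<And>x. x \<in> A \<Longrightarrow> f x \<in> filt w (s x)) \<Longrightarrow> prod f A \<in> filt w (sum s A)"
  by (induction A rule: infinite_finite_induct) (auto intro: filt_mult)

lemma mon_in_filt: "mon a \<in> filt w s \<longleftrightarrow> s \<le> wt w a" for a :: "'n::finite \<Rightarrow>\<^sub>0 nat"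
  by (auto simp: filt_def nth_mon)

lemma mon_mem_filt: "s \<le> wt w a \<Longrightarrow> (mon a :: ('n::finite,'k::comm_ring_1) mfps) \<in> filt w s"
  by (simp add: mon_in_filt)

lemma max_ideal_eq: "max_ideal = (mpower 1 :: ('n::finite, 'k::comm_ring_1) mfps set)"
proof -
  have "wt (\<lambda>_. 1) a < 1 \<longleftrightarrow> a = 0" for a :: "'n \<Rightarrow>\<^sub>0 nat"
    using mdeg_eq_0_iff[of a] by (simp add: mdeg_eq_wt)
  then have "1 \<le> wt (\<lambda>_. 1) a \<longleftrightarrow> a \<noteq> 0" for a :: "'n \<Rightarrow>\<^sub>0 nat" by (metis not_le)
  then show ?thesis by (auto simp: max_ideal_def filt_def)
qed

lemma var_in_filt: "s \<le> w i \<Longrightarrow> mfps_var i \<in> filt w s"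
  by (simp add: var_eq_mon mon_in_filt)

lemma filt_eq_0:
  assumes "\<And>N. f \<in> mpower N" shows "f = 0"
  by (rule mfps_eqI) (use mpowerD[OF assms] in auto)

text \<open>Each nonconstant monomial is charged to one chosen variable \<open>\<iota> a\<close>
  dividing it, so that the sum over the variables counts every coefficient exactly once.\<close>

lemma mpower_Suc_decomp:
  fixes f :: "('n::finite, 'k::comm_ring_1) mfps"
  assumes "f \<in> mpower (Suc N)"
  shows "\<exists>g. (\<forall>i. g i \<in> mpower N) \<and> f = (\<Sum>i\<in>UNIV. mfps_var i * g i)"
proof -
  define \<iota> where "\<iota> a = (SOME i. lookup a i > 0)" for a :: "'n \<Rightarrow>\<^sub>0 nat"
  have \<iota>: "lookup a (\<iota> a) > 0" if "a \<noteq> 0" for a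
  proof -
    have "\<exists>i. lookup a i > 0" using that by (metis gr0I poly_mapping_eqI lookup_zero)
    then show ?thesis unfolding \<iota>_def by (rule someI_ex)
  qed
  define g where "g i = (Abs_mfps (\<lambda>c. if \<iota> (c + single i 1) = i
      then mfps_nth f (c + single i 1) else 0) :: ('n, 'k) mfps)" for i
  have g: "g i \<in> mpower N" for i
  proof (rule mpowerI)
    fix a :: "'n \<Rightarrow>\<^sub>0 nat" assume "mdeg a < N"
    then have "mfps_nth f (a + single i 1) = 0"
      using mpowerD[OF assms, of "a + single i 1"] by simp
    then show "mfps_nth (g i) a = 0" by (simp add: g_def)
  qed
  have "f = (\<Sum>i\<in>UNIV. mfps_var i * g i)"
  proof (rule mfps_eqI)
    fix a :: "'n \<Rightarrow>\<^sub>0 nat"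
    show "mfps_nth f a = mfps_nth (\<Sum>i\<in>UNIV. mfps_var i * g i) a"
    proof (cases "a = 0")
      case True
      have "mfps_nth (mfps_var i * g i) 0 = 0" for i
        unfolding var_eq_mon by (rule nth_mon_mult_0) (metis add_is_0 mdeg_add mdeg_single mdeg_zero zero_neq_one)
      moreover have "mfps_nth f 0 = 0" using mpowerD[OF assms, of 0] by simp
      ultimately show ?thesis using True by simp
    next
      case False
      have "mfps_nth (mfps_var i * g i) a = (if i = \<iota> a then mfps_nth f a else 0)" for i
      proof (cases "\<exists>b. a = single i 1 + b")
        case True
        then obtain b where b: "a = single i 1 + b" by blast
        have "mfps_nth (mfps_var i * g i) a = mfps_nth (g i) b"
          unfolding b var_eq_mon by (rule nth_mon_mult)
        then show ?thesis by (auto simp: g_def b add.commute)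
      next
        case F: False
        then have "i \<noteq> \<iota> a" using exists_single_add[OF \<iota>[OF False]] by (metis add.commute)
        then show ?thesis using F unfolding var_eq_mon by (simp add: nth_mon_mult_0)
      qed
      then show ?thesis by simp
    qed
  qed
  with g show ?thesis by blast
qed

definition trunc :: "nat \<Rightarrow> ('n::finite, 'k::comm_ring_1) mfps \<Rightarrow> ('n, 'k) mfps" where
  "trunc N f = (\<Sum>a | mdeg a < N. mfps_scale (mfps_nth f a) (mon a))"

lemma nth_trunc: "mfps_nth (trunc N f) b = (if mdeg b < N then mfps_nth f b else 0)"
proof -
  have "mfps_nth (trunc N f) b = (\<Sum>a | mdeg a < N. if a = b then mfps_nth f b else 0)"
    unfolding trunc_def nth_sum by (rule sum.cong) (auto simp: nth_mon)
  then show ?thesis by (simp add: finite_mdeg_less)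
qed

lemma trunc_diff: "f - trunc N f \<in> mpower N"
  by (rule mpowerI) (simp add: nth_trunc)

section \<open>Continuous linear maps\<close>

text \<open>Linearity together with continuity for the m-adic topology in a uniform form. The
  permitted loss \<open>c\<close> of order is 1 for derivations and 0 for local homomorphisms. Such
  maps are determined by their values on monomials, and the product rule, the chain rule and the
  multiplicativity of substitutions are verified there.\<close>

definition clin :: "(('n::finite, 'k::comm_ring_1) mfps \<Rightarrow> ('n, 'k) mfps) \<Rightarrow> bool" where
  "clin D \<longleftrightarrow> (\<forall>f g. D (f + g) = D f + D g) \<and> (\<forall>c f. D (mfps_scale c f) = mfps_scale c (D f)) \<and>
     (\<exists>c. \<forall>N. \<forall>f\<in>mpower (N + c). D f \<in> mpower N)"

lemma clinE:
  assumes "clin D" obtains c where "\<And>N g. g \<in> mpower (N + c) \<Longrightarrow> D g \<in> mpower N"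
  using assms unfolding clin_def by metis

lemma clin_add: "clin D \<Longrightarrow> D (f + g) = D f + D g" by (simp add: clin_def)
lemma clin_scale: "clin D \<Longrightarrow> D (mfps_scale c f) = mfps_scale c (D f)" by (simp add: clin_def)
lemma clin_zero: "clin D \<Longrightarrow> D 0 = 0" using clin_scale[of D 0 0] by simp
lemma clin_sum: "clin D \<Longrightarrow> D (sum f A) = (\<Sum>x\<in>A. D (f x))"
  by (induction A rule: infinite_finite_induct) (auto simp: clin_add clin_zero)
lemma clin_uminus: assumes "clin D" shows "D (- f) = - D f"
  using clin_add[OF assms, of f "- f"] clin_zero[OF assms] by (simp add: eq_neg_iff_add_eq_0 add.commute)
lemma clin_minus: assumes "clin D" shows "D (f - g) = D f - D g"
  using clin_add[OF assms, of f "- g"] clin_uminus[OF assms] by simp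

text \<open>A given coefficient of \<open>D f\<close> depends on a truncation of \<open>f\<close>
  only, since the tail lies in so high a power of the maximal ideal that its image cannot reach the
  coefficient. The truncation is a finite sum of monomials.\<close>

lemma clin_mem:
  assumes D: "clin D" and m: "\<And>a. mfps_nth f a \<noteq> 0 \<Longrightarrow> D (mon a) \<in> filt w t"
  shows "D f \<in> filt w t"
proof (rule filtI)
  fix b :: "'a \<Rightarrow>\<^sub>0 nat" assume b: "wt w b < t"
  obtain c where c: "\<And>N g. g \<in> mpower (N + c) \<Longrightarrow> D g \<in> mpower N"
    using clinE[OF D] by blast
  let ?N = "Suc (mdeg b)"
  have "D f = D (trunc (?N + c) f) + D (f - trunc (?N + c) f)"
    using clin_add[OF D] by (metis add.commute diff_add_cancel)
  moreover have "mfps_nth (D (f - trunc (?N + c) f)) b = 0"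
    by (rule mpowerD[OF c[OF trunc_diff]]) simp
  moreover have "D (trunc (?N + c) f) \<in> filt w t"
    unfolding trunc_def clin_sum[OF D] clin_scale[OF D]
  proof (rule filt_sum)
    fix a
    show "mfps_scale (mfps_nth f a) (D (mon a)) \<in> filt w t"
      by (cases "mfps_nth f a = 0") (auto intro: filt_scale m)
  qed
  ultimately show "mfps_nth (D f) b = 0" using filtD[OF _ b] by simp
qed

lemma clin_eq_0: "clin D \<Longrightarrow> (\<And>a. D (mon a) = 0) \<Longrightarrow> D f = 0"
  by (rule filt_eq_0, rule clin_mem) auto

lemma clin_add_fun: assumes "clin D" "clin E" shows "clin (\<lambda>f. D f + E f)"
proof -
  obtain c where c: "\<And>N g. g \<in> mpower (N + c) \<Longrightarrow> D g \<in> mpower N"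
    using clinE[OF assms(1)] by blast
  obtain d where d: "\<And>N g. g \<in> mpower (N + d) \<Longrightarrow> E g \<in> mpower N"
    using clinE[OF assms(2)] by blast
  have "D f + E f \<in> mpower N" if "f \<in> mpower (N + (c + d))" for N f
    by (rule filt_add; (rule c | rule d); rule filt_mono[OF that]; simp)
  then have "\<exists>c. \<forall>N. \<forall>f\<in>mpower (N + c). D f + E f \<in> mpower N" by blast
  then show ?thesis using assms unfolding clin_def by (simp add: scale_add algebra_simps)
qed

lemma clin_comp: assumes "clin D" "clin E" shows "clin (\<lambda>f. D (E f))"
proof -
  obtain c where c: "\<And>N g. g \<in> mpower (N + c) \<Longrightarrow> D g \<in> mpower N"
    using clinE[OF assms(1)] by blast
  obtain d where d: "\<And>N g. g \<in> mpower (N + d) \<Longrightarrow> E g \<in> mpower N"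
    using clinE[OF assms(2)] by blast
  have "D (E f) \<in> mpower N" if "f \<in> mpower (N + (c + d))" for N f
    using that by (intro c d) (simp add: add.assoc)
  then have "\<exists>c. \<forall>N. \<forall>f\<in>mpower (N + c). D (E f) \<in> mpower N" by blast
  then show ?thesis using assms unfolding clin_def by simp
qed

lemma clin_id: "clin (\<lambda>f. f)"
  unfolding clin_def by (auto intro!: exI[of _ 0])

lemma clin_zero_fun: "clin (\<lambda>f. 0)"
  unfolding clin_def by auto

lemma clin_mult_left: "clin (\<lambda>f. g * f)"
  unfolding clin_def by (auto simp: scale_mult_right ring_distribs intro!: exI[of _ 0] filt_mult_left)

lemma clin_mult_right: "clin (\<lambda>f. f * g)"
  using clin_mult_left[of g] by (simp add: mult.commute)

lemma clin_scale_fun: "clin (\<lambda>f. mfps_scale c f)"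
  using clin_mult_left[of "mfps_scale c 1"] by (simp add: scale_eq_mult[symmetric])

lemma clin_uminus_fun: "clin D \<Longrightarrow> clin (\<lambda>f. - D f)"
proof -
  assume "clin D"
  then have "clin (\<lambda>f. mfps_scale (-1) (D f))" by (rule clin_comp[OF clin_scale_fun])
  moreover have "mfps_scale (-1) g = - g" for g :: "('a, 'b) mfps" by (rule mfps_eqI) simp
  ultimately show ?thesis by simp
qed

lemma clin_minus_fun: "clin D \<Longrightarrow> clin E \<Longrightarrow> clin (\<lambda>f. D f - E f)"
  using clin_add_fun[of D "\<lambda>f. - E f"] clin_uminus_fun[of E] by simp

lemma clin_sum_fun: "(\<And>i. i \<in> A \<Longrightarrow> clin (D i)) \<Longrightarrow> clin (\<lambda>f. \<Sum>i\<in>A. D i f)"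
  by (induction A rule: infinite_finite_induct) (auto intro: clin_add_fun clin_zero_fun)

lemma clin_pderiv: "clin (mfps_pderiv i)"
  unfolding clin_def
proof (intro conjI allI exI ballI)
  fix N and f :: "('a, 'b) mfps" assume f: "f \<in> mpower (N + 1)"
  show "mfps_pderiv i f \<in> mpower N"
    by (rule mpowerI) (simp add: nth_pderiv mpowerD[OF f])
qed (rule mfps_eqI, simp add: nth_pderiv algebra_simps)+

lemma clin_eqI:
  assumes "clin D" "clin E" "\<And>a. D (mon a) = E (mon a)" shows "D f = E f"
  using clin_eq_0[OF clin_minus_fun[OF assms(1,2)], of f] assms(3) by simp

lemma bilinear_eqI:
  assumes "\<And>g. clin (\<lambda>f. B f g)" "\<And>f. clin (B f)" "\<And>g. clin (\<lambda>f. C f g)" "\<And>f. clin (C f)"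
    and "\<And>a b. B (mon a) (mon b) = C (mon a) (mon b)"
  shows "B f g = C f g"
proof -
  have "B (mon a) g = C (mon a) g" for a by (rule clin_eqI) (rule assms)+
  then show ?thesis by (rule clin_eqI[OF assms(1,3)])
qed

section \<open>Derivatives\<close>

lemma pderiv_mem_filt:
  assumes "f \<in> filt w (s + w i)" shows "mfps_pderiv i f \<in> filt w s"
  by (rule filtI) (use assms in \<open>simp add: nth_pderiv filtD\<close>)

lemma pderiv_mem_mpower: "f \<in> mpower (Suc s) \<Longrightarrow> mfps_pderiv i f \<in> mpower s"
  using pderiv_mem_filt[of f "\<lambda>_. 1" s i] unfolding Suc_eq_plus1 .

lemma pderiv_mon: "mfps_pderiv i (mon a :: ('n::finite, 'k::comm_ring_1) mfps) =
    mfps_scale (of_nat (lookup a i)) (mon (a - single i 1))"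
proof (rule mfps_eqI)
  fix b :: "'n \<Rightarrow>\<^sub>0 nat"
  have 1: "a - single i 1 = b" if "b + single i 1 = a"
    using that by auto
  show "mfps_nth (mfps_pderiv i (mon a)) b = mfps_nth (mfps_scale (of_nat (lookup a i))
      (mon (a - single i 1)) :: ('n, 'k) mfps) b"
  proof (cases "b + single i 1 = a")
    case True
    then have "lookup a i = lookup b i + 1" by (auto simp: lookup_add)
    then show ?thesis using True 1 by (simp add: nth_pderiv nth_mon)
  next
    case False
    have "lookup a i = 0" if "b = a - single i 1"
      using exists_single_add[of a i] False that by fastforce
    then show ?thesis using False by (auto simp: nth_pderiv nth_mon)
  qed
qed

lemma pderiv_mult:
  "mfps_pderiv i (f * g) = mfps_pderiv i f * g + f * mfps_pderiv i (g :: ('n::finite, 'k::comm_ring_1) mfps)"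
proof -
  \<comment> \<open>Truncated subtraction of exponents does no harm: if the variable does not divide
    the monomial the scalar is zero, and otherwise the subtraction is exact.\<close>
  have *: "mfps_scale (of_nat (lookup a i)) (mon (a - single i 1)) * mon b =
      mfps_scale (of_nat (lookup a i)) (mon (a + b - single i 1) :: ('n, 'k) mfps)" for a b
  proof (cases "lookup a i = 0")
    case False
    then obtain c where "a = c + single i 1" using exists_single_add[of a i] by auto
    then have "a - single i 1 + b = a + b - single i 1"
      by (simp add: add.assoc add.commute[of _ b]) (simp flip: add.assoc)
    then show ?thesis by (simp add: scale_mult_left mon_mult)
  qed simp
  have mm: "mfps_pderiv i (mon a * mon b) = mfps_pderiv i (mon a) * mon b + mon a * (mfps_pderiv i (mon b) :: ('n, 'k) mfps)" for a b
    using *[of a b] *[of b a] unfolding mon_mult pderiv_mon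
    by (simp add: lookup_add mult.commute[of "mon a"] add.commute[of b]) (rule mfps_eqI, simp add: algebra_simps)
  show ?thesis
    by (rule bilinear_eqI[where B = "\<lambda>f g. mfps_pderiv i (f * g)"])
      (rule clin_comp[OF clin_pderiv] clin_comp[OF clin_mult_right clin_pderiv] clin_comp[OF clin_mult_left clin_pderiv]
        clin_add_fun clin_mult_right clin_mult_left mm)+
qed

lemma pderiv_one [simp]: "mfps_pderiv i 1 = 0"
  unfolding mon_zero[symmetric] pderiv_mon by simp

lemma pderiv_var: "mfps_pderiv i (mfps_var j) = (if i = j then 1 else 0)"
  unfolding var_eq_mon pderiv_mon by (simp add: lookup_single mon_zero)

lemma pderiv_add: "mfps_pderiv i (f + g :: ('n::finite, 'k::comm_ring_1) mfps) = mfps_pderiv i f + mfps_pderiv i g"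
  by (rule clin_add[OF clin_pderiv])
lemma pderiv_diff: "mfps_pderiv i (f - g :: ('n::finite, 'k::comm_ring_1) mfps) = mfps_pderiv i f - mfps_pderiv i g"
  by (rule clin_minus[OF clin_pderiv])
lemma pderiv_scale: "mfps_pderiv i (mfps_scale c f :: ('n::finite, 'k::comm_ring_1) mfps) = mfps_scale c (mfps_pderiv i f)"
  by (rule clin_scale[OF clin_pderiv])
lemma pderiv_sum: "mfps_pderiv i (sum f A :: ('n::finite, 'k::comm_ring_1) mfps) = (\<Sum>x\<in>A. mfps_pderiv i (f x))"
  by (rule clin_sum[OF clin_pderiv])
lemma pderiv_zero [simp]: "mfps_pderiv i (0 :: ('n::finite, 'k::comm_ring_1) mfps) = 0"
  by (rule clin_zero[OF clin_pderiv])

section \<open>Substitution and local homomorphisms\<close>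

text \<open>Local algebra homomorphisms. Continuity is a consequence: \<open>lhom_mem_mpower\<close>
  derives it from the images of the variables.\<close>

definition lhom :: "(('n::finite, 'k::comm_ring_1) mfps \<Rightarrow> ('n, 'k) mfps) \<Rightarrow> bool" where
  "lhom \<Phi> \<longleftrightarrow> \<Phi> 1 = 1 \<and> (\<forall>f g. \<Phi> (f + g) = \<Phi> f + \<Phi> g) \<and> (\<forall>f g. \<Phi> (f * g) = \<Phi> f * \<Phi> g) \<and>
     (\<forall>c f. \<Phi> (mfps_scale c f) = mfps_scale c (\<Phi> f)) \<and> (\<forall>i. \<Phi> (mfps_var i) \<in> mpower 1)"

lemma lhom_one: "lhom \<Phi> \<Longrightarrow> \<Phi> 1 = 1" by (simp add: lhom_def)
lemma lhom_mult: "lhom \<Phi> \<Longrightarrow> \<Phi> (f * g) = \<Phi> f * \<Phi> g" by (simp add: lhom_def)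
lemma lhom_var: "lhom \<Phi> \<Longrightarrow> \<Phi> (mfps_var i) \<in> mpower 1" by (simp add: lhom_def)

lemma lhom_power: "lhom \<Phi> \<Longrightarrow> \<Phi> (f ^ m) = \<Phi> f ^ m"
  by (induction m) (auto simp: lhom_one lhom_mult)

lemma lhom_prod: "lhom \<Phi> \<Longrightarrow> \<Phi> (prod f A) = (\<Prod>x\<in>A. \<Phi> (f x))"
  by (induction A rule: infinite_finite_induct) (auto simp: lhom_one lhom_mult)

text \<open>Additivity says nothing about infinite sums. Splitting off one variable at a time needs
  only the finite sum over the variables, and each variable contributes one order.\<close>

lemma lhom_mem_mpower:
  assumes \<Phi>: "lhom \<Phi>" shows "f \<in> mpower N \<Longrightarrow> \<Phi> f \<in> mpower N"
proof (induction N arbitrary: f)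
  case (Suc N)
  obtain g where g: "\<And>i. g i \<in> mpower N" "f = (\<Sum>i\<in>UNIV. mfps_var i * g i)"
    using mpower_Suc_decomp[OF Suc(2)] by blast
  have add: "\<Phi> (sum h A) = (\<Sum>x\<in>A. \<Phi> (h x))" for h :: "'c \<Rightarrow> _" and A
  proof -
    have "\<Phi> (mfps_scale 0 0) = mfps_scale 0 (\<Phi> 0)" using \<Phi> unfolding lhom_def by blast
    then have "\<Phi> 0 = 0" by simp
    then show ?thesis using \<Phi> unfolding lhom_def
      by (induction A rule: infinite_finite_induct) auto
  qed
  have "\<Phi> (mfps_var i) * \<Phi> (g i) \<in> mpower (Suc N)" for i
    by (rule filt_mult_le[OF lhom_var[OF \<Phi>] Suc(1)[OF g(1)]]) simp
  then show ?case unfolding g(2) add lhom_mult[OF \<Phi>] by (intro filt_sum)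
qed simp

lemma lhom_clin: "lhom \<Phi> \<Longrightarrow> clin \<Phi>"
  unfolding clin_def using lhom_mem_mpower[of \<Phi>] by (auto simp: lhom_def intro!: exI[of _ 0])

definition mpow :: "('n::finite \<Rightarrow> ('n, 'k::comm_ring_1) mfps) \<Rightarrow> ('n \<Rightarrow>\<^sub>0 nat) \<Rightarrow> ('n, 'k) mfps" where
  "mpow \<phi> a = (\<Prod>i\<in>UNIV. \<phi> i ^ lookup a i)"

lemma mpow_add: "mpow \<phi> (a + b) = mpow \<phi> a * mpow \<phi> b"
  by (simp add: mpow_def lookup_add power_add prod.distrib)

lemma mpow_zero [simp]: "mpow \<phi> 0 = 1" by (simp add: mpow_def)

lemma mpow_single: "mpow \<phi> (single i m) = \<phi> i ^ m"
proof -
  have "mpow \<phi> (single i m) = (\<Prod>j\<in>UNIV. if j = i then \<phi> i ^ m else 1)"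
    unfolding mpow_def by (rule prod.cong) (auto simp: lookup_single)
  then show ?thesis by simp
qed

lemma mon_eq_mpow: "mon a = mpow mfps_var a"
proof (induction a rule: mdeg_induct)
  case zero show ?case by (simp add: mon_zero)
next
  case (add a i)
  then show ?case by (simp add: mpow_add mpow_single var_eq_mon mon_mult[symmetric])
qed

lemma mpow_mem_filt: "(\<And>i. \<phi> i \<in> filt w (v i)) \<Longrightarrow> mpow \<phi> a \<in> filt w (wt v a)"
  unfolding mpow_def wt_def by (rule filt_prod) (subst mult.commute, rule filt_power)

lemma mpow_mem_mpower: "(\<And>i. \<phi> i \<in> mpower 1) \<Longrightarrow> mpow \<phi> a \<in> mpower (mdeg a)"
  using mpow_mem_filt[of \<phi> "\<lambda>_. 1" "\<lambda>_. 1" a] by (simp add: mdeg_eq_wt)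

lemma lhom_mon: "lhom \<Phi> \<Longrightarrow> \<Phi> (mon a) = mpow (\<lambda>i. \<Phi> (mfps_var i)) a"
  unfolding mon_eq_mpow by (simp add: mpow_def lhom_prod lhom_power)

lemma lhom_filt:
  assumes "lhom \<Phi>" "\<And>i. \<Phi> (mfps_var i) \<in> filt v (w i)" "f \<in> filt w s"
  shows "\<Phi> f \<in> filt v s"
proof (rule clin_mem[OF lhom_clin[OF assms(1)]])
  fix a assume "mfps_nth f a \<noteq> 0"
  then have "s \<le> wt w a" using assms(3) by (simp add: filt_def)
  moreover have "\<Phi> (mon a) \<in> filt v (wt w a)"
    unfolding lhom_mon[OF assms(1)] by (rule mpow_mem_filt) (rule assms(2))
  ultimately show "\<Phi> (mon a) \<in> filt v s" by (rule filt_mono[rotated])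
qed

lemma lhom_eqI:
  assumes "lhom \<Phi>" "lhom \<Psi>" "\<And>i. \<Phi> (mfps_var i) = \<Psi> (mfps_var i)" shows "\<Phi> f = \<Psi> f"
  by (rule clin_eqI) (auto simp: lhom_clin lhom_mon assms)

text \<open>When every \<open>\<phi> i\<close> has zero constant term, exponents of degree above
  \<open>mdeg b\<close> contribute nothing to the coefficient at \<open>b\<close>; the cut-off
  builds this finiteness into the definition.\<close>

definition subst :: "('n::finite \<Rightarrow> ('n, 'k::comm_ring_1) mfps) \<Rightarrow> ('n, 'k) mfps \<Rightarrow> ('n, 'k) mfps" where
  "subst \<phi> f = Abs_mfps (\<lambda>b. \<Sum>a | mdeg a \<le> mdeg b. mfps_nth f a * mfps_nth (mpow \<phi> a) b)"

lemma nth_subst: "mfps_nth (subst \<phi> f) b = (\<Sum>a | mdeg a \<le> mdeg b. mfps_nth f a * mfps_nth (mpow \<phi> a) b)"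
  by (simp add: subst_def)

context
  fixes \<phi> :: "'n::finite \<Rightarrow> ('n, 'k::comm_ring_1) mfps"
  assumes \<phi>: "\<And>i. \<phi> i \<in> mpower 1"
begin

lemma subst_mon: "subst \<phi> (mon a) = mpow \<phi> a"
proof (rule mfps_eqI)
  fix b
  have "mfps_nth (subst \<phi> (mon a)) b =
      (\<Sum>c | mdeg c \<le> mdeg b. if c = a then mfps_nth (mpow \<phi> a) b else 0)"
    unfolding nth_subst by (rule sum.cong) (auto simp: nth_mon)
  also have "\<dots> = mfps_nth (mpow \<phi> a) b"
    using mpowerD[OF mpow_mem_mpower[OF \<phi>], of b a] by (auto simp: finite_mdeg_le)
  finally show "mfps_nth (subst \<phi> (mon a)) b = mfps_nth (mpow \<phi> a) b" .
qed

lemma clin_subst: "clin (subst \<phi>)"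
  unfolding clin_def
proof (intro conjI allI exI ballI)
  fix N and f :: "('n, 'k) mfps" assume f: "f \<in> mpower (N + 0)"
  show "subst \<phi> f \<in> mpower N"
    by (rule mpowerI) (use mpowerD[OF f] in \<open>auto simp: nth_subst intro!: sum.neutral\<close>)
qed (rule mfps_eqI, simp add: nth_subst algebra_simps sum.distrib sum_distrib_left)+

lemma lhom_subst: "lhom (subst \<phi>)"
proof -
  have mm: "subst \<phi> (mon a * mon b) = subst \<phi> (mon a) * subst \<phi> (mon b)" for a b
    by (simp add: mon_mult subst_mon mpow_add)
  have "subst \<phi> (f * g) = subst \<phi> f * subst \<phi> g" for f g
    by (rule bilinear_eqI[where B = "\<lambda>f g. subst \<phi> (f * g)"])
      (rule clin_comp[OF clin_subst] clin_comp[OF clin_mult_right clin_subst] clin_comp[OF clin_mult_left clin_subst]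
        clin_mult_right clin_mult_left mm)+
  moreover have "subst \<phi> 1 = 1" using subst_mon[of 0] by (simp add: mon_zero)
  moreover have "subst \<phi> (mfps_var i) = \<phi> i" for i
    unfolding var_eq_mon subst_mon by (simp add: mpow_single)
  ultimately show ?thesis unfolding lhom_def
    using \<phi> clin_add[OF clin_subst] clin_scale[OF clin_subst] by simp
qed

lemma subst_var: "subst \<phi> (mfps_var i) = \<phi> i"
  unfolding var_eq_mon subst_mon by (simp add: mpow_single)

end

lemma lhom_comp: "lhom \<Phi> \<Longrightarrow> lhom \<Psi> \<Longrightarrow> lhom (\<lambda>f. \<Phi> (\<Psi> f))"
  using lhom_mem_mpower[of \<Phi>] unfolding lhom_def by auto

lemma lhom_id: "lhom (\<lambda>f. f)"
  unfolding lhom_def by (auto intro: var_in_filt)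

lemma chain_rule:
  assumes \<Phi>: "lhom \<Phi>"
  shows "mfps_pderiv i (\<Phi> f) = (\<Sum>j\<in>UNIV. \<Phi> (mfps_pderiv j f) * mfps_pderiv i (\<Phi> (mfps_var j)))"
proof (rule clin_eqI[where D = "\<lambda>f. mfps_pderiv i (\<Phi> f)"])
  fix a
  note lin = clin_add[OF lhom_clin[OF \<Phi>]] clin_zero[OF lhom_clin[OF \<Phi>]]
  show "mfps_pderiv i (\<Phi> (mon a)) = (\<Sum>j\<in>UNIV. \<Phi> (mfps_pderiv j (mon a)) * mfps_pderiv i (\<Phi> (mfps_var j)))"
  proof (induction a rule: mdeg_induct)
    case zero show ?case by (simp add: mon_zero lhom_one[OF \<Phi>] lin)
  next
    case (add a k)
    have "(\<Sum>j\<in>UNIV. \<Phi> (mfps_pderiv j (mon (a + single k 1))) * mfps_pderiv i (\<Phi> (mfps_var j)))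
      = (\<Sum>j\<in>UNIV. \<Phi> (mfps_pderiv j (mon a)) * mfps_pderiv i (\<Phi> (mfps_var j)) * \<Phi> (mfps_var k)
         + (if j = k then \<Phi> (mon a) * mfps_pderiv i (\<Phi> (mfps_var k)) else 0))"
      unfolding mon_mult[symmetric] var_eq_mon[symmetric]
      by (rule sum.cong) (auto simp: pderiv_mult pderiv_var lin lhom_mult[OF \<Phi>] lhom_one[OF \<Phi>] algebra_simps)
    also have "\<dots> = mfps_pderiv i (\<Phi> (mon (a + single k 1)))"
      unfolding mon_mult[symmetric] var_eq_mon[symmetric] by (simp add: sum.distrib lhom_mult[OF \<Phi>] pderiv_mult add sum_distrib_right[symmetric])
    finally show ?case by simp
  qed
next
  show "clin (\<lambda>f. mfps_pderiv i (\<Phi> f))" by (rule clin_comp[OF clin_pderiv lhom_clin[OF \<Phi>]])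
  show "clin (\<lambda>f. \<Sum>j\<in>UNIV. \<Phi> (mfps_pderiv j f) * mfps_pderiv i (\<Phi> (mfps_var j)))"
    by (rule clin_sum_fun, rule clin_comp[OF clin_mult_right], rule clin_comp[OF lhom_clin[OF \<Phi>] clin_pderiv])
qed

section \<open>Automorphisms\<close>

text \<open>The Neumann series g + E g + E (E g) + ..., whose coefficient at \<open>a\<close> no
  longer changes after \<open>mdeg a\<close> terms because every application of \<open>E\<close>
  raises the order.\<close>

lemma geometric_series:
  fixes E :: "('n::finite, 'k::comm_ring_1) mfps \<Rightarrow> ('n, 'k) mfps"
  assumes E: "clin E" and raise: "\<And>s f. f \<in> mpower s \<Longrightarrow> E f \<in> mpower (Suc s)"
  shows "\<exists>h. h - E h = g"
proof -
  define h :: "('n, 'k) mfps" where "h = Abs_mfps (\<lambda>a. \<Sum>j\<le>mdeg a. mfps_nth ((E ^^ j) g) a)"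
  have pow: "(E ^^ j) g \<in> mpower j" for j
    by (induction j) (auto intro: raise)
  have "h - E h - g \<in> mpower N" for N
  proof -
    define S where "S = (\<Sum>j<N. (E ^^ j) g)"
    have "h - S \<in> mpower N"
    proof (rule mpowerI)
      fix a :: "'n \<Rightarrow>\<^sub>0 nat" assume "mdeg a < N"
      then have "(\<Sum>j<N. mfps_nth ((E ^^ j) g) a) = (\<Sum>j\<le>mdeg a. mfps_nth ((E ^^ j) g) a)"
        by (intro sum.mono_neutral_right) (auto intro!: mpowerD[OF pow])
      then show "mfps_nth (h - S) a = 0" by (simp add: h_def S_def)
    qed
    moreover from this have "E (h - S) \<in> mpower N" using raise filt_mono by (meson le_Suc_eq order_refl)
    moreover have "S - E S - g = - (E ^^ N) g"
      using sum_lessThan_telescope'[of "\<lambda>j. (E ^^ j) g" N]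
      unfolding S_def clin_sum[OF E] sum_subtractf by simp
    moreover have "h - E h - g = (h - S) - E (h - S) + (S - E S - g)"
      by (simp add: clin_minus[OF E])
    ultimately show ?thesis using pow[of N] by (simp only: filt_add filt_diff filt_uminus)
  qed
  then have "h - E h - g = 0" by (rule filt_eq_0)
  then show ?thesis by (intro exI[of _ h]) simp
qed

lemma unit_iff:
  fixes f :: "('n::finite, 'k::field) mfps"
  assumes "mfps_nth f 0 \<noteq> 0" shows "\<exists>g. f * g = 1"
proof -
  define c where "c = inverse (mfps_nth f 0)"
  define u where "u = 1 - mfps_scale c f"
  have "u \<in> mpower 1"
    unfolding max_ideal_eq[symmetric] max_ideal_def u_def c_def using assms by (simp add: nth_one)
  then have "\<exists>h. h - u * h = 1"
    by (intro geometric_series clin_mult_left) (metis filt_mult plus_1_eq_Suc)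
  then obtain h where "h - u * h = 1" by blast
  then have "mfps_scale c f * h = 1" by (simp add: u_def algebra_simps)
  then have "f * mfps_scale c h = 1" by (simp add: scale_mult_left scale_mult_right)
  then show ?thesis by blast
qed

lemma nth_mult_0: "mfps_nth (f * g :: ('n::finite, 'k::comm_ring_1) mfps) 0 = mfps_nth f 0 * mfps_nth g 0"
proof -
  have "splittings (0 :: 'n \<Rightarrow>\<^sub>0 nat) = {(0, 0)}"
    unfolding splittings_def by (auto, (metis add_is_0 mdeg_add mdeg_eq_0_iff mdeg_zero)+)
  then show ?thesis by (simp add: nth_mult)
qed

text \<open>An algebra automorphism is automatically local: if the image of x_i had constant term c
  different from 0, then x_i - c would be a unit, although its image has constant term 0.\<close>

lemma right_group_lhom:
  fixes \<Phi> :: "('n::finite, 'k::field) mfps \<Rightarrow> ('n, 'k) mfps"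
  assumes "\<Phi> \<in> right_group" shows "lhom \<Phi>"
proof -
  have hom: "\<Phi> 1 = 1" "\<And>f g. \<Phi> (f + g) = \<Phi> f + \<Phi> g" "\<And>f g. \<Phi> (f * g) = \<Phi> f * \<Phi> g"
    "\<And>c f. \<Phi> (mfps_scale c f) = mfps_scale c (\<Phi> f)"
    using assms by (auto simp: right_group_def)
  have "mfps_nth (\<Phi> (mfps_var i)) 0 = 0" for i
  proof (rule ccontr)
    define c where "c = mfps_nth (\<Phi> (mfps_var i)) 0"
    assume "mfps_nth (\<Phi> (mfps_var i)) 0 \<noteq> 0"
    then have c: "c \<noteq> 0" by (simp add: c_def)
    have "mfps_nth (mfps_var i :: ('n, 'k) mfps) 0 = 0"
      by (simp add: var_eq_mon nth_mon) (metis mdeg_single mdeg_zero zero_neq_one)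
    then have "mfps_nth (mfps_var i + mfps_scale (- c) 1 :: ('n, 'k) mfps) 0 \<noteq> 0"
      using c by (simp add: nth_one)
    then obtain g where "(mfps_var i + mfps_scale (- c) 1) * g = 1" using unit_iff by blast
    then have "(\<Phi> (mfps_var i) + mfps_scale (- c) 1) * \<Phi> g = 1" using hom by metis
    then have "mfps_nth ((\<Phi> (mfps_var i) + mfps_scale (- c) 1) * \<Phi> g) 0 = 1" by (simp add: nth_one)
    then show False unfolding nth_mult_0 by (simp add: nth_one c_def)
  qed
  then have "\<Phi> (mfps_var i) \<in> mpower 1" for i
    unfolding max_ideal_eq[symmetric] max_ideal_def by simp
  then show ?thesis using hom by (simp add: lhom_def)
qed

lemma right_groupI: "lhom \<Phi> \<Longrightarrow> bij \<Phi> \<Longrightarrow> \<Phi> \<in> right_group"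
  by (auto simp: right_group_def lhom_def)

lemma right_group_bij: "\<Phi> \<in> right_group \<Longrightarrow> bij \<Phi>"
  by (simp add: right_group_def)

lemma right_group_id: "(\<lambda>f. f) \<in> right_group"
  by (intro right_groupI lhom_id) (simp add: bij_def)

lemma right_group_comp: "\<Phi> \<in> right_group \<Longrightarrow> \<Psi> \<in> right_group \<Longrightarrow> (\<lambda>f. \<Phi> (\<Psi> f)) \<in> right_group"
proof -
  assume 1: "\<Phi> \<in> right_group" "\<Psi> \<in> right_group"
  have "bij (\<lambda>f. \<Phi> (\<Psi> f))"
    using bij_comp[OF right_group_bij[OF 1(2)] right_group_bij[OF 1(1)]] by (simp add: comp_def)
  then show ?thesis by (rule right_groupI[OF lhom_comp[OF right_group_lhom[OF 1(1)] right_group_lhom[OF 1(2)]]])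
qed

lemma right_group_inv:
  assumes "\<Phi> \<in> right_group" shows "inv \<Phi> \<in> right_group"
proof -
  have bij: "bij \<Phi>" using assms by (rule right_group_bij)
  have eq: "inv \<Phi> f = g \<longleftrightarrow> f = \<Phi> g" for f g
    using bij_inv_eq_iff[OF bij, of g f] by auto
  have r: "\<Phi> (inv \<Phi> f) = f" for f using eq[of f "inv \<Phi> f"] by simp
  show ?thesis using assms bij_imp_bij_inv[OF bij] unfolding right_group_def by (simp add: eq r)
qed

lemma right_equiv_refl: "f \<sim>\<^sub>r f"
  unfolding right_equiv_def by (rule bexI[OF _ right_group_id]) simp

lemma right_equiv_trans: "f \<sim>\<^sub>r g \<Longrightarrow> g \<sim>\<^sub>r h \<Longrightarrow> f \<sim>\<^sub>r h"
  unfolding right_equiv_def by (elim bexE) (rule bexI[OF _ right_group_comp], simp)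

lemma right_equiv_sym: "f \<sim>\<^sub>r g \<Longrightarrow> g \<sim>\<^sub>r f"
  unfolding right_equiv_def using right_group_inv by (metis right_group_bij inv_f_f bij_is_inj)

lemma right_equivI: "\<Phi> \<in> right_group \<Longrightarrow> f \<sim>\<^sub>r \<Phi> f"
  unfolding right_equiv_def by blast

section \<open>Explicit automorphisms: unipotent ones, shears, dilations, permutations\<close>

lemma aut_inverse:
  assumes "\<And>i. \<phi> i \<in> mpower 1" "\<And>i. \<psi> i \<in> mpower 1"
    and "\<And>i. subst \<phi> (\<psi> i) = mfps_var i" "\<And>i. subst \<psi> (\<phi> i) = mfps_var i"
  shows "subst \<phi> \<in> right_group"
proof -
  note 1 = lhom_subst[of \<phi>, OF assms(1)] lhom_subst[of \<psi>, OF assms(2)]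
  have "subst \<phi> (subst \<psi> f) = f" for f
    by (rule lhom_eqI[OF lhom_comp[OF 1(1,2)] lhom_id]) (simp add: subst_var[of \<psi>, OF assms(2)] assms)
  moreover have "subst \<psi> (subst \<phi> f) = f" for f
    by (rule lhom_eqI[OF lhom_comp[OF 1(2,1)] lhom_id]) (simp add: subst_var[of \<phi>, OF assms(1)] assms)
  ultimately show ?thesis
    by (intro right_groupI 1 bijI') metis+
qed

lemma mpow_perturb:
  assumes "\<And>i. \<xi> i \<in> mpower 2"
  shows "mpow (\<lambda>i. mfps_var i + \<xi> i) a - mon a \<in> mpower (Suc (mdeg a))"
proof (induction a rule: mdeg_induct)
  case zero show ?case by (simp add: mon_zero)
next
  case (add a k)
  let ?m = "mpow (\<lambda>i. mfps_var i + \<xi> i) a"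
  have "mpow (\<lambda>i. mfps_var i + \<xi> i) (a + single k 1) - mon (a + single k 1) =
      (?m - mon a) * (mfps_var k + \<xi> k) + mon a * \<xi> k"
    by (simp add: mpow_add mpow_single mon_mult[symmetric] var_eq_mon[symmetric] algebra_simps)
  moreover have "mfps_var k + \<xi> k \<in> mpower 1"
    by (intro filt_add var_in_filt filt_mono[OF assms]) auto
  then have "(?m - mon a) * (mfps_var k + \<xi> k) \<in> mpower (Suc (mdeg (a + single k 1)))"
    by (rule filt_mult_le[OF add]) simp
  moreover have "mon a * \<xi> k \<in> mpower (Suc (mdeg (a + single k 1)))"
    by (rule filt_mult_le[OF mon_mem_filt[OF order_refl] assms]) (simp flip: mdeg_eq_wt)
  ultimately show ?case by (simp only: filt_add)
qed

text \<open>The map \<open>E\<close>, identity minus substitution, raises the order. Surjectivity is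
  the geometric series; injectivity holds because an element f of the kernel satisfies f = E f and
  hence lies in every power of the maximal ideal.\<close>

lemma aut_unipotent:
  fixes \<xi> :: "'n::finite \<Rightarrow> ('n, 'k::field) mfps"
  assumes \<xi>: "\<And>i. \<xi> i \<in> mpower 2"
  shows "subst (\<lambda>i. mfps_var i + \<xi> i) \<in> right_group"
proof -
  let ?\<Phi> = "subst (\<lambda>i. mfps_var i + \<xi> i)"
  have loc: "mfps_var i + \<xi> i \<in> mpower 1" for i
    by (intro filt_add var_in_filt filt_mono[OF assms]) auto
  define E where "E f = f - ?\<Phi> f" for f
  have E: "clin E" unfolding E_def by (intro clin_minus_fun clin_id clin_subst loc)
  have raise: "E f \<in> mpower (Suc s)" if f: "f \<in> mpower s" for s f
  proof (rule clin_mem[OF E])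
    fix a assume "mfps_nth f a \<noteq> 0"
    then have "s \<le> mdeg a" using mpowerD[OF f] by (metis not_le)
    moreover have "E (mon a) \<in> mpower (Suc (mdeg a))"
      using filt_uminus[OF mpow_perturb[where a = a and \<xi> = \<xi>, OF \<xi>]] by (simp add: E_def subst_mon[OF loc])
    ultimately show "E (mon a) \<in> mpower (Suc s)" using filt_mono by (meson Suc_le_mono)
  qed
  have "\<exists>h. ?\<Phi> h = g" for g
    using geometric_series[OF E raise, of g] by (simp add: E_def)
  moreover have zero: "f = 0" if "?\<Phi> f = 0" for f
  proof (rule filt_eq_0)
    fix N
    show "f \<in> mpower N"
    proof (induction N)
      case (Suc N) then show ?case using raise[OF Suc] that by (simp add: E_def)
    qed simp
  qed
  then have "f = g" if "?\<Phi> f = ?\<Phi> g" for f g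
    using that clin_minus[OF clin_subst[of "\<lambda>i. mfps_var i + \<xi> i", OF loc], of f g] zero[of "f - g"] by simp
  ultimately show ?thesis by (intro right_groupI lhom_subst loc bijI') metis+
qed

text \<open>By \<open>c i = 0\<close> the added linear form does not involve the sheared variable,
  so the shear with \<open>- c\<close> is the inverse.\<close>

lemma aut_shear:
  fixes c :: "'n::finite \<Rightarrow> 'k::field" and i :: 'n
  assumes "c i = 0"
  shows "subst (\<lambda>k. if k = i then mfps_var i + (\<Sum>j\<in>UNIV. mfps_scale (c j) (mfps_var j)) else mfps_var k) \<in> right_group"
proof -
  let ?\<phi> = "\<lambda>c k. if k = i then mfps_var i + (\<Sum>j\<in>UNIV. mfps_scale (c j) (mfps_var j)) else (mfps_var k :: ('n, 'k) mfps)"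
  have loc: "?\<phi> c k \<in> mpower 1" for c k by (auto intro!: filt_add filt_sum filt_scale var_in_filt)
  have "subst (?\<phi> c) (?\<phi> d k) = mfps_var k" if d: "\<And>j. c j + d j = 0" "d i = 0" for c d k
  proof -
    note v = subst_var[of "?\<phi> c", OF loc] and lin = lhom_clin[OF lhom_subst[of "?\<phi> c", OF loc]]
    have fx: "subst (?\<phi> c) (mfps_scale (d j) (mfps_var j)) = mfps_scale (d j) (mfps_var j)" for j
      using d(2) by (cases "j = i") (simp_all add: clin_scale[OF lin] v clin_zero[OF lin])
    have "mfps_scale (c j) (mfps_var j) + mfps_scale (d j) (mfps_var j) = (0 :: ('n, 'k) mfps)" for j
      using d(1) by (intro mfps_eqI) (simp flip: distrib_right)
    then have "(\<Sum>j\<in>UNIV. mfps_scale (c j) (mfps_var j)) + (\<Sum>j\<in>UNIV. mfps_scale (d j) (mfps_var j)) = (0 :: ('n, 'k) mfps)"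
      by (simp flip: sum.distrib)
    then show ?thesis
      by (simp add: v clin_add[OF lin] clin_sum[OF lin] fx add.assoc)
  qed
  from this[of c "\<lambda>j. - c j"] this[of "\<lambda>j. - c j" c] show ?thesis using assms
    by (intro aut_inverse[of "?\<phi> c" "?\<phi> (\<lambda>j. - c j)"] loc) auto
qed

lemma aut_dilation:
  fixes c :: "'k::field" and i :: "'n::finite"
  assumes "c \<noteq> 0"
  shows "subst (\<lambda>k. if k = i then mfps_scale c (mfps_var i) else mfps_var k) \<in> right_group"
proof -
  let ?\<phi> = "\<lambda>c k. if k = i then mfps_scale c (mfps_var i) else (mfps_var k :: ('n, 'k) mfps)"
  have loc: "?\<phi> c k \<in> mpower 1" for c k by (auto intro!: filt_scale var_in_filt)
  have "subst (?\<phi> c) (?\<phi> d k) = mfps_var k" if "d * c = 1" for c d k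
    using that by (simp add: subst_var[OF loc] clin_scale[OF clin_subst[OF loc]] scale_scale)
  from this[of "inverse c" c] this[of c "inverse c"] show ?thesis using assms
    by (intro aut_inverse[of "?\<phi> c" "?\<phi> (inverse c)"] loc) auto
qed

lemma aut_permutation:
  fixes \<pi> :: "'n::finite \<Rightarrow> 'n"
  assumes "bij \<pi>"
  shows "subst (\<lambda>k. mfps_var (\<pi> k) :: ('n, 'k::field) mfps) \<in> right_group"
proof -
  have loc: "(mfps_var (\<tau> k) :: ('n, 'k) mfps) \<in> mpower 1" for \<tau> :: "'n \<Rightarrow> 'n" and k by (intro var_in_filt) simp
  have v: "subst (\<lambda>k. mfps_var (\<tau> k)) (mfps_var i) = (mfps_var (\<tau> i) :: ('n, 'k) mfps)" for \<tau> :: "'n \<Rightarrow> 'n" and i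
    by (rule subst_var) (rule loc)
  show ?thesis using assms
    by (intro aut_inverse[of _ "\<lambda>k. mfps_var (inv \<pi> k)"] loc)
      (simp_all add: v surj_f_inv_f inv_f_f bij_is_surj bij_is_inj)
qed

section \<open>Taylor expansion and finite determinacy\<close>

text \<open>The remainder T is quadratic in \<xi>, which raises the order t of f by s - 1 twice. On
  monomials this follows from the recursion T(m x_k) = d(m) \<xi>_k + T(m) (x_k + \<xi>_k), where d
  is the first-order term. No factorials occur, so the estimate holds in every
  characteristic.\<close>

lemma taylor:
  fixes \<xi> :: "'n::finite \<Rightarrow> ('n, 'k::comm_ring_1) mfps"
  assumes \<xi>: "\<And>i. \<xi> i \<in> mpower s" and s: "s \<ge> 1" and f: "f \<in> mpower t"
  shows "subst (\<lambda>i. mfps_var i + \<xi> i) f - f - (\<Sum>i\<in>UNIV. \<xi> i * mfps_pderiv i f) \<in> mpower (2 * s + t - 2)"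
proof -
  let ?\<Phi> = "subst (\<lambda>i. mfps_var i + \<xi> i)" and ?d = "\<lambda>f. \<Sum>i\<in>UNIV. \<xi> i * mfps_pderiv i f"
  have loc: "mfps_var i + \<xi> i \<in> mpower 1" for i
    by (intro filt_add var_in_filt filt_mono[OF \<xi> s]) auto
  define T where "T f = ?\<Phi> f - f - ?d f" for f
  have T: "clin T"
    unfolding T_def by (intro clin_minus_fun clin_id clin_subst loc clin_sum_fun clin_comp[OF clin_mult_left clin_pderiv])
  have d: "?d (mon a) \<in> mpower (s + mdeg a - 1)" for a
  proof (rule filt_sum)
    fix i
    have "mfps_pderiv i (mon a :: ('n, 'k) mfps) \<in> mpower (mdeg a - 1)"
      by (cases "mdeg a") (auto intro!: pderiv_mem_mpower mon_mem_filt simp flip: mdeg_eq_wt)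
    then show "\<xi> i * mfps_pderiv i (mon a) \<in> mpower (s + mdeg a - 1)"
      by (rule filt_mult_le[OF \<xi>]) simp
  qed
  have mon: "T (mon a) \<in> mpower (2 * s + mdeg a - 2)" for a
  proof (induction a rule: mdeg_induct)
    case zero show ?case by (simp add: T_def mon_zero lhom_one[OF lhom_subst[OF loc]])
  next
    case (add a k)
    have "?d (mon a * mfps_var k) = ?d (mon a) * mfps_var k + mon a * \<xi> k"
    proof -
      have "?d (mon a * mfps_var k) = (\<Sum>i\<in>UNIV. \<xi> i * mfps_pderiv i (mon a) * mfps_var k + (if i = k then mon a * \<xi> k else 0))"
        by (rule sum.cong) (auto simp: pderiv_mult pderiv_var algebra_simps)
      then show ?thesis by (simp add: sum.distrib sum_distrib_right)
    qed
    then have "T (mon a * mfps_var k) = ?d (mon a) * \<xi> k + T (mon a) * (mfps_var k + \<xi> k)"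
      unfolding T_def lhom_mult[OF lhom_subst[OF loc]] subst_var[OF loc] by (simp add: algebra_simps)
    moreover have "?d (mon a) * \<xi> k \<in> mpower (2 * s + mdeg (a + single k 1) - 2)"
      by (rule filt_mult_le[OF d \<xi>]) (use s in simp)
    moreover have "T (mon a) * (mfps_var k + \<xi> k) \<in> mpower (2 * s + mdeg (a + single k 1) - 2)"
      by (rule filt_mult_le[OF add loc]) (use s in simp)
    ultimately show ?case by (simp add: mon_mult[symmetric] var_eq_mon[symmetric] filt_add)
  qed
  have "T f \<in> mpower (2 * s + t - 2)"
  proof (rule clin_mem[OF T])
    fix a assume "mfps_nth f a \<noteq> 0"
    then have "t \<le> mdeg a" using mpowerD[OF f] by (metis not_le)
    then show "T (mon a) \<in> mpower (2 * s + t - 2)" by (intro filt_mono[OF mon]) simp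
  qed
  then show ?thesis by (simp add: T_def)
qed

text \<open>\<open>\<mm>\<^sup>M\<close> lies in the Jacobian ideal, by Nakayama's lemma.\<close>

definition jac_covers :: "nat \<Rightarrow> ('n::finite, 'k::comm_ring_1) mfps \<Rightarrow> bool" where
  "jac_covers M f \<longleftrightarrow> (\<forall>h\<in>mpower M. \<exists>r. h - (\<Sum>i\<in>UNIV. r i * mfps_pderiv i f) \<in> mpower (Suc M))"

text \<open>The coefficients of the combination inherit the surplus order \<open>t\<close>: writing
  h as a sum of x_k g_k moves one variable at a time from h into them.\<close>

lemma jac_covers_higher:
  fixes f :: "('n::finite, 'k::comm_ring_1) mfps"
  assumes "jac_covers M f" "h \<in> mpower (M + t)"
  shows "\<exists>r. (\<forall>i. r i \<in> mpower t) \<and> h - (\<Sum>i\<in>UNIV. r i * mfps_pderiv i f) \<in> mpower (Suc (M + t))"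
  using assms(2)
proof (induction t arbitrary: h)
  case 0 then show ?case using assms(1) unfolding jac_covers_def by auto
next
  case (Suc t)
  obtain g where g: "\<And>i. g i \<in> mpower (M + t)" "h = (\<Sum>i\<in>UNIV. mfps_var i * g i)"
    using mpower_Suc_decomp[of h "M + t"] Suc(2) by auto
  obtain r where r: "\<And>k i. r k i \<in> mpower t"
      "\<And>k. g k - (\<Sum>i\<in>UNIV. r k i * mfps_pderiv i f) \<in> mpower (Suc (M + t))"
    using Suc(1)[OF g(1)] by metis
  define q where "q i = (\<Sum>k\<in>UNIV. mfps_var k * r k i)" for i
  have "q i \<in> mpower (Suc t)" for i
    unfolding q_def by (rule filt_sum, rule filt_mult_le[OF var_in_filt[of 1] r(1)]) simp_all
  moreover have "h - (\<Sum>i\<in>UNIV. q i * mfps_pderiv i f) =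
      (\<Sum>k\<in>UNIV. mfps_var k * (g k - (\<Sum>i\<in>UNIV. r k i * mfps_pderiv i f)))"
    unfolding g(2) q_def sum_distrib_right sum_subtractf sum_distrib_left right_diff_distrib
    by (subst (2) sum.swap) (simp add: mult.assoc)
  moreover have "\<dots> \<in> mpower (Suc (M + Suc t))"
    by (rule filt_sum, rule filt_mult_le[OF var_in_filt[of 1] r(2)]) simp_all
  ultimately show ?case by (intro exI[of _ q]) simp
qed

lemma jet_eqI: "f - g \<in> mpower (Suc k) \<Longrightarrow> jet k f = jet k g"
proof -
  assume fg: "f - g \<in> mpower (Suc k)"
  have "mfps_nth f a = mfps_nth g a" if "mdeg a \<le> k" for a
    using mpowerD[OF fg, of a] that by simp
  then show ?thesis by (auto simp: jet_def jet_index_def)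
qed

text \<open>Each step removes the part of lowest order of the difference by a unipotent automorphism
  whose linear effect lies in the Jacobian ideal. Since \<open>f\<close> is determined by some jet,
  possibly of huge order \<open>k\<close>, finitely many steps suffice. The point is that the
  conclusion depends on \<open>M\<close> only, so the order of determinacy is brought down to 2M
  independently of \<open>k\<close>.\<close>

lemma finitely_determined:
  fixes f :: "('n::finite, 'k::field) mfps"
  assumes f: "f \<in> mpower 2" and M: "M \<ge> 1" and jac: "jac_covers M f" and det: "right_determined k f"
    and g: "g - f \<in> mpower (Suc (2 * M))"
  shows "g \<sim>\<^sub>r f"
proof -
  have step: "\<exists>h'\<in>mpower (Suc (M + t)). f + h \<sim>\<^sub>r f + h'" if h: "h \<in> mpower (M + t)" and t: "t \<ge> Suc M" for h t
  proof -
    obtain r where r: "\<And>i. r i \<in> mpower t" "h - (\<Sum>i\<in>UNIV. r i * mfps_pderiv i f) \<in> mpower (Suc (M + t))"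
      using jac_covers_higher[OF jac h] by blast
    define \<xi> where "\<xi> i = - r i" for i
    have \<xi>: "\<xi> i \<in> mpower t" for i unfolding \<xi>_def by (intro filt_uminus r)
    then have \<xi>2: "\<xi> i \<in> mpower 2" for i by (rule filt_mono) (use t M in simp)
    let ?\<Phi> = "subst (\<lambda>i. mfps_var i + \<xi> i)"
    have fh: "f + h \<in> mpower 2"
      by (intro filt_add f filt_mono[OF h]) (use t M in simp)
    define T where "T = ?\<Phi> (f + h) - (f + h) - (\<Sum>i\<in>UNIV. \<xi> i * mfps_pderiv i (f + h))"
    \<comment> \<open>The quadratic error has order 2t, which exceeds M + t because \<open>t\<close>
      is at least M + 1; this is why the difference must start in order 2M + 1.\<close>
    have "T \<in> mpower (2 * t + 2 - 2)"
      unfolding T_def by (rule taylor[OF \<xi> _ fh]) (use t in simp)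
    then have T: "T \<in> mpower (Suc (M + t))" by (rule filt_mono) (use t in simp)
    have dh: "(\<Sum>i\<in>UNIV. \<xi> i * mfps_pderiv i h) \<in> mpower (Suc (M + t))"
    proof (rule filt_sum)
      fix i
      have "mfps_pderiv i h \<in> mpower (M + t - 1)"
        by (rule pderiv_mem_mpower) (use h t in simp)
      then show "\<xi> i * mfps_pderiv i h \<in> mpower (Suc (M + t))"
        by (rule filt_mult_le[OF \<xi>]) (use t M in simp)
    qed
    define h' where "h' = (h - (\<Sum>i\<in>UNIV. r i * mfps_pderiv i f)) + (\<Sum>i\<in>UNIV. \<xi> i * mfps_pderiv i h) + T"
    have "(\<Sum>i\<in>UNIV. \<xi> i * mfps_pderiv i f) = - (\<Sum>i\<in>UNIV. r i * mfps_pderiv i f)"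
      by (simp add: \<xi>_def sum_negf)
    then have "?\<Phi> (f + h) = f + h'"
      by (simp add: h'_def T_def pderiv_add distrib_left sum.distrib)
    then have "f + h \<sim>\<^sub>r f + h'" using right_equivI[OF aut_unipotent[of \<xi>, OF \<xi>2], of "f + h"] by simp
    moreover have "h' \<in> mpower (Suc (M + t))" unfolding h'_def by (intro filt_add r T dh)
    ultimately show ?thesis by blast
  qed
  have "\<exists>h\<in>mpower (M + (Suc M + j)). g \<sim>\<^sub>r f + h" for j
  proof (induction j)
    case 0 then show ?case using g right_equiv_refl[of g] by (intro bexI[of _ "g - f"]) (simp_all add: mult_2)
  next
    case (Suc j)
    then obtain h where h: "h \<in> mpower (M + (Suc M + j))" "g \<sim>\<^sub>r f + h" by blast
    obtain h' where h': "h' \<in> mpower (Suc (M + (Suc M + j)))" "f + h \<sim>\<^sub>r f + h'"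
      using step[OF h(1)] by auto
    show ?case using h' right_equiv_trans[OF h(2) h'(2)] by (intro bexI[of _ h']) simp_all
  qed
  then obtain h where h: "h \<in> mpower (M + (Suc M + k))" "g \<sim>\<^sub>r f + h" by blast
  have "h \<in> mpower (Suc k)" by (rule filt_mono[OF h(1)]) simp
  then have "jet k (f + h) = jet k f" by (intro jet_eqI) simp
  moreover have "f + h \<in> \<mm>" unfolding max_ideal_eq
    by (intro filt_add filt_mono[OF f] filt_mono[OF h(1)]) simp_all
  ultimately have "f + h \<sim>\<^sub>r f" using det unfolding right_determined_def by blast
  then show ?thesis using h(2) right_equiv_trans by blast
qed

lemma max_ideal_sq_subset: "max_ideal_sq \<subseteq> (mpower 2 :: ('n::finite, 'k::field) mfps set)"
proof
  fix f :: "('n, 'k) mfps" assume "f \<in> max_ideal_sq"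
  then have "f \<in> mfps_ideal.span {f * g | f g. f \<in> \<mm> \<and> g \<in> \<mm>}"
    by (simp add: max_ideal_sq_def mfps_ideal_gen_def)
  then show "f \<in> mpower 2"
  proof (induction rule: mfps_ideal.span_induct_alt)
    case (step c x y)
    then have "x \<in> mpower 2" unfolding max_ideal_eq by (auto intro: filt_mult_le)
    then show ?case using step by (intro filt_add filt_mult_left)
  qed simp
qed


section \<open>Polynomial functions\<close>

lemma polyfun_uminus: "P \<in> polyfun \<Longrightarrow> (\<lambda>v. - P v) \<in> polyfun"
  using polyfun.mult[OF polyfun.const[of "-1"]] by fastforce

lemma polyfun_diff: "P \<in> polyfun \<Longrightarrow> Q \<in> polyfun \<Longrightarrow> (\<lambda>v. P v - Q v) \<in> polyfun"
  using polyfun.add[OF _ polyfun_uminus] by fastforce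

lemma polyfun_sum: "(\<And>x. x \<in> A \<Longrightarrow> P x \<in> polyfun) \<Longrightarrow> (\<lambda>v. \<Sum>x\<in>A. P x v) \<in> polyfun"
  by (induction A rule: infinite_finite_induct) (auto intro: polyfun.const polyfun.add)

lemma polyfun_prod: "(\<And>x. x \<in> A \<Longrightarrow> P x \<in> polyfun) \<Longrightarrow> (\<lambda>v. \<Prod>x\<in>A. P x v) \<in> polyfun"
  by (induction A rule: infinite_finite_induct) (auto intro: polyfun.const polyfun.mult)

lemma polyfun_compose:
  assumes "P \<in> polyfun" "\<And>i. (\<lambda>u. L u i) \<in> polyfun"
  shows "(\<lambda>u. P (L u)) \<in> polyfun"
  using assms(1) by induction (auto intro: polyfun.intros assms(2))

lemma polyfun_line:
  assumes "P \<in> polyfun" shows "\<exists>p. \<forall>t. P (\<lambda>i. u i + t * v i) = poly p t"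
  using assms
proof induction
  case (const c) show ?case by (intro exI[of _ "[:c:]"]) simp
next
  case (coord i) show ?case by (intro exI[of _ "[:u i, v i:]"]) simp
next
  case (add P Q)
  then obtain p q where "\<forall>t. P (\<lambda>i. u i + t * v i) = poly p t" "\<forall>t. Q (\<lambda>i. u i + t * v i) = poly q t" by blast
  then show ?case by (intro exI[of _ "p + q"]) simp
next
  case (mult P Q)
  then obtain p q where "\<forall>t. P (\<lambda>i. u i + t * v i) = poly p t" "\<forall>t. Q (\<lambda>i. u i + t * v i) = poly q t" by blast
  then show ?case by (intro exI[of _ "p * q"]) simp
qed

lemma alg_closed_infinite: "infinite (UNIV :: 'k::alg_closed_field set)"
proof
  assume fin: "finite (UNIV :: 'k set)"
  define p :: "'k poly" where "p = (\<Prod>a\<in>UNIV. [:- a, 1:])"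
  have "degree p = card (UNIV :: 'k set)"
    unfolding p_def by (subst degree_prod_eq_sum_degree) auto
  moreover have "card (UNIV :: 'k set) > 0" using fin by (simp add: finite_UNIV_card_ge_0)
  ultimately have "degree (p + 1) > 0" by (simp add: degree_add_eq_left)
  then obtain x where "poly (p + 1) x = 0" using alg_closed_imp_poly_has_root by blast
  moreover have "poly p x = 0" using fin by (simp add: p_def poly_prod)
  ultimately show False by simp
qed

lemma polyfun_nonzero_line:
  assumes "P \<in> polyfun" "P (\<lambda>i. u i + t * v i) \<noteq> 0"
  shows "finite {t. P (\<lambda>i. u i + t * v i) = (0 :: 'k::field)}"
proof -
  obtain p where p: "\<forall>t. P (\<lambda>i. u i + t * v i) = poly p t" using polyfun_line[OF assms(1)] by blast
  then have "p \<noteq> 0" using assms(2) by auto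
  then show ?thesis using poly_roots_finite[of p] p by simp
qed

text \<open>Irreducibility of affine space over an infinite field: on the line joining the two
  points each polynomial has only finitely many zeros.\<close>

lemma polyfun_common_nonzero:
  fixes P Q :: "('i \<Rightarrow> 'k::field) \<Rightarrow> 'k"
  assumes inf: "infinite (UNIV :: 'k set)" and P: "P \<in> polyfun" "u \<in> affine_space D" "P u \<noteq> 0"
    and Q: "Q \<in> polyfun" "v \<in> affine_space D" "Q v \<noteq> 0"
  shows "\<exists>w\<in>affine_space D. P w \<noteq> 0 \<and> Q w \<noteq> 0"
proof -
  let ?l = "\<lambda>t i. u i + t * (v i - u i)"
  have "finite {t. P (?l t) = 0}"
    by (rule polyfun_nonzero_line[OF P(1), where t = 0]) (use P in simp)
  moreover have "finite {t. Q (?l t) = 0}"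
    by (rule polyfun_nonzero_line[OF Q(1), where t = 1]) (use Q in simp)
  ultimately have "finite ({t. P (?l t) = 0} \<union> {t. Q (?l t) = 0})" by simp
  then obtain t where "P (?l t) \<noteq> 0" "Q (?l t) \<noteq> 0"
    using inf by (metis (mono_tags, lifting) UnCI mem_Collect_eq ex_new_if_finite)
  moreover have "?l t \<in> affine_space D" using P(2) Q(2) by (auto simp: affine_space_def)
  ultimately show ?thesis by blast
qed

section \<open>Hilbert's basis theorem\<close>

text \<open>Subrings and their ideals are sets in one ambient ring, so that adjoining an element
  does not change the type; the ambient ring will be the ring of all functions on the coordinate
  vectors.\<close>

inductive_set idl :: "'a::comm_ring_1 set \<Rightarrow> 'a set \<Rightarrow> 'a set" for R F where
  zero: "0 \<in> idl R F"
| step: "r \<in> R \<Longrightarrow> f \<in> F \<Longrightarrow> g \<in> idl R F \<Longrightarrow> r * f + g \<in> idl R F"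

definition noeth :: "'a::comm_ring_1 set \<Rightarrow> bool" where
  "noeth R \<longleftrightarrow> (\<forall>F\<subseteq>R. \<exists>F0\<subseteq>F. finite F0 \<and> F \<subseteq> idl R F0)"

definition subring :: "'a::comm_ring_1 set \<Rightarrow> bool" where
  "subring R \<longleftrightarrow> 0 \<in> R \<and> 1 \<in> R \<and> (\<forall>x\<in>R. \<forall>y\<in>R. x + y \<in> R \<and> x * y \<in> R \<and> - x \<in> R)"

lemma idl_mono: "x \<in> idl R F \<Longrightarrow> F \<subseteq> G \<Longrightarrow> x \<in> idl R G"
  by (induction rule: idl.induct) (auto intro: idl.intros)

lemma idl_add: "x \<in> idl R F \<Longrightarrow> y \<in> idl R F \<Longrightarrow> x + y \<in> idl R F"
  by (induction rule: idl.induct) (auto intro: idl.intros simp: add.assoc)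

lemma idl_mult: "subring R \<Longrightarrow> x \<in> idl R F \<Longrightarrow> r \<in> R \<Longrightarrow> r * x \<in> idl R F"
proof -
  assume R: "subring R" and x: "x \<in> idl R F" and r: "r \<in> R"
  show ?thesis using x
  proof induction
    case (step s f g)
    have "(r * s) * f + r * g \<in> idl R F" using step R r by (intro idl.step) (auto simp: subring_def)
    then show ?case by (simp add: algebra_simps)
  qed (simp add: idl.zero)
qed

lemma idl_gen: "subring R \<Longrightarrow> x \<in> F \<Longrightarrow> x \<in> idl R F"
  using idl.step[of 1 R x F 0] by (auto intro: idl.zero simp: subring_def)

lemma idl_trans: "subring R \<Longrightarrow> x \<in> idl R F \<Longrightarrow> F \<subseteq> idl R G \<Longrightarrow> x \<in> idl R G"
proof -
  assume R: "subring R" and x: "x \<in> idl R F" and FG: "F \<subseteq> idl R G"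
  show ?thesis using x by induction (use R FG in \<open>auto intro: idl.zero idl_add idl_mult\<close>)
qed

lemma idl_finite: "x \<in> idl R F \<Longrightarrow> \<exists>F0\<subseteq>F. finite F0 \<and> x \<in> idl R F0"
proof (induction rule: idl.induct)
  case zero show ?case by (rule exI[of _ "{}"]) (auto intro: idl.zero)
next
  case (step r f g)
  then obtain F0 where "F0 \<subseteq> F" "finite F0" "g \<in> idl R F0" by blast
  then show ?case using step
    by (intro exI[of _ "insert f F0"]) (auto intro!: idl.step elim: idl_mono)
qed

lemma idl_finite_set:
  "finite G \<Longrightarrow> G \<subseteq> idl R F \<Longrightarrow> \<exists>F0\<subseteq>F. finite F0 \<and> G \<subseteq> idl R F0"
proof (induction rule: finite_induct)
  case (insert x G)
  then obtain F0 F1 where "F0 \<subseteq> F" "finite F0" "G \<subseteq> idl R F0" "F1 \<subseteq> F" "finite F1" "x \<in> idl R F1"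
    using idl_finite[of x R F] by auto
  then show ?case
    by (intro exI[of _ "F0 \<union> F1"]) (auto elim: idl_mono)
qed auto

lemma idl_diff: "subring R \<Longrightarrow> x \<in> idl R F \<Longrightarrow> y \<in> idl R F \<Longrightarrow> x - y \<in> idl R F"
proof -
  assume R: "subring R" and xy: "x \<in> idl R F" "y \<in> idl R F"
  have "- 1 \<in> R" using R unfolding subring_def by blast
  then have "x + (- 1) * y \<in> idl R F" by (intro idl_add idl_mult R xy)
  then show ?thesis by simp
qed

text \<open>Values of polynomial expressions in \<open>t\<close> of degree below \<open>d\<close>.
  As \<open>t\<close> may be algebraic over \<open>R\<close>, an element can have several such
  expressions; leading coefficients below are those of some expression.\<close>

primrec pdeg :: "'a::comm_ring_1 set \<Rightarrow> 'a \<Rightarrow> nat \<Rightarrow> 'a set" where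
  "pdeg R t 0 = {0}"
| "pdeg R t (Suc d) = {g + r * t ^ d | g r. g \<in> pdeg R t d \<and> r \<in> R}"

context
  fixes R :: "'a::comm_ring_1 set" and t :: 'a
  assumes R: "subring R"
begin

lemma pdeg_zero: "0 \<in> pdeg R t d"
  by (induction d) (use R in \<open>force simp: subring_def\<close>)+

lemma pdeg_Suc: "x \<in> pdeg R t d \<Longrightarrow> x \<in> pdeg R t (Suc d)"
  using R by (force simp: subring_def)

lemma pdeg_mono: "x \<in> pdeg R t d \<Longrightarrow> d \<le> e \<Longrightarrow> x \<in> pdeg R t e"
  by (induction e) (auto simp: le_Suc_eq intro: pdeg_Suc simp del: pdeg.simps)

lemma pdeg_add: "x \<in> pdeg R t d \<Longrightarrow> y \<in> pdeg R t d \<Longrightarrow> x + y \<in> pdeg R t d"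
proof (induction d arbitrary: x y)
  case (Suc d)
  then obtain g r h s where "x = g + r * t ^ d" "y = h + s * t ^ d" "g \<in> pdeg R t d" "h \<in> pdeg R t d" "r \<in> R" "s \<in> R"
    by auto
  then have "x + y = (g + h) + (r + s) * t ^ d" "g + h \<in> pdeg R t d" "r + s \<in> R"
    using Suc R by (auto simp: algebra_simps subring_def)
  then show ?case by auto
qed auto

lemma pdeg_scale: "x \<in> pdeg R t d \<Longrightarrow> r \<in> R \<Longrightarrow> r * x \<in> pdeg R t d"
proof (induction d arbitrary: x)
  case (Suc d)
  then obtain g s where "x = g + s * t ^ d" "g \<in> pdeg R t d" "s \<in> R" by auto
  then have "r * x = r * g + (r * s) * t ^ d" "r * g \<in> pdeg R t d" "r * s \<in> R"
    using Suc R by (auto simp: algebra_simps subring_def)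
  then show ?case by auto
qed auto

lemma pdeg_t: "x \<in> pdeg R t d \<Longrightarrow> t * x \<in> pdeg R t (Suc d)"
proof (induction d arbitrary: x)
  case (Suc d)
  then obtain g s where "x = g + s * t ^ d" "g \<in> pdeg R t d" "s \<in> R" by auto
  then have "t * x = t * g + s * t ^ Suc d" "t * g \<in> pdeg R t (Suc d)" "s \<in> R"
    using Suc by (auto simp: algebra_simps simp del: pdeg.simps)
  then show ?case unfolding pdeg.simps(2)[of R t "Suc d"] by blast
qed (use R in \<open>auto simp: subring_def\<close>)

lemma pdeg_tpow: "x \<in> pdeg R t d \<Longrightarrow> t ^ k * x \<in> pdeg R t (d + k)"
  by (induction k) (auto simp: mult.assoc intro: pdeg_t simp del: pdeg.simps)

lemma pdeg_mult: "x \<in> pdeg R t d \<Longrightarrow> y \<in> pdeg R t e \<Longrightarrow> x * y \<in> pdeg R t (d + e)"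
proof (induction e arbitrary: y)
  case (Suc e)
  then obtain g s where y: "y = g + s * t ^ e" "g \<in> pdeg R t e" "s \<in> R" by auto
  then have "x * y = x * g + s * (t ^ e * x)" by (simp add: algebra_simps)
  moreover have "x * g \<in> pdeg R t (d + Suc e)" using Suc y by (intro pdeg_mono[OF Suc(1)]) auto
  moreover have "s * (t ^ e * x) \<in> pdeg R t (d + Suc e)"
    using Suc y by (intro pdeg_mono[OF pdeg_scale[OF pdeg_tpow]]) auto
  ultimately show ?case by (simp only: pdeg_add)
qed (auto intro: pdeg_zero)

lemma pdeg_uminus: "x \<in> pdeg R t d \<Longrightarrow> - x \<in> pdeg R t d"
  using pdeg_scale[of x d "-1"] R unfolding subring_def by (metis mult_minus1)

lemma pdeg_base: "r \<in> R \<Longrightarrow> r \<in> pdeg R t 1"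
  by (force simp: One_nat_def)

lemma pdeg_tpow_scale: "s \<in> R \<Longrightarrow> s * t ^ k \<in> pdeg R t (Suc k)"
  using pdeg_zero by force

definition "adjoin = (\<Union>d. pdeg R t d)"

lemma subring_adjoin: "subring adjoin"
proof -
  have "x + y \<in> adjoin" if "x \<in> adjoin" "y \<in> adjoin" for x y
  proof -
    from that obtain d e where "x \<in> pdeg R t d" "y \<in> pdeg R t e" by (auto simp: adjoin_def)
    then have "x + y \<in> pdeg R t (max d e)" by (intro pdeg_add) (auto elim: pdeg_mono)
    then show ?thesis by (auto simp: adjoin_def)
  qed
  moreover have "x * y \<in> adjoin" if "x \<in> adjoin" "y \<in> adjoin" for x y
    using that pdeg_mult unfolding adjoin_def by blast
  moreover have "- x \<in> adjoin" if "x \<in> adjoin" for x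
    using that pdeg_uminus unfolding adjoin_def by blast
  moreover have "0 \<in> adjoin" "1 \<in> adjoin"
    using pdeg_zero[of 0] pdeg_base[of 1] R unfolding adjoin_def subring_def by blast+
  ultimately show ?thesis by (simp add: subring_def)
qed

lemma adjoin_base: "r \<in> R \<Longrightarrow> r \<in> adjoin"
  using pdeg_base unfolding adjoin_def by blast

lemma adjoin_t: "t \<in> adjoin"
proof -
  have "1 * t ^ 1 \<in> pdeg R t (Suc 1)" by (rule pdeg_tpow_scale) (use R in \<open>simp add: subring_def\<close>)
  then show ?thesis unfolding adjoin_def by (intro UN_I[of "Suc 1"]) (simp_all del: pdeg.simps)
qed

text \<open>Multiplying generators of leading exponent \<open>e\<close> by t^(d - e) realises every
  \<open>R\<close>-combination of their leading coefficients in degree \<open>d\<close>.\<close>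

lemma leading_combination:
  assumes "r \<in> idl R B" and "\<And>b. b \<in> B \<Longrightarrow> \<exists>h\<in>G. h - b * t ^ e \<in> pdeg R t e" and "e \<le> d"
  shows "\<exists>y\<in>idl adjoin G. y - r * t ^ d \<in> pdeg R t d"
  using assms(1)
proof induction
  case zero show ?case using pdeg_zero by (intro bexI[of _ 0]) (auto intro: idl.zero)
next
  case (step s b r)
  then obtain y h where y: "y \<in> idl adjoin G" "y - r * t ^ d \<in> pdeg R t d"
    and h: "h \<in> G" "h - b * t ^ e \<in> pdeg R t e" using assms(2) by metis
  have "s * t ^ (d - e) \<in> adjoin" using pdeg_tpow_scale[OF step(1)] unfolding adjoin_def by blast
  then have "s * t ^ (d - e) * h + y \<in> idl adjoin G" using h y by (intro idl.step)
  moreover have "s * (t ^ (d - e) * (h - b * t ^ e)) \<in> pdeg R t d"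
    using pdeg_scale[OF pdeg_tpow[OF h(2), of "d - e"] step(1)] assms(3) by simp
  then have "s * (t ^ (d - e) * (h - b * t ^ e)) + (y - r * t ^ d) \<in> pdeg R t d"
    using y by (intro pdeg_add)
  moreover have "t ^ (d - e) * t ^ e = t ^ d" using assms(3) by (simp flip: power_add)
  then have "s * (t ^ (d - e) * (h - b * t ^ e)) + (y - r * t ^ d) = s * t ^ (d - e) * h + y - (s * b + r) * t ^ d"
    by (simp add: algebra_simps)
  ultimately show ?case by auto
qed

text \<open>Hilbert's argument: the sets \<open>L d\<close> of leading coefficients increase with
  the degree, and finitely many elements, all found in some degree N, generate their union. Lifts of
  generators in the degrees up to N generate the ideal, by descent on the degree. They are finally
  expressed through finitely many elements of \<open>F\<close> itself.\<close>

lemma hilbert_basis: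
  assumes noeth: "noeth R" shows "noeth adjoin"
  unfolding noeth_def
proof (intro allI impI)
  note S = subring_adjoin
  fix F assume F: "F \<subseteq> adjoin"
  define I where "I = idl adjoin F"
  define L where "L d = {r \<in> R. \<exists>g\<in>pdeg R t d. g + r * t ^ d \<in> I}" for d
  have LSuc: "L d \<subseteq> L (Suc d)" for d
  proof
    fix r assume "r \<in> L d"
    then obtain g where "r \<in> R" "g \<in> pdeg R t d" "g + r * t ^ d \<in> I" by (auto simp: L_def)
    then have "t * g \<in> pdeg R t (Suc d)" "t * (g + r * t ^ d) \<in> I"
      using pdeg_t idl_mult[OF S _ adjoin_t] by (auto simp: I_def simp del: pdeg.simps)
    then show "r \<in> L (Suc d)" using \<open>r \<in> R\<close> by (auto simp: L_def algebra_simps simp del: pdeg.simps)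
  qed
  have Lmono: "L d \<subseteq> L e" if "d \<le> e" for d e using that LSuc by (rule lift_Suc_mono_le[rotated])
  have LR: "L d \<subseteq> R" for d by (auto simp: L_def)
  obtain L0 where L0: "L0 \<subseteq> (\<Union>d. L d)" "finite L0" "(\<Union>d. L d) \<subseteq> idl R L0"
    using noeth[unfolded noeth_def, rule_format, of "\<Union>d. L d"] LR by blast
  have "\<exists>N. L0 \<subseteq> L N"
    using L0(2,1)
  proof (induction rule: finite_induct)
    case (insert x A)
    then obtain N M where "A \<subseteq> L N" "x \<in> L M" by auto
    then have "insert x A \<subseteq> L (max N M)" using Lmono[of N "max N M"] Lmono[of M "max N M"] by auto
    then show ?case by blast
  qed auto
  then obtain N where N: "L0 \<subseteq> L N" by blast
  have "\<exists>B\<subseteq>L d. finite B \<and> L d \<subseteq> idl R B" for d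
    using noeth[unfolded noeth_def, rule_format, OF LR] by blast
  then obtain B0 where B0: "\<And>d. B0 d \<subseteq> L d" "\<And>d. finite (B0 d)" "\<And>d. L d \<subseteq> idl R (B0 d)" by metis
  \<comment> \<open>In degree N the generators \<open>L0\<close> of the whole union are taken, so
    that \<open>B N\<close> serves all degrees from N on; hence \<open>min d N\<close>
    below.\<close>
  define B where "B d = (if d = N then L0 else B0 d)" for d
  have B: "B d \<subseteq> L d" "finite (B d)" for d using B0 L0 N by (auto simp: B_def)
  have "\<forall>d. \<forall>b\<in>B d. \<exists>h\<in>I. h - b * t ^ d \<in> pdeg R t d"
  proof (intro allI ballI)
    fix d b assume "b \<in> B d"
    then have "b \<in> L d" using B by blast
    then obtain g where "g \<in> pdeg R t d" "g + b * t ^ d \<in> I" by (auto simp: L_def)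
    then show "\<exists>h\<in>I. h - b * t ^ d \<in> pdeg R t d" by (intro bexI[of _ "g + b * t ^ d"]) auto
  qed
  then obtain h where h: "\<And>d b. b \<in> B d \<Longrightarrow> h d b \<in> I \<and> h d b - b * t ^ d \<in> pdeg R t d" by metis
  define G where "G = (\<Union>d\<in>{..N}. h d ` B d)"
  have G: "finite G" "G \<subseteq> I" using B h by (auto simp: G_def)
  have lead: "\<exists>y\<in>idl adjoin G. y - r * t ^ d \<in> pdeg R t d" if r: "r \<in> L d" for r d
  proof -
    define e where "e = min d N"
    have "r \<in> idl R (B e)"
    proof (cases "d < N")
      case True then show ?thesis using r B0(3)[of d] by (auto simp: e_def B_def)
    next
      case False then show ?thesis using r L0(3) by (auto simp: e_def B_def)
    qed
    then show ?thesis
    proof (rule leading_combination)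
      fix b assume b: "b \<in> B e"
      then have "h e b \<in> G" by (auto simp: G_def e_def)
      then show "\<exists>h\<in>G. h - b * t ^ e \<in> pdeg R t e" using h[OF b] by blast
    qed (simp add: e_def)
  qed
  have GI: "idl adjoin G \<subseteq> I" using G(2) idl_trans[OF S] unfolding I_def by blast
  have gen: "x \<in> idl adjoin G" if "x \<in> I" "x \<in> pdeg R t d" for x d
    using that
  proof (induction d arbitrary: x)
    case 0 then show ?case by (auto intro: idl.zero)
  next
    case (Suc d)
    then obtain g r where x: "x = g + r * t ^ d" "g \<in> pdeg R t d" "r \<in> R" by auto
    then have "r \<in> L d" using Suc(2) by (auto simp: L_def)
    then obtain y where y: "y \<in> idl adjoin G" "y - r * t ^ d \<in> pdeg R t d" using lead by blast
    have "x - y = g + - (y - r * t ^ d)" by (simp add: x)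
    then have "x - y \<in> pdeg R t d" using pdeg_add[OF x(2) pdeg_uminus[OF y(2)]] by (simp only:)
    moreover have "x - y \<in> I" using Suc(2) y GI idl_diff[OF S] unfolding I_def by blast
    ultimately have "x - y \<in> idl adjoin G" using Suc(1) by blast
    then have "(x - y) + y \<in> idl adjoin G" using y(1) by (rule idl_add)
    then show ?case by simp
  qed
  obtain F0 where F0: "F0 \<subseteq> F" "finite F0" "G \<subseteq> idl adjoin F0"
    using idl_finite_set[OF G(1) G(2)[unfolded I_def]] by metis
  have "F \<subseteq> idl adjoin F0"
  proof
    fix x assume "x \<in> F"
    then have "x \<in> I" "x \<in> adjoin" using F idl_gen[OF S, of x F] unfolding I_def by blast+
    then have "x \<in> idl adjoin G" using gen unfolding adjoin_def by blast
    then show "x \<in> idl adjoin F0" using F0(3) by (rule idl_trans[OF S])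
  qed
  then show "\<exists>F0\<subseteq>F. finite F0 \<and> F \<subseteq> idl adjoin F0" using F0 by blast
qed

end

lemma coordinate_ring_noeth:
  assumes "finite D"
  shows "\<exists>S :: (('i \<Rightarrow> 'k::field) \<Rightarrow> 'k) set. subring S \<and> noeth S \<and> (\<forall>c. (\<lambda>v. c) \<in> S) \<and> (\<forall>i\<in>D. (\<lambda>v. v i) \<in> S)"
  using assms
proof (induction rule: finite_induct)
  case empty
  define S where "S = range (\<lambda>(c :: 'k) (v :: 'i \<Rightarrow> 'k). c)"
  have "subring S" unfolding subring_def S_def by (auto simp: zero_fun_def one_fun_def plus_fun_def times_fun_def fun_Compl_def image_iff fun_eq_iff)
  moreover have "noeth S" unfolding noeth_def
  proof (intro allI impI)
    fix F assume F: "F \<subseteq> S"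
    show "\<exists>F0\<subseteq>F. finite F0 \<and> F \<subseteq> idl S F0"
    proof (cases "F \<subseteq> {0}")
      case True then show ?thesis by (intro exI[of _ "{}"]) (auto intro: idl.zero)
    next
      case False
      then obtain c where c: "(\<lambda>v. c) \<in> F" "c \<noteq> 0" using F unfolding S_def by (auto simp: zero_fun_def)
      have "x \<in> idl S {\<lambda>v. c}" if "x \<in> F" for x
      proof -
        have "x \<in> S" using that F by blast
        then obtain d where d: "x = (\<lambda>v. d)" unfolding S_def by blast
        have "(\<lambda>v. d / c) * (\<lambda>v. c) + 0 \<in> idl S {\<lambda>v. c}"
          by (rule idl.step) (auto simp: S_def intro: idl.zero)
        moreover have "(\<lambda>v. d / c) * (\<lambda>v. c) + 0 = x" using c d by (auto simp: fun_eq_iff times_fun_def)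
        ultimately show ?thesis by simp
      qed
      then show ?thesis using c by (intro exI[of _ "{\<lambda>v. c}"]) auto
    qed
  qed
  ultimately show ?case by (intro exI[of _ S]) (auto simp: S_def)
next
  case (insert i D)
  then obtain S :: "(('i \<Rightarrow> 'k) \<Rightarrow> 'k) set" where S: "subring S" "noeth S" "\<forall>c. (\<lambda>v. c) \<in> S" "\<forall>i\<in>D. (\<lambda>v. v i) \<in> S" by blast
  let ?T = "adjoin S (\<lambda>v. v i)"
  show ?case
    using S subring_adjoin[OF S(1)] hilbert_basis[OF S(1,2)] adjoin_t[OF S(1)] adjoin_base[OF S(1)]
    by (intro exI[of _ ?T]) auto
qed

text \<open>A function in \<open>polyfun\<close> may involve coordinates outside \<open>D\<close>.
  These vanish on \<open>affine_space D\<close>, so the function is replaced by a member of the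
  noetherian ring \<open>S\<close> with the same values there. Finitely many equations then generate
  the others.\<close>

lemma zero_locus_finite:
  fixes F :: "(('i \<Rightarrow> 'k::field) \<Rightarrow> 'k) set"
  assumes D: "finite D" and F: "F \<subseteq> polyfun"
  shows "\<exists>F0\<subseteq>F. finite F0 \<and> zero_locus D F0 = zero_locus D F"
proof -
  obtain S :: "(('i \<Rightarrow> 'k) \<Rightarrow> 'k) set" where S: "subring S" "noeth S" "\<And>c. (\<lambda>v. c) \<in> S" "\<And>i. i \<in> D \<Longrightarrow> (\<lambda>v. v i) \<in> S"
    using coordinate_ring_noeth[OF D] by blast
  have "\<exists>Q\<in>S. \<forall>v\<in>affine_space D. Q v = P v" if "P \<in> polyfun" for P
    using that
  proof induction
    case (const c) show ?case using S(3)[of c] by (intro bexI[of _ "\<lambda>v. c"]) auto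
  next
    case (coord i)
    show ?case
    proof (cases "i \<in> D")
      case True then show ?thesis using S(4)[OF True] by (intro bexI[of _ "\<lambda>v. v i"]) auto
    next
      case False then show ?thesis using S(3)[of 0] by (intro bexI[of _ "\<lambda>v. 0"]) (auto simp: affine_space_def)
    qed
  next
    case (add P Q)
    then obtain P' Q' where "P' \<in> S" "Q' \<in> S" "\<forall>v\<in>affine_space D. P' v = P v" "\<forall>v\<in>affine_space D. Q' v = Q v" by blast
    then show ?case using S(1) by (intro bexI[of _ "P' + Q'"]) (auto simp: subring_def)
  next
    case (mult P Q)
    then obtain P' Q' where "P' \<in> S" "Q' \<in> S" "\<forall>v\<in>affine_space D. P' v = P v" "\<forall>v\<in>affine_space D. Q' v = Q v" by blast
    then show ?case using S(1) by (intro bexI[of _ "P' * Q'"]) (auto simp: subring_def)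
  qed
  then have "\<forall>P\<in>F. \<exists>Q. Q \<in> S \<and> (\<forall>v\<in>affine_space D. Q v = P v)" using F by blast
  from bchoice[OF this] obtain Q where Q: "\<And>P. P \<in> F \<Longrightarrow> Q P \<in> S"
      "\<And>P v. P \<in> F \<Longrightarrow> v \<in> affine_space D \<Longrightarrow> Q P v = P v" by auto
  obtain G where "G \<subseteq> Q ` F" "finite G" "Q ` F \<subseteq> idl S G"
    using S(2)[unfolded noeth_def, rule_format, of "Q ` F"] Q(1) by blast
  then obtain F0 where F0: "F0 \<subseteq> F" "finite F0" "Q ` F \<subseteq> idl S (Q ` F0)"
    by (metis finite_subset_image)
  have "P v = 0" if v: "v \<in> zero_locus D F0" and P: "P \<in> F" for v P
  proof -
    have va: "v \<in> affine_space D" and v0: "\<And>P. P \<in> F0 \<Longrightarrow> P v = 0" using v by (auto simp: zero_locus_def)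
    have "x v = 0" if "x \<in> idl S (Q ` F0)" for x
      using that
    proof induction
      case (step r f g)
      then obtain P where P: "P \<in> F0" "f = Q P" by blast
      then have "f v = 0" using v0[OF P(1)] Q(2)[OF _ va, of P] F0(1) by auto
      then show ?case using step by simp
    qed simp
    then show ?thesis using subsetD[OF F0(3) imageI[OF P]] Q(2)[OF P va] by metis
  qed
  then have "zero_locus D F0 = zero_locus D F" using F0(1) by (auto simp: zero_locus_def)
  then show ?thesis using F0 by blast
qed

section \<open>Images of polynomial maps that raise the dimension\<close>

interpretation fun_vs: vector_space "\<lambda>(a :: 'k::field) (f :: 'x \<Rightarrow> 'k) x. a * f x"
  by unfold_locales (auto simp: fun_eq_iff algebra_simps)

text \<open>Repetitions in the family are treated apart: they give an obvious relation, but
  dependence of the image as a set does not see them.\<close>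

lemma family_dependent:
  fixes F :: "'i \<Rightarrow> 'x \<Rightarrow> 'k::field"
  assumes I: "finite I" and T: "finite T" "card T < card I" and F: "\<And>i. i \<in> I \<Longrightarrow> F i \<in> fun_vs.span T"
  shows "\<exists>\<kappa>. (\<exists>i\<in>I. \<kappa> i \<noteq> 0) \<and> (\<forall>x. (\<Sum>i\<in>I. \<kappa> i * F i x) = 0)"
proof (cases "inj_on F I")
  case True
  have "fun_vs.dependent (F ` I)"
  proof (rule ccontr)
    assume "\<not> fun_vs.dependent (F ` I)"
    then have "card (F ` I) \<le> card T"
      using fun_vs.independent_span_bound[OF T(1)] F by blast
    then show False using T(2) card_image[OF True] by simp
  qed
  then obtain u where u: "\<exists>v\<in>F ` I. u v \<noteq> 0" "(\<Sum>v\<in>F ` I. (\<lambda>x. u v * v x)) = 0"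
    using fun_vs.dependent_finite[of "F ` I"] I by auto
  have "(\<Sum>i\<in>I. u (F i) * F i x) = 0" for x
  proof -
    have "(\<Sum>i\<in>I. u (F i) * F i x) = (\<Sum>v\<in>F ` I. u v * v x)"
      using sum.reindex[OF True, of "\<lambda>v. u v * v x"] by simp
    also have "\<dots> = (\<Sum>v\<in>F ` I. (\<lambda>x. u v * v x)) x" proof -
      have "(\<Sum>v\<in>V. u v * v x) = (\<Sum>v\<in>V. (\<lambda>x. u v * v x)) x" for V :: "('x \<Rightarrow> 'k) set"
        by (induction V rule: infinite_finite_induct) auto
      then show ?thesis .
    qed
    finally show ?thesis using u(2) by simp
  qed
  then show ?thesis using u(1) by (intro exI[of _ "\<lambda>i. u (F i)"]) auto
next
  case False
  then obtain i j where ij: "i \<in> I" "j \<in> I" "i \<noteq> j" "F i = F j" by (auto simp: inj_on_def)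
  define \<kappa> where "\<kappa> = (\<lambda>l. if l = i then 1 else if l = j then - 1 else (0 :: 'k))"
  have "(\<Sum>l\<in>I. \<kappa> l * F l x) = 0" for x
  proof -
    have "(\<Sum>l\<in>I. \<kappa> l * F l x) = (\<Sum>l\<in>{i, j}. \<kappa> l * F l x)"
      using ij I by (intro sum.mono_neutral_right) (auto simp: \<kappa>_def)
    then show ?thesis using ij by (simp add: \<kappa>_def)
  qed
  then show ?thesis using ij by (intro exI[of _ \<kappa>]) (auto simp: \<kappa>_def)
qed

section \<open>Polynomial functions of bounded degree and images of polynomial maps\<close>

definition monfuns :: "'j set \<Rightarrow> nat \<Rightarrow> (('j \<Rightarrow> 'k::field) \<Rightarrow> 'k) set" where
  "monfuns J E = (\<lambda>b u. \<Prod>j\<in>J. u j ^ b j) ` (J \<rightarrow>\<^sub>E {..E})"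

lemma finite_monfuns: "finite J \<Longrightarrow> finite (monfuns J E)"
  by (auto simp: monfuns_def intro!: finite_PiE)

lemma card_monfuns: "finite J \<Longrightarrow> card (monfuns J E) \<le> Suc E ^ card J"
  unfolding monfuns_def using card_image_le[of "J \<rightarrow>\<^sub>E {..E}"] by (simp add: card_PiE finite_PiE)

lemma monfunsI: "(\<And>j. j \<in> J \<Longrightarrow> b j \<le> E) \<Longrightarrow> (\<lambda>u. \<Prod>j\<in>J. u j ^ b j) \<in> monfuns J E"
  unfolding monfuns_def by (rule image_eqI[of _ _ "restrict b J"]) (auto simp: fun_eq_iff)

lemma span_monfuns_const: "(\<lambda>u. c) \<in> fun_vs.span (monfuns J E)"
proof -
  have "(\<lambda>u. \<Prod>j\<in>J. u j ^ 0) \<in> monfuns J E" by (rule monfunsI[of J "\<lambda>_. 0"]) simp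
  from fun_vs.span_scale[OF fun_vs.span_base[OF this], of c] show ?thesis by simp
qed

lemma monfuns_mono: "E \<le> E' \<Longrightarrow> monfuns J E \<subseteq> monfuns J E'"
  unfolding monfuns_def by (intro image_mono PiE_mono) auto

lemma span_monfuns_mono: "P \<in> fun_vs.span (monfuns J E) \<Longrightarrow> E \<le> E' \<Longrightarrow> P \<in> fun_vs.span (monfuns J E')"
  using fun_vs.span_mono[OF monfuns_mono] by blast

lemma span_monfuns_mult:
  assumes "P \<in> fun_vs.span (monfuns J E)" "Q \<in> fun_vs.span (monfuns J E')"
  shows "(\<lambda>u. P u * Q u) \<in> fun_vs.span (monfuns J (E + E'))"
  using assms(1)
proof (induction rule: fun_vs.span_induct_alt)
  case base show ?case using fun_vs.span_zero by (simp add: zero_fun_def)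
next
  case (step c p P)
  have "(\<lambda>u. p u * Q u) \<in> fun_vs.span (monfuns J (E + E'))"
    using assms(2)
  proof (induction rule: fun_vs.span_induct_alt)
    case base show ?case using fun_vs.span_zero by (simp add: zero_fun_def)
  next
    case (step d q Q)
    obtain a b where ab: "a \<in> J \<rightarrow>\<^sub>E {..E}" "b \<in> J \<rightarrow>\<^sub>E {..E'}" "p = (\<lambda>u. \<Prod>j\<in>J. u j ^ a j)" "q = (\<lambda>u. \<Prod>j\<in>J. u j ^ b j)"
      using step \<open>p \<in> monfuns J E\<close> unfolding monfuns_def by auto
    then have "(\<lambda>u. p u * q u) = (\<lambda>u. \<Prod>j\<in>J. u j ^ (a j + b j))"
      by (simp add: power_add prod.distrib)
    moreover have "\<dots> \<in> monfuns J (E + E')"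
      by (rule monfunsI) (use ab PiE_mem in \<open>fastforce intro: add_mono\<close>)
    ultimately have "(\<lambda>u. p u * q u) \<in> fun_vs.span (monfuns J (E + E'))" by (simp add: fun_vs.span_base)
    from fun_vs.span_add[OF fun_vs.span_scale[OF this, of d] step(2)] show ?case
      by (simp add: plus_fun_def algebra_simps)
  qed
  from fun_vs.span_add[OF fun_vs.span_scale[OF this, of c] step(2)] show ?case
    by (simp add: plus_fun_def algebra_simps)
qed

lemma span_monfuns_prod:
  assumes "\<And>x. x \<in> A \<Longrightarrow> P x \<in> fun_vs.span (monfuns J E)"
  shows "(\<lambda>u. \<Prod>x\<in>A. P x u) \<in> fun_vs.span (monfuns J (card A * E))"
  using assms
proof (induction A rule: infinite_finite_induct)
  case (insert x A)
  then show ?case using span_monfuns_mult[of "P x" J E] by simp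
qed (auto intro: span_monfuns_const)

lemma span_monfuns_diff_const:
  assumes "P \<in> fun_vs.span (monfuns J E)" shows "(\<lambda>u. (P u - a) * c) \<in> fun_vs.span (monfuns J E)"
proof -
  have "(\<lambda>u. c * (P u - a)) \<in> fun_vs.span (monfuns J E)"
    using fun_vs.span_scale[OF fun_vs.span_diff[OF assms span_monfuns_const[of a]], of c] by (simp add: fun_diff_def)
  then show ?thesis by (simp add: mult.commute)
qed

lemma polyfun_degree:
  fixes P :: "('j \<Rightarrow> 'k::field) \<Rightarrow> 'k"
  assumes J: "finite J" and P: "P \<in> polyfun"
  shows "\<exists>E. (\<lambda>u. P (\<lambda>j. if j \<in> J then u j else 0)) \<in> fun_vs.span (monfuns J E)"
  using P
proof induction
  case (const c) then show ?case using span_monfuns_const by blast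
next
  case (coord i)
  show ?case
  proof (cases "i \<in> J")
    case True
    have "(\<lambda>u :: 'j \<Rightarrow> 'k. \<Prod>j\<in>J. u j ^ (if j = i then 1 else 0)) \<in> monfuns J 1"
      by (rule monfunsI[of J "\<lambda>j. if j = i then 1 else 0"]) simp
    moreover have "(\<Prod>j\<in>J. u j ^ (if j = i then 1 else 0)) = u i" for u :: "'j \<Rightarrow> 'k"
    proof -
      have "(\<Prod>j\<in>J. u j ^ (if j = i then 1 else 0)) = (\<Prod>j\<in>J. if j = i then u i else 1)"
        by (rule prod.cong) auto
      then show ?thesis using True J by simp
    qed
    ultimately show ?thesis using True by (intro exI[of _ 1] fun_vs.span_base) auto
  next
    case False then show ?thesis using span_monfuns_const[of 0] by auto
  qed
next
  case (add P Q)
  then obtain E E' where 1: "(\<lambda>u. P (\<lambda>j. if j \<in> J then u j else 0)) \<in> fun_vs.span (monfuns J E)"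
    "(\<lambda>u. Q (\<lambda>j. if j \<in> J then u j else 0)) \<in> fun_vs.span (monfuns J E')" by blast
  from fun_vs.span_add[OF span_monfuns_mono[OF 1(1), of "max E E'"] span_monfuns_mono[OF 1(2), of "max E E'"]]
  show ?case by (intro exI[of _ "max E E'"]) (simp add: plus_fun_def)
next
  case (mult P Q)
  then show ?case using span_monfuns_mult by blast
qed

text \<open>Dimension theory is replaced by linear algebra. On a grid with N points per axis the N^s
  Lagrange polynomials, s = \<open>card M\<close>, are independent, but pulled back along the maps
  in \<open>C\<close> they lie in a space whose dimension grows only like the power
  \<open>card J\<close> of N. A nontrivial relation between the pullbacks defines a polynomial H
  that is nonzero at a grid point and vanishes on all images at once; a common nonzero of H and
  \<open>H0\<close> is the desired point.\<close>

lemma polynomial_images_not_dense: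
  fixes \<pi> :: "'c \<Rightarrow> ('j \<Rightarrow> 'k::field) \<Rightarrow> 'i \<Rightarrow> 'k"
  assumes inf: "infinite (UNIV :: 'k set)"
    and M: "finite M" and J: "finite J" and less: "card J < card M" and C: "finite C"
    and \<pi>: "\<And>c i. c \<in> C \<Longrightarrow> i \<in> M \<Longrightarrow> (\<lambda>u. \<pi> c u i) \<in> polyfun"
    and H0: "H0 \<in> polyfun" "v0 \<in> affine_space M" "H0 v0 \<noteq> 0"
  shows "\<exists>v\<in>affine_space M. H0 v \<noteq> 0 \<and> (\<forall>c\<in>C. \<forall>u\<in>affine_space J. \<exists>i\<in>M. \<pi> c u i \<noteq> v i)"
proof -
  define res :: "('j \<Rightarrow> 'k) \<Rightarrow> 'j \<Rightarrow> 'k" where "res u = (\<lambda>j. if j \<in> J then u j else 0)" for u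
  have "\<exists>E. c \<in> C \<and> i \<in> M \<longrightarrow> (\<lambda>u. \<pi> c (res u) i) \<in> fun_vs.span (monfuns J E)" for c i
    using polyfun_degree[OF J \<pi>[of c i]] unfolding res_def by auto
  then obtain e' where e': "\<And>c i. c \<in> C \<Longrightarrow> i \<in> M \<Longrightarrow> (\<lambda>u. \<pi> c (res u) i) \<in> fun_vs.span (monfuns J (e' c i))"
    by metis
  define e where "e = (\<lambda>(c, i). e' c i)"
  have e: "(\<lambda>u. \<pi> c (res u) i) \<in> fun_vs.span (monfuns J (e (c, i)))" if "c \<in> C" "i \<in> M" for c i
    using e'[OF that] by (simp add: e_def)
  define E where "E = Max (insert 0 (e ` (C \<times> M)))"
  have E: "(\<lambda>u. \<pi> c (res u) i) \<in> fun_vs.span (monfuns J E)" if "c \<in> C" "i \<in> M" for c i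
  proof (rule span_monfuns_mono[OF e[OF that]])
    show "e (c, i) \<le> E" unfolding E_def using that C M by (intro Max_ge) auto
  qed
  define s where "s = card M"
  \<comment> \<open>With this value the pullbacks span at most N^\<open>card J\<close> (N - 1)
    dimensions, fewer than N^s because \<open>card J\<close> is smaller than s.\<close>
  define N where "N = card C * (s * E + 1) ^ card J + 1"
  obtain A :: "'k set" where A: "finite A" "card A = N"
    using infinite_arbitrarily_large[OF inf] by blast
  define grid where "grid = M \<rightarrow>\<^sub>E A"
  have grid: "finite grid" "card grid = N ^ s"
    using A M by (auto simp: grid_def s_def finite_PiE card_PiE)
  \<comment> \<open>The Lagrange polynomial of the grid point \<open>g\<close>: it is 1 at
    \<open>g\<close> and 0 at the other grid points, and it has at most s N linear factors.\<close>
  define lag where "lag g v = (\<Prod>(i, a)\<in>(SIGMA i:M. A - {g i}). (v i - a) * inverse (g i - a))" for g v :: "'i \<Rightarrow> 'k"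
  have lag_poly: "lag g \<in> polyfun" for g
    unfolding lag_def by (rule polyfun_prod) (auto intro!: polyfun.mult polyfun_diff polyfun.coord polyfun.const)
  have lag_cong: "lag g v = lag g w" if "\<And>i. i \<in> M \<Longrightarrow> v i = w i" for g v w
    unfolding lag_def by (rule prod.cong) (auto simp: that)
  have lag_self: "lag g g = 1" for g
    unfolding lag_def by (rule prod.neutral) (auto intro!: right_inverse)
  have lag_other: "lag g h = 0" if gh: "g \<in> grid" "h \<in> grid" "g \<noteq> h" for g h
  proof -
    obtain i where i: "i \<in> M" "g i \<noteq> h i"
      using PiE_ext[OF gh(1,2)[unfolded grid_def]] gh(3) by blast
    then have "(i, h i) \<in> (SIGMA i:M. A - {g i})" using PiE_mem[OF gh(2)[unfolded grid_def]] by simp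
    moreover have "finite (SIGMA i:M. A - {g i})" using M A by auto
    ultimately show ?thesis unfolding lag_def by (intro prod_zero bexI[of _ "(i, h i)"]) auto
  qed
  have lag_deg: "(\<lambda>u. lag g (\<pi> c (res u))) \<in> fun_vs.span (monfuns J (s * N * E))" if "c \<in> C" for g c
  proof -
    have "(\<lambda>u. \<Prod>x\<in>(SIGMA i:M. A - {g i}). (\<pi> c (res u) (fst x) - snd x) * inverse (g (fst x) - snd x))
      \<in> fun_vs.span (monfuns J (card (SIGMA i:M. A - {g i}) * E))"
      by (rule span_monfuns_prod, rule span_monfuns_diff_const) (use E that in auto)
    moreover have "card (SIGMA i:M. A - {g i}) * E \<le> s * N * E"
    proof -
      have "card (SIGMA i:M. A - {g i}) \<le> card (M \<times> A)" using M A by (intro card_mono) auto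
      then show ?thesis using A by (simp add: card_cartesian_product s_def)
    qed
    ultimately show ?thesis unfolding lag_def case_prod_beta by (rule span_monfuns_mono)
  qed
  \<comment> \<open>Functions on the disjoint union of copies of the source space, one for each map:
    a linear relation between them holds for every map simultaneously.\<close>
  define emb :: "'c \<Rightarrow> (('j \<Rightarrow> 'k) \<Rightarrow> 'k) \<Rightarrow> 'c \<times> ('j \<Rightarrow> 'k) \<Rightarrow> 'k" where
    "emb c P = (\<lambda>(c', u). if c' = c then P u else 0)" for c P
  define T where "T = (\<Union>c\<in>C. emb c ` monfuns J (s * N * E))"
  have T: "finite T" using C finite_monfuns[OF J] by (auto simp: T_def)
  have emb_span: "emb c P \<in> fun_vs.span T" if "c \<in> C" "P \<in> fun_vs.span (monfuns J (s * N * E))" for c P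
    using that(2)
  proof (induction rule: fun_vs.span_induct_alt)
    case base
    have "emb c (\<lambda>a. 0) = 0" by (auto simp: emb_def fun_eq_iff)
    then show ?case using fun_vs.span_zero[of T] by (simp add: zero_fun_def)
  next
    case (step a p P)
    have "emb c p \<in> fun_vs.span T" using step that by (intro fun_vs.span_base) (auto simp: T_def)
    then have "(\<lambda>x. a * emb c p x) + emb c P \<in> fun_vs.span T"
      using step by (intro fun_vs.span_add fun_vs.span_scale) auto
    moreover have "(\<lambda>x. a * emb c p x) + emb c P = emb c ((\<lambda>x. a * p x) + P)" by (auto simp: emb_def fun_eq_iff)
    ultimately show ?case by (simp add: plus_fun_def)
  qed
  define Fg where "Fg g = (\<Sum>c\<in>C. emb c (\<lambda>u. lag g (\<pi> c (res u))))" for g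
  have "Fg g \<in> fun_vs.span T" for g
    unfolding Fg_def by (intro fun_vs.span_sum emb_span lag_deg)
  moreover have "card T < card grid"
  proof -
    have "card T \<le> (\<Sum>c\<in>C. card (emb c ` monfuns J (s * N * E)))"
      unfolding T_def by (rule card_UN_le[OF C])
    also have "\<dots> \<le> (\<Sum>c\<in>C. Suc (s * N * E) ^ card J)"
      by (intro sum_mono order_trans[OF card_image_le[OF finite_monfuns[OF J]] card_monfuns[OF J]])
    also have "\<dots> \<le> card C * (N * (s * E + 1)) ^ card J"
    proof -
      have "Suc (s * N * E) \<le> N * (s * E + 1)" by (simp add: N_def algebra_simps)
      then show ?thesis by (simp add: power_mono del: power_Suc)
    qed
    also have "\<dots> = N ^ card J * (N - 1)"
      unfolding power_mult_distrib by (simp add: N_def)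
    also have "\<dots> < N ^ card J * N" by (simp add: N_def)
    also have "\<dots> \<le> N ^ s"
      unfolding power_Suc2[symmetric] s_def by (rule power_increasing) (use less in \<open>auto simp: N_def\<close>)
    finally show ?thesis using grid by simp
  qed
  ultimately obtain \<kappa> g0 where \<kappa>: "g0 \<in> grid" "\<kappa> g0 \<noteq> 0" "\<And>x. (\<Sum>g\<in>grid. \<kappa> g * Fg g x) = 0"
    using family_dependent[OF grid(1) T, of Fg] by blast
  define H where "H v = (\<Sum>g\<in>grid. \<kappa> g * lag g v)" for v
  have H: "H \<in> polyfun"
    unfolding H_def by (intro polyfun_sum polyfun.mult polyfun.const lag_poly)
  have H_cong: "H v = H w" if "\<And>i. i \<in> M \<Longrightarrow> v i = w i" for v w
    unfolding H_def by (rule sum.cong) (auto simp: lag_cong[OF that])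
  have "H g0 = (\<Sum>g\<in>grid. if g = g0 then \<kappa> g0 else 0)"
    unfolding H_def using \<kappa>(1) by (intro sum.cong) (auto simp: lag_self lag_other)
  then have "H g0 \<noteq> 0" using \<kappa> grid by simp
  then have g0: "H (\<lambda>i. if i \<in> M then g0 i else 0) \<noteq> 0"
    using H_cong[of g0 "\<lambda>i. if i \<in> M then g0 i else 0"] by simp
  have H_im: "H (\<pi> c u) = 0" if "c \<in> C" "u \<in> affine_space J" for c u
  proof -
    have "res u = u" using that(2) by (auto simp: res_def affine_space_def)
    have "Fg g (c, u) = lag g (\<pi> c u)" for g
    proof -
      have "Fg g (c, u) = (\<Sum>c'\<in>C. emb c' (\<lambda>u. lag g (\<pi> c' (res u))) (c, u))"
        unfolding Fg_def using C by (induction rule: finite_induct) auto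
      also have "\<dots> = (\<Sum>c'\<in>C. if c' = c then lag g (\<pi> c u) else 0)"
        by (rule sum.cong) (auto simp: emb_def \<open>res u = u\<close>)
      finally show ?thesis using that C by simp
    qed
    then show ?thesis using \<kappa>(3)[of "(c, u)"] by (simp add: H_def)
  qed
  have "(\<lambda>i. if i \<in> M then g0 i else 0) \<in> affine_space M" by (simp add: affine_space_def)
  from polyfun_common_nonzero[OF inf H this g0 H0]
  obtain v where v: "v \<in> affine_space M" "H v \<noteq> 0" "H0 v \<noteq> 0" by blast
  have "\<exists>i\<in>M. \<pi> c u i \<noteq> v i" if "c \<in> C" "u \<in> affine_space J" for c u
    using H_cong[of "\<pi> c u" v] H_im[OF that] v(2) by auto
  then show ?thesis using v by blast
qed


section \<open>Varieties of dimension zero\<close>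

text \<open>These are the noetherian topological spaces, described by quasi-compactness of all
  subsets, a form that passes easily to subspaces and finite covers.\<close>

definition hereditarily_compact :: "'x topology \<Rightarrow> bool" where
  "hereditarily_compact T \<longleftrightarrow> (\<forall>A\<subseteq>topspace T. compactin T A)"

lemma topspace_zariski: "topspace (zariski D :: ('i \<Rightarrow> 'k::field) topology) = affine_space D"
proof
  show "topspace (zariski D :: ('i \<Rightarrow> 'k) topology) \<subseteq> affine_space D"
    using openin_topspace[of "zariski D :: ('i \<Rightarrow> 'k) topology"] unfolding openin_zariski by blast
  have "openin (zariski D) (affine_space D :: ('i \<Rightarrow> 'k) set)"
    unfolding openin_zariski
    by (rule exI[of _ "{\<lambda>v. 1}"]) (auto simp: zero_locus_def intro: polyfun.const)
  then show "affine_space D \<subseteq> topspace (zariski D :: ('i \<Rightarrow> 'k) topology)" by (rule openin_subset)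
qed

text \<open>Collecting the equations of all members of a cover, finitely many of them already have
  the same zero locus, and each belongs to one member.\<close>

lemma hereditarily_compact_zariski:
  assumes D: "finite D"
  shows "hereditarily_compact (zariski D :: ('i \<Rightarrow> 'k::field) topology)"
  unfolding hereditarily_compact_def compactin_def topspace_zariski
proof (intro allI impI conjI)
  fix A and \<U> :: "('i \<Rightarrow> 'k) set set"
  assume A: "A \<subseteq> affine_space D" and "(\<forall>U\<in>\<U>. openin (zariski D) U) \<and> A \<subseteq> \<Union>\<U>"
  then have \<U>: "\<forall>U\<in>\<U>. \<exists>F. F \<subseteq> polyfun \<and> U = affine_space D - zero_locus D F" and cov: "A \<subseteq> \<Union>\<U>"
    by (auto simp: openin_zariski)
  from bchoice[OF \<U>] obtain F where F': "\<forall>U\<in>\<U>. F U \<subseteq> polyfun \<and> U = affine_space D - zero_locus D (F U)" ..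
  have F: "F U \<subseteq> polyfun" "U = affine_space D - zero_locus D (F U)" if "U \<in> \<U>" for U
    using bspec[OF F' that] by (rule conjunct1 conjunct2)+
  define G where "G = (\<Union>U\<in>\<U>. F U)"
  have "G \<subseteq> polyfun" using F(1) by (auto simp: G_def)
  then obtain F0 where F0: "F0 \<subseteq> G" "finite F0" "zero_locus D F0 = zero_locus D G"
    using zero_locus_finite[OF D, of G] by blast
  have "\<forall>P\<in>F0. \<exists>U. U \<in> \<U> \<and> P \<in> F U" using F0(1) by (auto simp: G_def)
  from bchoice[OF this] obtain u where u: "\<And>P. P \<in> F0 \<Longrightarrow> u P \<in> \<U>" "\<And>P. P \<in> F0 \<Longrightarrow> P \<in> F (u P)" by blast
  have "A \<subseteq> \<Union>(u ` F0)"
  proof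
    fix v assume v: "v \<in> A"
    then obtain U where U: "U \<in> \<U>" "v \<in> U" using cov by blast
    have "v \<notin> zero_locus D (F U)" using U F(2)[OF U(1)] by blast
    then have "v \<notin> zero_locus D G" using U(1) by (auto simp: G_def zero_locus_def)
    then have "v \<notin> zero_locus D F0" using F0(3) by simp
    then obtain P where P: "P \<in> F0" "P v \<noteq> 0" using A v by (auto simp: zero_locus_def)
    have "v \<in> affine_space D - zero_locus D (F (u P))" using P u(2)[OF P(1)] A v by (auto simp: zero_locus_def)
    then have "v \<in> u P" using F(2)[OF u(1)[OF P(1)]] by simp
    then show "v \<in> \<Union>(u ` F0)" using P by blast
  qed
  then show "\<exists>\<F>. finite \<F> \<and> \<F> \<subseteq> \<U> \<and> A \<subseteq> \<Union>\<F>"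
    using F0(2) u(1) by (intro exI[of _ "u ` F0"]) auto
qed

lemma hereditarily_compact_subtopology:
  "hereditarily_compact T \<Longrightarrow> hereditarily_compact (subtopology T S)"
  by (auto simp: hereditarily_compact_def compactin_subtopology)

lemma hereditarily_compact_homeomorphic:
  assumes h: "homeomorphic_map T T' h" and T': "hereditarily_compact T'"
  shows "hereditarily_compact T"
  unfolding hereditarily_compact_def
proof (intro allI impI)
  fix A assume A: "A \<subseteq> topspace T"
  then have "h ` A \<subseteq> topspace T'" using homeomorphic_imp_surjective_map[OF h] by blast
  then show "compactin T A"
    using T' homeomorphic_map_compactness[OF h A] by (auto simp: hereditarily_compact_def)
qed

lemma hereditarily_compact_cover:
  assumes "finite \<U>" "\<Union>\<U> = topspace T" "\<And>U. U \<in> \<U> \<Longrightarrow> hereditarily_compact (subtopology T U)"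
  shows "hereditarily_compact T"
  unfolding hereditarily_compact_def
proof (intro allI impI)
  fix A assume A: "A \<subseteq> topspace T"
  have "compactin T (\<Union>U\<in>\<U>. A \<inter> U)"
  proof (rule compactin_Union)
    fix S assume "S \<in> (\<lambda>U. A \<inter> U) ` \<U>"
    then obtain U where U: "U \<in> \<U>" "S = A \<inter> U" by blast
    then have "S \<subseteq> topspace (subtopology T U)" using A by auto
    then have "compactin (subtopology T U) S" using assms(3)[OF U(1)] by (auto simp: hereditarily_compact_def)
    then show "compactin T S" by (simp add: compactin_subtopology)
  qed (use assms(1) in simp)
  moreover have "(\<Union>U\<in>\<U>. A \<inter> U) = A" using A assms(2) by blast
  ultimately show "compactin T A" by simp
qed

lemma t1_space_zariski: "t1_space (zariski D :: ('i \<Rightarrow> 'k::field) topology)"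
  unfolding t1_space_closedin_singleton topspace_zariski
proof
  fix x :: "'i \<Rightarrow> 'k" assume x: "x \<in> affine_space D"
  let ?F = "(\<lambda>i v. v i - x i) ` UNIV"
  have "zero_locus D ?F = {x}" using x by (auto simp: zero_locus_def)
  moreover have "?F \<subseteq> polyfun" by (auto intro!: polyfun_diff polyfun.coord polyfun.const)
  ultimately have "openin (zariski D) (affine_space D - {x})" unfolding openin_zariski by (intro exI[of _ ?F]) simp
  then show "closedin (zariski D) {x}" using x by (simp add: closedin_def topspace_zariski)
qed

lemma t1_space_open_cover:
  assumes "\<Union>\<U> = topspace T" "\<And>U. U \<in> \<U> \<Longrightarrow> openin T U" "\<And>U. U \<in> \<U> \<Longrightarrow> t1_space (subtopology T U)"
  shows "t1_space T"
  unfolding t1_space_closedin_singleton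
proof
  fix x assume x: "x \<in> topspace T"
  have "openin T (U - {x})" if U: "U \<in> \<U>" for U
  proof (cases "x \<in> U")
    case True
    then have "closedin (subtopology T U) {x}"
      using assms(3)[OF U] x unfolding t1_space_closedin_singleton by auto
    then have "openin (subtopology T U) (topspace (subtopology T U) - {x})" by (rule openin_diff[OF openin_topspace])
    moreover have "topspace (subtopology T U) = U" using openin_subset[OF assms(2)[OF U]] by auto
    ultimately show ?thesis using openin_open_subtopology[OF assms(2)[OF U]] by auto
  next
    case False then show ?thesis using assms(2)[OF U] by simp
  qed
  then have "openin T (\<Union>U\<in>\<U>. U - {x})" by (rule openin_Union[OF, simplified] | blast)+
  moreover have "(\<Union>U\<in>\<U>. U - {x}) = topspace T - {x}" using assms(1) by blast
  ultimately show "closedin T {x}" using x by (simp add: closedin_def)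
qed

text \<open>A minimal infinite closed set is irreducible: of two closed sets covering it, one meets
  it in an infinite set, hence contains it. Together with one of its points, which is closed by T1,
  it forms a chain of length 1.\<close>

lemma finite_if_krull_dim_0:
  assumes hc: "hereditarily_compact T" and t1: "t1_space T" and dim: "krull_dim T = 0"
  shows "finite (topspace T)"
proof (rule ccontr)
  assume inf: "infinite (topspace T)"
  define r where "r = {(C, D). closedin T C \<and> closedin T D \<and> C \<subset> D}"
  \<comment> \<open>Descending chain condition for closed sets: the union of the complements of an
    infinite descending chain is compact, so it is exhausted by one of them and the chain
    stops.\<close>
  have "wf r"
    unfolding wf_iff_no_infinite_down_chain
  proof
    assume "\<exists>f. \<forall>i. (f (Suc i), f i) \<in> r"
    then obtain f where "\<forall>i. (f (Suc i), f i) \<in> r" ..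
    then have f: "closedin T (f i)" "f (Suc i) \<subset> f i" for i by (auto simp: r_def)
    have anti: "f j \<subseteq> f i" if "i \<le> j" for i j
      by (rule lift_Suc_antimono_le[of f, OF psubset_imp_subset[OF f(2)] that])
    let ?A = "\<Union>i. topspace T - f i"
    have "compactin T ?A" using hc by (auto simp: hereditarily_compact_def)
    then obtain \<F> where \<F>: "finite \<F>" "\<F> \<subseteq> range (\<lambda>i. topspace T - f i)" "?A \<subseteq> \<Union>\<F>"
      using f(1) unfolding compactin_def by (elim conjE allE[of _ "range (\<lambda>i. topspace T - f i)"]) auto
    then obtain I where I: "finite I" "\<F> = (\<lambda>i. topspace T - f i) ` I"
      by (metis finite_subset_image)
    obtain N where N: "\<And>i. i \<in> I \<Longrightarrow> i \<le> N" using I(1) by (metis finite_nat_set_iff_bounded_le)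
    obtain x where x: "x \<in> f N" "x \<notin> f (Suc N)" using f(2)[of N] by blast
    then have "x \<in> ?A" using closedin_subset[OF f(1)[of N]] by blast
    then obtain i where "i \<in> I" "x \<notin> f i" using \<F>(3) I(2) by blast
    then show False using anti[OF N] x(1) by blast
  qed
  moreover have "topspace T \<in> {C. closedin T C \<and> infinite C}" using inf by simp
  ultimately obtain C where C: "closedin T C" "infinite C"
    and min: "\<And>D. (D, C) \<in> r \<Longrightarrow> \<not> (closedin T D \<and> infinite D)"
    by (rule wfE_min) blast
  have irr: "irreducible_set T C"
    unfolding irreducible_set_def
  proof (intro conjI allI impI)
    fix A B assume AB: "closedin T A" "closedin T B" "C \<subseteq> A \<union> B"
    then have "C = (C \<inter> A) \<union> (C \<inter> B)" by blast
    then have "infinite (C \<inter> A) \<or> infinite (C \<inter> B)" using C(2) by (metis finite_Un)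
    moreover have "closedin T (C \<inter> A)" "closedin T (C \<inter> B)" using AB C by auto
    ultimately have "C \<inter> A = C \<or> C \<inter> B = C" using min C(1) unfolding r_def by blast
    then show "C \<subseteq> A \<or> C \<subseteq> B" by blast
  qed (use C closedin_subset in auto)
  obtain x where x: "x \<in> C" using C(2) by (metis finite.emptyI ex_in_conv)
  have xc: "closedin T {x}" using t1 x closedin_subset[OF C(1)] unfolding t1_space_closedin_singleton by blast
  have xi: "irreducible_set T {x}" using closedin_subset[OF xc] by (auto simp: irreducible_set_def)
  have "{x} \<subset> C" using x C(2) by (metis finite.emptyI finite.insertI empty_subsetI insert_subset psubsetI)
  then have "(1::nat) \<in> {r. \<exists>C :: nat \<Rightarrow> 'a set.
      (\<forall>i\<le>r. closedin T (C i) \<and> irreducible_set T (C i)) \<and> (\<forall>i<r. C i \<subset> C (Suc i))}"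
    using C(1) irr xc xi by (intro CollectI exI[of _ "\<lambda>i. if i = 0 then {x} else C"]) auto
  then have "enat 1 \<le> krull_dim T" unfolding krull_dim_def by (rule SUP_upper)
  then show False using dim by (simp add: enat_0_iff)
qed

lemma affine_chart_homeomorphic:
  assumes "affine_chart Y U m h"
  shows "openin (fs_top Y) U \<and> (\<exists>C. homeomorphic_map (subtopology (fs_top Y) U) (subtopology (zariski {..<m}) C) h)"
  using assms by (auto simp: affine_chart_def fspace_iso_def induced_def affine_fspace_def)

lemma variety_topology:
  assumes "is_variety (Y :: ('x, 'k::field) fspace)"
  shows "hereditarily_compact (fs_top Y)" "t1_space (fs_top Y)"
proof -
  obtain \<U> where \<U>: "finite \<U>" "\<Union>\<U> = points Y" "\<forall>U\<in>\<U>. \<exists>m h. affine_chart Y U m h"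
    using assms unfolding is_variety_def by blast
  have ch: "openin (fs_top Y) U \<and> hereditarily_compact (subtopology (fs_top Y) U) \<and> t1_space (subtopology (fs_top Y) U)"
    if U: "U \<in> \<U>" for U
  proof -
    obtain m h C where h: "openin (fs_top Y) U" and
      hom: "homeomorphic_map (subtopology (fs_top Y) U) (subtopology (zariski {..<m} :: (nat \<Rightarrow> 'k) topology) C) h"
      using bspec[OF \<U>(3) U] affine_chart_homeomorphic by blast
    have "hereditarily_compact (subtopology (fs_top Y) U)"
      by (rule hereditarily_compact_homeomorphic[OF hom hereditarily_compact_subtopology[OF hereditarily_compact_zariski]]) simp
    moreover have "t1_space (subtopology (fs_top Y) U)"
      using homeomorphic_t1_space[of "subtopology (fs_top Y) U" "subtopology (zariski {..<m} :: (nat \<Rightarrow> 'k) topology) C"]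
        homeomorphic_map_imp_homeomorphic_space[OF hom] t1_space_subtopology[OF t1_space_zariski] by blast
    ultimately show ?thesis using h by blast
  qed
  show "hereditarily_compact (fs_top Y)" using hereditarily_compact_cover[OF \<U>(1,2)] ch by blast
  show "t1_space (fs_top Y)" using t1_space_open_cover[OF \<U>(2)] ch by blast
qed

section \<open>Right simple singularities have finitely many classes nearby\<close>

text \<open>This replaces modality in everything that follows: it passes to equivalent series and to
  generic members of polynomial families, without any quotient being mentioned. The representatives
  in \<open>\<C>\<close> may lie anywhere; only their number matters.\<close>

definition fin_near :: "('n::finite, 'k::field) mfps \<Rightarrow> bool" where
  "fin_near f \<longleftrightarrow> f \<in> mpower 1 \<and> (\<exists>k. \<exists>H\<in>polyfun. H (jet k f) \<noteq> 0 \<and>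
     (\<exists>\<C>. finite \<C> \<and> (\<forall>g\<in>mpower 1. H (jet k g) \<noteq> 0 \<longrightarrow> (\<exists>h\<in>\<C>. h \<sim>\<^sub>r g))))"

text \<open>An infimum of extended naturals is attained, and the empty one is infinite. Hence
  modality 0 provides an actual jet order, an actual neighbourhood and an actual
  stratification.\<close>

lemma INF_enat_eq_0: "(INF x\<in>A. F x) = (0 :: enat) \<Longrightarrow> \<exists>x\<in>A. F x = 0"
proof -
  assume 0: "(INF x\<in>A. F x) = (0 :: enat)"
  then have "F ` A \<noteq> {}" by (auto simp: Inf_enat_def)
  then obtain y where "y \<in> F ` A" by blast
  then have "(LEAST x. x \<in> F ` A) \<in> F ` A" by (rule LeastI)
  moreover have "(LEAST x. x \<in> F ` A) = 0" using 0 \<open>F ` A \<noteq> {}\<close> by (simp add: Inf_enat_def)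
  ultimately have "0 \<in> F ` A" by simp
  then show ?thesis by (metis imageE)
qed

lemma SUP_enat_eq_0: "(SUP x\<in>A. F x) = (0 :: enat) \<Longrightarrow> x \<in> A \<Longrightarrow> F x = 0"
  by (metis SUP_upper bot.extremum_uniqueI bot_enat_def)

lemma jet_mem_affine: "jet k f \<in> affine_space (jet_index k)"
  by (simp add: jet_def affine_space_def)

lemma jet_Abs_jet: "v \<in> affine_space (jet_index k) \<Longrightarrow> jet k (Abs_mfps v) = v"
  by (auto simp: jet_def affine_space_def)

lemma Abs_mem_max: "v \<in> affine_space (jet_index k) \<Longrightarrow> (Abs_mfps v :: ('n::finite, 'k::field) mfps) \<in> mpower 1"
  unfolding max_ideal_eq[symmetric] max_ideal_def by (simp add: affine_space_def jet_index_def)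

text \<open>The image in the quotient has dimension 0 and lies in a variety, a noetherian T1 space;
  such a set is finite.\<close>

lemma finite_image_of_stratum:
  assumes strat: "rosenlicht_stratification H act X S" and mod: "stratified_modality S U = 0"
    and s: "(Xi, Yi, q) \<in> set S"
  shows "finite (q ` (U \<inter> Xi))"
proof -
  obtain i where i: "i < length S" "S ! i = (Xi, Yi, q)" using s by (metis in_set_conv_nth)
  have *: "Xi \<subseteq> points X" "is_variety Yi" "geometric_quotient H act (induced X Xi) Yi q"
    using strat i unfolding rosenlicht_stratification_def by (auto simp: Let_def dest!: spec[of _ i])
  have "krull_dim (subtopology (fs_top Yi) (q ` (U \<inter> Xi))) = 0"
    using SUP_enat_eq_0[OF mod[unfolded stratified_modality_def] s] by simp
  then have "finite (topspace (subtopology (fs_top Yi) (q ` (U \<inter> Xi))))"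
    by (intro finite_if_krull_dim_0 hereditarily_compact_subtopology t1_space_subtopology variety_topology[OF *(2)])
  moreover have "q ` Xi = topspace (fs_top Yi)"
  proof -
    have "q ` topspace (subtopology (fs_top X) Xi) = topspace (fs_top Yi)"
      using *(3) quotient_imp_surjective_map unfolding geometric_quotient_def by (fastforce simp: induced_def)
    then show ?thesis using *(1) by (simp add: Int_absorb1)
  qed
  then have "topspace (subtopology (fs_top Yi) (q ` (U \<inter> Xi))) = q ` (U \<inter> Xi)" by auto
  ultimately show ?thesis by simp
qed

text \<open>Points of a geometric quotient are orbits, so each of the finitely many strata
  contributes finitely many orbits of jets meeting \<open>U\<close>. On \<open>W\<close> all series
  are determined by their k-jets, and there an orbit of jets lies in a single class of series. The
  neighbourhood used is cut out by the product of equations for \<open>U\<close> and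
  \<open>W\<close>.\<close>

lemma right_simple_fin_near:
  fixes f :: "('n::finite, 'k::field) mfps"
  assumes f: "f \<in> mpower 1" and simple: "right_simple f"
  shows "fin_near f" "\<exists>k. right_determined k f"
proof -
  obtain k where k: "sufficiently_large k f"
    and "point_modality (right_group_jets k) (jet_act k) (jet_space k) (jet k f) = 0"
    using INF_enat_eq_0[OF simple[unfolded right_simple_def right_modality_def]] by blast
  then obtain U where U: "openin (fs_top (jet_space k)) U" "jet k f \<in> U"
    and "open_modality (right_group_jets k) (jet_act k) (jet_space k) U = 0"
    using INF_enat_eq_0 unfolding point_modality_def by blast
  then obtain S where S: "rosenlicht_stratification (right_group_jets k) (jet_act k) (jet_space k) S"
    "stratified_modality S U = 0"
    using INF_enat_eq_0 unfolding open_modality_def by blast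
  obtain W where W: "openin (fs_top (jet_space k)) W" "jet k f \<in> W"
      "\<And>g. g \<in> \<mm> \<Longrightarrow> jet k g \<in> W \<Longrightarrow> right_determined k g"
    using k unfolding sufficiently_large_def by blast
  show "\<exists>k. right_determined k f" using W(2,3) f unfolding max_ideal_eq by blast
  have basic: "\<exists>H\<in>polyfun. H (jet k f) \<noteq> 0 \<and> (\<forall>v\<in>affine_space (jet_index k). H v \<noteq> 0 \<longrightarrow> v \<in> V)"
    if V: "openin (fs_top (jet_space k)) V" "jet k f \<in> V" for V
  proof -
    obtain F where F: "F \<subseteq> polyfun" "V = affine_space (jet_index k) - zero_locus (jet_index k) F"
      using V(1) unfolding jet_space_def affine_fspace_def by (auto simp: openin_zariski)
    then obtain P where "P \<in> F" "P (jet k f) \<noteq> 0" using V(2) by (auto simp: zero_locus_def)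
    then show ?thesis using F by (intro bexI[of _ P]) (auto simp: zero_locus_def)
  qed
  obtain P where P: "P \<in> polyfun" "P (jet k f) \<noteq> 0" "\<And>v. v \<in> affine_space (jet_index k) \<Longrightarrow> P v \<noteq> 0 \<Longrightarrow> v \<in> U"
    using basic[OF U] by blast
  obtain Q where Q: "Q \<in> polyfun" "Q (jet k f) \<noteq> 0" "\<And>v. v \<in> affine_space (jet_index k) \<Longrightarrow> Q v \<noteq> 0 \<Longrightarrow> v \<in> W"
    using basic[OF W(1,2)] by blast
  have "\<forall>s\<in>set S. \<exists>V. V \<subseteq> U \<inter> fst s \<and> finite V \<and> snd (snd s) ` (U \<inter> fst s) = snd (snd s) ` V"
  proof
    fix s assume s: "s \<in> set S"
    obtain Xi Yi q where [simp]: "s = (Xi, Yi, q)" by (cases s)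
    have "finite (q ` (U \<inter> Xi))" by (rule finite_image_of_stratum[OF S]) (use s in simp)
    then obtain V where "V \<subseteq> U \<inter> Xi" "finite V" "q ` (U \<inter> Xi) = q ` V"
      using finite_subset_image[of "q ` (U \<inter> Xi)" q "U \<inter> Xi"] by blast
    then show "\<exists>V. V \<subseteq> U \<inter> fst s \<and> finite V \<and> snd (snd s) ` (U \<inter> fst s) = snd (snd s) ` V" by auto
  qed
  from bchoice[OF this] obtain V where V': "\<forall>s\<in>set S. V s \<subseteq> U \<inter> fst s \<and> finite (V s) \<and>
      snd (snd s) ` (U \<inter> fst s) = snd (snd s) ` V s" ..
  have V: "V s \<subseteq> U \<inter> fst s" "finite (V s)" "snd (snd s) ` (U \<inter> fst s) = snd (snd s) ` V s" if "s \<in> set S" for s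
    using bspec[OF V' that] by (rule conjunct1 conjunct2[THEN conjunct1] conjunct2[THEN conjunct2])+
  \<comment> \<open>Finitely many jets in \<open>U\<close> that meet all points of the images of the
    strata, read as polynomials.\<close>
  define \<C> :: "('n, 'k) mfps set" where "\<C> = Abs_mfps ` (\<Union>s\<in>set S. V s)"
  have "finite \<C>" using V(2) by (simp add: \<C>_def)
  moreover have "\<exists>h\<in>\<C>. h \<sim>\<^sub>r g" if g: "g \<in> mpower 1" "P (jet k g) * Q (jet k g) \<noteq> 0" for g
  proof -
    have gU: "jet k g \<in> U" and gW: "jet k g \<in> W"
      using g(2) P(3)[OF jet_mem_affine] Q(3)[OF jet_mem_affine] by auto
    have "jet k g \<in> points (jet_space k)" by (simp add: jet_space_def affine_fspace_def topspace_zariski jet_mem_affine)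
    then have "jet k g \<in> \<Union> (fst ` set S)"
      using conjunct1[OF S(1)[unfolded rosenlicht_stratification_def]] by (auto simp: case_prod_beta)
    then obtain s where s: "s \<in> set S" "jet k g \<in> fst s" by (metis UN_E)
    obtain Xi Yi q where sx: "s = (Xi, Yi, q)" by (cases s)
    obtain i where i: "i < length S" "S ! i = (Xi, Yi, q)" using s sx by (metis in_set_conv_nth)
    have Xi: "Xi \<subseteq> points (jet_space k)" "geometric_quotient (right_group_jets k) (jet_act k) (induced (jet_space k) Xi) Yi q"
      using S(1) i unfolding rosenlicht_stratification_def by (auto simp: Let_def dest!: spec[of _ i])
    have "q (jet k g) \<in> q ` V s" using V(3)[OF s(1)] s(2) gU by (auto simp: sx)
    then obtain v where v: "v \<in> V s" "q v = q (jet k g)" by auto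
    have vXi: "v \<in> Xi" using V(1)[OF s(1)] v(1) by (auto simp: sx)
    have pts: "points (induced (jet_space k) Xi) = Xi" using Xi(1) by (auto simp: induced_def)
    have "\<exists>T\<in>right_group_jets k. jet_act k T v = jet k g"
      using Xi(2) v(2) vXi s(2) unfolding geometric_quotient_def pts by (auto simp: sx)
    then obtain T where T: "T \<in> right_group_jets k" "jet_act k T v = jet k g" by blast
    define \<Psi> where "\<Psi> = (SOME \<Phi>. \<Phi> \<in> right_group \<and> aut_jet k \<Phi> = T)"
    have \<Psi>: "\<Psi> \<in> right_group"
    proof -
      have "\<exists>\<Phi>. \<Phi> \<in> right_group \<and> aut_jet k \<Phi> = T" using T(1) by (auto simp: right_group_jets_def)
      from someI_ex[OF this] show ?thesis by (simp add: \<Psi>_def)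
    qed
    have va: "v \<in> affine_space (jet_index k)"
      using vXi Xi(1) by (auto simp: jet_space_def affine_fspace_def topspace_zariski)
    have "jet k (\<Psi> (Abs_mfps v)) = jet k g" using T(2) by (simp add: jet_act_def \<Psi>_def)
    moreover have "\<Psi> (Abs_mfps v) \<in> \<mm>" unfolding max_ideal_eq
      by (rule lhom_mem_mpower[OF right_group_lhom[OF \<Psi>] Abs_mem_max[OF va]])
    ultimately have "\<Psi> (Abs_mfps v) \<sim>\<^sub>r g"
      using W(3)[OF _ gW] g(1) unfolding right_determined_def max_ideal_eq by blast
    then have "Abs_mfps v \<sim>\<^sub>r g" using right_equiv_trans[OF right_equivI[OF \<Psi>]] by blast
    then show ?thesis using v(1) s(1) by (auto simp: \<C>_def)
  qed
  moreover have "(\<lambda>v. P v * Q v) \<in> polyfun" using P Q by (intro polyfun.mult)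
  ultimately show "fin_near f" unfolding fin_near_def using P(2) Q(2)
    by (intro exI[of _ k] bexI[of _ "\<lambda>v. P v * Q v"] conjI exI[of _ \<C>] f ballI impI) simp_all
qed

text \<open>An automorphism acts on k-jets by the map \<open>L\<close>, whose components are
  polynomial, indeed affine, in the coefficients; the equation of the neighbourhood is pulled back
  along it.\<close>

lemma fin_near_right_equiv:
  fixes f g :: "('n::finite, 'k::field) mfps"
  assumes near: "fin_near f" and fg: "f \<sim>\<^sub>r g" shows "fin_near g"
proof -
  obtain \<Phi> where \<Phi>: "\<Phi> \<in> right_group" "f = \<Phi> g" using right_equiv_sym[OF fg] unfolding right_equiv_def by blast
  note h = right_group_lhom[OF \<Phi>(1)] and c = lhom_clin[OF right_group_lhom[OF \<Phi>(1)]]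
  obtain k H \<C> where H: "H \<in> polyfun" "H (jet k f) \<noteq> 0" and C: "finite \<C>"
      "\<And>g. g \<in> mpower 1 \<Longrightarrow> H (jet k g) \<noteq> 0 \<Longrightarrow> \<exists>h\<in>\<C>. h \<sim>\<^sub>r g"
    using near unfolding fin_near_def by blast
  have f: "f \<in> mpower 1" using near by (simp add: fin_near_def)
  have g: "g \<in> mpower 1"
  proof -
    have "inv \<Phi> f \<in> mpower 1" by (rule lhom_mem_mpower[OF right_group_lhom[OF right_group_inv[OF \<Phi>(1)]] f])
    then show ?thesis using \<Phi>(2) right_group_bij[OF \<Phi>(1)] by (simp add: bij_is_inj)
  qed
  define L where "L v = (\<lambda>a. if a \<in> jet_index k then
      mfps_nth (\<Phi> 1) a * mfps_nth g 0 + (\<Sum>b\<in>jet_index k. v b * mfps_nth (\<Phi> (mon b)) a) else 0)" for v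
  have jet: "jet k (\<Phi> u) = L (jet k u)" if "mfps_nth u 0 = mfps_nth g 0" for u
  proof
    fix a
    show "jet k (\<Phi> u) a = L (jet k u) a"
    proof (cases "a \<in> jet_index k")
      case True
      have "trunc (Suc k) u = mfps_scale (mfps_nth u 0) 1 + (\<Sum>b\<in>jet_index k. mfps_scale (mfps_nth u b) (mon b))"
      proof -
        have "{a :: 'n \<Rightarrow>\<^sub>0 nat. mdeg a < Suc k} = insert 0 (jet_index k)"
          by (auto simp: jet_index_def mdeg_eq_0_iff[symmetric])
        moreover have "(0 :: 'n \<Rightarrow>\<^sub>0 nat) \<notin> jet_index k" by (simp add: jet_index_def)
        ultimately show ?thesis by (simp add: trunc_def finite_jet_index mon_zero)
      qed
      moreover have "\<Phi> u = \<Phi> (trunc (Suc k) u) + \<Phi> (u - trunc (Suc k) u)" by (simp add: clin_minus[OF c])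
      moreover have "mfps_nth (\<Phi> (u - trunc (Suc k) u)) a = 0"
        by (rule mpowerD[OF lhom_mem_mpower[OF h trunc_diff]]) (use True in \<open>simp add: jet_index_def\<close>)
      ultimately show ?thesis using True that
        by (simp add: jet_def L_def clin_add[OF c] clin_sum[OF c] clin_scale[OF c] mult.commute)
    qed (simp add: jet_def L_def)
  qed
  have L: "(\<lambda>v. L v a) \<in> polyfun" for a
    unfolding L_def by (cases "a \<in> jet_index k")
      (auto intro!: polyfun.intros polyfun_sum)
  have "(\<lambda>v. H (L v)) \<in> polyfun" by (rule polyfun_compose[OF H(1) L])
  moreover have "H (L (jet k g)) \<noteq> 0" using H(2) jet[of g] \<Phi>(2) by simp
  moreover have "\<exists>h\<in>\<C>. h \<sim>\<^sub>r u" if u: "u \<in> mpower 1" "H (L (jet k u)) \<noteq> 0" for u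
  proof -
    have "mfps_nth u 0 = mfps_nth g 0" using mpowerD[OF u(1), of 0] mpowerD[OF g, of 0] by simp
    then have "H (jet k (\<Phi> u)) \<noteq> 0" using jet[of u] u(2) by simp
    then obtain h where "h \<in> \<C>" "h \<sim>\<^sub>r \<Phi> u" using C(2) lhom_mem_mpower[OF h u(1)] by blast
    then show ?thesis using right_equiv_trans[OF _ right_equiv_sym[OF right_equivI[OF \<Phi>(1), of u]]] by blast
  qed
  ultimately show ?thesis unfolding fin_near_def using C(1) g
    by (intro conjI exI[of _ k] bexI[of _ "\<lambda>v. H (L v)"] exI[of _ \<C>]) auto
qed

text \<open>The equation of the neighbourhood is restricted to a finite-dimensional affine family
  through \<open>f\<close>. The same finite set of classes serves all members off its zero set, and
  each of them is again of this kind.\<close>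

lemma fin_near_family:
  fixes f :: "('n::finite, 'k::field) mfps" and e :: "'i \<Rightarrow> ('n, 'k) mfps"
  assumes near: "fin_near f" and M: "finite M" and e: "\<And>i. i \<in> M \<Longrightarrow> e i \<in> mpower 1"
  shows "\<exists>H\<in>polyfun. \<exists>\<C>. H (\<lambda>i. 0) \<noteq> 0 \<and> finite \<C> \<and>
    (\<forall>v. H v \<noteq> 0 \<longrightarrow> fin_near (f + (\<Sum>i\<in>M. mfps_scale (v i) (e i))) \<and>
       (\<exists>h\<in>\<C>. h \<sim>\<^sub>r f + (\<Sum>i\<in>M. mfps_scale (v i) (e i))))"
proof -
  obtain k H \<C> where H: "H \<in> polyfun" "H (jet k f) \<noteq> 0" and C: "finite \<C>"
      "\<And>g. g \<in> mpower 1 \<Longrightarrow> H (jet k g) \<noteq> 0 \<Longrightarrow> \<exists>h\<in>\<C>. h \<sim>\<^sub>r g" and f: "f \<in> mpower 1"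
    using near unfolding fin_near_def by blast
  let ?f = "\<lambda>v. f + (\<Sum>i\<in>M. mfps_scale (v i) (e i))"
  have fv: "?f v \<in> mpower 1" for v by (intro filt_add f filt_sum filt_scale e)
  have "(\<lambda>v. jet k (?f v) a) \<in> polyfun" for a
    by (cases "a \<in> jet_index k") (auto simp: jet_def intro!: polyfun.intros polyfun_sum)
  then have "(\<lambda>v. H (jet k (?f v))) \<in> polyfun" by (intro polyfun_compose[OF H(1)])
  moreover have "H (jet k (?f (\<lambda>i. 0))) \<noteq> 0" using H(2) by simp
  moreover have "fin_near (?f v)" if "H (jet k (?f v)) \<noteq> 0" for v
    unfolding fin_near_def using that H(1) C fv
    by (intro conjI exI[of _ k] bexI[of _ H] exI[of _ \<C>]) auto
  ultimately show ?thesis using C fv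
    by (intro bexI[of _ "\<lambda>v. H (jet k (?f v))"] exI[of _ \<C>]) auto
qed

text \<open>A nonzero polynomial in the parameter is nonzero at some nonzero value. The result is
  used to add squares or products of variables, which raises the rank of the Hessian.\<close>

lemma fin_near_perturb:
  fixes f :: "('n::finite, 'k::field) mfps"
  assumes inf: "infinite (UNIV :: 'k set)" and near: "fin_near f" and e: "e \<in> mpower 1"
  shows "\<exists>c. c \<noteq> 0 \<and> fin_near (f + mfps_scale c e)"
proof -
  obtain H where H: "H \<in> polyfun" "H (\<lambda>i::unit. 0) \<noteq> 0"
      "\<And>v. H v \<noteq> 0 \<Longrightarrow> fin_near (f + (\<Sum>i\<in>{()}. mfps_scale (v i) e))"
    using fin_near_family[OF near, of "{()}" "\<lambda>_. e"] e by auto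
  obtain v where v: "H v \<noteq> 0" "v () \<noteq> 0"
    using polyfun_common_nonzero[OF inf H(1) _ H(2) polyfun.coord[of "()"], of "{()}" "\<lambda>_. 1"]
    by (auto simp: affine_space_def)
  then show ?thesis using H(3)[OF v(1)] by auto
qed

section \<open>A criterion for infinitely many classes nearby\<close>

definition supported_in :: "'n set \<Rightarrow> ('n \<Rightarrow>\<^sub>0 nat) \<Rightarrow> bool" where
  "supported_in P a \<longleftrightarrow> (\<forall>i. i \<notin> P \<longrightarrow> lookup a i = 0)"

text \<open>The variables outside \<open>P\<close>, called transversal, all carry the weight
  \<open>s\<close>. It is a separate argument because it is raised step by step while an
  automorphism is being controlled.\<close>

definition weight :: "'n set \<Rightarrow> ('n \<Rightarrow> nat) \<Rightarrow> nat \<Rightarrow> 'n \<Rightarrow> nat" where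
  "weight P u s = (\<lambda>i. if i \<in> P then u i else s)"

lemma wt_mono: "(\<And>i. w i \<le> v i) \<Longrightarrow> wt w a \<le> wt v a"
  unfolding wt_def by (intro sum_mono mult_right_mono) auto

lemma wt_weight_supported: "supported_in P a \<Longrightarrow> wt (weight P u s) a = wt u a"
  unfolding wt_def supported_in_def weight_def by (rule sum.cong) auto

lemma lookup_le_wt: "w i * lookup a i \<le> wt w (a :: 'n::finite \<Rightarrow>\<^sub>0 nat)"
  unfolding wt_def by (rule member_le_sum) auto

lemma wt_weight_unsupported:
  assumes "\<not> supported_in P a" shows "s \<le> wt (weight P u s) a"
proof -
  obtain i where i: "i \<notin> P" "lookup a i \<noteq> 0" using assms by (auto simp: supported_in_def)
  then have "s \<le> weight P u s i * lookup a i" by (simp add: weight_def)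
  then show ?thesis using lookup_le_wt[of "weight P u s" i a] by linarith
qed

lemma weight_mono: "s \<le> t \<Longrightarrow> weight P u s i \<le> weight P u t i"
  by (simp add: weight_def)

lemma filt_weight_mono: "f \<in> filt (weight P u s) m \<Longrightarrow> s \<le> t \<Longrightarrow> f \<in> filt (weight P u t) m"
proof (rule filtI)
  fix a assume f: "f \<in> filt (weight P u s) m" and st: "s \<le> t" and a: "wt (weight P u t) a < m"
  have "wt (weight P u s) a \<le> wt (weight P u t) a" by (rule wt_mono[OF weight_mono[OF st]])
  then show "mfps_nth f a = 0" using filtD[OF f] a by simp
qed

text \<open>A monomial containing a transversal variable has weight at least \<open>s\<close> in any
  case; on all other monomials both weights agree.\<close>

lemma filt_weight_antimono: "f \<in> filt (weight P u t) t \<Longrightarrow> s \<le> t \<Longrightarrow> f \<in> filt (weight P u s) s"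
proof (rule filtI, rule ccontr)
  fix a assume f: "f \<in> filt (weight P u t) t" and st: "s \<le> t"
    and a: "wt (weight P u s) a < s" "mfps_nth f a \<noteq> 0"
  then have "supported_in P a" using wt_weight_unsupported[of P a s u] by linarith
  then show False using filtD[OF f, of a] a st by (simp add: wt_weight_supported)
qed

text \<open>An automorphism carries the Jacobian ideal of f into that of its image: the chain rule
  for the inverse expresses the derivatives of f through those of \<Phi> f.\<close>

lemma transport_derivatives:
  fixes \<Phi> :: "('n::finite, 'k::field) mfps \<Rightarrow> ('n, 'k) mfps"
  assumes \<Phi>: "\<Phi> \<in> right_group" and g: "\<And>j. mfps_pderiv j (\<Phi> f) \<in> filt w t"
  shows "\<Phi> (mfps_pderiv i f) \<in> filt w t"
proof -
  let ?\<Psi> = "inv \<Phi>"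
  note \<Psi> = right_group_lhom[OF right_group_inv[OF \<Phi>]] and h = right_group_lhom[OF \<Phi>]
  have 1: "?\<Psi> (\<Phi> x) = x" for x using right_group_bij[OF \<Phi>] by (simp add: bij_is_inj)
  have 2: "\<Phi> (?\<Psi> x) = x" for x using right_group_bij[OF \<Phi>] by (simp add: bij_is_surj surj_f_inv_f)
  have "mfps_pderiv i f = (\<Sum>j\<in>UNIV. ?\<Psi> (mfps_pderiv j (\<Phi> f)) * mfps_pderiv i (?\<Psi> (mfps_var j)))"
    using chain_rule[OF \<Psi>, of i "\<Phi> f"] by (simp add: 1)
  then have "\<Phi> (mfps_pderiv i f) = (\<Sum>j\<in>UNIV. mfps_pderiv j (\<Phi> f) * \<Phi> (mfps_pderiv i (?\<Psi> (mfps_var j))))"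
    by (simp add: clin_sum[OF lhom_clin[OF h]] lhom_mult[OF h] 2)
  then show ?thesis by (simp add: filt_sum filt_mult_right g)
qed

text \<open>The automorphism must respect the locus where all \<open>x\<^sub>i\<close>, \<open>i \<notin> P\<close>, vanish to order \<open>e\<close>, because there
  the \<open>\<partial>\<^sub>i f\<close>, which are coordinates transversal to it, generate modulo order \<open>e\<close> the Jacobian ideal.\<close>

lemma automorphism_filtered:
  fixes \<Phi> :: "('n::finite, 'k::field) mfps \<Rightarrow> ('n, 'k) mfps"
  assumes \<Phi>: "\<Phi> \<in> right_group" and s0: "s0 \<le> e"
    and base: "\<And>i. \<Phi> (mfps_var i) \<in> filt (weight P u s0) (weight P u s0 i)"
    and tr: "\<And>i s. i \<notin> P \<Longrightarrow> s0 \<le> s \<Longrightarrow> s < e \<Longrightarrow>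
      mfps_pderiv i f - mfps_scale (\<epsilon> i) (mfps_var (\<sigma> i)) \<in> filt (weight P u s) (Suc s)"
    and \<epsilon>: "\<And>i. i \<notin> P \<Longrightarrow> \<epsilon> i \<noteq> 0" and \<sigma>: "\<And>j. j \<notin> P \<Longrightarrow> \<exists>i. i \<notin> P \<and> \<sigma> i = j"
    and g: "\<And>j. mfps_pderiv j (\<Phi> f) \<in> filt (weight P u e) e"
  shows "\<Phi> (mfps_var i) \<in> filt (weight P u e) (weight P u e i)"
proof -
  note h = right_group_lhom[OF \<Phi>]
  \<comment> \<open>One pass raises the transversal weight by one: a derivative of f is a nonzero
    multiple of a transversal variable up to weight s + 1, while its image has at least this weight
    because the derivatives of \<Phi> f have weight \<open>e\<close> > s.\<close>
  have "\<forall>i. \<Phi> (mfps_var i) \<in> filt (weight P u s) (weight P u s i)" if "s0 \<le> s" "s \<le> e" for s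
    using that
  proof (induction s rule: dec_induct)
    case base then show ?case using assms(3) by blast
  next
    case (step s)
    then have IH: "\<Phi> (mfps_var i) \<in> filt (weight P u s) (weight P u s i)" for i by simp
    show ?case
    proof
      fix j
      show "\<Phi> (mfps_var j) \<in> filt (weight P u (Suc s)) (weight P u (Suc s) j)"
      proof (cases "j \<in> P")
        case True
        then show ?thesis using filt_weight_mono[OF IH[of j], of "Suc s"] by (simp add: weight_def)
      next
        case False
        then obtain i where i: "i \<notin> P" "\<sigma> i = j" using \<sigma> by blast
        have "\<Phi> (mfps_pderiv i f - mfps_scale (\<epsilon> i) (mfps_var j)) \<in> filt (weight P u s) (Suc s)"
          using lhom_filt[OF h IH tr[OF i(1)]] step i(2) by simp
        then have "\<Phi> (mfps_pderiv i f) - mfps_scale (\<epsilon> i) (\<Phi> (mfps_var j)) \<in> filt (weight P u (Suc s)) (Suc s)"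
          by (simp add: clin_minus[OF lhom_clin[OF h]] clin_scale[OF lhom_clin[OF h]] filt_weight_mono)
        moreover have "\<Phi> (mfps_pderiv i f) \<in> filt (weight P u (Suc s)) (Suc s)"
          by (rule transport_derivatives[OF \<Phi>], rule filt_weight_antimono[OF g]) (use step in simp)
        ultimately have "\<Phi> (mfps_pderiv i f) - (\<Phi> (mfps_pderiv i f) - mfps_scale (\<epsilon> i) (\<Phi> (mfps_var j)))
            \<in> filt (weight P u (Suc s)) (Suc s)" by (rule filt_diff[rotated])
        then have "mfps_scale (\<epsilon> i) (\<Phi> (mfps_var j)) \<in> filt (weight P u (Suc s)) (Suc s)" by simp
        then have "mfps_scale (inverse (\<epsilon> i)) (mfps_scale (\<epsilon> i) (\<Phi> (mfps_var j))) \<in> filt (weight P u (Suc s)) (Suc s)"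
          by (rule filt_scale)
        then show ?thesis using \<epsilon>[OF i(1)] False by (simp add: scale_scale weight_def)
      qed
    qed
  qed
  then show ?thesis using s0 by blast
qed

text \<open>Only the parts of lowest weight of the substituted series contribute to the part of
  lowest weight of a monomial.\<close>

lemma mpow_perturb_weighted:
  assumes \<phi>: "\<And>i. \<phi> i \<in> filt w (v i)" and \<psi>: "\<And>i. \<psi> i - \<phi> i \<in> filt w (Suc (v i))"
  shows "mpow \<psi> a - mpow \<phi> a \<in> filt w (Suc (wt v a))"
proof (induction a rule: mdeg_induct)
  case (add a k)
  have "mpow \<psi> (a + single k 1) - mpow \<phi> (a + single k 1) =
      (mpow \<psi> a - mpow \<phi> a) * (\<phi> k + (\<psi> k - \<phi> k)) + mpow \<phi> a * (\<psi> k - \<phi> k)"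
    by (simp add: mpow_add mpow_single algebra_simps)
  moreover have "\<phi> k + (\<psi> k - \<phi> k) \<in> filt w (v k)" by (rule filt_add[OF \<phi> filt_mono[OF \<psi>]]) simp
  then have "(mpow \<psi> a - mpow \<phi> a) * (\<phi> k + (\<psi> k - \<phi> k)) \<in> filt w (Suc (wt v (a + single k 1)))"
    by (rule filt_mult_le[OF add]) simp
  moreover have "mpow \<phi> a * (\<psi> k - \<phi> k) \<in> filt w (Suc (wt v (a + single k 1)))"
    by (rule filt_mult_le[OF mpow_mem_filt[of \<phi>, OF \<phi>] \<psi>]) simp
  ultimately show ?case by (simp only: filt_add)
qed simp

lemma of_nat_mfps: "(of_nat m :: ('n::finite, 'k::comm_ring_1) mfps) = mfps_scale (of_nat m) 1"
proof (induction m)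
  case (Suc m)
  then show ?case by (auto intro!: mfps_eqI simp: algebra_simps)
qed (simp)

lemma frobenius_add:
  fixes x y :: "('n::finite, 'k::field) mfps"
  assumes p: "CHAR('k) = p" "prime p"
  shows "(x + y) ^ p = x ^ p + y ^ p"
proof -
  have "(x + y) ^ p = (\<Sum>j\<le>p. of_nat (p choose j) * x ^ j * y ^ (p - j))" by (rule binomial_ring)
  also have "\<dots> = (\<Sum>j\<in>{0, p}. of_nat (p choose j) * x ^ j * y ^ (p - j))"
  proof (rule sum.mono_neutral_right)
    show "\<forall>j\<in>{..p} - {0, p}. of_nat (p choose j) * x ^ j * y ^ (p - j) = 0"
    proof
      fix j assume "j \<in> {..p} - {0, p}"
      then have "p dvd (p choose j)" by (intro dvd_choose_prime p) auto
      then have "(of_nat (p choose j) :: 'k) = 0" using p by (simp add: of_nat_eq_0_iff_char_dvd)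
      then show "of_nat (p choose j) * x ^ j * y ^ (p - j) = 0" by (simp add: of_nat_mfps)
    qed
  qed auto
  also have "\<dots> = x ^ p + y ^ p"
    using prime_gt_0_nat[OF p(2)] by (simp add: add.commute)
  finally show ?thesis .
qed

definition param_subst :: "('n::finite \<times> ('n \<Rightarrow>\<^sub>0 nat)) set \<Rightarrow> ('n \<times> ('n \<Rightarrow>\<^sub>0 nat) \<Rightarrow> 'k) \<Rightarrow> 'n \<Rightarrow> ('n, 'k::comm_ring_1) mfps" where
  "param_subst J l i = (\<Sum>b\<in>{b. (i, b) \<in> J}. mfps_scale (l (i, b)) (mon b))"

lemma polyfun_coeff_mult:
  assumes "\<And>a. (\<lambda>l. mfps_nth (A l) a) \<in> polyfun" "\<And>a. (\<lambda>l. mfps_nth (B l) a) \<in> polyfun"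
  shows "(\<lambda>l. mfps_nth (A l * B l :: ('n::finite, 'k::field) mfps) a) \<in> polyfun"
  unfolding nth_mult case_prod_beta by (intro polyfun_sum polyfun.mult assms)

lemma polyfun_coeff_mpow:
  assumes "\<And>i a. (\<lambda>l. mfps_nth (\<phi> l i) a) \<in> polyfun"
  shows "(\<lambda>l. mfps_nth (mpow (\<phi> l) b :: ('n::finite, 'k::field) mfps) a) \<in> polyfun"
proof (induction b arbitrary: a rule: mdeg_induct)
  case zero show ?case by (simp add: polyfun.const)
next
  case (add b k)
  show ?case unfolding mpow_add mpow_single power_one_right by (intro polyfun_coeff_mult add assms)
qed

lemma polyfun_coeff_param: "(\<lambda>l. mfps_nth (param_subst J l i :: ('n::finite, 'k::field) mfps) a) \<in> polyfun"
  unfolding param_subst_def nth_sum nth_scale by (intro polyfun_sum polyfun.mult polyfun.const polyfun.coord)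

lemma not_fin_near:
  fixes f :: "('n::finite, 'k::field) mfps" and M :: "('n \<Rightarrow>\<^sub>0 nat) set" and J :: "('n \<times> ('n \<Rightarrow>\<^sub>0 nat)) set"
  assumes inf: "infinite (UNIV :: 'k set)" and near: "fin_near f"
    and M: "finite M" "\<And>a. a \<in> M \<Longrightarrow> supported_in P a" "\<And>a. a \<in> M \<Longrightarrow> a \<noteq> 0" "\<And>a. a \<in> M \<Longrightarrow> wt u a \<le> D"
    and J: "finite J" "card J < card M" "\<And>i b. i \<in> P \<Longrightarrow> supported_in P b \<Longrightarrow> wt u b = u i \<Longrightarrow> (i, b) \<in> J"
    and J': "\<And>i b. (i, b) \<in> J \<Longrightarrow> i \<in> P \<and> supported_in P b \<and> wt u b = u i"
    and u: "\<And>i. i \<in> P \<Longrightarrow> u i < e" and e: "s0 \<le> e" "D < 2 * e"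
    and rest: "f - (\<Sum>a\<in>M. mfps_scale (mfps_nth f a) (mon a)) \<in> filt (weight P u e) (Suc D)"
    and Mpow: "\<And>a. a \<in> M \<Longrightarrow> wt u a = D \<or>
       (prime (CHAR('k)) \<and> (\<exists>i\<in>P. a = single i (CHAR('k)) \<and> D < CHAR('k) * Suc (u i)))"
    and Md: "\<And>a j. a \<in> M \<Longrightarrow> (mfps_pderiv j (mon a) :: ('n, 'k) mfps) \<in> filt (weight P u e) e"
    and d: "\<And>j. mfps_pderiv j f \<in> filt (weight P u e) e"
    and tr: "\<And>i s. i \<notin> P \<Longrightarrow> s0 \<le> s \<Longrightarrow> s < e \<Longrightarrow>
      mfps_pderiv i f - mfps_scale (\<epsilon> i) (mfps_var (\<sigma> i)) \<in> filt (weight P u s) (Suc s)"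
    and \<epsilon>: "\<And>i. i \<notin> P \<Longrightarrow> \<epsilon> i \<noteq> 0" and \<sigma>: "\<And>j. j \<notin> P \<Longrightarrow> \<exists>i. i \<notin> P \<and> \<sigma> i = j"
    and H1: "H1 \<in> polyfun" "H1 (\<lambda>a. 0) \<noteq> 0"
    and base: "\<And>\<Phi> v v' i. \<Phi> \<in> right_group \<Longrightarrow> H1 v \<noteq> 0 \<Longrightarrow>
      \<Phi> (f + (\<Sum>a\<in>M. mfps_scale (v a) (mon a))) = f + (\<Sum>a\<in>M. mfps_scale (v' a) (mon a)) \<Longrightarrow>
      \<Phi> (mfps_var i) \<in> filt (weight P u s0) (weight P u s0 i)"
  shows False
proof -
  define F where "F v = f + (\<Sum>a\<in>M. mfps_scale (v a) (mon a))" for v :: "('n \<Rightarrow>\<^sub>0 nat) \<Rightarrow> 'k"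
  have monm: "(mon a :: ('n, 'k) mfps) \<in> mpower 1" if "a \<in> M" for a
    using M(3)[OF that] mdeg_eq_0_iff[of a] unfolding mdeg_eq_wt by (intro mon_mem_filt) linarith
  obtain H \<C> where H: "H \<in> polyfun" "H (\<lambda>i. 0) \<noteq> 0" and \<C>: "finite \<C>"
      "\<And>v. H v \<noteq> 0 \<Longrightarrow> \<exists>h\<in>\<C>. h \<sim>\<^sub>r F v"
    using fin_near_family[of f M mon, OF near M(1) monm] unfolding F_def by blast
  define H' where "H' v = H v * H1 v" for v
  have H': "H' \<in> polyfun" "H' (\<lambda>a. 0) \<noteq> 0" using H H1 unfolding H'_def by (auto intro: polyfun.mult)
  \<comment> \<open>A class representative in \<open>\<C>\<close> need not belong to the family.
    Each class that meets the family is given a member of it, depending on the class alone, so that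
    only finitely many maps \<open>\<pi>\<close> arise.\<close>
  define rep where "rep h = (SOME v. H' v \<noteq> 0 \<and> h \<sim>\<^sub>r F v)" for h
  have rep: "H' (rep h) \<noteq> 0 \<and> h \<sim>\<^sub>r F (rep h)" if "H' v \<noteq> 0" "h \<sim>\<^sub>r F v" for v h
    unfolding rep_def by (rule someI[of _ v]) (use that in simp)
  define \<Lambda> :: "('n \<times> ('n \<Rightarrow>\<^sub>0 nat) \<Rightarrow> 'k) \<Rightarrow> ('n \<Rightarrow>\<^sub>0 nat) \<Rightarrow> ('n, 'k) mfps" where
    "\<Lambda> l = mpow (param_subst J l)" for l
  \<comment> \<open>The parameters predicted for the image of the chosen member: coefficients at
    \<open>M\<close> after the graded substitution with parameters \<open>l\<close>, minus those of
    \<open>f\<close>.\<close>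
  define \<pi> where "\<pi> h l a = (\<Sum>b\<in>M. (mfps_nth f b + rep h b) * mfps_nth (\<Lambda> l b) a) - mfps_nth f a" for h l a
  have pi_poly: "(\<lambda>l. \<pi> h l a) \<in> polyfun" for h a
    unfolding \<pi>_def \<Lambda>_def
    by (intro polyfun_diff polyfun_sum polyfun.mult polyfun.const polyfun_coeff_mpow polyfun_coeff_param)
  obtain v where v: "H' v \<noteq> 0" "\<And>h l. h \<in> \<C> \<Longrightarrow> l \<in> affine_space J \<Longrightarrow> \<exists>a\<in>M. \<pi> h l a \<noteq> v a"
    using polynomial_images_not_dense[where \<pi> = \<pi>, OF inf M(1) J(1,2) \<C>(1) pi_poly H'(1) _ H'(2)]
    by (auto simp: affine_space_def)
  obtain h where h: "h \<in> \<C>" "h \<sim>\<^sub>r F v" using \<C>(2) v(1) unfolding H'_def by auto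
  define r where "r = rep h"
  have r: "H1 r \<noteq> 0" "h \<sim>\<^sub>r F r" using rep[OF v(1) h(2)] by (auto simp: r_def H'_def)
  obtain \<Phi> where \<Phi>: "\<Phi> \<in> right_group" "F v = \<Phi> (F r)"
    using right_equiv_trans[OF right_equiv_sym[OF r(2)] h(2)] unfolding right_equiv_def by blast
  note lh = right_group_lhom[OF \<Phi>(1)]
  let ?w = "weight P u e"
  have dF: "mfps_pderiv j (F x) \<in> filt ?w e" for j x
    unfolding F_def pderiv_add pderiv_sum pderiv_scale by (intro filt_add d filt_sum filt_scale Md)
  have trF: "mfps_pderiv i (F r) - mfps_scale (\<epsilon> i) (mfps_var (\<sigma> i)) \<in> filt (weight P u s) (Suc s)"
    if "i \<notin> P" "s0 \<le> s" "s < e" for i s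
  proof -
    have "(mfps_pderiv i (mon a) :: ('n, 'k) mfps) = 0" if "a \<in> M" for a
      using M(2)[OF that] \<open>i \<notin> P\<close> by (simp add: pderiv_mon supported_in_def)
    then have "mfps_pderiv i (F r) = mfps_pderiv i f"
      unfolding F_def pderiv_add pderiv_sum pderiv_scale by simp
    then show ?thesis using tr[OF that] by simp
  qed
  have fil: "\<Phi> (mfps_var i) \<in> filt ?w (?w i)" for i
  proof (rule automorphism_filtered[OF \<Phi>(1) e(1) _ trF \<epsilon> \<sigma>])
    show "\<Phi> (mfps_var i) \<in> filt (weight P u s0) (weight P u s0 i)" for i
      using base[OF \<Phi>(1) r(1), of v i] \<Phi>(2) by (simp add: F_def)
    show "mfps_pderiv j (\<Phi> (F r)) \<in> filt ?w e" for j using dF[of j v] \<Phi>(2) by simp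
  qed auto
  \<comment> \<open>The graded part of \<Phi> on the variables of \<open>P\<close>: for x_i just the
    coefficients at exponents of weight \<open>u i\<close>.\<close>
  define l where "l = (\<lambda>(i, b). if (i, b) \<in> J then mfps_nth (\<Phi> (mfps_var i)) b else 0)"
  have l: "l \<in> affine_space J" by (auto simp: affine_space_def l_def)
  have finJ: "finite {b. (i, b) \<in> J}" for i
    by (rule finite_subset[OF _ finite_imageI[OF J(1), of snd]]) force
  have nth_lin: "mfps_nth (param_subst J l i) b = l (i, b)" for i b
  proof -
    have "mfps_nth (param_subst J l i) b = (\<Sum>b'\<in>{b. (i, b) \<in> J}. if b' = b then l (i, b) else 0)"
      unfolding param_subst_def nth_sum nth_scale by (rule sum.cong) (auto simp: nth_mon)
    then show ?thesis using finJ by (auto simp: l_def)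
  qed
  have lin1: "param_subst J l i \<in> filt ?w (u i)" if "i \<in> P" for i
    unfolding param_subst_def by (intro filt_sum filt_scale mon_mem_filt)
      (use J' in \<open>auto simp: wt_weight_supported\<close>)
  have lin2: "\<Phi> (mfps_var i) - param_subst J l i \<in> filt ?w (Suc (u i))" if i: "i \<in> P" for i
  proof (rule filtI)
    fix b assume b: "wt ?w b < Suc (u i)"
    show "mfps_nth (\<Phi> (mfps_var i) - param_subst J l i) b = 0"
    proof (cases "wt ?w b = u i")
      case True
      then have "supported_in P b" using wt_weight_unsupported[of P b e u] u[OF i] by linarith
      then have "(i, b) \<in> J" using True J(3)[OF i] by (simp add: wt_weight_supported)
      then show ?thesis by (simp add: nth_lin) (simp add: l_def)
    next
      case False
      then have "wt ?w b < u i" using b by simp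
      moreover have "?w i = u i" using i by (simp add: weight_def)
      ultimately show ?thesis using filtD[OF fil[of i], of b] filtD[OF lin1[OF i], of b] by simp
    qed
  qed
  have close: "\<Phi> (mon a) - \<Lambda> l a \<in> filt ?w (Suc D)" if a: "a \<in> M" for a
    using Mpow[OF a]
  proof
    assume D: "wt u a = D"
    define \<phi> where "\<phi> i = (if i \<in> P then param_subst J l i else 0)" for i
    define \<psi> where "\<psi> i = (if i \<in> P then \<Phi> (mfps_var i) else 0)" for i
    have "mpow \<psi> a - mpow \<phi> a \<in> filt ?w (Suc (wt u a))"
      by (rule mpow_perturb_weighted) (auto simp: \<phi>_def \<psi>_def lin1 lin2)
    moreover have "mpow \<phi> a = \<Lambda> l a" "mpow \<psi> a = \<Phi> (mon a)"
      unfolding \<Lambda>_def lhom_mon[OF lh] mpow_def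
      by (rule prod.cong; use M(2)[OF a] in \<open>auto simp: supported_in_def \<phi>_def \<psi>_def\<close>)+
    ultimately show ?thesis using D by simp
  next
    assume "prime (CHAR('k)) \<and> (\<exists>i\<in>P. a = single i (CHAR('k)) \<and> D < CHAR('k) * Suc (u i))"
    then obtain i where i: "i \<in> P" "prime (CHAR('k))" "a = single i (CHAR('k))" "D < CHAR('k) * Suc (u i)" by blast
    \<comment> \<open>This rest has weight at least u_i + 1, so its p-th power has weight at least p
      (u_i + 1) > D.\<close>
    let ?R = "\<Phi> (mfps_var i) - param_subst J l i"
    have "\<Phi> (mon a) = (param_subst J l i + ?R) ^ CHAR('k)"
      by (simp add: lhom_mon[OF lh] i(3) mpow_single)
    also have "\<dots> = \<Lambda> l a + ?R ^ CHAR('k)"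
      unfolding frobenius_add[OF refl i(2)] by (simp add: \<Lambda>_def i(3) mpow_single)
    finally have "\<Phi> (mon a) - \<Lambda> l a = ?R ^ CHAR('k)" by simp
    then show ?thesis using filt_mono[OF filt_power[OF lin2[OF i(1)]], of "Suc D" "CHAR('k)"] i(4) by simp
  qed
  have "\<pi> h l a = v a" if a: "a \<in> M" for a
  proof -
    define G where "G = (\<Sum>b\<in>M. mfps_scale (mfps_nth f b + r b) (mon b))"
    have FG: "F r - G \<in> filt ?w (Suc D)"
    proof -
      have "F r - G = f - (\<Sum>a\<in>M. mfps_scale (mfps_nth f a) (mon a))"
        unfolding F_def G_def by (rule mfps_eqI) (simp add: distrib_right sum.distrib)
      then show ?thesis using rest by simp
    qed
    have "\<Phi> (F r - G) \<in> filt ?w (Suc D)" by (rule lhom_filt[OF lh fil FG])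
    then have 1: "F v - \<Phi> G \<in> filt ?w (Suc D)" by (simp add: clin_minus[OF lhom_clin[OF lh]] \<Phi>(2))
    have "\<Phi> G - (\<Sum>b\<in>M. mfps_scale (mfps_nth f b + r b) (\<Lambda> l b)) =
        (\<Sum>b\<in>M. mfps_scale (mfps_nth f b + r b) (\<Phi> (mon b) - \<Lambda> l b))"
      unfolding G_def clin_sum[OF lhom_clin[OF lh]] clin_scale[OF lhom_clin[OF lh]]
      by (rule mfps_eqI) (simp add: right_diff_distrib sum_subtractf)
    also have "\<dots> \<in> filt ?w (Suc D)" by (intro filt_sum filt_scale close)
    finally have 2: "\<Phi> G - (\<Sum>b\<in>M. mfps_scale (mfps_nth f b + r b) (\<Lambda> l b)) \<in> filt ?w (Suc D)" .
    have "wt ?w a < Suc D" using M(4)[OF a] M(2)[OF a] by (simp add: wt_weight_supported)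
    then have "mfps_nth (F v) a = mfps_nth (\<Sum>b\<in>M. mfps_scale (mfps_nth f b + r b) (\<Lambda> l b)) a"
      using filtD[OF filt_add[OF 1 2], of a] by simp
    also have "\<dots> = \<pi> h l a + mfps_nth f a" by (simp add: \<pi>_def r_def)
    also have "mfps_nth (F v) a = mfps_nth f a + v a"
    proof -
      have "(\<Sum>b\<in>M. v b * mfps_nth (mon b) a) = (\<Sum>b\<in>M. if b = a then v a else 0)"
        by (rule sum.cong) (auto simp: nth_mon)
      then show ?thesis using M(1) a by (simp add: F_def)
    qed
    finally show ?thesis by simp
  qed
  then show False using v(2)[OF h(1) l] by blast
qed

lemma scale_power: "mfps_scale c f ^ m = mfps_scale (c ^ m) (f ^ m :: ('n::finite, 'k::comm_ring_1) mfps)"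
  by (induction m) (simp_all add: scale_mult_left scale_mult_right scale_scale mult.commute)

lemma var_power: "mfps_var i ^ m = mon (single i m)"
  unfolding mon_eq_mpow mpow_single ..

lemma cube_diff: "(a + r) ^ 3 - a ^ 3 = (r * a) * (a + a + a) + (r * r) * (a + a + a + (r :: 'a::comm_ring_1))"
  by (simp add: power3_eq_cube algebra_simps)

section \<open>Hessians\<close>

definition hess :: "'n \<Rightarrow> 'n \<Rightarrow> ('n::finite, 'k::comm_ring_1) mfps \<Rightarrow> 'k" where
  "hess i j f = mfps_nth (mfps_pderiv i (mfps_pderiv j f)) 0"

lemma nth_pderiv_single: "mfps_nth (mfps_pderiv j f) (single i 1) = hess i j (f :: ('n::finite, 'k::comm_ring_1) mfps)"
  by (simp add: hess_def nth_pderiv[of i])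

lemma hess_neq: "i \<noteq> j \<Longrightarrow> hess i j (f :: ('n::finite, 'k::comm_ring_1) mfps) = mfps_nth f (single i 1 + single j 1)"
  by (simp add: hess_def nth_pderiv lookup_add lookup_single)

lemma hess_eq: "hess i i (f :: ('n::finite, 'k::comm_ring_1) mfps) = 2 * mfps_nth f (single i 2)"
proof -
  have "single i 1 + single i 1 = single i (2::nat)"
    by (metis one_add_one single_add)
  then show ?thesis by (simp add: hess_def nth_pderiv lookup_add lookup_single)
qed

lemma hess_sym: "hess i j (f :: ('n::finite, 'k::comm_ring_1) mfps) = hess j i f"
  by (cases "i = j") (simp_all add: hess_neq add.commute)

lemma hess_add: "hess i j (f + g :: ('n::finite, 'k::comm_ring_1) mfps) = hess i j f + hess i j g"
  by (simp add: hess_def pderiv_add)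

lemma hess_scale: "hess i j (mfps_scale c f :: ('n::finite, 'k::comm_ring_1) mfps) = c * hess i j f"
  by (simp add: hess_def pderiv_scale)

lemma nth_lhom_0:
  assumes "lhom \<Phi>" shows "mfps_nth (\<Phi> f) 0 = mfps_nth f 0"
proof -
  have "f - mfps_scale (mfps_nth f 0) 1 \<in> mpower 1"
    unfolding max_ideal_eq[symmetric] max_ideal_def by (simp add: nth_one)
  then have "\<Phi> (f - mfps_scale (mfps_nth f 0) 1) \<in> mpower 1" by (rule lhom_mem_mpower[OF assms])
  then have "\<Phi> f - mfps_scale (mfps_nth f 0) 1 \<in> mpower 1"
    by (simp add: clin_minus[OF lhom_clin[OF assms]] clin_scale[OF lhom_clin[OF assms]] lhom_one[OF assms])
  from mpowerD[OF this, of 0] show ?thesis by (simp add: nth_one)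
qed

lemma nth_pderiv_0: "mfps_nth (mfps_pderiv i f) 0 = mfps_nth (f :: ('n::finite, 'k::comm_ring_1) mfps) (single i 1)"
  by (simp add: nth_pderiv)

text \<open>Congruence by the linear part of \<Phi>. The terms with second derivatives of \<Phi>
  carry a first derivative of f as a factor, and this vanishes at the origin for f of order
  2.\<close>

lemma hess_lhom:
  fixes f :: "('n::finite, 'k::comm_ring_1) mfps"
  assumes \<Phi>: "lhom \<Phi>" and f: "f \<in> mpower 2"
  shows "hess i j (\<Phi> f) = (\<Sum>k\<in>UNIV. \<Sum>l\<in>UNIV. hess k l f *
    mfps_nth (\<Phi> (mfps_var k)) (single i 1) * mfps_nth (\<Phi> (mfps_var l)) (single j 1))"
proof -
  let ?A = "\<lambda>k i. mfps_nth (\<Phi> (mfps_var k)) (single i 1)"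
  have "mfps_nth (mfps_pderiv l f) 0 = 0" for l
    using mpowerD[OF f, of "single l 1"] by (simp add: nth_pderiv_0)
  then have z: "mfps_nth (\<Phi> (mfps_pderiv l f)) 0 = 0" for l by (simp add: nth_lhom_0[OF \<Phi>])
  have h: "mfps_nth (mfps_pderiv i (\<Phi> h)) 0 = (\<Sum>k\<in>UNIV. mfps_nth (mfps_pderiv k h) 0 * ?A k i)" for h
    unfolding chain_rule[OF \<Phi>, of i h] nth_sum nth_mult_0 nth_lhom_0[OF \<Phi>] by (simp only: nth_pderiv_0)
  have "hess i j (\<Phi> f) = (\<Sum>l\<in>UNIV. mfps_nth (mfps_pderiv i (\<Phi> (mfps_pderiv l f))) 0 * ?A l j)"
    unfolding hess_def chain_rule[OF \<Phi>, of j f] pderiv_sum pderiv_mult nth_sum nth_add nth_mult_0 z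
    by (simp add: nth_pderiv_0)
  also have "\<dots> = (\<Sum>l\<in>UNIV. (\<Sum>k\<in>UNIV. hess k l f * ?A k i) * ?A l j)"
    by (simp only: h hess_def)
  also have "\<dots> = (\<Sum>k\<in>UNIV. \<Sum>l\<in>UNIV. hess k l f * ?A k i * ?A l j)"
    unfolding sum_distrib_right by (rule sum.swap)
  finally show ?thesis .
qed

lemma single_eq_iff:
  "single i m = single j n \<longleftrightarrow> (i = j \<and> m = n) \<or> (m = 0 \<and> n = 0)"
  by (metis lookup_single_eq lookup_single_not_eq single_zero)

lemma single_eq_0_iff: "single i m = 0 \<longleftrightarrow> m = 0"
  by (metis lookup_single_eq lookup_zero single_zero)

section \<open>Families of non-simple singularities\<close>

lemma supported_add: "supported_in P (a + b) \<longleftrightarrow> supported_in P a \<and> supported_in P b"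
  by (auto simp: supported_in_def lookup_add)

lemma supported_single: "supported_in P (single i m) \<longleftrightarrow> i \<in> P \<or> m = 0"
  by (auto simp: supported_in_def lookup_single when_def)

lemma supported_zero [simp]: "supported_in P 0"
  by (simp add: supported_in_def)

lemma unsupported_split:
  assumes "\<not> supported_in P (a :: 'n \<Rightarrow>\<^sub>0 nat)"
  obtains i b where "i \<notin> P" "a = b + single i 1"
proof -
  obtain i where "i \<notin> P" "lookup a i > 0" using assms by (auto simp: supported_in_def)
  then show ?thesis using exists_single_add[of a i] that by blast
qed

text \<open>The filtration hypotheses of \<open>not_fin_near\<close> follow from conditions on
  coefficients. \<open>A\<close> makes the transversal block of the Hessian a monomial matrix
  belonging to the involution \<sigma>: the identity for diagonal Hessians, a pairing in
  characteristic 2. \<open>B\<close> excludes terms of low weight that are linear in the transversal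
  variables; terms quadratic in them have weight at least 2e > D anyway.\<close>

lemma not_fin_near_coefficients:
  fixes f :: "('n::finite, 'k::field) mfps" and M :: "('n \<Rightarrow>\<^sub>0 nat) set" and J :: "('n \<times> ('n \<Rightarrow>\<^sub>0 nat)) set"
  assumes inf: "infinite (UNIV :: 'k set)" and near: "fin_near f"
    and M: "finite M" "\<And>a. a \<in> M \<Longrightarrow> supported_in P a" "\<And>a. a \<in> M \<Longrightarrow> a \<noteq> 0" "\<And>a. a \<in> M \<Longrightarrow> wt u a \<le> D"
    and J: "finite J" "card J < card M" "\<And>i b. i \<in> P \<Longrightarrow> supported_in P b \<Longrightarrow> wt u b = u i \<Longrightarrow> (i, b) \<in> J"
      "\<And>i b. (i, b) \<in> J \<Longrightarrow> i \<in> P \<and> supported_in P b \<and> wt u b = u i"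
    and u: "\<And>i. i \<in> P \<Longrightarrow> 0 < u i \<and> u i < e \<and> e + u i \<le> Suc D" and e: "0 < s0" "s0 \<le> e" "D < 2 * e"
    and Mpow: "\<And>a. a \<in> M \<Longrightarrow> wt u a = D \<or>
       (prime (CHAR('k)) \<and> (\<exists>i\<in>P. a = single i (CHAR('k)) \<and> D < CHAR('k) * Suc (u i)))"
    and Md: "\<And>a j. a \<in> M \<Longrightarrow> j \<in> P \<Longrightarrow> e + u j \<le> wt u a \<or> (of_nat (lookup a j) :: 'k) = 0"
    and A: "\<And>i j. i \<notin> P \<Longrightarrow> j \<notin> P \<Longrightarrow> hess j i f = (if j = \<sigma> i then \<epsilon> i else 0)"
    and B: "\<And>i b. i \<notin> P \<Longrightarrow> supported_in P b \<Longrightarrow> wt u b < e \<Longrightarrow> mfps_nth f (b + single i 1) = 0"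
    and D: "\<And>a. supported_in P a \<Longrightarrow> wt u a \<le> D \<Longrightarrow> mfps_nth f a \<noteq> 0 \<Longrightarrow> a \<in> M"
    and \<epsilon>: "\<And>i. i \<notin> P \<Longrightarrow> \<epsilon> i \<noteq> 0" and \<sigma>: "\<And>j. j \<notin> P \<Longrightarrow> \<sigma> j \<notin> P" "\<And>j. j \<notin> P \<Longrightarrow> \<sigma> (\<sigma> j) = j"
    and H1: "H1 \<in> polyfun" "H1 (\<lambda>a. 0) \<noteq> 0"
    and base: "\<And>\<Phi> v v' i. \<Phi> \<in> right_group \<Longrightarrow> H1 v \<noteq> 0 \<Longrightarrow>
      \<Phi> (f + (\<Sum>a\<in>M. mfps_scale (v a) (mon a))) = f + (\<Sum>a\<in>M. mfps_scale (v' a) (mon a)) \<Longrightarrow>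
      \<Phi> (mfps_var i) \<in> filt (weight P u s0) (weight P u s0 i)"
  shows False
proof -
  have pos: "supported_in P b \<Longrightarrow> wt u b = 0 \<Longrightarrow> b = 0" for b :: "'n \<Rightarrow>\<^sub>0 nat"
  proof (rule poly_mapping_eqI)
    fix i assume b: "supported_in P b" "wt u b = 0"
    show "lookup b i = lookup 0 i"
      using lookup_le_wt[of u i b] b u[of i] by (cases "i \<in> P") (auto simp: supported_in_def)
  qed
  show False
  proof (rule not_fin_near[where f = f and M = M and P = P and u = u and D = D and J = J and e = e and \<sigma> = \<sigma> and \<epsilon> = \<epsilon>
        and ?s0.0 = s0 and ?H1.0 = H1, OF inf near M J u[THEN conjunct2, THEN conjunct1] e(2,3) _ Mpow _ _ _ \<epsilon> _ H1])
    show "f - (\<Sum>a\<in>M. mfps_scale (mfps_nth f a) (mon a)) \<in> filt (weight P u e) (Suc D)"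
    proof (rule filtI)
      fix b assume b: "wt (weight P u e) b < Suc D"
      have s: "mfps_nth (\<Sum>a\<in>M. mfps_scale (mfps_nth f a) (mon a)) b = (if b \<in> M then mfps_nth f b else 0)"
      proof -
        have "mfps_nth (\<Sum>a\<in>M. mfps_scale (mfps_nth f a) (mon a)) b = (\<Sum>a\<in>M. if a = b then mfps_nth f b else 0)"
          unfolding nth_sum nth_scale by (rule sum.cong) (auto simp: nth_mon)
        then show ?thesis using M(1) by simp
      qed
      show "mfps_nth (f - (\<Sum>a\<in>M. mfps_scale (mfps_nth f a) (mon a))) b = 0"
      proof (cases "supported_in P b")
        case True
        then show ?thesis using D[OF True] b unfolding nth_diff s by (auto simp: wt_weight_supported)
      next
        case False
        then obtain i c where i: "i \<notin> P" "b = c + single i 1" by (rule unsupported_split)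
        then have "wt (weight P u e) c < e" using b e by (simp add: weight_def)
        then have c: "supported_in P c" using wt_weight_unsupported[of P c e u] by linarith
        then have "mfps_nth f b = 0" using B[OF i(1) c] \<open>wt (weight P u e) c < e\<close> i(2) by (simp add: wt_weight_supported)
        then show ?thesis unfolding nth_diff s by simp
      qed
    qed
  next
    fix a j assume a: "a \<in> M"
    show "(mfps_pderiv j (mon a) :: ('n, 'k) mfps) \<in> filt (weight P u e) e"
    proof (cases "j \<in> P \<and> (of_nat (lookup a j) :: 'k) \<noteq> 0")
      case True
      then have "e + u j \<le> wt u a" using Md[OF a] by blast
      then have "e + weight P u e j \<le> wt (weight P u e) a"
        using True M(2)[OF a] by (simp add: wt_weight_supported) (simp add: weight_def)
      then show ?thesis by (intro pderiv_mem_filt mon_mem_filt)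
    next
      case False
      then have "(of_nat (lookup a j) :: 'k) = 0" using M(2)[OF a] by (auto simp: supported_in_def)
      then show ?thesis by (simp add: pderiv_mon)
    qed
  next
    fix j
    show "mfps_pderiv j f \<in> filt (weight P u e) e"
    proof (rule filtI)
      fix a assume a: "wt (weight P u e) a < e"
      then have sa: "supported_in P a" using wt_weight_unsupported[of P a e u] by linarith
      then have wa: "wt u a < e" using a by (simp add: wt_weight_supported)
      let ?c = "a + single j 1"
      show "mfps_nth (mfps_pderiv j f) a = 0"
      proof (cases "j \<in> P")
        case False then show ?thesis using B[OF False sa wa] by (simp add: nth_pderiv)
      next
        case True
        then have sc: "supported_in P ?c" using sa by (simp add: supported_add supported_single)
        have wc: "wt u ?c < e + u j" using wa by simp
        show ?thesis
        proof (cases "mfps_nth f ?c = 0")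
          case False
          then have "?c \<in> M" using D[OF sc _ False] wc u[OF True] by auto
          then have "(of_nat (lookup ?c j) :: 'k) = 0" using Md[OF _ True] wc by fastforce
          then show ?thesis by (simp add: nth_pderiv lookup_add)
        qed (simp add: nth_pderiv)
      qed
    qed
  next
    fix i s assume i: "i \<notin> P" and s: "s0 \<le> s" "s < e"
    show "mfps_pderiv i f - mfps_scale (\<epsilon> i) (mfps_var (\<sigma> i)) \<in> filt (weight P u s) (Suc s)"
    proof (rule filtI)
      fix a assume a: "wt (weight P u s) a < Suc s"
      show "mfps_nth (mfps_pderiv i f - mfps_scale (\<epsilon> i) (mfps_var (\<sigma> i))) a = 0"
      proof (cases "supported_in P a")
        case True
        then have "wt u a < e" using a s by (simp add: wt_weight_supported)
        then have "mfps_nth (mfps_pderiv i f) a = 0" using B[OF i True] by (simp add: nth_pderiv)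
        moreover have "a \<noteq> single (\<sigma> i) 1" using True \<sigma>(1)[OF i] by (auto simp: supported_single)
        ultimately show ?thesis by (simp add: var_eq_mon nth_mon)
      next
        case False
        then obtain j c where j: "j \<notin> P" "a = c + single j 1" by (rule unsupported_split)
        then have wc: "wt (weight P u s) c = 0" using a by (simp add: weight_def)
        then have "supported_in P c" using wt_weight_unsupported[of P c s u] s e by linarith
        then have "c = 0" using pos wc by (simp add: wt_weight_supported)
        then have "mfps_nth (mfps_pderiv i f) a = hess j i f" using j by (simp add: nth_pderiv_single)
        moreover have "mfps_nth (mfps_var (\<sigma> i) :: ('n, 'k) mfps) a = (if j = \<sigma> i then 1 else 0)"
          using j \<open>c = 0\<close> by (auto simp: var_eq_mon nth_mon single_eq_iff)
        ultimately show ?thesis using A[OF i j(1)] by simp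
      qed
    qed
  next
    fix j assume "j \<notin> P" then show "\<exists>i. i \<notin> P \<and> \<sigma> i = j" using \<sigma> by blast
  next
    fix \<Phi> :: "('n, 'k) mfps \<Rightarrow> ('n, 'k) mfps" and v v' i
    assume "\<Phi> \<in> right_group" "H1 v \<noteq> 0"
      "\<Phi> (f + (\<Sum>a\<in>M. mfps_scale (v a) (mon a))) = f + (\<Sum>a\<in>M. mfps_scale (v' a) (mon a))"
    then show "\<Phi> (mfps_var i) \<in> filt (weight P u s0) (weight P u s0 i)" by (rule base)
  qed
qed

lemma weight_one: "weight P (\<lambda>_. 1) 1 = (\<lambda>_. 1)"
  by (simp add: weight_def fun_eq_iff)

lemma mdeg_1_eq_single: "mdeg (b :: 'n::finite \<Rightarrow>\<^sub>0 nat) = 1 \<Longrightarrow> \<exists>j. b = single j 1"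
proof -
  assume b: "mdeg b = 1"
  then have "b \<noteq> 0" by auto
  then obtain j where "lookup b j > 0" by (metis gr0I poly_mapping_eqI lookup_zero)
  then obtain c where c: "b = c + single j 1" using exists_single_add[of b j] by blast
  then have "mdeg c = 0" using b by simp
  then show ?thesis using c by (intro exI[of _ j]) (simp add: mdeg_eq_0_iff)
qed

text \<open>The case of weight \<open>1\<close>: the graded automorphisms form \<open>GL(P)\<close>.\<close>

lemma not_fin_near_homogeneous:
  fixes f :: "('n::finite, 'k::field) mfps" and M :: "('n \<Rightarrow>\<^sub>0 nat) set"
  assumes inf: "infinite (UNIV :: 'k set)" and near: "fin_near f"
    and M: "finite M" "\<And>a. a \<in> M \<Longrightarrow> supported_in P a" "\<And>a. a \<in> M \<Longrightarrow> a \<noteq> 0" "\<And>a. a \<in> M \<Longrightarrow> mdeg a \<le> D"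
    and card: "card P * card P < card M" and e: "2 \<le> e" "e \<le> D" "D < 2 * e"
    and Mpow: "\<And>a. a \<in> M \<Longrightarrow> mdeg a = D \<or>
       (prime (CHAR('k)) \<and> (\<exists>i\<in>P. a = single i (CHAR('k)) \<and> D < CHAR('k) * 2))"
    and Md: "\<And>a j. a \<in> M \<Longrightarrow> j \<in> P \<Longrightarrow> e + 1 \<le> mdeg a \<or> (of_nat (lookup a j) :: 'k) = 0"
    and A: "\<And>i j. i \<notin> P \<Longrightarrow> j \<notin> P \<Longrightarrow> hess j i f = (if j = \<sigma> i then \<epsilon> i else 0)"
    and B: "\<And>i b. i \<notin> P \<Longrightarrow> supported_in P b \<Longrightarrow> mdeg b < e \<Longrightarrow> mfps_nth f (b + single i 1) = 0"
    and D: "\<And>a. supported_in P a \<Longrightarrow> mdeg a \<le> D \<Longrightarrow> mfps_nth f a \<noteq> 0 \<Longrightarrow> a \<in> M"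
    and \<epsilon>: "\<And>i. i \<notin> P \<Longrightarrow> \<epsilon> i \<noteq> 0" and \<sigma>: "\<And>j. j \<notin> P \<Longrightarrow> \<sigma> j \<notin> P" "\<And>j. j \<notin> P \<Longrightarrow> \<sigma> (\<sigma> j) = j"
  shows False
proof -
  let ?J = "(\<lambda>(i, j). (i, single j (1::nat))) ` (P \<times> P)"
  have J: "finite ?J" "card ?J < card M"
    using card card_image_le[of "P \<times> P" "\<lambda>(i, j). (i, single j (1::nat))"]
    by (auto simp: card_cartesian_product)
  show False
  proof (rule not_fin_near_coefficients[where u = "\<lambda>_. 1" and ?s0.0 = 1 and J = ?J and ?H1.0 = "\<lambda>_. 1" and M = M and P = P and D = D
        and e = e and f = f and \<sigma> = \<sigma> and \<epsilon> = \<epsilon>, OF inf near M(1-3) _ J])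
    fix i b assume "i \<in> P" "supported_in P b" "wt (\<lambda>_. 1) b = 1"
    then obtain j where "b = single j 1" using mdeg_1_eq_single[of b] by (auto simp: mdeg_eq_wt)
    then show "(i, b) \<in> ?J" using \<open>i \<in> P\<close> \<open>supported_in P b\<close> by (auto simp: supported_single)
  next
    fix \<Phi> :: "('n, 'k) mfps \<Rightarrow> ('n, 'k) mfps" and i assume "\<Phi> \<in> right_group"
    then show "\<Phi> (mfps_var i) \<in> filt (weight P (\<lambda>_. 1) 1) (weight P (\<lambda>_. 1) 1 i)"
      unfolding weight_one by (rule lhom_var[OF right_group_lhom])
  qed (use assms in \<open>auto simp: supported_single mdeg_eq_wt[symmetric] intro: polyfun.const\<close>)
qed

text \<open>The coefficients of y^p and y^(p+1) are two parameters against the single one of y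
  \<mapsto> cy. Since y^p has zero derivative, it cannot be used to remove y^(p+1). The bounds on
  \<open>e\<close> give the derivative of y^(p+1) weight at least e and keep p + 1 below 2e.\<close>

lemma not_fin_near_A:
  fixes f :: "('n::finite, 'k::field) mfps" and y :: 'n
  assumes inf: "infinite (UNIV :: 'k set)" and p: "CHAR('k) = p" "prime p" and near: "fin_near f"
    and e: "2 \<le> e" "e \<le> p" "p + 2 \<le> 2 * e"
    and A: "\<And>i j. i \<noteq> y \<Longrightarrow> j \<noteq> y \<Longrightarrow> hess j i f = (if j = \<sigma> i then \<epsilon> i else 0)"
    and B: "\<And>i b. i \<noteq> y \<Longrightarrow> b < e \<Longrightarrow> mfps_nth f (single y b + single i 1) = 0"
    and C: "\<And>j. j < p \<Longrightarrow> mfps_nth f (single y j) = 0"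
    and \<epsilon>: "\<And>i. i \<noteq> y \<Longrightarrow> \<epsilon> i \<noteq> 0" and \<sigma>: "\<And>j. j \<noteq> y \<Longrightarrow> \<sigma> j \<noteq> y" "\<And>j. j \<noteq> y \<Longrightarrow> \<sigma> (\<sigma> j) = j"
  shows False
proof -
  let ?M = "{single y p, single y (p + 1)}"
  have sup: "\<exists>m. b = single y m \<and> mdeg b = m" if "supported_in {y} b" for b :: "'n \<Rightarrow>\<^sub>0 nat"
  proof -
    have "b = single y (lookup b y)"
      using that by (intro poly_mapping_eqI) (auto simp: supported_in_def lookup_single when_def)
    then show ?thesis by (metis mdeg_single)
  qed
  have p0: "p > 0" using prime_gt_0_nat[OF p(2)] .
  show False
  proof (rule not_fin_near_homogeneous[where M = ?M and P = "{y}" and D = "p + 1" and e = e and \<sigma> = \<sigma> and \<epsilon> = \<epsilon>, OF inf near])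
    show "card {y} * card {y} < card ?M" by (simp add: single_eq_iff)
  next
    fix i b assume "i \<notin> {y}" "supported_in {y} b" "mdeg b < e"
    then show "mfps_nth f (b + single i 1) = 0" using sup[of b] B[of i "mdeg b"] by auto
  next
    fix a assume a: "supported_in {y} a" "mdeg a \<le> p + 1" "mfps_nth f a \<noteq> 0"
    obtain m where m: "a = single y m" "mdeg a = m" using sup[OF a(1)] by blast
    then have "\<not> m < p" using C a(3) by auto
    then have "m = p \<or> m = p + 1" using m a(2) by linarith
    then show "a \<in> ?M" using m by auto
  qed (use assms p0 in \<open>auto simp: supported_single single_eq_iff single_eq_0_iff intro!: of_nat_eq_0_iff_char_dvd[THEN iffD2]\<close>)
qed

lemma finite_supported_degree: "finite {a :: 'n::finite \<Rightarrow>\<^sub>0 nat. supported_in P a \<and> mdeg a = D}"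
  by (rule finite_subset[OF _ finite_mdeg_le[of D]]) auto

lemma lookup_two: "x \<noteq> y \<Longrightarrow> lookup (single x i + single y (j::nat)) x = i"
  "x \<noteq> y \<Longrightarrow> lookup (single x i + single y (j::nat)) y = j"
  by (simp_all add: lookup_add lookup_single)

lemma card_binary_forms:
  fixes x y :: "'n::finite" assumes "x \<noteq> y"
  shows "Suc D \<le> card {a :: 'n \<Rightarrow>\<^sub>0 nat. supported_in {x, y} a \<and> mdeg a = D}"
proof -
  let ?m = "\<lambda>i. single x i + single y (D - i)"
  have "inj_on ?m {..D}"
  proof (rule inj_onI)
    fix i j assume "?m i = ?m j"
    then have "lookup (?m i) x = lookup (?m j) x" by (rule arg_cong)
    then show "i = j" unfolding lookup_two(1)[OF assms] .
  qed
  moreover have "?m ` {..D} \<subseteq> {a. supported_in {x, y} a \<and> mdeg a = D}"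
    by (auto simp: supported_add supported_single)
  then have "card (?m ` {..D}) \<le> card {a :: 'n \<Rightarrow>\<^sub>0 nat. supported_in {x, y} a \<and> mdeg a = D}"
    by (rule card_mono[OF finite_supported_degree])
  ultimately show ?thesis by (simp add: card_image)
qed

lemma card_ternary_cubics:
  fixes x y z :: "'n::finite" assumes "x \<noteq> y" "x \<noteq> z" "y \<noteq> z"
  shows "10 \<le> card {a :: 'n \<Rightarrow>\<^sub>0 nat. supported_in {x, y, z} a \<and> mdeg a = 3}"
proof -
  let ?m = "\<lambda>(i, j). single x i + single y j + single z (3 - i - j)"
  let ?I = "(SIGMA i:{..3::nat}. {..3 - i})"
  have l: "lookup (?m (i, j)) x = i" "lookup (?m (i, j)) y = j" for i j
    using assms by (auto simp: lookup_add lookup_single)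
  have "inj_on ?m ?I"
  proof (rule inj_onI)
    fix u v assume "?m u = ?m v"
    then have "lookup (?m (fst u, snd u)) x = lookup (?m (fst v, snd v)) x"
      "lookup (?m (fst u, snd u)) y = lookup (?m (fst v, snd v)) y" by simp_all
    then show "u = v" unfolding l by (rule prod_eqI)
  qed
  moreover have "?m ` ?I \<subseteq> {a. supported_in {x, y, z} a \<and> mdeg a = 3}"
    by (auto simp: supported_add supported_single)
  moreover have "card ?I = 10"
  proof -
    have "card ?I = (\<Sum>i\<le>3::nat. card {..3 - i})" by simp
    moreover have "{..3::nat} = {0, 1, 2, 3}" by auto
    ultimately show ?thesis by simp
  qed
  ultimately show ?thesis using card_mono[OF finite_supported_degree[of "{x, y, z}" 3], of "?m ` ?I"] card_image[of ?m ?I] by simp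
qed

text \<open>Forms of degree \<open>D\<close> modulo the linear group, whose dimension is the square
  of \<open>card P\<close>. The instances used are ternary cubics (10 > 9) and binary quartics (5 >
  4).\<close>

lemma not_fin_near_forms:
  fixes f :: "('n::finite, 'k::field) mfps"
  assumes inf: "infinite (UNIV :: 'k set)" and near: "fin_near f"
    and card: "card P * card P < card {a :: 'n \<Rightarrow>\<^sub>0 nat. supported_in P a \<and> mdeg a = D}" and D3: "3 \<le> D"
    and A: "\<And>i j. i \<notin> P \<Longrightarrow> j \<notin> P \<Longrightarrow> hess j i f = (if j = \<sigma> i then \<epsilon> i else 0)"
    and B: "\<And>i b. i \<notin> P \<Longrightarrow> supported_in P b \<Longrightarrow> mdeg b < D - 1 \<Longrightarrow> mfps_nth f (b + single i 1) = 0"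
    and D: "\<And>a. supported_in P a \<Longrightarrow> mdeg a < D \<Longrightarrow> mfps_nth f a = 0"
    and \<epsilon>: "\<And>i. i \<notin> P \<Longrightarrow> \<epsilon> i \<noteq> 0" and \<sigma>: "\<And>j. j \<notin> P \<Longrightarrow> \<sigma> j \<notin> P" "\<And>j. j \<notin> P \<Longrightarrow> \<sigma> (\<sigma> j) = j"
  shows False
proof (rule not_fin_near_homogeneous[where M = "{a. supported_in P a \<and> mdeg a = D}" and P = P and D = D
      and e = "D - 1" and \<sigma> = \<sigma> and \<epsilon> = \<epsilon>, OF inf near finite_supported_degree])
  show "supported_in P a \<Longrightarrow> mdeg a \<le> D \<Longrightarrow> mfps_nth f a \<noteq> 0 \<Longrightarrow> a \<in> {a. supported_in P a \<and> mdeg a = D}" for a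
    using D[of a] by (cases "mdeg a < D") auto
qed (use assms in auto)

text \<open>The four binary cubic monomials alone only balance the dimension 4 of GL_2. The squares
  x^2 and y^2 are p-th powers for p = 2 and may be added, which makes six parameters.\<close>

lemma not_fin_near_char_2:
  fixes f :: "('n::finite, 'k::field) mfps" and x y :: 'n
  assumes inf: "infinite (UNIV :: 'k set)" and p: "CHAR('k) = 2" and near: "fin_near f" and f: "f \<in> mpower 2" and xy: "x \<noteq> y"
    and A: "\<And>i j. i \<notin> {x, y} \<Longrightarrow> hess j i f = (if j = \<sigma> i then \<epsilon> i else 0)" and A': "hess x y f = 0"
    and \<epsilon>: "\<And>i. i \<notin> {x, y} \<Longrightarrow> \<epsilon> i \<noteq> 0" and \<sigma>: "\<And>j. j \<notin> {x, y} \<Longrightarrow> \<sigma> j \<notin> {x, y}" "\<And>j. j \<notin> {x, y} \<Longrightarrow> \<sigma> (\<sigma> j) = j"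
  shows False
proof -
  let ?C = "{a :: 'n \<Rightarrow>\<^sub>0 nat. supported_in {x, y} a \<and> mdeg a = 3}"
  let ?S = "{single x 2, single y (2::nat)}"
  have sq: "(of_nat 2 :: 'k) = 0" using of_nat_CHAR[where 'a = 'k] p by simp
  show False
  proof (rule not_fin_near_homogeneous[where M = "?S \<union> ?C" and P = "{x, y}" and D = 3 and e = 2 and \<sigma> = \<sigma> and \<epsilon> = \<epsilon>, OF inf near])
    have "card (?S \<union> ?C) = card ?S + card ?C"
      by (intro card_Un_disjoint finite_supported_degree) auto
    moreover have "card ?S = 2" using xy by (simp add: single_eq_iff)
    ultimately show "card {x, y} * card {x, y} < card (?S \<union> ?C)"
      using card_binary_forms[OF xy, of 3] xy by simp
  next
    fix a j assume "a \<in> ?S \<union> ?C" "j \<in> {x, y}"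
    then show "2 + 1 \<le> mdeg a \<or> (of_nat (lookup a j) :: 'k) = 0"
      using sq xy by (auto simp: lookup_single when_def split: if_splits)
  next
    fix i b assume i: "i \<notin> {x, y}" and b: "supported_in {x, y} b" "mdeg b < 2"
    show "mfps_nth f (b + single i 1) = 0"
    proof (cases "mdeg b = 0")
      case True then show ?thesis using mpowerD[OF f, of "single i 1"] by (simp add: mdeg_eq_0_iff)
    next
      case False
      then obtain j where j: "b = single j 1" using mdeg_1_eq_single[of b] b by auto
      then have "j \<in> {x, y}" using b by (simp add: supported_single)
      then have "hess j i f = 0" using A[OF i, of j] \<sigma>(1)[OF i] by auto
      then show ?thesis using j i \<open>j \<in> {x, y}\<close> hess_neq[of j i f] by auto
    qed
  next
    fix a assume a: "supported_in {x, y} a" "mdeg a \<le> 3" "mfps_nth f a \<noteq> 0"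
    show "a \<in> ?S \<union> ?C"
    proof (cases "mdeg a = 3")
      case False
      then have "mdeg a = 2" using mpowerD[OF f, of a] a by (metis Suc_1 eval_nat_numeral(3) le_Suc_eq not_less not_less_eq_eq le_less)
      then have "a \<noteq> 0" by auto
      then obtain i where "lookup a i > 0" by (metis gr0I poly_mapping_eqI lookup_zero)
      then obtain b where b: "a = b + single i 1" using exists_single_add[of a i] by blast
      then have "mdeg b = 1" using \<open>mdeg a = 2\<close> by simp
      then obtain j where j: "b = single j 1" using mdeg_1_eq_single by blast
      have ij: "i \<in> {x, y}" "j \<in> {x, y}" using a(1) b j by (auto simp: supported_add supported_single)
      have "i = j"
      proof (rule ccontr)
        assume "i \<noteq> j"
        then have "hess j i f \<noteq> 0" using a(3) b j hess_neq[of j i f] by simp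
        then show False using ij A' hess_sym[of x y f] \<open>i \<noteq> j\<close> by auto
      qed
      then have "a = single i 2" unfolding b j by (metis one_add_one single_add)
      then show ?thesis using ij by auto
    qed (use a in simp)
  qed (use assms in \<open>auto simp: supported_single single_eq_0_iff finite_supported_degree\<close>)
qed

lemma supported_two:
  assumes "supported_in {x, y} a" "x \<noteq> y"
  shows "a = single x (lookup a x) + single y (lookup a y)"
  using assms by (intro poly_mapping_eqI) (auto simp: supported_in_def lookup_add lookup_single when_def)

lemma mdeg_le_wt: "(\<And>i. 0 < w i) \<Longrightarrow> mdeg a \<le> wt w a"
  unfolding mdeg_eq_wt by (rule wt_mono) (simp add: Suc_le_eq One_nat_def)

lemma mdeg_le_1_cases:
  assumes "mdeg (a :: 'n::finite \<Rightarrow>\<^sub>0 nat) \<le> 1" obtains "a = 0" | j where "a = single j 1"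
proof (cases "mdeg a = 0")
  case True then show ?thesis using that by (simp add: mdeg_eq_0_iff)
next
  case False then show ?thesis using that mdeg_1_eq_single[of a] assms by force
qed

text \<open>The stratum of \<open>J\<^sub>1\<^sub>0\<close>, where \<open>x\<close> has weight \<open>2\<close> and \<open>y\<close> has weight \<open>1\<close>; the graded automorphisms are
  \<open>x \<mapsto> \<alpha>x + \<beta>y\<^sup>2\<close>, \<open>y \<mapsto> \<gamma>y\<close>.\<close>

lemma not_fin_near_J10:
  fixes f :: "('n::finite, 'k::field) mfps" and x y :: 'n
  assumes inf: "infinite (UNIV :: 'k set)" and near: "fin_near f" and xy: "x \<noteq> y"
    and A: "\<And>i j. i \<notin> {x, y} \<Longrightarrow> j \<notin> {x, y} \<Longrightarrow> hess j i f = (if j = \<sigma> i then \<epsilon> i else 0)"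
    and B: "\<And>i k l. i \<notin> {x, y} \<Longrightarrow> 2 * k + l < 4 \<Longrightarrow>
      mfps_nth f (single x k + single y l + single i 1) = 0"
    and D: "\<And>k l. 2 * k + l < 6 \<Longrightarrow> mfps_nth f (single x k + single y l) = 0"
    and x3: "mfps_nth f (single x 3) \<noteq> 0"
    and \<epsilon>: "\<And>i. i \<notin> {x, y} \<Longrightarrow> \<epsilon> i \<noteq> 0" and \<sigma>: "\<And>j. j \<notin> {x, y} \<Longrightarrow> \<sigma> j \<notin> {x, y}" "\<And>j. j \<notin> {x, y} \<Longrightarrow> \<sigma> (\<sigma> j) = j"
  shows False
proof -
  let ?P = "{x, y}"
  define u where "u i = (if i = x then 2 else 1 :: nat)" for i
  define M where "M = (\<lambda>i. single x i + single y (6 - 2 * i)) ` {..3::nat}"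
  define J where "J = {(x, single x 1), (x, single y 2), (y, single y (1::nat))}"
  have u: "u x = 2" "u y = 1" using xy by (auto simp: u_def)
  have upos: "0 < u i" for i by (simp add: u_def)
  have sup: "\<exists>k l. a = single x k + single y l" if "supported_in ?P a" for a :: "'n \<Rightarrow>\<^sub>0 nat"
    using supported_two[OF that xy] by blast
  have M: "a \<in> M \<longleftrightarrow> supported_in ?P a \<and> wt u a = 6" for a
  proof
    assume "a \<in> M" then show "supported_in ?P a \<and> wt u a = 6"
      by (auto simp: M_def u supported_add supported_single)
  next
    assume a: "supported_in ?P a \<and> wt u a = 6"
    then obtain k l where kl: "a = single x k + single y l" using sup by blast
    then have "l = 6 - 2 * k" "k \<le> 3" using a by (auto simp: u)
    then show "a \<in> M" using kl by (auto simp: M_def)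
  qed
  have fM: "finite M" by (simp add: M_def)
  have cM: "card M = 4"
  proof -
    have "inj_on (\<lambda>i. single x i + single y (6 - 2 * i)) {..3::nat}"
    proof (rule inj_onI)
      fix i j :: nat assume "single x i + single y (6 - 2 * i) = single x j + single y (6 - 2 * j)"
      then have "lookup (single x i + single y (6 - 2 * i)) x =
          lookup (single x j + single y (6 - 2 * j)) x" by (rule arg_cong)
      then show "i = j" unfolding lookup_two(1)[OF xy] .
    qed
    then show ?thesis unfolding M_def by (simp add: card_image)
  qed
  have cJ: "finite J" "card J < card M"
    using card_insert_le_m1[of 3] cM unfolding J_def by (auto simp: card_insert_if)
  have fx3: "single x 3 \<in> M" unfolding M by (simp add: supported_single u)
  define F where "F v = f + (\<Sum>a\<in>M. mfps_scale (v a) (mon a))" for v :: "('n \<Rightarrow>\<^sub>0 nat) \<Rightarrow> 'k"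
  have nthF: "mfps_nth (F v) b = mfps_nth f b + (if b \<in> M then v b else 0)" for v b
  proof -
    have "(\<Sum>a\<in>M. v a * mfps_nth (mon a :: ('n, 'k) mfps) b) = (\<Sum>a\<in>M. if a = b then v b else 0)"
      by (rule sum.cong) (auto simp: nth_mon)
    then show ?thesis using fM by (simp add: F_def)
  qed
  have BF: "mfps_nth (F v) (c + single i 1) = 0" if "i \<notin> ?P" "supported_in ?P c" "wt u c < 4" for v c i
  proof -
    obtain k l where kl: "c = single x k + single y l" using sup[OF \<open>supported_in ?P c\<close>] by blast
    have "c + single i 1 \<notin> M" using \<open>i \<notin> ?P\<close> unfolding M by (auto simp: supported_add supported_single)
    then show ?thesis using B[OF \<open>i \<notin> ?P\<close>, of k l] \<open>wt u c < 4\<close> kl by (simp add: nthF u)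
  qed
  have DF: "mfps_nth (F v) c = 0" if "supported_in ?P c" "wt u c < 6" for v c
  proof -
    obtain k l where kl: "c = single x k + single y l" using sup[OF \<open>supported_in ?P c\<close>] by blast
    have "c \<notin> M" using \<open>wt u c < 6\<close> unfolding M by simp
    then show ?thesis using D[of k l] \<open>wt u c < 6\<close> kl by (simp add: nthF u)
  qed
  have AF: "hess j i (F v) = (if j = \<sigma> i then \<epsilon> i else 0)" if "i \<notin> ?P" "j \<notin> ?P" for i j v
  proof -
    have "(mfps_pderiv i (mon a) :: ('n, 'k) mfps) = 0" if "a \<in> M" for a
      using that \<open>i \<notin> ?P\<close> unfolding M by (simp add: pderiv_mon supported_in_def)
    then have "mfps_pderiv i (F v) = mfps_pderiv i f" unfolding F_def pderiv_add pderiv_sum pderiv_scale by simp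
    then show ?thesis using A[OF that] by (simp add: hess_def)
  qed
  have wu: "wt u a \<le> 2 * mdeg a" for a
    unfolding mdeg_def wt_def sum_distrib_left by (intro sum_mono mult_right_mono) (auto simp: u_def)
  show False
  \<comment> \<open>The polynomial condition keeps the coefficient of x^3 nonzero. The cubic part on
    the plane then determines the line x = 0, which forces automorphisms to respect the weights 2
    and 1.\<close>
  proof (rule not_fin_near_coefficients[where u = u and ?s0.0 = 2 and J = J and ?H1.0 = "\<lambda>v. v (single x 3) + mfps_nth f (single x 3)"
        and M = M and P = ?P and D = 6 and e = 4 and f = f and \<sigma> = \<sigma> and \<epsilon> = \<epsilon>, OF inf near fM _ _ _ cJ])
    fix i b assume i: "i \<in> ?P" and b: "supported_in ?P b" "wt u b = u i"
    obtain k l where kl: "b = single x k + single y l" using sup[OF b(1)] by blast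
    have kl': "2 * k + l = u i" using b(2) kl by (simp add: u)
    show "(i, b) \<in> J"
    proof (cases "i = x")
      case True
      then have "(k = 1 \<and> l = 0) \<or> (k = 0 \<and> l = 2)" using kl' u by (cases k) auto
      then show ?thesis using True kl by (auto simp: J_def)
    next
      case False
      then have "2 * k + l = 1" using kl' u i by simp
      then have "k = 0 \<and> l = 1" by presburger
      then show ?thesis using False kl i by (auto simp: J_def)
    qed
  next
    fix a assume "supported_in ?P a" "wt u a \<le> 6" "mfps_nth f a \<noteq> 0"
    then show "a \<in> M" using DF[of a "\<lambda>_. 0"] unfolding M by (cases "wt u a < 6") (auto simp: nthF)
  next
    fix i b assume "i \<notin> ?P" "supported_in ?P b" "wt u b < 4"
    then show "mfps_nth f (b + single i 1) = 0" using BF[of i b "\<lambda>_. 0"] by (simp add: nthF)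
  next
    show "(\<lambda>v. v (single x 3) + mfps_nth f (single x 3)) \<in> polyfun"
      by (intro polyfun.intros)
  next
    fix \<Phi> :: "('n, 'k) mfps \<Rightarrow> ('n, 'k) mfps" and v v' :: "('n \<Rightarrow>\<^sub>0 nat) \<Rightarrow> 'k" and i
    assume \<Phi>: "\<Phi> \<in> right_group" and c: "v (single x 3) + mfps_nth f (single x 3) \<noteq> 0"
      and "\<Phi> (f + (\<Sum>a\<in>M. mfps_scale (v a) (mon a))) = f + (\<Sum>a\<in>M. mfps_scale (v' a) (mon a))"
    then have FF: "\<Phi> (F v) = F v'" by (simp add: F_def)
    note lh = right_group_lhom[OF \<Phi>]
    let ?w = "weight ?P (\<lambda>_. 1) 2"
    \<comment> \<open>A preliminary filtration, with weight 1 on the plane and 2 transversally: it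
      prevents the transversal variables from entering the comparison of cubic parts.\<close>
    have fil: "\<Phi> (mfps_var i) \<in> filt ?w (?w i)" for i
    proof (rule automorphism_filtered[where f = "F v" and \<sigma> = \<sigma> and \<epsilon> = \<epsilon> and ?s0.0 = 1, OF \<Phi>])
      show "\<Phi> (mfps_var i) \<in> filt (weight ?P (\<lambda>_. 1) 1) (weight ?P (\<lambda>_. 1) 1 i)" for i
        unfolding weight_one by (rule lhom_var[OF lh])
    next
      fix i s assume i: "i \<notin> ?P" and s: "1 \<le> s" "s < (2::nat)"
      then have s1: "s = 1" by simp
      show "mfps_pderiv i (F v) - mfps_scale (\<epsilon> i) (mfps_var (\<sigma> i)) \<in> filt (weight ?P (\<lambda>_. 1) s) (Suc s)"
        unfolding s1 weight_one
      proof (rule mpowerI)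
        fix a :: "'n \<Rightarrow>\<^sub>0 nat" assume "mdeg a < Suc 1"
        then have "mdeg a \<le> 1" by simp
        then show "mfps_nth (mfps_pderiv i (F v) - mfps_scale (\<epsilon> i) (mfps_var (\<sigma> i))) a = 0"
        proof (cases rule: mdeg_le_1_cases)
          case 1
          then show ?thesis using BF[OF i, of 0 v] by (simp add: nth_pderiv var_eq_mon nth_mon single_eq_0_iff eq_commute[of 0])
        next
          case (2 j)
          show ?thesis
          proof (cases "j \<in> ?P")
            case True
            then have "mfps_nth (F v) (single j 1 + single i 1) = 0"
              by (intro BF[OF i]) (auto simp: supported_single u_def)
            moreover have "j \<noteq> \<sigma> i" using True \<sigma>(1)[OF i] by auto
            ultimately show ?thesis using 2 by (simp add: nth_pderiv var_eq_mon nth_mon single_eq_iff)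
          next
            case False
            then show ?thesis unfolding 2 nth_diff nth_scale nth_pderiv_single
              using AF[OF i False] by (simp add: var_eq_mon nth_mon single_eq_iff)
          qed
        qed
      qed
    next
      fix j
      show "mfps_pderiv j (\<Phi> (F v)) \<in> filt ?w 2" unfolding FF
      proof (rule filtI)
        fix a assume a: "wt ?w a < 2"
        then have sa: "supported_in ?P a" using wt_weight_unsupported[of ?P a 2 "\<lambda>_. 1"] by linarith
        then have "mdeg a \<le> 1" using a by (simp add: wt_weight_supported mdeg_eq_wt)
        then have wa: "wt u a \<le> 2" using wu[of a] by linarith
        show "mfps_nth (mfps_pderiv j (F v')) a = 0"
        proof (cases "j \<in> ?P")
          case True
          then have "mfps_nth (F v') (a + single j 1) = 0"
            using sa wa by (intro DF) (auto simp: supported_add supported_single u_def)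
          then show ?thesis by (simp add: nth_pderiv)
        next
          case False
          then show ?thesis using BF[OF False sa, of v'] wa by (simp add: nth_pderiv)
        qed
      qed
    next
      fix j assume "j \<notin> ?P" then show "\<exists>i. i \<notin> ?P \<and> \<sigma> i = j" using \<sigma> by blast
    qed (use \<epsilon> in auto)
    \<comment> \<open>The coefficient of y in \<Phi> x, to be shown zero. Up to weight 3 the source
      is c x^3, and the target contains no y^3, so the cube of \<Phi> x has no y^3 either; this
      means l^3 = 0, in characteristic 3 as well.\<close>
    define l where "l = mfps_nth (\<Phi> (mfps_var x)) (single y 1)"
    define c where "c = mfps_nth (F v) (single x 3)"
    have c0: "c \<noteq> 0" using \<open>v _ + _ \<noteq> 0\<close> fx3 by (simp add: c_def nthF add.commute)
    have "F v - mfps_scale c (mon (single x 3)) \<in> filt ?w 4"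
    proof (rule filtI)
      fix b assume b: "wt ?w b < 4"
      show "mfps_nth (F v - mfps_scale c (mon (single x 3))) b = 0"
      proof (cases "supported_in ?P b")
        case True
        then obtain k l where kl: "b = single x k + single y l" using sup by blast
        have "k + l < 4" using b kl by (simp add: weight_def)
        show ?thesis
        proof (cases "2 * k + l < 6")
          case T: True
          then have "mfps_nth (F v) b = 0" using kl by (intro DF[OF True]) (simp add: u)
          moreover have "b \<noteq> single x 3"
          proof
            assume "b = single x 3"
            then have "wt u b = 6" by (simp add: u)
            then show False using T kl by (simp add: u)
          qed
          ultimately show ?thesis by (simp add: nth_mon)
        next
          case False
          then have "k = 3 \<and> l = 0" using \<open>k + l < 4\<close> by linarith
          then show ?thesis using kl by (simp add: nth_mon c_def)
        qed
      next
        case False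
        then obtain i a where i: "i \<notin> ?P" "b = a + single i 1" by (rule unsupported_split)
        then have wa: "wt ?w a < 2" using b by (simp add: weight_def)
        then have sa: "supported_in ?P a" using wt_weight_unsupported[of ?P a 2 "\<lambda>_. 1"] by linarith
        then have "mdeg a \<le> 1" using wa by (simp add: wt_weight_supported mdeg_eq_wt)
        then have "mfps_nth (F v) b = 0" unfolding i(2) using wu[of a] by (intro BF[OF i(1) sa]) linarith
        moreover have "b \<noteq> single x 3" using False by (auto simp: supported_single)
        ultimately show ?thesis by (simp add: nth_mon)
      qed
    qed
    then have "\<Phi> (F v - mfps_scale c (mon (single x 3))) \<in> filt ?w 4" by (rule lhom_filt[OF lh fil])
    then have "F v' - mfps_scale c (\<Phi> (mfps_var x) ^ 3) \<in> filt ?w 4"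
      by (simp add: clin_minus[OF lhom_clin[OF lh]] clin_scale[OF lhom_clin[OF lh]] FF lhom_mon[OF lh] mpow_single)
    from filtD[OF this, of "single y 3"]
    have cube: "mfps_nth (\<Phi> (mfps_var x) ^ 3) (single y 3) = 0"
      using c0 DF[of "single y 3" v'] by (simp add: supported_single u weight_def)
    \<comment> \<open>Weights singling out y: the rest of \<Phi> x has weight 2, so its cube differs
      from (ly)^3 only in weight 4 and above, beyond y^3.\<close>
    define w' where "w' i = (if i = y then 1 else 2 :: nat)" for i
    define R where "R = \<Phi> (mfps_var x) - mfps_scale l (mfps_var y)"
    have w'pos: "0 < w' i" for i by (simp add: w'_def)
    have R: "R \<in> filt w' 2"
    proof (rule filtI)
      fix a assume a: "wt w' a < 2"
      then have "mdeg a \<le> 1" using mdeg_le_wt[of w' a] w'pos by fastforce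
      then show "mfps_nth R a = 0"
      proof (cases rule: mdeg_le_1_cases)
        case 1
        then show ?thesis using mpowerD[OF lhom_var[OF lh, of x], of 0]
          by (simp add: R_def var_eq_mon nth_mon single_eq_0_iff eq_commute[of 0])
      next
        case (2 j)
        then have "j = y" using a by (auto simp: w'_def split: if_splits)
        then show ?thesis using 2 by (simp add: R_def l_def var_eq_mon nth_mon)
      qed
    qed
    let ?A = "mfps_scale l (mfps_var y)"
    have A1: "?A \<in> filt w' 1" by (intro filt_scale var_in_filt) (simp add: w'_def)
    have "\<Phi> (mfps_var x) = ?A + R" by (simp add: R_def)
    then have "\<Phi> (mfps_var x) ^ 3 - ?A ^ 3 = (R * ?A) * (?A + ?A + ?A) + (R * R) * (?A + ?A + ?A + R)"
      using cube_diff[of ?A R] by simp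
    moreover have "(R * ?A) * (?A + ?A + ?A) \<in> filt w' 4"
      by (rule filt_mult_le[OF filt_mult[OF R A1] filt_add[OF filt_add[OF A1 A1] A1]]) simp
    moreover have "(R * R) * (?A + ?A + ?A + R) \<in> filt w' 4"
      by (rule filt_mult_right, rule filt_mult_le[OF R R]) simp
    ultimately have "\<Phi> (mfps_var x) ^ 3 - ?A ^ 3 \<in> filt w' 4" by (simp only: filt_add)
    from filtD[OF this, of "single y 3"]
    have "mfps_nth (?A ^ 3) (single y 3) = 0" using cube by (simp add: w'_def)
    moreover have "?A ^ 3 = mfps_scale (l ^ 3) (mon (single y 3))"
      by (simp add: scale_power var_power)
    ultimately have l0: "l = 0" by (simp add: nth_mon)
    show "\<Phi> (mfps_var i) \<in> filt (weight ?P u 2) (weight ?P u 2 i)"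
    proof (rule filtI)
      fix a assume a: "wt (weight ?P u 2) a < weight ?P u 2 i"
      have wpos: "0 < weight ?P u 2 j" for j using upos by (simp add: weight_def)
      have w2: "weight ?P u 2 i \<le> 2" by (simp add: weight_def u_def)
      have "mdeg a \<le> 1" using mdeg_le_wt[of "weight ?P u 2" a] wpos a w2 by fastforce
      then show "mfps_nth (\<Phi> (mfps_var i)) a = 0"
      proof (cases rule: mdeg_le_1_cases)
        case 1
        then show ?thesis using mpowerD[OF lhom_var[OF lh, of i], of 0] by simp
      next
        case (2 j)
        then have j: "weight ?P u 2 j < weight ?P u 2 i" using a by simp
        then have jy: "j = y" "i \<noteq> y" using w2 wpos[of j] by (auto simp: weight_def u_def split: if_splits)
        show ?thesis
        proof (cases "i = x")
          case True then show ?thesis using l0 2 jy by (simp add: l_def)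
        next
          case False
          then show ?thesis using filtD[OF fil[of i], of a] 2 jy by (simp add: weight_def)
        qed
      qed
    qed
  qed (use assms u upos in \<open>auto simp: M J_def supported_single\<close>)
qed

section \<open>Diagonalisation of the Hessian and the splitting lemma\<close>

text \<open>An elementary congruence: multiples of row and column \<open>j\<close> are added to the
  others.\<close>

lemma hess_shear:
  fixes f :: "('n::finite, 'k::field) mfps"
  assumes f: "f \<in> mpower 2" and c: "c j = 0"
  shows "hess i l (subst (\<lambda>k. if k = j then mfps_var j + (\<Sum>m\<in>UNIV. mfps_scale (c m) (mfps_var m)) else mfps_var k) f) =
    hess i l f + c i * hess j l f + c l * hess i j f + c i * c l * hess j j f"
proof -
  let ?\<phi> = "\<lambda>k. if k = j then mfps_var j + (\<Sum>m\<in>UNIV. mfps_scale (c m) (mfps_var m)) else (mfps_var k :: ('n, 'k) mfps)"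
  have loc: "?\<phi> k \<in> mpower 1" for k by (auto intro!: filt_add filt_sum filt_scale var_in_filt)
  have A: "mfps_nth (?\<phi> k) (single m 1) = (if k = m then 1 else 0) + (if k = j then c m else 0)" for k m
  proof -
    have "(\<Sum>l\<in>UNIV. c l * mfps_nth (mfps_var l :: ('n, 'k) mfps) (single m 1)) = (\<Sum>l\<in>UNIV. if l = m then c m else 0)"
      by (rule sum.cong) (auto simp: var_eq_mon nth_mon single_eq_iff)
    then show ?thesis by (auto simp: var_eq_mon nth_mon single_eq_iff)
  qed
  have "hess i l (subst ?\<phi> f) = (\<Sum>k\<in>UNIV. \<Sum>m\<in>UNIV. hess k m f *
      ((if k = i then 1 else 0) + (if k = j then c i else 0)) * ((if m = l then 1 else 0) + (if m = j then c l else 0)))"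
    unfolding hess_lhom[OF lhom_subst[of ?\<phi>, OF loc] f] subst_var[of ?\<phi>, OF loc] A ..
  also have "\<dots> = (\<Sum>k\<in>UNIV. ((if k = i then 1 else 0) + (if k = j then c i else 0)) * (hess k l f + c l * hess k j f))"
  proof (rule sum.cong)
    fix k
    have "(\<Sum>m\<in>UNIV. hess k m f * ((if k = i then 1 else 0) + (if k = j then c i else 0)) * ((if m = l then 1 else 0) + (if m = j then c l else 0)))
      = (\<Sum>m\<in>UNIV. (if m = l then ((if k = i then 1 else 0) + (if k = j then c i else 0)) * hess k l f else 0) +
          (if m = j then ((if k = i then 1 else 0) + (if k = j then c i else 0)) * (c l * hess k j f) else 0))"
      by (rule sum.cong) (simp_all add: algebra_simps)
    then show "(\<Sum>m\<in>UNIV. hess k m f * ((if k = i then 1 else 0) + (if k = j then c i else 0)) * ((if m = l then 1 else 0) + (if m = j then c l else 0)))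
      = ((if k = i then 1 else 0) + (if k = j then c i else 0)) * (hess k l f + c l * hess k j f)"
      by (simp add: sum.distrib distrib_left)
  qed simp
  also have "\<dots> = (\<Sum>k\<in>UNIV. (if k = i then hess i l f + c l * hess i j f else 0) + (if k = j then c i * (hess j l f + c l * hess j j f) else 0))"
    by (rule sum.cong) (auto simp: algebra_simps)
  also have "\<dots> = hess i l f + c i * hess j l f + c l * hess i j f + c i * c l * hess j j f"
    by (simp add: sum.distrib algebra_simps)
  finally show ?thesis .
qed

definition diag :: "'n set \<Rightarrow> ('n::finite, 'k::comm_ring_1) mfps \<Rightarrow> bool" where
  "diag P f \<longleftrightarrow> (\<forall>i j. i \<noteq> j \<longrightarrow> hess i j f = 0) \<and> (\<forall>i\<in>P. hess i i f = 0) \<and> (\<forall>i. i \<notin> P \<longrightarrow> hess i i f \<noteq> 0)"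

lemma right_equiv_mpower:
  assumes "f \<sim>\<^sub>r g" "f \<in> mpower m" shows "g \<in> mpower m"
proof -
  obtain \<Phi> where \<Phi>: "\<Phi> \<in> right_group" "g = \<Phi> f" using assms(1) unfolding right_equiv_def by blast
  show ?thesis unfolding \<Phi>(2) by (rule lhom_mem_mpower[OF right_group_lhom[OF \<Phi>(1)] assms(2)])
qed

text \<open>Gram-Schmidt with a maximal set S of split-off variables. A nonzero diagonal entry
  outside S would enlarge S; if only an off-diagonal entry h_jk is nonzero there, a shear produces
  the diagonal entry 2 h_jk. Hence the Hessian vanishes outside S.\<close>

lemma diagonalise:
  fixes f :: "('n::finite, 'k::field) mfps"
  assumes f: "f \<in> mpower 2" and two: "(2 :: 'k) \<noteq> 0"
  shows "\<exists>g P. f \<sim>\<^sub>r g \<and> diag P g"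
proof -
  define good where "good S g \<longleftrightarrow> f \<sim>\<^sub>r g \<and> (\<forall>i\<in>S. hess i i g \<noteq> 0 \<and> (\<forall>j. j \<noteq> i \<longrightarrow> hess i j g = 0))" for S g
  have "good {} f" by (simp add: good_def right_equiv_refl)
  then have ex: "\<exists>m S g. good S g \<and> card S = m" by blast
  have bd: "m \<le> card (UNIV :: 'n set)" if "\<exists>S g. good S g \<and> card S = m" for m
    using that card_mono[of "UNIV :: 'n set"] by auto
  obtain m where m: "\<exists>S g. good S g \<and> card S = m" "\<And>k. \<exists>S g. good S g \<and> card S = k \<Longrightarrow> k \<le> m"
    using ex_has_greatest_nat[of "\<lambda>m. \<exists>S g. good S g \<and> card S = m" _ id "Suc (card (UNIV :: 'n set))"] ex bd
    by (metis id_apply le_imp_less_Suc)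
  obtain S g where g: "good S g" "card S = m" using m(1) by blast
  have extend: False if "good S h" "j \<notin> S" "hess j j h \<noteq> 0" for h j
  proof -
    have h2: "h \<in> mpower 2" using that(1) f right_equiv_mpower unfolding good_def by blast
    define c where "c l = (if l = j then 0 else - hess j l h / hess j j h)" for l
    let ?\<Phi> = "subst (\<lambda>k. if k = j then mfps_var j + (\<Sum>m\<in>UNIV. mfps_scale (c m) (mfps_var m)) else mfps_var k)"
    have cj: "c j = 0" by (simp add: c_def)
    note H = hess_shear[OF h2, of c j, OF cj]
    have cS: "c i = 0" if "i \<in> S" for i
      using that \<open>good S h\<close> \<open>j \<notin> S\<close> hess_sym[of i j h] unfolding good_def c_def by auto
    have "good (insert j S) (?\<Phi> h)"
      unfolding good_def
    proof (intro conjI ballI)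
      show "f \<sim>\<^sub>r ?\<Phi> h" using that(1) right_equivI[OF aut_shear[of c j, OF cj], of h] right_equiv_trans unfolding good_def by blast
    next
      fix i assume i: "i \<in> insert j S"
      show "hess i i (?\<Phi> h) \<noteq> 0"
        using i that cS[of i] cj unfolding H good_def by auto
      show "\<forall>l. l \<noteq> i \<longrightarrow> hess i l (?\<Phi> h) = 0"
      proof (intro allI impI)
        fix l assume l: "l \<noteq> i"
        show "hess i l (?\<Phi> h) = 0"
        proof (cases "i = j")
          case True then show ?thesis using l that(3) unfolding H by (simp add: c_def)
        next
          case False
          then have "i \<in> S" using i by simp
          moreover from this have "hess i l h = 0" "hess i j h = 0" using that(1) l False unfolding good_def by auto
          ultimately show ?thesis using cS unfolding H by simp
        qed
      qed
    qed
    moreover have "card (insert j S) = Suc m" using g(2) that(2) by simp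
    ultimately show False using m(2)[of "Suc m"] by auto
  qed
  have d0: "hess j j g = 0" if "j \<notin> S" for j using extend[OF g(1) that] by blast
  have off: "hess j k g = 0" if jk: "j \<notin> S" "k \<notin> S" "j \<noteq> k" for j k
  proof (rule ccontr)
    assume nz: "hess j k g \<noteq> 0"
    have g2: "g \<in> mpower 2" using g(1) f right_equiv_mpower unfolding good_def by blast
    define c where "c l = (if l = j then 1 else (0 :: 'k))" for l
    let ?\<Phi> = "subst (\<lambda>l. if l = k then mfps_var k + (\<Sum>m\<in>UNIV. mfps_scale (c m) (mfps_var m)) else mfps_var l)"
    have ck: "c k = 0" using jk by (simp add: c_def)
    note H = hess_shear[OF g2, of c k, OF ck]
    have "good S (?\<Phi> g)"
      unfolding good_def
    proof (intro conjI ballI allI impI)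
      show "f \<sim>\<^sub>r ?\<Phi> g" using g(1) right_equivI[OF aut_shear[of c k, OF ck], of g] right_equiv_trans unfolding good_def by blast
    next
      fix i assume i: "i \<in> S"
      then have ij: "c i = 0" "hess i k g = 0" using jk g(1) unfolding good_def by (auto simp: c_def)
      show "hess i i (?\<Phi> g) \<noteq> 0" using i ij g(1) unfolding H good_def by auto
      fix l assume "l \<noteq> i"
      then show "hess i l (?\<Phi> g) = 0" using i ij g(1) unfolding H good_def by auto
    qed
    moreover have "hess j j (?\<Phi> g) = 2 * hess j k g"
      unfolding H using d0[OF jk(1)] d0[OF jk(2)] hess_sym[of j k g] by (simp add: c_def)
    ultimately show False using extend[of "?\<Phi> g" j] jk(1) nz two by simp
  qed
  have "diag (- S) g"
    unfolding diag_def using g(1) d0 off hess_sym unfolding good_def by (metis Compl_iff)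
  then show ?thesis using g(1) unfolding good_def by blast
qed

lemma hess_square: "hess i j (mfps_var x * mfps_var x) = (if i = x \<and> j = x then 2 else 0 :: 'k::comm_ring_1)"
proof -
  have sq: "mfps_var x * mfps_var x = (mon (single x 2) :: ('a, 'k) mfps)"
    unfolding var_eq_mon mon_mult single_add[symmetric] by simp
  show ?thesis
  proof (cases "i = j")
    case True
    then show ?thesis unfolding sq by (auto simp: hess_eq nth_mon single_eq_iff)
  next
    case False
    have "single i 1 + single j 1 \<noteq> single x (2 :: nat)"
    proof
      assume "single i 1 + single j 1 = single x (2 :: nat)"
      then have "lookup (single i 1 + single j 1) i = lookup (single x (2 :: nat)) i"
        by (rule arg_cong)
      then show False unfolding lookup_two(1)[OF False] by (simp add: lookup_single when_def split: if_splits)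
    qed
    then show ?thesis unfolding sq hess_neq[OF False] using False by (auto simp: nth_mon)
  qed
qed

text \<open>The variable x is taken out of the kernel of the Hessian while finitely many classes
  remain nearby; thus a large corank is brought down to one for which a parameter count is
  available.\<close>

lemma diag_perturb:
  fixes f :: "('n::finite, 'k::field) mfps"
  assumes inf: "infinite (UNIV :: 'k set)" and two: "(2 :: 'k) \<noteq> 0" and near: "fin_near f" and d: "diag P f" and x: "x \<in> P"
  shows "\<exists>c. fin_near (f + mfps_scale c (mfps_var x * mfps_var x)) \<and> diag (P - {x}) (f + mfps_scale c (mfps_var x * mfps_var x))"
proof -
  have "mfps_var x * mfps_var x \<in> mpower 1" by (rule filt_mult_right[OF var_in_filt]) simp
  then obtain c where c: "c \<noteq> 0" "fin_near (f + mfps_scale c (mfps_var x * mfps_var x))"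
    using fin_near_perturb[OF inf near] by blast
  have "diag (P - {x}) (f + mfps_scale c (mfps_var x * mfps_var x))"
    using d x c(1) two unfolding diag_def hess_add hess_scale hess_square by auto
  then show ?thesis using c by blast
qed

lemma mpower_mono: "f \<in> mpower s \<Longrightarrow> t \<le> s \<Longrightarrow> f \<in> mpower t"
  by (rule filt_mono)

lemma pderiv_diag:
  fixes f :: "('n::finite, 'k::field) mfps"
  assumes f: "f \<in> mpower 2" and d: "diag P f"
  shows "mfps_pderiv i f - mfps_scale (hess i i f) (mfps_var i) \<in> mpower 2"
proof (rule mpowerI)
  fix a :: "'n \<Rightarrow>\<^sub>0 nat" assume "mdeg a < 2"
  then have "mdeg a \<le> 1" by simp
  then show "mfps_nth (mfps_pderiv i f - mfps_scale (hess i i f) (mfps_var i)) a = 0"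
  proof (cases rule: mdeg_le_1_cases)
    case 1
    then show ?thesis using mpowerD[OF f, of "single i 1"]
      by (simp add: nth_pderiv_0 var_eq_mon nth_mon single_eq_0_iff eq_commute[of 0])
  next
    case (2 j)
    then show ?thesis using d hess_sym[of i j f]
      by (auto simp: nth_pderiv_single var_eq_mon nth_mon single_eq_iff diag_def)
  qed
qed

lemma hess_cong:
  fixes f g :: "('n::finite, 'k::comm_ring_1) mfps"
  assumes "f - g \<in> mpower 3" shows "hess i j f = hess i j g"
proof -
  have "mfps_pderiv i (mfps_pderiv j (f - g)) \<in> mpower 1"
    using assms by (intro pderiv_mem_mpower) (simp add: numeral_3_eq_3 One_nat_def)
  from mpowerD[OF this, of 0] show ?thesis by (simp add: hess_def pderiv_diff)
qed

text \<open>The splitting lemma up to order \<open>N\<close>. A transversal variable x_i equals, up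
  to the factor h_ii and terms of order 2, the derivative of g by x_i; monomials divisible by it are
  therefore removed, degree by degree, by substituting for x_i.\<close>

lemma split_off_squares:
  fixes f :: "('n::finite, 'k::field) mfps"
  assumes f: "f \<in> mpower 2" and d: "diag P f" and N: "2 \<le> N"
  shows "\<exists>g. f \<sim>\<^sub>r g \<and> g \<in> mpower 2 \<and> diag P g \<and>
    (\<forall>a. 3 \<le> mdeg a \<longrightarrow> mdeg a \<le> N \<longrightarrow> \<not> supported_in P a \<longrightarrow> mfps_nth g a = 0)"
  using N
proof (induction N rule: dec_induct)
  case base then show ?case using f d right_equiv_refl by (intro exI[of _ f]) auto
next
  case (step N)
  then obtain g where g: "f \<sim>\<^sub>r g" "g \<in> mpower 2" "diag P g"
    "\<And>a. 3 \<le> mdeg a \<Longrightarrow> mdeg a \<le> N \<Longrightarrow> \<not> supported_in P a \<Longrightarrow> mfps_nth g a = 0" by blast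
  define bad where "bad = {a :: 'n \<Rightarrow>\<^sub>0 nat. mdeg a = Suc N \<and> \<not> supported_in P a}"
  have fin: "finite bad" unfolding bad_def by (rule finite_subset[OF _ finite_mdeg_le[of "Suc N"]]) auto
  have "\<forall>a\<in>bad. \<exists>ib. fst ib \<notin> P \<and> a = snd ib + single (fst ib) 1"
    unfolding bad_def using unsupported_split by (metis (no_types, lifting) fst_conv mem_Collect_eq snd_conv)
  from bchoice[OF this] obtain ib where ib: "\<And>a. a \<in> bad \<Longrightarrow> fst (ib a) \<notin> P \<and> a = snd (ib a) + single (fst (ib a)) 1"
    by blast
  \<comment> \<open>Every unwanted monomial is written as m x_i for one chosen transversal x_i; here
    the cofactors m belonging to x_i are collected.\<close>
  define \<mu> where "\<mu> i = (\<Sum>a | a \<in> bad \<and> fst (ib a) = i. mfps_scale (mfps_nth g a) (mon (snd (ib a))))" for i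
  have deg: "mdeg (snd (ib a)) = N" if "a \<in> bad" for a
  proof -
    have "mdeg a = mdeg (snd (ib a)) + 1" using ib[OF that] by (metis mdeg_add mdeg_single)
    then show ?thesis using that by (simp add: bad_def)
  qed
  have \<mu>: "\<mu> i \<in> mpower N" for i
    unfolding \<mu>_def by (intro filt_sum filt_scale mon_mem_filt) (auto simp: deg simp flip: mdeg_eq_wt)
  define h where "h = (\<Sum>a\<in>bad. mfps_scale (mfps_nth g a) (mon a))"
  have h: "(\<Sum>i\<in>UNIV. \<mu> i * mfps_var i) = h"
  proof -
    have "(\<Sum>i\<in>UNIV. \<mu> i * mfps_var i) = (\<Sum>i\<in>UNIV. \<Sum>a | a \<in> bad \<and> fst (ib a) = i. mfps_scale (mfps_nth g a) (mon a))"
      unfolding \<mu>_def sum_distrib_right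
    proof (intro sum.cong)
      fix i a assume "a \<in> {a. a \<in> bad \<and> fst (ib a) = i}"
      then have "a = snd (ib a) + single i 1" using ib[of a] by auto
      then have "mon (snd (ib a)) * mfps_var i = (mon a :: ('n, 'k) mfps)" by (simp add: var_eq_mon mon_mult)
      then show "mfps_scale (mfps_nth g a) (mon (snd (ib a))) * mfps_var i = mfps_scale (mfps_nth g a) (mon a)"
        by (simp add: scale_mult_left)
    qed auto
    also have "\<dots> = h" unfolding h_def by (rule sum.group[OF fin]) auto
    finally show ?thesis .
  qed
  have \<mu>P: "\<mu> i = 0" if "i \<in> P" for i
    unfolding \<mu>_def by (rule sum.neutral) (use ib that in auto)
  define \<xi> where "\<xi> i = mfps_scale (- inverse (hess i i g)) (\<mu> i)" for i
  have \<xi>: "\<xi> i \<in> mpower N" for i unfolding \<xi>_def by (rule filt_scale[OF \<mu>])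
  let ?\<Phi> = "subst (\<lambda>i. mfps_var i + \<xi> i)"
  have T: "?\<Phi> g - g - (\<Sum>i\<in>UNIV. \<xi> i * mfps_pderiv i g) \<in> mpower (Suc (Suc N))"
    by (rule mpower_mono[OF taylor[OF \<xi> _ g(2)]]) (use step in auto)
  have lin: "(\<Sum>i\<in>UNIV. \<xi> i * mfps_pderiv i g) + h \<in> mpower (Suc (Suc N))"
  proof -
    have "\<xi> i * mfps_scale (hess i i g) (mfps_var i) = - (\<mu> i * mfps_var i)" for i
    proof (cases "i \<in> P")
      case False
      then have "hess i i g \<noteq> 0" using g(3) by (simp add: diag_def)
      then show ?thesis by (simp add: \<xi>_def scale_mult_left scale_mult_right scale_scale)
    qed (simp add: \<mu>P \<xi>_def)
    then have "(\<Sum>i\<in>UNIV. \<xi> i * mfps_pderiv i g) + h =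
        (\<Sum>i\<in>UNIV. \<xi> i * (mfps_pderiv i g - mfps_scale (hess i i g) (mfps_var i)))"
      unfolding h[symmetric] by (simp add: right_diff_distrib sum.distrib sum_negf)
    also have "\<dots> \<in> mpower (Suc (Suc N))"
      by (rule filt_sum, rule filt_mult_le[OF \<xi> pderiv_diag[OF g(2,3)]]) simp
    finally show ?thesis .
  qed
  have close: "?\<Phi> g - (g - h) \<in> mpower (Suc (Suc N))"
    using filt_add[OF T lin] by (simp add: algebra_simps)
  have nth: "mfps_nth (?\<Phi> g) a = mfps_nth g a - (if a \<in> bad then mfps_nth g a else 0)" if "mdeg a \<le> Suc N" for a
  proof -
    have "(\<Sum>b\<in>bad. mfps_nth g b * mfps_nth (mon b :: ('n, 'k) mfps) a) = (\<Sum>b\<in>bad. if b = a then mfps_nth g a else 0)"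
      by (rule sum.cong) (auto simp: nth_mon)
    then have "mfps_nth h a = (if a \<in> bad then mfps_nth g a else 0)" using fin by (simp add: h_def)
    then show ?thesis using mpowerD[OF close, of a] that by simp
  qed
  have \<xi>2: "\<xi> i \<in> mpower 2" for i by (rule mpower_mono[OF \<xi>]) (use step in simp)
  have eq: "f \<sim>\<^sub>r ?\<Phi> g" using right_equiv_trans[OF g(1) right_equivI[OF aut_unipotent[of \<xi>, OF \<xi>2], of g]] .
  have "h \<in> mpower 3" unfolding h_def
    by (intro filt_sum filt_scale mon_mem_filt) (use step in \<open>auto simp: bad_def simp flip: mdeg_eq_wt\<close>)
  then have "?\<Phi> g - (g - h) - h \<in> mpower 3" using step by (intro filt_diff mpower_mono[OF close]) auto
  then have "hess i j (?\<Phi> g) = hess i j g" for i j by (intro hess_cong) simp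
  then have "diag P (?\<Phi> g)" using g(3) by (simp add: diag_def)
  moreover have "mfps_nth (?\<Phi> g) a = 0" if a: "3 \<le> mdeg a" "mdeg a \<le> Suc N" "\<not> supported_in P a" for a
    using nth[OF a(2)] g(4)[OF a(1) _ a(3)] a by (auto simp: bad_def)
  ultimately show ?case using eq right_equiv_mpower[OF eq f] by blast
qed

section \<open>Series in the variables of \<open>P\<close> and coordinate changes fixing the
  others\<close>

definition psup :: "'n set \<Rightarrow> ('n::finite, 'k::comm_ring_1) mfps \<Rightarrow> bool" where
  "psup P f \<longleftrightarrow> (\<forall>a. mfps_nth f a \<noteq> 0 \<longrightarrow> supported_in P a)"

lemma psupD: "psup P f \<Longrightarrow> \<not> supported_in P a \<Longrightarrow> mfps_nth f a = 0"
  by (auto simp: psup_def)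

lemma psup_zero: "psup P 0" by (simp add: psup_def)
lemma psup_one: "psup P 1" by (auto simp: psup_def nth_one)
lemma psup_var: "i \<in> P \<Longrightarrow> psup P (mfps_var i)"
  by (auto simp: psup_def var_eq_mon nth_mon supported_single split: if_splits)
lemma psup_add: "psup P f \<Longrightarrow> psup P g \<Longrightarrow> psup P (f + g)"
  by (auto simp: psup_def) (metis add.right_neutral)
lemma psup_scale: "psup P f \<Longrightarrow> psup P (mfps_scale c f)"
  unfolding psup_def nth_scale by (metis mult_zero_right)
lemma psup_uminus: "psup P f \<Longrightarrow> psup P (- f)"
  by (auto simp: psup_def)
lemma psup_diff: "psup P f \<Longrightarrow> psup P g \<Longrightarrow> psup P (f - g)"
  using psup_add[OF _ psup_uminus, of P f g] by simp
lemma psup_sum: "(\<And>x. x \<in> A \<Longrightarrow> psup P (f x)) \<Longrightarrow> psup P (sum f A)"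
  by (induction A rule: infinite_finite_induct) (auto intro: psup_add psup_zero)

lemma psup_mult:
  assumes "psup P f" "psup P g" shows "psup P (f * g)"
  unfolding psup_def
proof (intro allI impI, rule ccontr)
  fix a assume a: "mfps_nth (f * g) a \<noteq> 0" "\<not> supported_in P a"
  have "mfps_nth f b * mfps_nth g c = 0" if "b + c = a" for b c
    using a(2) psupD[OF assms(1), of b] psupD[OF assms(2), of c] that[symmetric] by (auto simp: supported_add)
  then have "mfps_nth (f * g) a = 0"
    unfolding nth_mult by (intro sum.neutral) (auto simp: splittings_def)
  then show False using a(1) by simp
qed

lemma psup_power: "psup P f \<Longrightarrow> psup P (f ^ m)"
  by (induction m) (auto intro: psup_one psup_mult)

lemma psup_pderiv: "psup P f \<Longrightarrow> psup P (mfps_pderiv i f)"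
  unfolding psup_def nth_pderiv by (metis supported_add mult_zero_right)

lemma psup_pderiv_outside: "psup P f \<Longrightarrow> i \<notin> P \<Longrightarrow> mfps_pderiv i f = 0"
  by (rule mfps_eqI) (simp add: nth_pderiv psupD supported_add supported_single)

lemma psup_prod: "(\<And>x. x \<in> A \<Longrightarrow> psup P (f x)) \<Longrightarrow> psup P (prod f A)"
  by (induction A rule: infinite_finite_induct) (auto intro: psup_mult psup_one)

lemma psup_mpow:
  assumes "\<And>i. i \<in> P \<Longrightarrow> psup P (\<phi> i)" "supported_in P a" shows "psup P (mpow \<phi> a)"
  unfolding mpow_def
proof (rule psup_prod)
  fix i show "psup P (\<phi> i ^ lookup a i)"
    by (cases "i \<in> P") (use assms in \<open>auto simp: supported_in_def intro: psup_power psup_one\<close>)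
qed

lemma psup_subst:
  assumes "\<And>i. i \<in> P \<Longrightarrow> psup P (\<phi> i)" "psup P f" shows "psup P (subst \<phi> f)"
  unfolding psup_def
proof (intro allI impI, rule ccontr)
  fix b assume b: "mfps_nth (subst \<phi> f) b \<noteq> 0" "\<not> supported_in P b"
  have "mfps_nth f a * mfps_nth (mpow \<phi> a) b = 0" for a
    using psupD[OF assms(2), of a] psupD[OF psup_mpow[of P \<phi> a, OF assms(1)] b(2)] by (cases "supported_in P a") auto
  then show False using b(1) by (simp add: nth_subst)
qed

text \<open>As the transversal variables are fixed, the split-off quadratic form is preserved;
  normal forms of the residual part can be found in isolation and are carried to the full series by
  \<open>pequiv_lift\<close>.\<close>

definition pequiv :: "'n set \<Rightarrow> ('n::finite, 'k::field) mfps \<Rightarrow> ('n, 'k) mfps \<Rightarrow> bool" where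
  "pequiv P F G \<longleftrightarrow> (\<exists>\<Phi>\<in>right_group. (\<forall>i. i \<notin> P \<longrightarrow> \<Phi> (mfps_var i) = mfps_var i) \<and>
     (\<forall>H. psup P H \<longrightarrow> psup P (\<Phi> H)) \<and> G = \<Phi> F)"

lemma pequiv_refl: "pequiv P F F"
  unfolding pequiv_def by (rule bexI[OF _ right_group_id]) auto

lemma pequiv_trans: "pequiv P F G \<Longrightarrow> pequiv P G H \<Longrightarrow> pequiv P F H"
proof -
  assume FG: "pequiv P F G" and GH: "pequiv P G H"
  obtain \<Phi> where \<Phi>: "\<Phi> \<in> right_group" "\<And>i. i \<notin> P \<Longrightarrow> \<Phi> (mfps_var i) = mfps_var i"
      "\<And>H. psup P H \<Longrightarrow> psup P (\<Phi> H)" "G = \<Phi> F"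
    using FG unfolding pequiv_def by blast
  obtain \<Psi> where \<Psi>: "\<Psi> \<in> right_group" "\<And>i. i \<notin> P \<Longrightarrow> \<Psi> (mfps_var i) = mfps_var i"
      "\<And>H. psup P H \<Longrightarrow> psup P (\<Psi> H)" "H = \<Psi> G"
    using GH unfolding pequiv_def by blast
  show ?thesis unfolding pequiv_def
    by (rule bexI[OF _ right_group_comp[OF \<Psi>(1) \<Phi>(1)]]) (simp add: \<Phi> \<Psi>)
qed

lemma pequiv_psup: "pequiv P F G \<Longrightarrow> psup P F \<Longrightarrow> psup P G"
  unfolding pequiv_def by blast

lemma pequiv_mpower: "pequiv P F G \<Longrightarrow> F \<in> mpower m \<Longrightarrow> G \<in> mpower m"
  unfolding pequiv_def using lhom_mem_mpower[OF right_group_lhom] by blast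

lemma pequiv_substI:
  assumes "subst \<phi> \<in> right_group" "\<And>i. \<phi> i \<in> mpower 1" "\<And>i. i \<notin> P \<Longrightarrow> \<phi> i = mfps_var i" "\<And>i. i \<in> P \<Longrightarrow> psup P (\<phi> i)"
  shows "pequiv P F (subst \<phi> F)"
  unfolding pequiv_def by (rule bexI[OF _ assms(1)]) (auto simp: subst_var[of \<phi>, OF assms(2)] assms(3) psup_subst assms(4))

definition qform :: "'n set \<Rightarrow> ('n \<Rightarrow> 'k) \<Rightarrow> ('n::finite, 'k::field) mfps" where
  "qform P q = (\<Sum>i\<in>- P. mfps_scale (q i) (mfps_var i * mfps_var i))"

lemma pequiv_lift:
  assumes "pequiv P F G" "R \<in> mpower m"
  shows "\<exists>R'\<in>mpower m. qform P q + F + R \<sim>\<^sub>r qform P q + G + R'"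
proof -
  obtain \<Phi> where \<Phi>: "\<Phi> \<in> right_group" "\<And>i. i \<notin> P \<Longrightarrow> \<Phi> (mfps_var i) = mfps_var i" "G = \<Phi> F"
    using assms(1) unfolding pequiv_def by blast
  note lh = right_group_lhom[OF \<Phi>(1)] and c = lhom_clin[OF right_group_lhom[OF \<Phi>(1)]]
  have "\<Phi> (qform P q) = qform P q"
    unfolding qform_def clin_sum[OF c] clin_scale[OF c] lhom_mult[OF lh] by (rule sum.cong) (auto simp: \<Phi>)
  then have "\<Phi> (qform P q + F + R) = qform P q + G + \<Phi> R" by (simp add: clin_add[OF c] \<Phi>(3))
  then show ?thesis using right_equivI[OF \<Phi>(1), of "qform P q + F + R"] lhom_mem_mpower[OF lh assms(2)] by auto
qed

text \<open>Only finitely many orders have been split, so a remainder \<open>R\<close> with mixed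
  terms stays. It is carried along in an order too high to influence the coefficients examined
  later.\<close>

lemma normal_form_squares:
  fixes f :: "('n::finite, 'k::field) mfps"
  assumes two: "(2 :: 'k) \<noteq> 0" and f: "f \<in> mpower 2" and d: "diag P f" and N: "2 \<le> N"
  shows "\<exists>q F R. f \<sim>\<^sub>r qform P q + F + R \<and> (\<forall>i. i \<notin> P \<longrightarrow> q i \<noteq> 0) \<and> psup P F \<and> F \<in> mpower 3 \<and> R \<in> mpower (Suc N)"
proof -
  obtain g where g: "f \<sim>\<^sub>r g" "g \<in> mpower 2" "diag P g"
    "\<And>a. 3 \<le> mdeg a \<Longrightarrow> mdeg a \<le> N \<Longrightarrow> \<not> supported_in P a \<Longrightarrow> mfps_nth g a = 0"
    using split_off_squares[OF f d N] by blast
  define q where "q i = mfps_nth g (single i 2)" for i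
  define F :: "('n, 'k) mfps" where "F = Abs_mfps (\<lambda>a. if supported_in P a \<and> 3 \<le> mdeg a then mfps_nth g a else 0)"
  define R where "R = g - qform P q - F"
  have q: "q i \<noteq> 0 \<longleftrightarrow> i \<notin> P" for i
    using g(3) two unfolding diag_def hess_eq q_def by auto
  have sq: "(mfps_var i * mfps_var i :: ('n, 'k) mfps) = mon (single i 2)" for i
    unfolding var_eq_mon mon_mult single_add[symmetric] by simp
  have nq: "mfps_nth (qform P q) a = (if \<exists>i. a = single i 2 then mfps_nth g a else 0)" for a
  proof (cases "\<exists>i. a = single i 2")
    case True
    then obtain i where i: "a = single i 2" by blast
    have "mfps_nth (qform P q) a = (\<Sum>j\<in>- P. if j = i then q i else 0)"
      unfolding qform_def nth_sum nth_scale sq i by (rule sum.cong) (auto simp: nth_mon single_eq_iff)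
    also have "\<dots> = q i" using q[of i] by auto
    finally show ?thesis using True i by (simp add: q_def)
  next
    case False
    then show ?thesis unfolding qform_def nth_sum nth_scale sq by (auto simp: nth_mon)
  qed
  have "R \<in> mpower (Suc N)"
  proof (rule mpowerI)
    fix a :: "'n \<Rightarrow>\<^sub>0 nat" assume a: "mdeg a < Suc N"
    consider "mdeg a < 2" | "mdeg a = 2" | "3 \<le> mdeg a" by linarith
    then show "mfps_nth R a = 0"
    proof cases
      case 1
      then show ?thesis using mpowerD[OF g(2), of a] by (auto simp: R_def nq F_def)
    next
      case 2
      show ?thesis
      proof (cases "\<exists>i. a = single i 2")
        case True then show ?thesis using 2 by (simp add: R_def nq F_def)
      next
        case False
        have "a \<noteq> 0" using 2 by auto
        then obtain i where "lookup a i > 0" by (metis gr0I poly_mapping_eqI lookup_zero)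
        then obtain b where b: "a = b + single i 1" using exists_single_add[of a i] by blast
        then have "mdeg b = 1" using 2 by simp
        then obtain j where j: "b = single j 1" using mdeg_1_eq_single by blast
        have "i \<noteq> j"
        proof
          assume "i = j"
          then have "a = single i 2" unfolding b j by (simp flip: single_add)
          then show False using False by blast
        qed
        then have "mfps_nth g a = 0" using g(3) hess_neq[of j i g] unfolding b j diag_def by simp
        then show ?thesis using 2 False by (simp add: R_def nq F_def)
      qed
    next
      case 3
      then have "\<not> (\<exists>i. a = single i 2)" by auto
      then show ?thesis using 3 a g(4)[of a] by (auto simp: R_def nq F_def)
    qed
  qed
  moreover have "psup P F" by (auto simp: psup_def F_def split: if_splits)
  moreover have "F \<in> mpower 3" by (rule mpowerI) (simp add: F_def)
  moreover have "g = qform P q + F + R" by (simp add: R_def)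
  ultimately show ?thesis using g(1) q by metis
qed

section \<open>Normal forms in two variables\<close>

lemma nth_var_mult: "mfps_nth (mfps_var x * A) (b + single x 1) = mfps_nth (A :: ('n::finite, 'k::comm_ring_1) mfps) b"
  unfolding var_eq_mon by (subst add.commute) (rule nth_mon_mult)

lemma nth_var_mult_0:
  assumes "lookup b x = 0"
  shows "mfps_nth (mfps_var x * (A :: ('n::finite, 'k::comm_ring_1) mfps)) b = 0"
  unfolding var_eq_mon by (rule nth_mon_mult_0) (use assms in \<open>auto simp: lookup_add\<close>)

text \<open>In the lowest degree \<open>r\<close> a binary monomial is divisible by x or equals y^r;
  all else goes into \<open>Z\<close>. Applied repeatedly, this reads off the coefficients of a
  binary form.\<close>

lemma psup_decomp:
  fixes G :: "('n::finite, 'k::field) mfps"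
  assumes xy: "x \<noteq> y" and G: "psup {x, y} G" "G \<in> mpower r"
  shows "\<exists>A c Z. G = mfps_var x * A + mfps_scale c (mfps_var y ^ r) + Z \<and>
    psup {x, y} A \<and> A \<in> mpower (r - 1) \<and> psup {x, y} Z \<and> Z \<in> mpower (Suc r)"
proof -
  define A :: "('n, 'k) mfps" where "A = Abs_mfps (\<lambda>b. mfps_nth G (b + single x 1))"
  define c where "c = mfps_nth G (single y r)"
  define Z where "Z = G - mfps_var x * A - mfps_scale c (mfps_var y ^ r)"
  have A1: "psup {x, y} A"
    unfolding psup_def
  proof (intro allI impI)
    fix b assume "mfps_nth A b \<noteq> 0"
    then have "supported_in {x, y} (b + single x 1)" using psupD[OF G(1)] by (auto simp: A_def)
    then show "supported_in {x, y} b" by (simp add: supported_add)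
  qed
  have A2: "A \<in> mpower (r - 1)"
    by (rule mpowerI) (use mpowerD[OF G(2)] in \<open>simp add: A_def\<close>)
  have Z1: "psup {x, y} Z" unfolding Z_def
    by (intro psup_diff psup_scale psup_mult psup_power psup_var A1 G) simp_all
  have "Z \<in> mpower (Suc r)"
  proof (rule mpowerI)
    fix a :: "'n \<Rightarrow>\<^sub>0 nat" assume a: "mdeg a < Suc r"
    show "mfps_nth Z a = 0"
    proof (cases "supported_in {x, y} a")
      case True
      show ?thesis
      proof (cases "lookup a x = 0")
        case T: True
        have ay: "a = single y (lookup a y)"
          using supported_two[OF True xy] T by simp
        have "mfps_nth G a = (if a = single y r then c else 0)"
        proof (cases "mdeg a = r")
          case True
          then have "a = single y r" using ay by (metis mdeg_single)
          then show ?thesis by (simp add: c_def)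
        next
          case False
          then show ?thesis using mpowerD[OF G(2), of a] a by auto
        qed
        then show ?thesis using nth_var_mult_0[OF T, of A] by (simp add: Z_def var_power nth_mon)
      next
        case False
        then obtain b where b: "a = b + single x 1" using exists_single_add[of a x] by auto
        have "a \<noteq> single y r" using False xy by (auto simp: lookup_single)
        then show ?thesis unfolding Z_def nth_diff b nth_var_mult by (simp add: A_def var_power nth_mon)
      qed
    qed (use psupD[OF Z1] in simp)
  qed
  then show ?thesis using A1 A2 Z1
    by (intro exI[of _ A] exI[of _ c] exI[of _ Z]) (simp add: Z_def)
qed

lemma var_mpower: "mfps_var i \<in> mpower 1"
  by (rule var_in_filt) simp

lemma var_power_mpower: "mfps_var i ^ m \<in> mpower m"
  using filt_power[OF var_mpower, of i m] by simp

text \<open>One step of the tangent-space method in the plane; the error order is 2s + 3 - 2 by the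
  Taylor estimate for a series of order 3.\<close>

lemma pequiv_step:
  fixes F :: "('n::finite, 'k::field) mfps"
  assumes xy: "x \<noteq> y" and F: "F \<in> mpower 3" and s: "2 \<le> s"
    and \<xi>: "psup {x, y} \<xi>" "\<xi> \<in> mpower s" and \<eta>: "psup {x, y} \<eta>" "\<eta> \<in> mpower s"
  shows "\<exists>F'. pequiv {x, y} F F' \<and> F' - (F + \<xi> * mfps_pderiv x F + \<eta> * mfps_pderiv y F) \<in> mpower (Suc (2 * s))"
proof -
  define \<zeta> where "\<zeta> i = (if i = x then \<xi> else if i = y then \<eta> else 0)" for i
  have \<zeta>: "\<zeta> i \<in> mpower s" for i by (simp add: \<zeta>_def \<xi> \<eta>)
  have \<zeta>2: "\<zeta> i \<in> mpower 2" for i by (rule mpower_mono[OF \<zeta> s])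
  have loc: "mfps_var i + \<zeta> i \<in> mpower 1" for i
    by (rule filt_add[OF var_mpower mpower_mono[OF \<zeta>2]]) simp
  have "pequiv {x, y} F (subst (\<lambda>i. mfps_var i + \<zeta> i) F)"
    by (rule pequiv_substI[OF aut_unipotent[of \<zeta>, OF \<zeta>2] loc])
      (auto simp: \<zeta>_def xy not_sym[OF xy] intro!: psup_add psup_var \<xi> \<eta>)
  moreover have "(\<Sum>i\<in>UNIV. \<zeta> i * mfps_pderiv i F) = \<xi> * mfps_pderiv x F + \<eta> * mfps_pderiv y F"
  proof -
    have "(\<Sum>i\<in>UNIV. \<zeta> i * mfps_pderiv i F) = (\<Sum>i\<in>{x, y}. \<zeta> i * mfps_pderiv i F)"
      by (rule sum.mono_neutral_right) (auto simp: \<zeta>_def)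
    then show ?thesis using xy by (simp add: \<zeta>_def)
  qed
  moreover have "subst (\<lambda>i. mfps_var i + \<zeta> i) F - F - (\<Sum>i\<in>UNIV. \<zeta> i * mfps_pderiv i F) \<in> mpower (Suc (2 * s))"
    by (rule mpower_mono[OF taylor[OF \<zeta> _ F]]) (use s in auto)
  ultimately show ?thesis by (intro exI[of _ "subst (\<lambda>i. mfps_var i + \<zeta> i) F"]) (simp add: algebra_simps)
qed

definition cst :: "'k \<Rightarrow> ('n::finite, 'k::comm_ring_1) mfps" where "cst c = mfps_scale c 1"

lemma scale_cst: "mfps_scale c f = cst c * f"
  by (simp add: cst_def scale_mult_left)

lemma cst_add: "cst (a + b) = (cst a + cst b :: ('n::finite, 'k::comm_ring_1) mfps)"
  by (rule mfps_eqI) (simp add: cst_def algebra_simps)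

lemma cst_mult: "cst (a * b) = (cst a * cst b :: ('n::finite, 'k::comm_ring_1) mfps)"
  by (simp add: cst_def scale_mult_left scale_scale)

lemma cst_one: "cst 1 = 1" by (simp add: cst_def)
lemma cst_zero: "cst 0 = 0" by (simp add: cst_def)

lemma psup_cst: "psup P (cst c)"
  unfolding cst_def by (intro psup_scale psup_one)

lemma pderiv_cube: "mfps_pderiv x (mfps_var x * mfps_var x * mfps_var x) =
    mfps_var x * mfps_var x + mfps_var x * mfps_var x + mfps_var x * mfps_var x"
  by (simp only: pderiv_mult pderiv_var simp_thms if_True mult_1_left mult_1_right distrib_right)

lemma pderiv_cube_other: "x \<noteq> y \<Longrightarrow> mfps_pderiv x (mfps_var y * mfps_var y * mfps_var y) = 0"
  by (simp add: pderiv_mult pderiv_var)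

lemma pderiv_square_mult: "x \<noteq> y \<Longrightarrow> mfps_pderiv x (mfps_var x * mfps_var x * mfps_var y) =
    mfps_var x * mfps_var y + mfps_var x * mfps_var y"
  by (simp only: pderiv_mult pderiv_var simp_thms if_True if_False mult_1_left mult_1_right mult_zero_right add_0_right distrib_right)

lemma pderiv_square_mult': "x \<noteq> y \<Longrightarrow> mfps_pderiv y (mfps_var x * mfps_var x * mfps_var y) = mfps_var x * mfps_var x"
  by (simp add: pderiv_mult pderiv_var)

text \<open>The cancellation in one step of \<open>E_form\<close>, and in the next lemma of
  \<open>D_form\<close>: the cofactor B disappears and only terms of higher order remain.\<close>

lemma E_identity: "(X * (X * B + s + Z') + Z) + - (B * (X * X)) + u - X * s = X * Z' + Z + (u :: 'a::comm_ring_1)"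
  by (simp add: algebra_simps)
lemma D_identity: "(X * (Y * B + D * (W * X * X) + Z') + Z) + - ((B - D * W * q) * (X * Y)) + u + (- (D * W * X)) * (X * X + q * Y) + v = X * Z' + Z + u + (v :: 'a::comm_ring_1)"
  by (simp add: algebra_simps)

text \<open>The derivatives of the cubic part are 2xy and x^2 + 3\<gamma>y^2. Modulo them every form
  of degree r \<ge> 4 is a multiple of y^r: multiples of xy are removed by changing x, and x^r by
  changing y, whose by-product x^(r-2) y^2 is again a multiple of xy.\<close>

lemma D_form:
  fixes F :: "('n::finite, 'k::field) mfps"
  assumes two: "(2 :: 'k) \<noteq> 0" and xy: "x \<noteq> y" and F: "psup {x, y} F"
    and C: "F - (mfps_var x * mfps_var x * mfps_var y + mfps_scale \<gamma> (mfps_var y * mfps_var y * mfps_var y)) \<in> mpower 4"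
    and r: "4 \<le> r"
  shows "\<exists>F' c. pequiv {x, y} F F' \<and> F' - (mfps_var x * mfps_var x * mfps_var y +
    mfps_scale \<gamma> (mfps_var y * mfps_var y * mfps_var y) + (\<Sum>j = 4..<r. mfps_scale (c j) (mfps_var y ^ j))) \<in> mpower r"
  using r
proof (induction r rule: dec_induct)
  case base
  then show ?case using C by (intro exI[of _ F] exI[of _ "\<lambda>_. 0"]) (simp add: pequiv_refl)
next
  case (step r)
  let ?X = "mfps_var x :: ('n, 'k) mfps" and ?Y = "mfps_var y :: ('n, 'k) mfps" and ?P = "{x, y}"
  let ?C = "?X * ?X * ?Y + mfps_scale \<gamma> (?Y * ?Y * ?Y)"
  have yx: "y \<noteq> x" using xy by simp
  obtain F1 c where F1: "pequiv ?P F F1" "F1 - (?C + (\<Sum>j = 4..<r. mfps_scale (c j) (?Y ^ j))) \<in> mpower r"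
    using step by blast
  define h where "h = (\<Sum>j = 4..<r. mfps_scale (c j) (?Y ^ j))"
  define G where "G = F1 - (?C + h)"
  have Gr: "G \<in> mpower r" using F1(2) by (simp add: G_def h_def)
  have ph: "psup {y} h" unfolding h_def by (intro psup_sum psup_scale psup_power psup_var) simp
  have ph2: "psup ?P h" unfolding h_def by (intro psup_sum psup_scale psup_power psup_var) simp
  have h4: "h \<in> mpower 4" unfolding h_def
    by (intro filt_sum filt_scale mpower_mono[OF var_power_mpower]) simp
  have pF1: "psup ?P F1" by (rule pequiv_psup[OF F1(1) F])
  have pC: "psup ?P ?C" by (intro psup_add psup_mult psup_scale psup_var) simp_all
  have pG: "psup ?P G" unfolding G_def by (intro psup_diff psup_add pF1 pC ph2)
  have C3: "?C \<in> mpower 3"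
    by (intro filt_add filt_scale filt_mult_le[OF filt_mult[OF var_mpower var_mpower] var_mpower]) simp_all
  have F1C: "F1 = ?C + h + G" by (simp add: G_def)
  have F13: "F1 \<in> mpower 3" unfolding F1C
    by (intro filt_add C3 mpower_mono[OF h4] mpower_mono[OF Gr]) (use step in auto)
  obtain A c' Z where A: "G = ?X * A + mfps_scale c' (?Y ^ r) + Z" "psup ?P A" "A \<in> mpower (r - 1)" "Z \<in> mpower (Suc r)"
    using psup_decomp[OF xy pG Gr] by blast
  obtain B d Z' where B: "A = ?Y * B + mfps_scale d (?X ^ (r - 1)) + Z'" "psup ?P B" "B \<in> mpower (r - 1 - 1)" "Z' \<in> mpower (Suc (r - 1))"
    using psup_decomp[OF yx, of A "r - 1"] A(2,3) by (auto simp: insert_commute)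
  \<comment> \<open>This avoids truncated subtraction: \<open>W\<close> below is x^(r-3), and the
    substituted increments have order m + 2 = r - 2.\<close>
  obtain m where m: "r = m + 4" using step(1) by (metis add.commute le_Suc_ex)
  define W where "W = ?X ^ Suc m"
  have W: "W \<in> mpower (Suc m)" unfolding W_def by (rule var_power_mpower)
  have Xr: "?X ^ (r - 1) = W * ?X * ?X" proof -
    have "r - 1 = Suc (Suc (Suc m))" by (simp add: m)
    then show ?thesis unfolding W_def by (simp only: power_Suc2)
  qed
  define H :: "('n, 'k) mfps" where "H = cst (1 / 2)"
  have H: "H + H = 1" unfolding H_def cst_add[symmetric] using two by (simp add: cst_one[symmetric] flip: add_divide_distrib)
  define g D where "g = (cst \<gamma> :: ('n, 'k) mfps)" and "D = (cst d :: ('n, 'k) mfps)"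
  define q where "q = g * (?Y + ?Y + ?Y)"
  \<comment> \<open>The increment \<open>\<eta>\<close> = -d x^(r-2) of y cancels d x^r; the summand
    with q in \<open>\<xi>\<close> compensates the term 3\<gamma>y^2 that comes with it.
    \<open>H\<close> is one half.\<close>
  define \<xi> where "\<xi> = - (H * (B - D * W * q))"
  define \<eta> where "\<eta> = - (D * W * ?X)"
  have q: "psup ?P q" "q \<in> mpower 1" unfolding q_def g_def
    by (intro psup_mult psup_cst psup_add psup_var; simp) (intro filt_mult_left filt_add var_mpower)
  have DWq: "D * W * q \<in> mpower (m + 2)"
    by (rule filt_mult_le[OF filt_mult_left[OF W] q(2)]) simp
  have \<xi>: "psup ?P \<xi>" "\<xi> \<in> mpower (m + 2)"
  proof -
    show "psup ?P \<xi>" unfolding \<xi>_def H_def D_def W_def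
      by (intro psup_uminus psup_mult psup_diff psup_cst psup_power psup_var B q) simp_all
    have "B \<in> mpower (m + 2)" using B(3) by (simp add: m)
    then show "\<xi> \<in> mpower (m + 2)" unfolding \<xi>_def
      by (intro filt_uminus filt_mult_left filt_diff DWq)
  qed
  have \<eta>: "psup ?P \<eta>" "\<eta> \<in> mpower (m + 2)"
  proof -
    show "psup ?P \<eta>" unfolding \<eta>_def D_def W_def
      by (intro psup_uminus psup_mult psup_cst psup_power psup_var) simp_all
    show "\<eta> \<in> mpower (m + 2)" unfolding \<eta>_def
      by (intro filt_uminus, rule filt_mult_le[OF filt_mult_left[OF W] var_mpower]) simp
  qed
  obtain F2 where F2: "pequiv ?P F1 F2" "F2 - (F1 + \<xi> * mfps_pderiv x F1 + \<eta> * mfps_pderiv y F1) \<in> mpower (Suc (2 * (m + 2)))"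
    using pequiv_step[OF xy F13 _ \<xi> \<eta>] by auto
  define U where "U = mfps_pderiv x G"
  define V where "V = mfps_pderiv y h + mfps_pderiv y G"
  have U: "U \<in> mpower 3" unfolding U_def by (rule pderiv_mem_mpower) (use Gr m in \<open>simp add: mpower_mono\<close>)
  have V: "V \<in> mpower 3" unfolding V_def
    by (intro filt_add pderiv_mem_mpower) (use Gr h4 m in \<open>simp_all add: mpower_mono\<close>)
  have dx: "mfps_pderiv x F1 = ?X * ?Y + ?X * ?Y + U"
    unfolding F1C pderiv_add U_def psup_pderiv_outside[OF ph, of x, simplified, OF xy]
    by (simp only: pderiv_scale pderiv_square_mult[OF xy] pderiv_cube_other[OF xy] scale_zero_right add_0_right)
  have dy: "mfps_pderiv y F1 = ?X * ?X + q * ?Y + V"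
    unfolding F1C pderiv_add V_def pderiv_scale pderiv_square_mult'[OF xy] pderiv_cube
    by (simp only: scale_cst g_def q_def add.assoc mult.assoc distrib_left distrib_right)
  have "H * (t + t) = (H + H) * t" for t by (simp only: distrib_left distrib_right)
  then have HT: "H * (?X * ?Y + ?X * ?Y) = ?X * ?Y" by (simp only: H mult_1_left)
  have x1: "\<xi> * (?X * ?Y + ?X * ?Y) = - ((B - D * W * q) * (?X * ?Y))"
  proof -
    have "\<xi> * t = - ((B - D * W * q) * (H * t))" for t unfolding \<xi>_def mult_minus_left by (simp only: mult_ac)
    then show ?thesis by (simp only: HT)
  qed
  have "F1 + \<xi> * mfps_pderiv x F1 + \<eta> * mfps_pderiv y F1 - (?C + h + mfps_scale c' (?Y ^ r)) =
      (?X * A + Z) + \<xi> * (?X * ?Y + ?X * ?Y) + \<xi> * U + \<eta> * (?X * ?X + q * ?Y) + \<eta> * V"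
    unfolding dx dy distrib_left[of \<xi> _ U] distrib_left[of \<eta> _ V] unfolding F1C A(1) by (simp only: add_ac diff_conv_add_uminus minus_add_distrib) simp
  also have "\<dots> = ?X * Z' + Z + \<xi> * U + \<eta> * V"
    unfolding x1 B(1) Xr \<eta>_def scale_cst D_def[symmetric] by (rule D_identity)
  also have "\<dots> \<in> mpower (Suc r)"
    by ((rule filt_add)+, rule filt_mult_le[OF var_mpower B(4)], simp add: m, rule A(4),
        rule filt_mult_le[OF \<xi>(2) U], simp add: m, rule filt_mult_le[OF \<eta>(2) V], simp add: m)
  finally have 1: "F1 + \<xi> * mfps_pderiv x F1 + \<eta> * mfps_pderiv y F1 - (?C + h + mfps_scale c' (?Y ^ r)) \<in> mpower (Suc r)" .
  have 2: "F2 - (F1 + \<xi> * mfps_pderiv x F1 + \<eta> * mfps_pderiv y F1) \<in> mpower (Suc r)"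
    by (rule mpower_mono[OF F2(2)]) (simp add: m)
  have "F2 - (?C + h + mfps_scale c' (?Y ^ r)) \<in> mpower (Suc r)"
    using filt_add[OF 2 1] by (simp only: add_diff_eq diff_add_cancel)
  moreover have "h + mfps_scale c' (?Y ^ r) = (\<Sum>j = 4..<Suc r. mfps_scale ((c(r := c')) j) (?Y ^ j))"
    unfolding h_def using step(1) by simp
  ultimately show ?case using pequiv_trans[OF F1(1) F2(1)]
    by (intro exI[of _ F2] exI[of _ "c(r := c')"]) (simp only: add.assoc)
qed

text \<open>The derivative 3x^2 of the cubic part removes all multiples of x^2, so that in degree
  \<open>r\<close> only y^r and x y^(r-1) survive.\<close>

lemma E_form:
  fixes F :: "('n::finite, 'k::field) mfps"
  assumes three: "(3 :: 'k) \<noteq> 0" and xy: "x \<noteq> y" and F: "psup {x, y} F"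
    and C: "F - mfps_var x * mfps_var x * mfps_var x \<in> mpower 4" and r: "4 \<le> r"
  shows "\<exists>F' c d. pequiv {x, y} F F' \<and> F' - (mfps_var x * mfps_var x * mfps_var x +
    (\<Sum>j = 4..<r. mfps_scale (c j) (mfps_var y ^ j) + mfps_scale (d j) (mfps_var x * mfps_var y ^ (j - 1)))) \<in> mpower r"
  using r
proof (induction r rule: dec_induct)
  case base
  then show ?case using C by (intro exI[of _ F] exI[of _ "\<lambda>_. 0"]) (simp add: pequiv_refl)
next
  case (step r)
  let ?X = "mfps_var x :: ('n, 'k) mfps" and ?Y = "mfps_var y :: ('n, 'k) mfps" and ?P = "{x, y}"
  let ?C = "?X * ?X * ?X"
  obtain F1 c d where F1: "pequiv ?P F F1"
      "F1 - (?C + (\<Sum>j = 4..<r. mfps_scale (c j) (?Y ^ j) + mfps_scale (d j) (?X * ?Y ^ (j - 1)))) \<in> mpower r"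
    using step by blast
  define h where "h = (\<Sum>j = 4..<r. mfps_scale (c j) (?Y ^ j) + mfps_scale (d j) (?X * ?Y ^ (j - 1)))"
  define G where "G = F1 - (?C + h)"
  have Gr: "G \<in> mpower r" using F1(2) by (simp add: G_def h_def)
  have ph2: "psup ?P h" unfolding h_def by (intro psup_sum psup_add psup_mult psup_scale psup_power psup_var) simp_all
  have h4: "h \<in> mpower 4" unfolding h_def
  proof (rule filt_sum)
    fix j assume j: "j \<in> {4..<r}"
    show "mfps_scale (c j) (?Y ^ j) + mfps_scale (d j) (?X * ?Y ^ (j - 1)) \<in> mpower 4"
      by (intro filt_add filt_scale mpower_mono[OF var_power_mpower] filt_mult_le[OF var_mpower var_power_mpower]) (use j in auto)
  qed
  have pF1: "psup ?P F1" by (rule pequiv_psup[OF F1(1) F])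
  have pC: "psup ?P ?C" by (intro psup_mult psup_var) simp_all
  have pG: "psup ?P G" unfolding G_def by (intro psup_diff psup_add pF1 pC ph2)
  have C3: "?C \<in> mpower 3"
    by (rule filt_mult_le[OF filt_mult[OF var_mpower var_mpower] var_mpower]) simp
  have F1C: "F1 = ?C + h + G" by (simp add: G_def)
  have F13: "F1 \<in> mpower 3" unfolding F1C
    by (intro filt_add C3 mpower_mono[OF h4] mpower_mono[OF Gr]) (use step in auto)
  obtain A c' Z where A: "G = ?X * A + mfps_scale c' (?Y ^ r) + Z" "psup ?P A" "A \<in> mpower (r - 1)" "Z \<in> mpower (Suc r)"
    using psup_decomp[OF xy pG Gr] by blast
  obtain B d' Z' where B: "A = ?X * B + mfps_scale d' (?Y ^ (r - 1)) + Z'" "psup ?P B" "B \<in> mpower (r - 1 - 1)" "Z' \<in> mpower (Suc (r - 1))"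
    using psup_decomp[OF xy A(2,3)] by auto
  obtain m where m: "r = m + 4" using step(1) by (metis add.commute le_Suc_ex)
  define H :: "('n, 'k) mfps" where "H = cst (1 / 3)"
  have "1 / 3 + 1 / 3 + 1 / 3 = (1 :: 'k)" using three by (simp flip: add_divide_distrib)
  then have H: "H + H + H = 1" unfolding H_def cst_add[symmetric] by (simp add: cst_one)
  define \<xi> where "\<xi> = - (H * B)"
  have \<xi>: "psup ?P \<xi>" "\<xi> \<in> mpower (m + 2)"
  proof -
    show "psup ?P \<xi>" unfolding \<xi>_def H_def by (intro psup_uminus psup_mult psup_cst B)
    have "B \<in> mpower (m + 2)" using B(3) by (simp add: m)
    then show "\<xi> \<in> mpower (m + 2)" unfolding \<xi>_def by (intro filt_uminus filt_mult_left)
  qed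
  obtain F2 where F2: "pequiv ?P F1 F2" "F2 - (F1 + \<xi> * mfps_pderiv x F1) \<in> mpower (Suc (2 * (m + 2)))"
    using pequiv_step[OF xy F13 _ \<xi> psup_zero filt_zero] by auto
  define U where "U = mfps_pderiv x h + mfps_pderiv x G"
  have U: "U \<in> mpower 3" unfolding U_def
    by (intro filt_add pderiv_mem_mpower) (use Gr h4 m in \<open>simp_all add: mpower_mono\<close>)
  have dx: "mfps_pderiv x F1 = ?X * ?X + ?X * ?X + ?X * ?X + U"
    unfolding F1C pderiv_add U_def by (simp only: pderiv_cube add.assoc)
  have "H * (t + t + t) = (H + H + H) * t" for t by (simp only: distrib_left distrib_right)
  then have HT: "H * (?X * ?X + ?X * ?X + ?X * ?X) = ?X * ?X" by (simp only: H mult_1_left)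
  have "\<xi> * t = - (B * (H * t))" for t unfolding \<xi>_def mult_minus_left by (simp only: mult_ac)
  then have x1: "\<xi> * (?X * ?X + ?X * ?X + ?X * ?X) = - (B * (?X * ?X))" by (simp only: HT)
  have "F1 + \<xi> * mfps_pderiv x F1 - (?C + h + (mfps_scale c' (?Y ^ r) + mfps_scale d' (?X * ?Y ^ (r - 1)))) =
      (?X * A + Z) + \<xi> * (?X * ?X + ?X * ?X + ?X * ?X) + \<xi> * U - mfps_scale d' (?X * ?Y ^ (r - 1))"
    unfolding dx distrib_left[of \<xi> _ U] unfolding F1C A(1) by (simp only: add_ac diff_conv_add_uminus minus_add_distrib) simp
  also have "\<dots> = ?X * Z' + Z + \<xi> * U"
    unfolding x1 B(1) scale_mult_right[symmetric] by (rule E_identity)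
  also have "\<dots> \<in> mpower (Suc r)"
    by ((rule filt_add)+, rule filt_mult_le[OF var_mpower B(4)], simp add: m, rule A(4),
        rule filt_mult_le[OF \<xi>(2) U], simp add: m)
  finally have 1: "F1 + \<xi> * mfps_pderiv x F1 - (?C + h + (mfps_scale c' (?Y ^ r) + mfps_scale d' (?X * ?Y ^ (r - 1)))) \<in> mpower (Suc r)" .
  have 2: "F2 - (F1 + \<xi> * mfps_pderiv x F1) \<in> mpower (Suc r)"
    by (rule mpower_mono[OF F2(2)]) (simp add: m)
  have "F2 - (?C + h + (mfps_scale c' (?Y ^ r) + mfps_scale d' (?X * ?Y ^ (r - 1)))) \<in> mpower (Suc r)"
    using filt_add[OF 2 1] by (simp only: add_diff_eq diff_add_cancel)
  moreover have "h + (mfps_scale c' (?Y ^ r) + mfps_scale d' (?X * ?Y ^ (r - 1))) =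
      (\<Sum>j = 4..<Suc r. mfps_scale ((c(r := c')) j) (?Y ^ j) + mfps_scale ((d(r := d')) j) (?X * ?Y ^ (j - 1)))"
    unfolding h_def using step(1) by simp
  ultimately show ?case using pequiv_trans[OF F1(1) F2(1)]
    by (intro exI[of _ F2] exI[of _ "c(r := c')"] exI[of _ "d(r := d')"]) (simp only: add.assoc)
qed

section \<open>Binary cubics\<close>

definition cubic :: "'n \<Rightarrow> 'n \<Rightarrow> 'k \<Rightarrow> 'k \<Rightarrow> 'k \<Rightarrow> 'k \<Rightarrow> ('n::finite, 'k::comm_ring_1) mfps" where
  "cubic x y a b c d = cst a * (mfps_var x * mfps_var x * mfps_var x) + cst b * (mfps_var x * mfps_var x * mfps_var y) +
     cst c * (mfps_var x * mfps_var y * mfps_var y) + cst d * (mfps_var y * mfps_var y * mfps_var y)"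

definition has_cubic :: "'n \<Rightarrow> 'n \<Rightarrow> ('n::finite, 'k::field) mfps \<Rightarrow> 'k \<Rightarrow> 'k \<Rightarrow> 'k \<Rightarrow> 'k \<Rightarrow> bool" where
  "has_cubic x y F a b c d \<longleftrightarrow> psup {x, y} F \<and> F - cubic x y a b c d \<in> mpower 4"

lemma has_cubic_exists:
  fixes F :: "('n::finite, 'k::field) mfps"
  assumes xy: "x \<noteq> y" and F: "psup {x, y} F" "F \<in> mpower 3"
  shows "\<exists>a b c d. has_cubic x y F a b c d"
proof -
  let ?X = "mfps_var x :: ('n, 'k) mfps" and ?Y = "mfps_var y :: ('n, 'k) mfps"
  obtain A d Z where A: "F = ?X * A + mfps_scale d (?Y ^ 3) + Z" "psup {x, y} A" "A \<in> mpower 2" "Z \<in> mpower 4"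
    using psup_decomp[OF xy F] by auto
  obtain B c Z2 where B: "A = ?X * B + mfps_scale c (?Y ^ 2) + Z2" "psup {x, y} B" "B \<in> mpower 1" "Z2 \<in> mpower 3"
    using psup_decomp[OF xy A(2,3)] by (auto simp: One_nat_def)
  obtain E b Z3 where E: "B = ?X * E + mfps_scale b (?Y ^ 1) + Z3" "psup {x, y} E" "Z3 \<in> mpower 2"
    using psup_decomp[OF xy B(2,3)] by auto
  define a where "a = mfps_nth E 0"
  define Z4 where "Z4 = E - cst a"
  have Z4: "Z4 \<in> mpower 1"
    unfolding max_ideal_eq[symmetric] max_ideal_def by (simp add: Z4_def a_def cst_def nth_one)
  have EE: "E = cst a + Z4" by (simp add: Z4_def)
  have "F = cubic x y a b c d + (?X * (?X * (?X * Z4)) + ?X * (?X * Z3) + ?X * Z2 + Z)"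
    unfolding cubic_def A(1) B(1) E(1) EE scale_cst power2_eq_square power3_eq_cube power_one_right
    by (simp only: algebra_simps)
  then have "F - cubic x y a b c d = ?X * (?X * (?X * Z4)) + ?X * (?X * Z3) + ?X * Z2 + Z" by simp
  also have "\<dots> \<in> mpower 4"
    by (intro filt_add A(4) filt_mult_le[OF var_mpower B(4)] filt_mult_le[OF var_mpower filt_mult[OF var_mpower E(3)]]
        filt_mult_le[OF var_mpower filt_mult[OF var_mpower filt_mult[OF var_mpower Z4]]]) simp_all
  finally show ?thesis using F(1) unfolding has_cubic_def by blast
qed

lemma has_cubic_transform:
  assumes F: "has_cubic x y F a b c d" and \<phi>: "subst \<phi> \<in> right_group" "\<And>i. \<phi> i \<in> mpower 1"
    "\<And>i. i \<notin> {x, y} \<Longrightarrow> \<phi> i = mfps_var i" "\<And>i. i \<in> {x, y} \<Longrightarrow> psup {x, y} (\<phi> i)"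
    and eq: "cst a * (\<phi> x * \<phi> x * \<phi> x) + cst b * (\<phi> x * \<phi> x * \<phi> y) +
     cst c * (\<phi> x * \<phi> y * \<phi> y) + cst d * (\<phi> y * \<phi> y * \<phi> y) = cubic x y a' b' c' d'"
  shows "pequiv {x, y} F (subst \<phi> F) \<and> has_cubic x y (subst \<phi> F) a' b' c' d'"
proof -
  have pe: "pequiv {x, y} F (subst \<phi> F)" by (rule pequiv_substI[OF \<phi>])
  note lh = lhom_subst[of \<phi>, OF \<phi>(2)] and v = subst_var[of \<phi>, OF \<phi>(2)]
  have cs: "subst \<phi> (cst e) = cst e" for e
    unfolding cst_def by (simp add: clin_scale[OF lhom_clin[OF lh]] lhom_one[OF lh])
  have "subst \<phi> (cubic x y a b c d) = cst a * (\<phi> x * \<phi> x * \<phi> x) + cst b * (\<phi> x * \<phi> x * \<phi> y) +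
     cst c * (\<phi> x * \<phi> y * \<phi> y) + cst d * (\<phi> y * \<phi> y * \<phi> y)"
    unfolding cubic_def by (simp only: clin_add[OF lhom_clin[OF lh]] lhom_mult[OF lh] v cs)
  also note eq
  finally have "subst \<phi> (cubic x y a b c d) = cubic x y a' b' c' d'" .
  then have "subst \<phi> F - cubic x y a' b' c' d' = subst \<phi> (F - cubic x y a b c d)"
    by (simp add: clin_minus[OF lhom_clin[OF lh]])
  also have "\<dots> \<in> mpower 4" by (rule lhom_mem_mpower[OF lh]) (use F in \<open>simp add: has_cubic_def\<close>)
  finally show ?thesis using pe pequiv_psup[OF pe] F unfolding has_cubic_def by blast
qed

lemma cubic_shear:
  fixes F :: "('n::finite, 'k::field) mfps"
  assumes xy: "x \<noteq> y" and F: "has_cubic x y F a b c d"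
  shows "\<exists>F'. pequiv {x, y} F F' \<and> has_cubic x y F' a (b + (l * a + l * a + l * a)) (c + (l * b + l * b) + l * l * (a + a + a))
    (d + l * c + l * l * b + l * l * l * a)"
proof -
  define e where "e j = (if j = y then l else 0)" for j
  let ?\<phi> = "\<lambda>k. if k = x then mfps_var x + (\<Sum>j\<in>UNIV. mfps_scale (e j) (mfps_var j)) else (mfps_var k :: ('n, 'k) mfps)"
  have ex: "e x = 0" using xy by (simp add: e_def)
  have "(\<Sum>j\<in>UNIV. mfps_scale (e j) (mfps_var j)) = (\<Sum>j\<in>UNIV. if j = y then mfps_scale l (mfps_var y) else (0 :: ('n, 'k) mfps))"
    by (rule sum.cong) (auto simp: e_def)
  then have s: "(\<Sum>j\<in>UNIV. mfps_scale (e j) (mfps_var j)) = cst l * (mfps_var y :: ('n, 'k) mfps)" by (simp add: scale_cst)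
  have "pequiv {x, y} F (subst ?\<phi> F) \<and> has_cubic x y (subst ?\<phi> F) a (b + (l * a + l * a + l * a)) (c + (l * b + l * b) + l * l * (a + a + a))
    (d + l * c + l * l * b + l * l * l * a)"
  proof (rule has_cubic_transform[OF F aut_shear[of e x, OF ex]])
    show "?\<phi> i \<in> mpower 1" for i by (auto intro!: filt_add filt_sum filt_scale var_mpower)
    show "?\<phi> i = mfps_var i" if "i \<notin> {x, y}" for i using that by simp
    show "psup {x, y} (?\<phi> i)" if "i \<in> {x, y}" for i unfolding s using that by (auto intro!: psup_add psup_mult psup_cst psup_var)
    show "cst a * (?\<phi> x * ?\<phi> x * ?\<phi> x) + cst b * (?\<phi> x * ?\<phi> x * ?\<phi> y) + cst c * (?\<phi> x * ?\<phi> y * ?\<phi> y) + cst d * (?\<phi> y * ?\<phi> y * ?\<phi> y) =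
       cubic x y a (b + (l * a + l * a + l * a)) (c + (l * b + l * b) + l * l * (a + a + a)) (d + l * c + l * l * b + l * l * l * a)"
      using xy not_sym[OF xy] unfolding s cubic_def cst_add cst_mult by (simp only: if_True if_False simp_thms) (simp only: algebra_simps)
  qed
  then show ?thesis by blast
qed

lemma cubic_dilation:
  fixes F :: "('n::finite, 'k::field) mfps"
  assumes xy: "x \<noteq> y" and F: "has_cubic x y F a b c d" and s: "s \<noteq> 0"
  shows "\<exists>F'. pequiv {x, y} F F' \<and> has_cubic x y F' (s * s * s * a) (s * s * b) (s * c) d"
proof -
  let ?\<phi> = "\<lambda>k. if k = x then mfps_scale s (mfps_var x) else (mfps_var k :: ('n, 'k) mfps)"
  have "pequiv {x, y} F (subst ?\<phi> F) \<and> has_cubic x y (subst ?\<phi> F) (s * s * s * a) (s * s * b) (s * c) d"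
  proof (rule has_cubic_transform[OF F aut_dilation[OF s]])
    show "?\<phi> i \<in> mpower 1" for i by (auto intro!: filt_scale var_mpower)
    show "?\<phi> i = mfps_var i" if "i \<notin> {x, y}" for i using that by simp
    show "psup {x, y} (?\<phi> i)" if "i \<in> {x, y}" for i using that by (auto intro!: psup_scale psup_var)
    show "cst a * (?\<phi> x * ?\<phi> x * ?\<phi> x) + cst b * (?\<phi> x * ?\<phi> x * ?\<phi> y) + cst c * (?\<phi> x * ?\<phi> y * ?\<phi> y) + cst d * (?\<phi> y * ?\<phi> y * ?\<phi> y) =
       cubic x y (s * s * s * a) (s * s * b) (s * c) d"
      using xy not_sym[OF xy] unfolding cubic_def cst_mult scale_cst by (simp only: if_True if_False simp_thms) (simp only: algebra_simps)
  qed
  then show ?thesis by blast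
qed

lemma cubic_swap:
  fixes F :: "('n::finite, 'k::field) mfps"
  assumes xy: "x \<noteq> y" and F: "has_cubic x y F a b c d"
  shows "\<exists>F'. pequiv {x, y} F F' \<and> has_cubic x y F' d c b a"
proof -
  define \<pi> where "\<pi> k = (if k = x then y else if k = y then x else k)" for k
  have "\<pi> (\<pi> k) = k" for k by (auto simp: \<pi>_def)
  then have \<pi>: "bij \<pi>" by (intro o_bij[of \<pi>]) (auto simp: fun_eq_iff)
  let ?\<phi> = "\<lambda>k. mfps_var (\<pi> k) :: ('n, 'k) mfps"
  have "pequiv {x, y} F (subst ?\<phi> F) \<and> has_cubic x y (subst ?\<phi> F) d c b a"
  proof (rule has_cubic_transform[OF F aut_permutation[OF \<pi>]])
    show "?\<phi> i \<in> mpower 1" for i by (rule var_mpower)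
    show "?\<phi> i = mfps_var i" if "i \<notin> {x, y}" for i using that by (simp add: \<pi>_def)
    show "psup {x, y} (?\<phi> i)" if "i \<in> {x, y}" for i using that by (auto simp: \<pi>_def intro!: psup_var)
    show "cst a * (?\<phi> x * ?\<phi> x * ?\<phi> x) + cst b * (?\<phi> x * ?\<phi> x * ?\<phi> y) + cst c * (?\<phi> x * ?\<phi> y * ?\<phi> y) + cst d * (?\<phi> y * ?\<phi> y * ?\<phi> y) =
       cubic x y d c b a"
      using xy not_sym[OF xy] unfolding cubic_def \<pi>_def by (simp only: if_True if_False simp_thms) (simp only: algebra_simps)
  qed
  then show ?thesis by blast
qed

lemma alg_closed_root:
  fixes a :: "'k::alg_closed_field"
  assumes "a \<noteq> 0" shows "\<exists>t. a * t ^ 3 + b * t ^ 2 + c * t + d = 0"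
proof -
  have "degree [:d, c, b, a:] > 0" using assms by simp
  then obtain t where "poly [:d, c, b, a:] t = 0" using alg_closed_imp_poly_has_root by blast
  then show ?thesis by (intro exI[of _ t]) (simp add: algebra_simps power2_eq_square power3_eq_cube)
qed

lemma alg_closed_sqrt: "\<exists>t. t * t = (a :: 'k::alg_closed_field)"
proof -
  have "degree [:- a, 0, 1:] > 0" by simp
  then obtain t where "poly [:- a, 0, 1:] t = 0" using alg_closed_imp_poly_has_root by blast
  then show ?thesis by (intro exI[of _ t]) (simp add: algebra_simps)
qed

text \<open>A root of the dehomogenised cubic gives a linear factor; a shear and a swap turn it into
  y, so x^3 no longer occurs. If x^2 y occurs, completing the square gives x^2 y + \<gamma> y^3. If
  not, the cubic is zero, a cube, or reduces to the previous case by one more shear and swap. The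
  parameter \<gamma> is kept, since it is absorbed in the one-variable part of the D form.\<close>

lemma cubic_normal_form:
  fixes F :: "('n::finite, 'k::alg_closed_field) mfps"
  assumes two: "(2 :: 'k) \<noteq> 0" and xy: "x \<noteq> y" and F: "psup {x, y} F" "F \<in> mpower 3"
  shows "\<exists>F'. pequiv {x, y} F F' \<and> (has_cubic x y F' 0 0 0 0 \<or> has_cubic x y F' 1 0 0 0 \<or> (\<exists>\<gamma>. has_cubic x y F' 0 1 0 \<gamma>))"
    (is "\<exists>F'. _ \<and> ?N F'")
proof -
  define nf where "nf G \<longleftrightarrow> (\<exists>F'. pequiv {x, y} G F' \<and> ?N F')" for G
  have nf_trans: "nf G" if "pequiv {x, y} G G'" "nf G'" for G G'
    using that pequiv_trans unfolding nf_def by blast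
  have D: "nf G" if G: "has_cubic x y G 0 b c d" and b: "b \<noteq> 0" for G b c d
  proof -
    obtain G1 d1 where G1: "pequiv {x, y} G G1" "has_cubic x y G1 0 b 0 d1"
    proof -
      define l where "l = - c / (2 * b)"
      have "c + (l * b + l * b) = 0" using b two by (simp add: l_def field_simps flip: mult_2)
      then show ?thesis using cubic_shear[OF xy G, of l] that by auto
    qed
    obtain s where s: "s * s = 1 / b" using alg_closed_sqrt by blast
    then have "s \<noteq> 0" using b by auto
    then obtain G2 where "pequiv {x, y} G1 G2" "has_cubic x y G2 0 (s * s * b) 0 d1"
      using cubic_dilation[OF xy G1(2), of s] by auto
    then have "nf G1" unfolding nf_def using s b by auto
    then show ?thesis by (rule nf_trans[OF G1(1)])
  qed
  have 0: "nf G" if G: "has_cubic x y G 0 b c d" for G b c d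
  proof (cases "b = 0")
    case b: True
    show ?thesis
    proof (cases "c = 0")
      case c: True
      show ?thesis
      proof (cases "d = 0")
        case True then show ?thesis using G b c pequiv_refl unfolding nf_def by blast
      next
        case False
        obtain G1 where G1: "pequiv {x, y} G G1" "has_cubic x y G1 d 0 0 0" using cubic_swap[OF xy G] b c by auto
        obtain s where "1 * s ^ 3 + 0 * s ^ 2 + 0 * s + - (1 / d) = 0" using alg_closed_root[of 1 0 0 "- (1 / d)"] by auto
        then have s: "s * s * s = 1 / d" by (simp add: power3_eq_cube algebra_simps)
        then have "s \<noteq> 0" using False by auto
        then obtain G2 where "pequiv {x, y} G1 G2" "has_cubic x y G2 (s * s * s * d) 0 0 0"
          using cubic_dilation[OF xy G1(2), of s] by auto
        then have "nf G1" unfolding nf_def using s False by auto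
        then show ?thesis by (rule nf_trans[OF G1(1)])
      qed
    next
      case c: False
      obtain G1 where G1: "pequiv {x, y} G G1" "has_cubic x y G1 0 0 c 0"
        using cubic_shear[OF xy G, of "- d / c"] b c by auto
      obtain G2 where G2: "pequiv {x, y} G1 G2" "has_cubic x y G2 0 c 0 0" using cubic_swap[OF xy G1(2)] by auto
      show ?thesis by (rule nf_trans[OF G1(1) nf_trans[OF G2(1) D[OF G2(2) c]]])
    qed
  qed (rule D[OF G])
  obtain a b c d where abcd: "has_cubic x y F a b c d" using has_cubic_exists[OF xy F] by blast
  have "nf F"
  proof (cases "a = 0")
    case True then show ?thesis using 0 abcd by blast
  next
    case False
    then obtain l where l: "a * l ^ 3 + b * l ^ 2 + c * l + d = 0" using alg_closed_root by blast
    obtain G b' c' where G: "pequiv {x, y} F G" "has_cubic x y G a b' c' 0"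
    proof -
      have "d + l * c + l * l * b + l * l * l * a = 0"
        using l by (simp add: power2_eq_square power3_eq_cube algebra_simps)
      then show ?thesis using cubic_shear[OF xy abcd, of l] that by auto
    qed
    obtain G2 where G2: "pequiv {x, y} G G2" "has_cubic x y G2 0 c' b' a" using cubic_swap[OF xy G(2)] by auto
    show ?thesis by (rule nf_trans[OF G(1) nf_trans[OF G2(1) 0[OF G2(2)]]])
  qed
  then show ?thesis unfolding nf_def .
qed

text \<open>In characteristic \<open>3\<close>, Euler's relation gives \<open>\<partial>\<^sub>xC = y\<cdot>l\<close> and \<open>\<partial>\<^sub>yC = - x\<cdot>l\<close>, so the gradient of a
  binary cubic vanishes on a line.\<close>

lemma cubic_char_3:
  fixes F :: "('n::finite, 'k::field) mfps"
  assumes three: "(3 :: 'k) = 0" and two: "(2 :: 'k) \<noteq> 0" and xy: "x \<noteq> y" and F: "psup {x, y} F" "F \<in> mpower 3"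
  shows "\<exists>F' a b d. pequiv {x, y} F F' \<and> has_cubic x y F' a b 0 d"
proof -
  obtain a b c d where abcd: "has_cubic x y F a b c d" using has_cubic_exists[OF xy F] by blast
  show ?thesis
  proof (cases "b = 0")
    case True then show ?thesis using cubic_swap[OF xy abcd] by blast
  next
    case False
    define l where "l = - c / (2 * b)"
    have "a + a + a = 3 * a" by simp
    then have "a + a + a = 0" using three by simp
    moreover have "c + (l * b + l * b) = 0" using False two by (simp add: l_def field_simps flip: mult_2)
    ultimately have "c + (l * b + l * b) + l * l * (a + a + a) = 0" by simp
    then show ?thesis using cubic_shear[OF xy abcd, of l] by metis
  qed
qed

section \<open>Simple singularities in odd characteristic\<close>

text \<open>The ideal \<open>j(g) + \<mm>\<^bsup>M + 1\<^esup>\<close>.\<close>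

definition jid :: "nat \<Rightarrow> ('n::finite, 'k::comm_ring_1) mfps \<Rightarrow> ('n, 'k) mfps set" where
  "jid M g = {h. \<exists>r. h - (\<Sum>i\<in>UNIV. r i * mfps_pderiv i g) \<in> mpower (Suc M)}"

lemma jid_mpower: "h \<in> mpower (Suc M) \<Longrightarrow> h \<in> jid M g"
  unfolding jid_def by (auto intro!: exI[of _ "\<lambda>_. 0"])

lemma jid_add: "h \<in> jid M g \<Longrightarrow> h' \<in> jid M g \<Longrightarrow> h + h' \<in> jid M g"
proof -
  assume "h \<in> jid M g" "h' \<in> jid M g"
  then obtain r s where rs: "h - (\<Sum>i\<in>UNIV. r i * mfps_pderiv i g) \<in> mpower (Suc M)"
    "h' - (\<Sum>i\<in>UNIV. s i * mfps_pderiv i g) \<in> mpower (Suc M)" by (auto simp: jid_def)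
  have "h + h' - (\<Sum>i\<in>UNIV. (r i + s i) * mfps_pderiv i g) =
      (h - (\<Sum>i\<in>UNIV. r i * mfps_pderiv i g)) + (h' - (\<Sum>i\<in>UNIV. s i * mfps_pderiv i g))"
    by (simp add: distrib_right sum.distrib)
  then have "h + h' - (\<Sum>i\<in>UNIV. (r i + s i) * mfps_pderiv i g) \<in> mpower (Suc M)"
    using filt_add[OF rs] by (simp only:)
  then show ?thesis unfolding jid_def by (intro CollectI exI[of _ "\<lambda>i. r i + s i"])
qed

lemma jid_mult: "h \<in> jid M g \<Longrightarrow> f * h \<in> jid M g"
proof -
  assume "h \<in> jid M g"
  then obtain r where r: "h - (\<Sum>i\<in>UNIV. r i * mfps_pderiv i g) \<in> mpower (Suc M)" by (auto simp: jid_def)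
  have "f * h - (\<Sum>i\<in>UNIV. (f * r i) * mfps_pderiv i g) = f * (h - (\<Sum>i\<in>UNIV. r i * mfps_pderiv i g))"
    by (simp add: right_diff_distrib sum_distrib_left mult.assoc)
  then have "f * h - (\<Sum>i\<in>UNIV. (f * r i) * mfps_pderiv i g) \<in> mpower (Suc M)"
    using filt_mult_left[OF r] by (simp only:)
  then show ?thesis unfolding jid_def by (intro CollectI exI[of _ "\<lambda>i. f * r i"])
qed

lemma jid_mult': "h \<in> jid M g \<Longrightarrow> h * f \<in> jid M g"
  using jid_mult[of h M g f] by (simp add: mult.commute)

lemma jid_uminus: "h \<in> jid M g \<Longrightarrow> - h \<in> jid M g"
  using jid_mult[of h M g "- 1"] by simp

lemma jid_diff: "h \<in> jid M g \<Longrightarrow> h' \<in> jid M g \<Longrightarrow> h - h' \<in> jid M g"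
  using jid_add[OF _ jid_uminus, of h M g h'] by simp

lemma jid_scale: "h \<in> jid M g \<Longrightarrow> mfps_scale c h \<in> jid M g"
  unfolding scale_cst by (rule jid_mult)

lemma jid_sum: "(\<And>x. x \<in> A \<Longrightarrow> f x \<in> jid M g) \<Longrightarrow> sum f A \<in> jid M g"
  by (induction A rule: infinite_finite_induct) (auto intro: jid_add jid_mpower)

lemma jid_pderiv: "mfps_pderiv i g \<in> jid M g"
proof -
  have "(\<Sum>j\<in>UNIV. (if j = i then 1 else 0) * mfps_pderiv j g) = (\<Sum>j\<in>UNIV. if j = i then mfps_pderiv i g else 0)"
    by (rule sum.cong) auto
  then show ?thesis unfolding jid_def by (auto intro!: exI[of _ "\<lambda>j. if j = i then 1 else 0"])
qed

lemma jac_coversI: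
  fixes g :: "('n::finite, 'k::field) mfps"
  assumes "\<And>a :: 'n \<Rightarrow>\<^sub>0 nat. mdeg a = M \<Longrightarrow> mon a \<in> jid M g"
  shows "jac_covers M g"
  unfolding jac_covers_def
proof
  fix h :: "('n, 'k) mfps" assume h: "h \<in> mpower M"
  have "trunc (Suc M) h \<in> jid M g" unfolding trunc_def
  proof (rule jid_sum)
    fix a :: "'n \<Rightarrow>\<^sub>0 nat" assume a: "a \<in> {a. mdeg a < Suc M}"
    show "mfps_scale (mfps_nth h a) (mon a) \<in> jid M g"
    proof (cases "mdeg a = M")
      case True then show ?thesis by (intro jid_scale assms)
    next
      case False
      then have "mfps_nth h a = 0" using a by (intro mpowerD[OF h]) simp
      then show ?thesis by (simp add: jid_mpower)
    qed
  qed
  then have "trunc (Suc M) h + (h - trunc (Suc M) h) \<in> jid M g"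
    by (rule jid_add[OF _ jid_mpower[OF trunc_diff]])
  then show "\<exists>r. h - (\<Sum>i\<in>UNIV. r i * mfps_pderiv i g) \<in> mpower (Suc M)" by (simp add: jid_def)
qed

lemma mon_split: "mon (a + b) = (mon a * mon b :: ('n::finite, 'k::comm_ring_1) mfps)"
  by (simp add: mon_mult)

text \<open>The derivatives of \<open>R\<close> have order M + 1 and are absorbed by the ideal, so
  those of the quadratic form and of \<open>F\<close> can be used as if \<open>R\<close> were
  zero.\<close>

lemma jid_form:
  fixes F R :: "('n::finite, 'k::field) mfps"
  assumes two: "(2 :: 'k) \<noteq> 0" and q: "\<And>i. i \<notin> P \<Longrightarrow> q i \<noteq> 0" and F: "psup P F" and R: "R \<in> mpower (Suc (Suc M))"
    and g: "g = qform P q + F + R"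
  shows "i \<notin> P \<Longrightarrow> mfps_var i \<in> jid M g" and "i \<in> P \<Longrightarrow> mfps_pderiv i F \<in> jid M g"
proof -
  have dR: "mfps_pderiv i R \<in> jid M g" for i by (intro jid_mpower pderiv_mem_mpower R)
  have dq: "mfps_pderiv i (qform P q) = (if i \<in> P then 0 else mfps_scale (2 * q i) (mfps_var i))" for i
  proof -
    have "mfps_pderiv i (mfps_var j * mfps_var j :: ('n, 'k) mfps) = (if j = i then mfps_scale 2 (mfps_var i) else 0)" for j
    proof -
      have "mfps_var i + mfps_var i = (mfps_scale 2 (mfps_var i) :: ('n, 'k) mfps)"
        by (rule mfps_eqI) (simp only: nth_add nth_scale mult_2)
      then show ?thesis unfolding pderiv_mult pderiv_var by (cases "i = j") (simp_all del: mult_2 mult_2_right)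
    qed
    then have "mfps_pderiv i (qform P q) = (\<Sum>j\<in>- P. if j = i then mfps_scale (2 * q i) (mfps_var i) else 0)"
      unfolding qform_def pderiv_sum pderiv_scale by (intro sum.cong) (auto simp: scale_scale mult.commute)
    then show ?thesis by simp
  qed
  have dg: "mfps_pderiv i g \<in> jid M g" for i by (rule jid_pderiv)
  show "mfps_var i \<in> jid M g" if i: "i \<notin> P" for i
  proof -
    have "mfps_pderiv i g - mfps_pderiv i R = mfps_scale (2 * q i) (mfps_var i)"
      unfolding g using i psup_pderiv_outside[OF F i] by (simp add: pderiv_add dq)
    then have "mfps_scale (2 * q i) (mfps_var i) \<in> jid M g" using jid_diff[OF dg[of i] dR[of i]] by simp
    from jid_scale[OF this, of "inverse (2 * q i)"] show ?thesis
      using two q[OF i] by (simp add: scale_scale)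
  qed
  show "mfps_pderiv i F \<in> jid M g" if i: "i \<in> P" for i
  proof -
    have "mfps_pderiv i g - mfps_pderiv i R = mfps_pderiv i F" unfolding g using i by (simp add: pderiv_add dq)
    then show ?thesis using jid_diff[OF dg[of i] dR[of i]] by simp
  qed
qed

lemma jac_covers_form:
  fixes F R :: "('n::finite, 'k::field) mfps"
  assumes "\<And>i. i \<notin> P \<Longrightarrow> mfps_var i \<in> jid M g" and "\<And>a. supported_in P a \<Longrightarrow> mdeg a = M \<Longrightarrow> mon a \<in> jid M (g :: ('n, 'k) mfps)"
  shows "jac_covers M g"
proof (rule jac_coversI)
  fix a :: "'n \<Rightarrow>\<^sub>0 nat" assume "mdeg a = M"
  show "mon a \<in> jid M g"
  proof (cases "supported_in P a")
    case False
    then obtain i b where "i \<notin> P" "a = b + single i 1" by (rule unsupported_split)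
    then show ?thesis unfolding mon_split var_eq_mon[symmetric] using assms(1)
      by (simp add: mon_split var_eq_mon[symmetric] jid_mult)
  qed (use assms(2) \<open>mdeg a = M\<close> in simp)
qed

section \<open>Series in one variable: order, derivative and units\<close>

lemma supported_one: "supported_in {y} b \<Longrightarrow> b = single y (lookup b y)"
  by (intro poly_mapping_eqI) (auto simp: supported_in_def lookup_single when_def)

lemma shift_power:
  fixes V :: "('n::finite, 'k::comm_ring_1) mfps"
  assumes V: "psup {y} V" "V \<in> mpower m"
  shows "\<exists>W. V = mfps_var y ^ m * W \<and> mfps_nth W 0 = mfps_nth V (single y m)"
proof -
  define W :: "('n, 'k) mfps" where "W = Abs_mfps (\<lambda>b. mfps_nth V (single y m + b))"
  have "V = mfps_var y ^ m * W"
  proof (rule mfps_eqI)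
    fix a
    show "mfps_nth V a = mfps_nth (mfps_var y ^ m * W) a"
    proof (cases "\<exists>b. a = single y m + b")
      case True
      then obtain b where b: "a = single y m + b" by blast
      show ?thesis unfolding b var_power nth_mon_mult by (simp add: W_def)
    next
      case False
      have "mfps_nth V a = 0"
      proof (rule ccontr)
        assume nz: "mfps_nth V a \<noteq> 0"
        have "supported_in {y} a" using psupD[OF V(1), of a] nz by (cases "supported_in {y} a") simp_all
        then have s: "a = single y (lookup a y)" by (rule supported_one)
        have "mdeg a = lookup a y" by (subst s) simp
        then have "m \<le> lookup a y" using mpowerD[OF V(2), of a] nz by (cases "mdeg a < m") auto
        then have "a = single y m + single y (lookup a y - m)"
          using s by (simp flip: single_add)
        then show False using False by blast
      qed
      then show ?thesis unfolding var_power nth_mon_mult_0[OF False] .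
    qed
  qed
  then show ?thesis by (intro exI[of _ W]) (simp add: W_def)
qed

lemma unit_kill:
  fixes W :: "('n::finite, 'k::field) mfps"
  assumes "f * W \<in> jid M g" "mfps_nth W 0 \<noteq> 0" shows "f \<in> jid M g"
proof -
  obtain u where "W * u = 1" using unit_iff[OF assms(2)] by blast
  then have "f * W * u = f" by (simp add: mult.assoc)
  then show ?thesis using jid_mult'[OF assms(1), of u] by simp
qed

lemma nth_pderiv_power: "mfps_nth (mfps_pderiv y F) (single y m) = of_nat (Suc m) * mfps_nth (F :: ('n::finite, 'k::comm_ring_1) mfps) (single y (Suc m))"
proof -
  have "single y m + single y 1 = single y (Suc m)"
    by (metis Suc_eq_plus1 single_add)
  then show ?thesis unfolding nth_pderiv by (simp add: add.commute[of 1])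
qed

lemma of_nat_nonzero: "CHAR('k::field) = p \<Longrightarrow> 0 < k \<Longrightarrow> k < p \<Longrightarrow> (of_nat k :: 'k) \<noteq> 0"
  by (simp add: of_nat_eq_0_iff_char_dvd nat_dvd_not_less)

lemma psup_singleton_mpower:
  assumes "psup {y} F" "\<And>j. j < k \<Longrightarrow> mfps_nth F (single y j) = 0" shows "F \<in> mpower k"
proof (rule mpowerI)
  fix a :: "'a \<Rightarrow>\<^sub>0 nat" assume a: "mdeg a < k"
  show "mfps_nth F a = 0"
  proof (cases "supported_in {y} a")
    case True
    then have s: "a = single y (lookup a y)" by (rule supported_one)
    have "mdeg a = lookup a y" by (subst s) simp
    then show ?thesis using assms(2)[of "lookup a y"] a by (subst s) simp
  qed (rule psupD[OF assms(1)])
qed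

lemma qform_nth_0: "(\<And>i. i \<notin> P \<Longrightarrow> a \<noteq> single i 2) \<Longrightarrow> mfps_nth (qform P q) a = 0"
proof -
  assume a: "\<And>i. i \<notin> P \<Longrightarrow> a \<noteq> single i 2"
  have "mfps_nth (mfps_var i * mfps_var i :: ('a, 'b) mfps) a = 0" if "i \<notin> P" for i
    using a[OF that] unfolding var_eq_mon mon_mult single_add[symmetric] nth_mon by simp
  then show ?thesis unfolding qform_def nth_sum nth_scale by (intro sum.neutral) auto
qed

lemma qform_nth_mixed: "i \<notin> P \<Longrightarrow> supported_in P b \<Longrightarrow> mfps_nth (qform P q) (b + single i 1) = 0"
proof (rule qform_nth_0)
  fix j assume i: "i \<notin> P" "supported_in P b" and j: "j \<notin> P"
  show "b + single i 1 \<noteq> single j 2"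
  proof
    assume eq: "b + single i 1 = single j 2"
    then have "lookup (b + single i 1) i = lookup (single j 2) i" by simp
    then show False using i by (auto simp: lookup_add lookup_single when_def supported_in_def split: if_splits)
  qed
qed

lemma qform_nth_supported: "supported_in P a \<Longrightarrow> mfps_nth (qform P q) a = 0"
  by (rule qform_nth_0) (auto simp: supported_single)

lemma qform_mpower: "qform P q \<in> mpower 2"
  unfolding qform_def by (intro filt_sum filt_scale, rule filt_mult_le[OF var_mpower var_mpower]) simp

lemma diag_qform:
  fixes F R :: "('n::finite, 'k::field) mfps"
  assumes two: "(2 :: 'k) \<noteq> 0" and q: "\<And>i. i \<notin> P \<Longrightarrow> q i \<noteq> 0" and F: "F \<in> mpower 3" and R: "R \<in> mpower 3"
  shows "diag P (qform P q + F + R)"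
proof -
  have "hess i j (qform P q + F + R) = hess i j (qform P q)" for i j
    by (rule hess_cong) (simp add: filt_add F R)
  moreover have "hess i j (qform P q) = (if i = j \<and> i \<notin> P then 2 * q i else 0)" for i j
  proof -
    have "hess i j (qform P q) = (\<Sum>l\<in>- P. q l * (if i = l \<and> j = l then 2 else 0))"
      unfolding qform_def hess_def pderiv_sum nth_sum pderiv_scale nth_scale by (simp only: hess_square[unfolded hess_def])
    also have "\<dots> = (\<Sum>l\<in>- P. if l = i then (if i = j then 2 * q i else 0) else 0)"
      by (rule sum.cong) auto
    finally show ?thesis by simp
  qed
  ultimately show ?thesis using two q by (simp add: diag_def)
qed

lemma diag_perturb_many:
  fixes f :: "('n::finite, 'k::field) mfps"
  assumes inf: "infinite (UNIV :: 'k set)" and two: "(2 :: 'k) \<noteq> 0" and Q: "Q \<subseteq> P"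
    and f: "fin_near f" "diag P f" "f \<in> mpower 2"
  shows "\<exists>g :: ('n, 'k) mfps. fin_near g \<and> diag Q g \<and> g \<in> mpower 2"
proof -
  have "\<exists>g :: ('n, 'k) mfps. fin_near g \<and> diag (P - T) g \<and> g \<in> mpower 2" if "finite T" "T \<subseteq> P" for T
    using that
  proof (induction rule: finite_induct)
    case empty then show ?case using f by auto
  next
    case (insert x T)
    then obtain g :: "('n, 'k) mfps" where g: "fin_near g" "diag (P - T) g" "g \<in> mpower 2" by auto
    obtain c where c: "fin_near (g + mfps_scale c (mfps_var x * mfps_var x))"
      "diag (P - T - {x}) (g + mfps_scale c (mfps_var x * mfps_var x))"
      using diag_perturb[OF inf two g(1,2), of x] insert by auto
    moreover have "g + mfps_scale c (mfps_var x * mfps_var x) \<in> mpower 2"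
      by (intro filt_add filt_scale g filt_mult_le[OF var_mpower var_mpower]) simp
    moreover have "P - T - {x} = P - insert x T" by blast
    ultimately show ?case by metis
  qed
  from this[of "P - Q"] show ?thesis using Q by (simp add: double_diff)
qed

lemma no_A:
  fixes g :: "('n::finite, 'k::field) mfps"
  assumes inf: "infinite (UNIV :: 'k set)" and p: "CHAR('k) = p" "prime p" and near: "fin_near g" and d: "diag {y} g"
    and e: "2 \<le> e" "e \<le> p" "p + 2 \<le> 2 * e"
    and B: "\<And>i b. i \<noteq> y \<Longrightarrow> b < e \<Longrightarrow> mfps_nth g (single y b + single i 1) = 0"
    and C: "\<And>j. j < p \<Longrightarrow> mfps_nth g (single y j) = 0"
  shows False
  by (rule not_fin_near_A[where \<sigma> = "\<lambda>i. i" and \<epsilon> = "\<lambda>i. hess i i g", OF inf p near e _ B C])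
    (use d in \<open>auto simp: diag_def\<close>)

text \<open>Adding c x^2 turns corank 2 into corank 1 without touching the coefficients of y^j and
  of y^b x_i, so \<open>no_A\<close> applies along the y-axis. This disposes of D and E forms that
  are too degenerate in y.\<close>

lemma no_A_perturbed:
  fixes g :: "('n::finite, 'k::field) mfps"
  assumes inf: "infinite (UNIV :: 'k set)" and p: "CHAR('k) = p" "prime p" and two: "(2 :: 'k) \<noteq> 0" and near: "fin_near g"
    and xy: "x \<noteq> y" and d: "diag {x, y} g"
    and e: "2 \<le> e" "e \<le> p" "p + 2 \<le> 2 * e"
    and B: "\<And>i b. i \<noteq> y \<Longrightarrow> b < e \<Longrightarrow> mfps_nth g (single y b + single i 1) = 0"
    and C: "\<And>j. j < p \<Longrightarrow> mfps_nth g (single y j) = 0"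
  shows False
proof -
  obtain c where c: "fin_near (g + mfps_scale c (mfps_var x * mfps_var x))"
    "diag ({x, y} - {x}) (g + mfps_scale c (mfps_var x * mfps_var x))"
    using diag_perturb[OF inf two near d, of x] by auto
  have "{x, y} - {x} = {y}" using xy by auto
  then have d': "diag {y} (g + mfps_scale c (mfps_var x * mfps_var x))" using c(2) by simp
  have sq: "mfps_var x * mfps_var x = (mon (single x 2) :: ('n, 'k) mfps)"
    unfolding var_eq_mon mon_mult single_add[symmetric] by simp
  show False
  proof (rule no_A[OF inf p c(1) d' e])
    fix i b assume i: "i \<noteq> y" "b < e"
    have "single y b + single i 1 \<noteq> single x (2 :: nat)"
    proof
      assume "single y b + single i 1 = single x (2 :: nat)"
      then have "lookup (single y b + single i 1) i = lookup (single x (2 :: nat)) i" by simp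
      then show False using i by (auto simp: lookup_add lookup_single when_def split: if_splits)
    qed
    then show "mfps_nth (g + mfps_scale c (mfps_var x * mfps_var x)) (single y b + single i 1) = 0"
      unfolding sq using B[OF i] by (simp add: nth_mon)
  next
    fix j assume "j < p"
    moreover have "single y j \<noteq> single x (2 :: nat)" using xy by (auto simp: single_eq_iff)
    ultimately show "mfps_nth (g + mfps_scale c (mfps_var x * mfps_var x)) (single y j) = 0"
      unfolding sq using C by (simp add: nth_mon)
  qed
qed

text \<open>The corank is lowered to exactly 3, where the ten coefficients of a ternary cubic
  outnumber the nine parameters of GL_3.\<close>

lemma no_corank_3:
  fixes f :: "('n::finite, 'k::field) mfps"
  assumes inf: "infinite (UNIV :: 'k set)" and two: "(2 :: 'k) \<noteq> 0" and f: "fin_near f" "diag P f" "f \<in> mpower 2"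
    and P: "3 \<le> card P"
  shows False
proof -
  obtain Q where Q: "Q \<subseteq> P" "card Q = 3" using P by (meson obtain_subset_with_card_n)
  obtain x y z where xyz: "Q = {x, y, z}" "x \<noteq> y" "x \<noteq> z" "y \<noteq> z"
    using Q(2) by (metis card_3_iff)
  obtain g :: "('n, 'k) mfps" where g: "fin_near g" "diag Q g" "g \<in> mpower 2" using diag_perturb_many[OF inf two Q(1) f] by blast
  show False
  proof (rule not_fin_near_forms[where P = Q and D = 3 and \<sigma> = "\<lambda>i. i" and \<epsilon> = "\<lambda>i. hess i i g", OF inf g(1)])
    show "card Q * card Q < card {a :: 'n \<Rightarrow>\<^sub>0 nat. supported_in Q a \<and> mdeg a = 3}"
      using card_ternary_cubics[OF xyz(2-4)] Q(2) unfolding xyz(1) by simp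
  next
    fix i b assume i: "i \<notin> Q" and b: "supported_in Q b" "mdeg b < 3 - 1"
    then have "mdeg b \<le> 1" by simp
    then show "mfps_nth g (b + single i 1) = 0"
    proof (cases rule: mdeg_le_1_cases)
      case 1 then show ?thesis using mpowerD[OF g(3), of "single i 1"] by simp
    next
      case (2 j)
      then have "j \<noteq> i" using i b by (auto simp: supported_single)
      then show ?thesis unfolding 2 using g(2) hess_neq[of j i g] by (simp add: diag_def)
    qed
  next
    fix a assume a: "supported_in Q a" "mdeg a < 3"
    show "mfps_nth g a = 0"
    proof (cases "mdeg a < 2")
      case False
      then have "a \<noteq> 0" by auto
      then obtain i where "lookup a i > 0" by (metis gr0I poly_mapping_eqI lookup_zero)
      then obtain b where b: "a = b + single i 1" using exists_single_add[of a i] by blast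
      then have "mdeg b = 1" using False a by simp
      then obtain j where j: "b = single j 1" using mdeg_1_eq_single by blast
      show ?thesis
      proof (cases "i = j")
        case True
        then have "i \<in> Q" using a(1) b j by (simp add: supported_add supported_single)
        then have "2 * mfps_nth g (single i 2) = 0" using g(2) hess_eq[of i g] by (simp add: diag_def)
        moreover have "a = single i 2" unfolding b j True by (simp flip: single_add)
        ultimately show ?thesis using two by simp
      next
        case False
        then show ?thesis unfolding b j using g(2) hess_neq[of j i g] by (simp add: diag_def)
      qed
    qed (rule mpowerD[OF g(3)])
  qed (use g(2) in \<open>auto simp: diag_def\<close>)
qed

text \<open>By \<open>cubic_char_3\<close> the term x y^2 can be removed from the cubic part. No x
  y^b with b < 3 and no y^j with j < 3 = p occurs then, which is the excluded A case with e = 3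
  after a square of x is added.\<close>

lemma no_corank_2_char_3:
  fixes f :: "('n::finite, 'k::field) mfps"
  assumes inf: "infinite (UNIV :: 'k set)" and p: "CHAR('k) = 3" and f: "fin_near f" "diag P f" "f \<in> mpower 2"
    and P: "2 \<le> card P"
  shows False
proof -
  have three: "(3 :: 'k) = 0" using of_nat_CHAR[where 'a = 'k] p by simp
  have two: "(2 :: 'k) \<noteq> 0" using of_nat_nonzero[OF p, of 2] by simp
  obtain Q where Q: "Q \<subseteq> P" "card Q = 2" using P by (meson obtain_subset_with_card_n)
  obtain x y where xy: "Q = {x, y}" "x \<noteq> y" using Q(2) by (metis card_2_iff)
  obtain f1 :: "('n, 'k) mfps" where f1: "fin_near f1" "diag {x, y} f1" "f1 \<in> mpower 2"
    using diag_perturb_many[OF inf two Q(1) f] unfolding xy(1) by blast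
  obtain q F R where F: "f1 \<sim>\<^sub>r qform {x, y} q + F + R" "\<And>i. i \<notin> {x, y} \<Longrightarrow> q i \<noteq> 0" "psup {x, y} F" "F \<in> mpower 3" "R \<in> mpower 4"
    using normal_form_squares[OF two f1(3,2), of 3] by auto
  obtain F' a0 b0 d0 where F': "pequiv {x, y} F F'" "has_cubic x y F' a0 b0 0 d0"
    using cubic_char_3[OF three two xy(2) F(3,4)] by blast
  obtain R' where R': "R' \<in> mpower 4" "qform {x, y} q + F + R \<sim>\<^sub>r qform {x, y} q + F' + R'"
    using pequiv_lift[OF F'(1) F(5)] by blast
  define g where "g = qform {x, y} q + F' + R'"
  have near: "fin_near g" unfolding g_def
    by (rule fin_near_right_equiv[OF fin_near_right_equiv[OF f1(1) F(1)] R'(2)])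
  have F'3: "F' \<in> mpower 3" by (rule pequiv_mpower[OF F'(1) F(4)])
  have F'p: "psup {x, y} F'" using F'(2) by (simp add: has_cubic_def)
  have R'3: "R' \<in> mpower 3" by (rule mpower_mono[OF R'(1)]) simp
  have dg: "diag {x, y} g" unfolding g_def by (rule diag_qform[OF two F(2) F'3 R'3])
  show False
  proof (rule no_A_perturbed[OF inf p _ two near xy(2) dg, of 3])
    fix i b assume i: "i \<noteq> y" and b: "b < (3::nat)"
    let ?a = "single y b + single i (1::nat)"
    have R0: "mfps_nth R' ?a = 0" by (rule mpowerD[OF R'(1)]) (use b in simp)
    show "mfps_nth g ?a = 0"
    proof (cases "i = x")
      case False
      then have out: "i \<notin> {x, y}" using i by simp
      have "mfps_nth F' ?a = 0" by (rule psupD[OF F'p]) (use out in \<open>simp add: supported_add supported_single\<close>)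
      then show ?thesis using R0 qform_nth_mixed[OF out, of "single y b" q]
        by (simp add: g_def supported_single)
    next
      case True
      have q0: "mfps_nth (qform {x, y} q) ?a = 0"
        by (rule qform_nth_supported) (simp add: True supported_add supported_single)
      have "mfps_nth F' ?a = 0"
      proof (cases "b = 2")
        case False
        then show ?thesis by (intro mpowerD[OF F'3]) (use b in simp)
      next
        case b2: True
        have a: "?a = single x 1 + single y 2" unfolding True b2 by (rule add.commute)
        have m: "mfps_nth (F' - cubic x y a0 b0 0 d0) ?a = 0"
          by (rule mpowerD[of _ 4]) (use F'(2) b2 in \<open>simp_all add: has_cubic_def\<close>)
        have "mfps_nth (mon (single x k + single y l) :: ('n, 'k) mfps) ?a = 0"
          if "k \<noteq> 1" for k l
        proof -
          have "lookup ?a x \<noteq> lookup (single x k + single y l) x"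
            unfolding a lookup_two(1)[OF xy(2)] using that by simp
          then show ?thesis unfolding nth_mon by auto
        qed
        from this[of 3 0] this[of 2 1] this[of 0 3]
        have "mfps_nth (cubic x y a0 b0 0 d0) ?a = 0"
          by (simp add: cubic_def cst_def scale_mult_left var_eq_mon mon_mult flip: single_add)
        then show ?thesis using m by simp
      qed
      then show ?thesis using q0 R0 by (simp add: g_def)
    qed
  next
    fix j assume j: "j < (3::nat)"
    have "mfps_nth F' (single y j) = 0" by (rule mpowerD[OF F'3]) (use j in simp)
    moreover have "mfps_nth R' (single y j) = 0" by (rule mpowerD[OF R'3]) (use j in simp)
    ultimately show "mfps_nth g (single y j) = 0"
      using qform_nth_supported[of "{x, y}" "single y j" q] by (simp add: g_def supported_single)
  qed simp_all
qed

section \<open>Jacobian ideals of the surviving normal forms\<close>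

lemma nth_xpow:
  fixes V :: "('n::finite, 'k::comm_ring_1) mfps"
  assumes xy: "x \<noteq> y" and V: "psup {y} V"
  shows "mfps_nth (mfps_var x ^ m * V) (single x k + single y l) =
    (if k = m then mfps_nth V (single y l) else 0)"
proof (cases "m \<le> k")
  case True
  then have "single x k + single y l =
      single x m + (single x (k - m) + single y l)"
    by (simp flip: single_add add.assoc)
  then have "mfps_nth (mfps_var x ^ m * V) (single x k + single y l) =
      mfps_nth V (single x (k - m) + single y l)"
    unfolding var_power by (simp only: nth_mon_mult)
  moreover have "mfps_nth V (single x (k - m) + single y l) = 0" if "k \<noteq> m"
    by (rule psupD[OF V]) (use that True xy in \<open>simp add: supported_add supported_single\<close>)
  ultimately show ?thesis by (cases "k = m") simp_all
next
  case False
  have "\<nexists>b. single x k + single y l = single x m + b"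
  proof
    assume "\<exists>b. single x k + single y l = single x m + b"
    then obtain b where b: "single x k + single y l = single x m + b" by blast
    have "lookup (single x k + single y l) x = k" by (rule lookup_two(1)[OF xy])
    then show False using False unfolding b by (simp add: lookup_add)
  qed
  then show ?thesis unfolding var_power using nth_mon_mult_0 False by auto
qed

lemma binary_covers:
  fixes g :: "('n::finite, 'k::field) mfps"
  assumes xy: "x \<noteq> y" and "\<And>i. i \<notin> {x, y} \<Longrightarrow> mfps_var i \<in> jid M g"
    and m: "\<And>i j. i + j = M \<Longrightarrow> mfps_var x ^ i * mfps_var y ^ j \<in> jid M g"
  shows "jac_covers M g"
proof (rule jac_covers_form[OF assms(2)])
  fix a :: "'n \<Rightarrow>\<^sub>0 nat" assume a: "supported_in {x, y} a" "mdeg a = M"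
  have s: "a = single x (lookup a x) + single y (lookup a y)"
    by (rule supported_two[OF a(1) xy])
  have "mdeg a = lookup a x + lookup a y" by (subst s) simp
  then have "mfps_var x ^ lookup a x * mfps_var y ^ lookup a y \<in> jid M g" using m a(2) by simp
  then show "mon a \<in> jid M g" unfolding var_power mon_mult s[symmetric] .
qed

lemma power_jid: "f ^ k \<in> jid M g \<Longrightarrow> k \<le> m \<Longrightarrow> f ^ m \<in> jid M g"
  using jid_mult[of "f ^ k" M g "f ^ (m - k)"] by (simp flip: power_add)

lemma psup_subset: "psup P F \<Longrightarrow> P \<subseteq> Q \<Longrightarrow> psup Q F"
  unfolding psup_def supported_in_def by blast

lemma pderiv_shift_power:
  fixes V :: "('n::finite, 'k::comm_ring_1) mfps"
  assumes "psup {y} V" "V \<in> mpower (Suc m)"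
  shows "\<exists>W. mfps_pderiv y V = mfps_var y ^ m * W \<and> mfps_nth W 0 = of_nat (Suc m) * mfps_nth V (single y (Suc m))"
  using shift_power[OF psup_pderiv[OF assms(1)] pderiv_mem_mpower[OF assms(2)], of y] unfolding nth_pderiv_power .

text \<open>The order is written as m + 1 in view of differentiation: m + 1 < p is a nonzero factor
  in the field.\<close>

lemma least_power:
  assumes "j < p" "mfps_nth F (single y j) \<noteq> 0" "psup {y} F" "F \<in> mpower 3"
  shows "\<exists>m. 2 \<le> m \<and> Suc m < p \<and> F \<in> mpower (Suc m) \<and> mfps_nth F (single y (Suc m)) \<noteq> 0"
proof -
  define k where "k = (LEAST j. mfps_nth F (single y j) \<noteq> 0)"
  have k: "mfps_nth F (single y k) \<noteq> 0" unfolding k_def by (rule LeastI[of _ j]) (rule assms(2))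
  have "k \<le> j" unfolding k_def by (rule Least_le) (rule assms(2))
  have "F \<in> mpower k" by (rule psup_singleton_mpower[OF assms(3)]) (use not_less_Least k_def in blast)
  moreover have "3 \<le> k" using mpowerD[OF assms(4), of "single y k"] k by (cases "k < 3") auto
  moreover from this obtain m where "k = Suc m" by (cases k) auto
  ultimately show ?thesis using k \<open>k \<le> j\<close> assms(1) by (intro exI[of _ m]) auto
qed

text \<open>If F has order m + 1 < p in y, its derivative is y^m times a unit, and y^m enters the
  ideal. Order p or more is excluded by the family y^p, y^(p+1).\<close>

lemma corank_1:
  fixes F R :: "('n::finite, 'k::field) mfps"
  assumes inf: "infinite (UNIV :: 'k set)" and p: "CHAR('k) = p" "prime p" "p \<noteq> 2" and near: "fin_near g"
    and q: "\<And>i. i \<notin> {y} \<Longrightarrow> q i \<noteq> 0" and F: "psup {y} F" "F \<in> mpower 3" and R: "R \<in> mpower (Suc (Suc M))"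
    and M: "p \<le> M" and g: "g = qform {y} q + F + R"
  shows "jac_covers M g"
proof -
  have p3: "3 \<le> p" using p(2,3) prime_ge_2_nat[of p] by simp
  have two: "(2 :: 'k) \<noteq> 0" using of_nat_nonzero[OF p(1), of 2] p3 by simp
  have R3: "R \<in> mpower 3" by (rule mpower_mono[OF R]) (use M p3 in simp)
  have dg: "diag {y} g" unfolding g by (rule diag_qform[OF two q F(2) R3])
  have "\<exists>j<p. mfps_nth F (single y j) \<noteq> 0"
  proof (rule ccontr)
    assume "\<not> ?thesis"
    then have z: "mfps_nth F (single y j) = 0" if "j < p" for j using that by blast
    \<comment> \<open>Values with p + 2 \<le> 2e and e \<le> p are admissible; p - 1 is too small
      for p = 3.\<close>
    define e where "e = (if p = 3 then 3 else p - 1)"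
    have e: "2 \<le> e" "e \<le> p" "p + 2 \<le> 2 * e" using p3 by (auto simp: e_def)
    show False
    proof (rule no_A[OF inf p(1,2) near dg e])
      fix i b assume i: "i \<noteq> y" "b < e"
      have "mfps_nth F (single y b + single i 1) = 0"
        by (rule psupD[OF F(1)]) (use i in \<open>simp add: supported_add supported_single\<close>)
      moreover have "mfps_nth R (single y b + single i 1) = 0"
        by (rule mpowerD[OF R]) (use i e M in simp)
      moreover have "mfps_nth (qform {y} q) (single y b + single i 1) = 0"
        by (rule qform_nth_mixed) (use i in \<open>simp_all add: supported_single\<close>)
      ultimately show "mfps_nth g (single y b + single i 1) = 0" by (simp add: g)
    next
      fix j assume j: "j < p"
      have "mfps_nth R (single y j) = 0" by (rule mpowerD[OF R]) (use j M in simp)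
      moreover have "mfps_nth (qform {y} q) (single y j) = 0"
        by (rule qform_nth_supported) (simp add: supported_single)
      ultimately show "mfps_nth g (single y j) = 0" using z[OF j] by (simp add: g)
    qed
  qed
  then obtain j where "j < p" "mfps_nth F (single y j) \<noteq> 0" by blast
  from least_power[OF this F] obtain m where m: "Suc m < p" "F \<in> mpower (Suc m)" "mfps_nth F (single y (Suc m)) \<noteq> 0"
    by blast
  obtain W where W: "mfps_pderiv y F = mfps_var y ^ m * W" "mfps_nth W 0 = of_nat (Suc m) * mfps_nth F (single y (Suc m))"
    using pderiv_shift_power[OF F(1) m(2)] by blast
  note rel = jid_form[OF two q F(1) R g]
  have "mfps_var y ^ m \<in> jid M g"
  proof (rule unit_kill)
    show "mfps_var y ^ m * W \<in> jid M g" using rel(2)[of y] unfolding W(1) by simp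
    show "mfps_nth W 0 \<noteq> 0" unfolding W(2) using of_nat_nonzero[OF p(1) _ m(1)] m(3) by simp
  qed
  then have y: "mfps_var y ^ M \<in> jid M g" by (rule power_jid) (use m M in simp)
  show ?thesis
  proof (rule jac_covers_form[OF rel(1)])
    fix a :: "'n \<Rightarrow>\<^sub>0 nat" assume a: "supported_in {y} a" "mdeg a = M"
    have s: "a = single y (lookup a y)" by (rule supported_one[OF a(1)])
    have "mdeg a = lookup a y" by (subst s) simp
    then have "a = single y M" using s a(2) by simp
    then show "mon a \<in> jid M g" using y unfolding var_power by simp
  qed simp
qed

lemma double_scale: "f + f = mfps_scale 2 (f :: ('n::finite, 'k::field) mfps)"
  by (rule mfps_eqI) (simp only: nth_add nth_scale mult_2)

lemma D_relation: "X * (X * X + Y * L * W) - L * W * (X * Y) = X * X * (X :: 'a::comm_ring_1)"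
  by (simp add: algebra_simps)

text \<open>For H of order m + 1 < p the derivatives give xy and x^2 + y^m W with W a unit;
  multiplying the latter by y and by x yields y^(m+1) and x^3. For H of order at least p, adding c
  x^2 would produce an excluded A singularity.\<close>

lemma corank_2_D:
  fixes H R :: "('n::finite, 'k::field) mfps"
  assumes inf: "infinite (UNIV :: 'k set)" and p: "CHAR('k) = p" "prime p" "5 \<le> p" and near: "fin_near g"
    and xy: "x \<noteq> y"
    and q: "\<And>i. i \<notin> {x, y} \<Longrightarrow> q i \<noteq> 0" and H: "psup {y} H" "H \<in> mpower 3" and R: "R \<in> mpower (Suc (Suc M))"
    and M: "p \<le> M" and g: "g = qform {x, y} q + (mfps_var x * mfps_var x * mfps_var y + H) + R"
  shows "jac_covers M g"
proof -
  let ?X = "mfps_var x :: ('n, 'k) mfps" and ?Y = "mfps_var y :: ('n, 'k) mfps"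
  have two: "(2 :: 'k) \<noteq> 0" using of_nat_nonzero[OF p(1), of 2] p(3) by simp
  have R3: "R \<in> mpower 3" by (rule mpower_mono[OF R]) (use M p in simp)
  have Hp: "psup {x, y} H" by (rule psup_subset[OF H(1)]) blast
  have F: "psup {x, y} (?X * ?X * ?Y + H)" by (intro psup_add psup_mult psup_var Hp) simp_all
  have "?X * ?X * ?Y \<in> mpower 3"
    by (rule filt_mult_le[OF filt_mult[OF var_mpower var_mpower] var_mpower]) simp
  then have F3: "?X * ?X * ?Y + H \<in> mpower 3" by (rule filt_add[OF _ H(2)])
  have dg: "diag {x, y} g" unfolding g by (rule diag_qform[OF two q F3 R3])
  have psY: "psup {y} ?Y" by (rule psup_var) simp
  have cF: "mfps_nth (?X * ?X * ?Y + H) (single x k + single y l) =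
     (if k = 2 then mfps_nth ?Y (single y l) else 0) + (if k = 0 then mfps_nth H (single y l) else 0)" for k l
    using nth_xpow[OF xy psY, of 2 k l] nth_xpow[OF xy H(1), of 0 k l] by (simp add: power2_eq_square)
  have "\<exists>j<p. mfps_nth H (single y j) \<noteq> 0"
  proof (rule ccontr)
    assume "\<not> ?thesis"
    then have z: "mfps_nth H (single y j) = 0" if "j < p" for j using that by blast
    show False
    proof (rule no_A_perturbed[OF inf p(1,2) two near xy dg, of "p - 1"])
      fix i b assume i: "i \<noteq> y" "b < p - 1"
      let ?a = "single y b + single i (1 :: nat)"
      have R0: "mfps_nth R ?a = 0" by (rule mpowerD[OF R]) (use i M in simp)
      show "mfps_nth g ?a = 0"
      proof (cases "i = x")
        case True
        have "mfps_nth (?X * ?X * ?Y + H) ?a = 0" using cF[of 1 b] unfolding True by (simp add: add.commute)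
        moreover have "mfps_nth (qform {x, y} q) ?a = 0"
          by (rule qform_nth_supported) (simp add: True supported_add supported_single)
        ultimately show ?thesis using R0 by (simp add: g)
      next
        case False
        have "mfps_nth (?X * ?X * ?Y + H) ?a = 0"
          by (rule psupD[OF F]) (use i False in \<open>simp add: supported_add supported_single\<close>)
        moreover have "mfps_nth (qform {x, y} q) ?a = 0"
          by (rule qform_nth_mixed) (use i False in \<open>simp_all add: supported_single\<close>)
        ultimately show ?thesis using R0 by (simp add: g)
      qed
    next
      fix j assume j: "j < p"
      have "mfps_nth R (single y j) = 0" by (rule mpowerD[OF R]) (use j M in simp)
      moreover have "mfps_nth (qform {x, y} q) (single y j) = 0"
        by (rule qform_nth_supported) (simp add: supported_single)
      moreover have "mfps_nth (?X * ?X * ?Y + H) (single y j) = 0"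
        using cF[of 0 j] z[OF j] by simp
      ultimately show "mfps_nth g (single y j) = 0" by (simp add: g)
    qed (use p in auto)
  qed
  then obtain j where "j < p" "mfps_nth H (single y j) \<noteq> 0" by blast
  from least_power[OF this H] obtain m where m: "2 \<le> m" "Suc m < p" "H \<in> mpower (Suc m)" "mfps_nth H (single y (Suc m)) \<noteq> 0"
    by blast
  obtain W where W: "mfps_pderiv y H = ?Y ^ m * W" "mfps_nth W 0 = of_nat (Suc m) * mfps_nth H (single y (Suc m))"
    using pderiv_shift_power[OF H(1) m(3)] by blast
  have W0: "mfps_nth W 0 \<noteq> 0" unfolding W(2) using of_nat_nonzero[OF p(1) _ m(2)] m(4) by simp
  note rel = jid_form[OF two q F R g]
  have "mfps_pderiv x H = 0" by (rule psup_pderiv_outside[OF H(1)]) (use xy in simp)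
  then have "mfps_scale 2 (?X * ?Y) \<in> jid M g"
    using rel(2)[of x] by (simp add: pderiv_add pderiv_square_mult[OF xy] double_scale)
  from jid_scale[OF this, of "inverse 2"] have XY: "?X * ?Y \<in> jid M g" using two by (simp add: scale_scale)
  have r2: "?X * ?X + ?Y ^ m * W \<in> jid M g"
    using rel(2)[of y] W(1) by (simp add: pderiv_add pderiv_square_mult'[OF xy])
  have "?Y * (?X * ?X + ?Y ^ m * W) - ?X * (?X * ?Y) = ?Y ^ Suc m * W"
    by (simp only: power_Suc distrib_left mult.assoc mult.left_commute[of ?Y ?X] mult.commute[of ?Y ?X] add_diff_cancel_left')
  then have "?Y ^ Suc m * W \<in> jid M g" using jid_diff[OF jid_mult[OF r2] jid_mult[OF XY]] by metis
  then have Y: "?Y ^ Suc m \<in> jid M g" by (rule unit_kill[OF _ W0])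
  obtain l where l: "m = Suc l" using m(1) by (cases m) auto
  have "?X * (?X * ?X + ?Y ^ m * W) - ?Y ^ l * W * (?X * ?Y) = ?X ^ 3"
    unfolding l power3_eq_cube power_Suc by (rule D_relation)
  then have X: "?X ^ 3 \<in> jid M g" using jid_diff[OF jid_mult[OF r2] jid_mult[OF XY]] by metis
  show ?thesis
  proof (rule binary_covers[OF xy rel(1)])
    fix i j assume ij: "i + j = M"
    consider "i = 0" | "j = 0" | i' j' where "i = Suc i'" "j = Suc j'" by (metis not0_implies_Suc)
    then show "?X ^ i * ?Y ^ j \<in> jid M g"
    proof cases
      case 1
      then show ?thesis using power_jid[OF Y, of j] ij M m by simp
    next
      case 2
      then show ?thesis using power_jid[OF X, of i] ij M p by simp
    next
      case 3
      have "?X ^ i * ?Y ^ j = (?X ^ i' * ?Y ^ j') * (?X * ?Y)" unfolding 3 power_Suc by (simp only: mult.assoc mult.left_commute mult.commute)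
      then show ?thesis using jid_mult[OF XY] by metis
    qed
  qed
qed

text \<open>Elimination of x: substituting X = -Z / A1 into t X^2 + A gives, after clearing
  denominators, t Z^2 + A1^2 A. The identity exhibits V times this as a combination of the two
  relations.\<close>

lemma E_relation:
  "t * (V * (X * A1 + Z)) * (X * A1 - Z) - V * A1 * A1 * (t * (X * X) + A) = - (V * (t * Z * Z + A1 * A1 * A) :: 'a::comm_ring_1)"
  by (simp add: algebra_simps)

lemma E_relation_square: "(t * (X * X) - A) * (t * (X * X) + A) + A * A = t * t * (X * X * X * X :: 'a::comm_ring_1)"
  by (simp add: algebra_simps)

lemma power_as_product: "Y ^ 2 = Y * Y" "Y ^ 3 = Y * Y * Y" "Y ^ 4 = Y * Y * Y * Y" "Y ^ 5 = Y * Y * Y * Y * (Y :: 'a::comm_ring_1)"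
proof -
  show "Y ^ 2 = Y * Y" "Y ^ 3 = Y * Y * Y" and 4: "Y ^ 4 = Y * Y * Y * Y"
    by (rule power2_eq_square power3_eq_cube power4_eq_xxxx)+
  have "Y ^ 5 = Y ^ 4 * Y" using power_Suc2[of Y 4] by simp
  then show "Y ^ 5 = Y * Y * Y * Y * Y" unfolding 4 .
qed

lemma nth_cst_0: "mfps_nth (cst c :: ('n::finite, 'k::field) mfps) 0 = c"
  by (simp add: cst_def nth_one)

lemma nth_var_0: "mfps_nth (mfps_var i :: ('n::finite, 'k::field) mfps) 0 = 0"
  using mpowerD[OF var_mpower, of 0 i] by simp

lemma triple_scale: "f + f + f = cst 3 * (f :: ('n::finite, 'k::field) mfps)"
proof -
  have "(1 + 1 + 1 :: 'k) = 3" by simp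
  then have "cst 3 = (1 + 1 + 1 :: ('n, 'k) mfps)" by (metis cst_add cst_one)
  then show ?thesis by (simp only: distrib_right mult_1_left)
qed

text \<open>The common end of the cases E6, E7 and E8: after elimination of x a power of y times a
  unit remains, and the cases differ only in the summand that supplies the constant term of the
  unit.\<close>

lemma E_kill:
  fixes A1 A2 W :: "('n::finite, 'k::field) mfps"
  assumes r1: "cst 3 * (X * X) + A \<in> jid M g" and r2: "V * (X * A1 + Z) \<in> jid M g"
    and U: "V * (cst 3 * Z * Z + A1 * A1 * A) = Y * U" "mfps_nth U 0 \<noteq> 0"
  shows "Y \<in> jid M g"
proof (rule unit_kill[OF _ U(2)])
  have "- (V * (cst 3 * Z * Z + A1 * A1 * A)) \<in> jid M g"
    unfolding E_relation[of _ _ X, symmetric] by (rule jid_diff[OF jid_mult'[OF jid_mult[OF r2]] jid_mult[OF r1]])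
  from jid_uminus[OF this] show "Y * U \<in> jid M g" unfolding U(1) by simp
qed

text \<open>The first nonzero coefficient among b4 of y^4, a3 of x y^3 and b5 of y^5 decides between
  E6, E7 and E8; if all vanish, the series belongs to the stratum of J10 and is excluded. For p = 5
  the case E8 is excluded too, since y^5 has zero derivative and adding c x^2 leads to the A
  case.\<close>

lemma corank_2_E:
  fixes A B R :: "('n::finite, 'k::field) mfps"
  assumes inf: "infinite (UNIV :: 'k set)" and p: "CHAR('k) = p" "prime p" "5 \<le> p" and near: "fin_near g"
    and xy: "x \<noteq> y"
    and q: "\<And>i. i \<notin> {x, y} \<Longrightarrow> q i \<noteq> 0" and A: "psup {y} A" "A \<in> mpower 3" and B: "psup {y} B" "B \<in> mpower 4"
    and R: "R \<in> mpower (Suc (Suc M))"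
    and M: "p + 9 \<le> M" and g: "g = qform {x, y} q + (mfps_var x * mfps_var x * mfps_var x + mfps_var x * A + B) + R"
  shows "jac_covers M g"
proof -
  let ?X = "mfps_var x :: ('n, 'k) mfps" and ?Y = "mfps_var y :: ('n, 'k) mfps"
  let ?F = "?X * ?X * ?X + ?X * A + B"
  have two: "(2 :: 'k) \<noteq> 0" using of_nat_nonzero[OF p(1), of 2] p(3) by simp
  have three: "(3 :: 'k) \<noteq> 0" using of_nat_nonzero[OF p(1), of 3] p(3) by simp
  have four: "(4 :: 'k) \<noteq> 0" using of_nat_nonzero[OF p(1), of 4] p(3) by simp
  have R3: "R \<in> mpower 3" by (rule mpower_mono[OF R]) (use M in simp)
  have Ap: "psup {x, y} A" by (rule psup_subset[OF A(1)]) blast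
  have Bp: "psup {x, y} B" by (rule psup_subset[OF B(1)]) blast
  have F: "psup {x, y} ?F" by (intro psup_add psup_mult psup_var Ap Bp) simp_all
  have "?X * ?X * ?X \<in> mpower 3" "?X * A \<in> mpower 3"
    by (rule filt_mult_le[OF filt_mult[OF var_mpower var_mpower] var_mpower], simp)
      (rule filt_mult_le[OF var_mpower A(2)], simp)
  then have F3: "?F \<in> mpower 3" by (intro filt_add mpower_mono[OF B(2)]) simp_all
  have dg: "diag {x, y} g" unfolding g by (rule diag_qform[OF two q F3 R3])
  have ps1: "psup {y} (1 :: ('n, 'k) mfps)" by (rule psup_one)
  have cF: "mfps_nth ?F (single x k + single y l) =
     (if k = 3 \<and> l = 0 then 1 else 0) + (if k = 1 then mfps_nth A (single y l) else 0)
      + (if k = 0 then mfps_nth B (single y l) else 0)" for k l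
    using nth_xpow[OF xy ps1, of 3 k l] nth_xpow[OF xy A(1), of 1 k l] nth_xpow[OF xy B(1), of 0 k l]
    by (simp add: power3_eq_cube nth_one single_eq_0_iff)
  have out: "mfps_nth g (b + single i 1) = 0"
    if i: "i \<notin> {x, y}" and b: "supported_in {x, y} b" "mdeg b \<le> M" for i b
  proof -
    have "mfps_nth ?F (b + single i 1) = 0"
      by (rule psupD[OF F]) (use i in \<open>simp add: supported_add supported_single\<close>)
    moreover have "mfps_nth R (b + single i 1) = 0"
      by (rule mpowerD[OF R]) (use b in simp)
    ultimately show ?thesis using qform_nth_mixed[OF i b(1), of q] by (simp add: g)
  qed
  have ins: "mfps_nth g (single x k + single y l) =
      mfps_nth ?F (single x k + single y l)" if "k + l \<le> M" for k l
  proof -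
    have "mfps_nth R (single x k + single y l) = 0"
      by (rule mpowerD[OF R]) (use that in simp)
    moreover have "mfps_nth (qform {x, y} q) (single x k + single y l) = 0"
      by (rule qform_nth_supported) (simp add: supported_add supported_single)
    ultimately show ?thesis by (simp add: g)
  qed
  note rel = jid_form[OF two q F R g]
  have dA: "mfps_pderiv x A = 0" "mfps_pderiv x B = 0"
    by (rule psup_pderiv_outside[OF A(1)], use xy in simp) (rule psup_pderiv_outside[OF B(1)], use xy in simp)
  have "mfps_pderiv x ?F = cst 3 * (?X * ?X) + A"
    unfolding pderiv_add pderiv_cube dA triple_scale by (simp add: pderiv_mult pderiv_var dA)
  then have r1: "cst 3 * (?X * ?X) + A \<in> jid M g" using rel(2)[of x] by simp
  have "mfps_pderiv y ?F = ?X * mfps_pderiv y A + mfps_pderiv y B"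
    using xy by (simp add: pderiv_add pderiv_cube_other pderiv_mult pderiv_var)
  then have r2: "?X * mfps_pderiv y A + mfps_pderiv y B \<in> jid M g" using rel(2)[of y] by simp
  define a3 where "a3 = mfps_nth A (single y 3)"
  define b4 where "b4 = mfps_nth B (single y 4)"
  define b5 where "b5 = mfps_nth B (single y 5)"
  have A4: "A \<in> mpower 4" if "a3 = 0"
  proof (rule psup_singleton_mpower[OF A(1)])
    fix j :: nat assume "j < 4"
    then show "mfps_nth A (single y j) = 0"
      using that mpowerD[OF A(2), of "single y j"] by (cases "j = 3") (auto simp: a3_def)
  qed
  have B5: "B \<in> mpower 5" if "b4 = 0"
  proof (rule psup_singleton_mpower[OF B(1)])
    fix j :: nat assume "j < 5"
    then show "mfps_nth B (single y j) = 0"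
      using that mpowerD[OF B(2), of "single y j"] by (cases "j = 4") (auto simp: b4_def)
  qed
  have B6: "B \<in> mpower 6" if "b4 = 0" "b5 = 0"
  proof (rule psup_singleton_mpower[OF B(1)])
    fix j :: nat assume "j < 6"
    then show "mfps_nth B (single y j) = 0"
      using that(2) mpowerD[OF B5[OF that(1)], of "single y j"] by (cases "j = 5") (auto simp: b5_def)
  qed
  have s3: "Suc 2 = 3" and s4: "Suc 3 = 4" and s5: "Suc 4 = 5" by simp_all
  obtain A1 where A1: "mfps_pderiv y A = ?Y ^ 2 * A1" "mfps_nth A1 0 = 3 * a3"
    using pderiv_shift_power[OF A(1), of 2] A(2) unfolding s3 a3_def by auto
  obtain A2 where A2: "A = ?Y ^ 3 * A2" "mfps_nth A2 0 = a3"
    using shift_power[OF A] unfolding a3_def by auto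
  have "?Y ^ 5 \<in> jid M g"
  proof (cases "b4 = 0")
    case False
    obtain W where W: "mfps_pderiv y B = ?Y ^ 3 * W" "mfps_nth W 0 = 4 * b4"
      using pderiv_shift_power[OF B(1), of 3] B(2) unfolding s4 b4_def by auto
    have "?Y ^ 4 \<in> jid M g"
    proof (rule E_kill[OF r1, of "?Y ^ 2" A1 "?Y * W" "?Y ^ 4" "cst 3 * W * W + ?Y * A1 * A1 * A2"])
      have "?X * mfps_pderiv y A + mfps_pderiv y B = ?Y ^ 2 * (?X * A1 + ?Y * W)"
        unfolding A1(1) W(1) unfolding power_as_product by (simp only: distrib_left mult_ac)
      then show "?Y ^ 2 * (?X * A1 + ?Y * W) \<in> jid M g" using r2 by simp
      show "?Y ^ 2 * (cst 3 * (?Y * W) * (?Y * W) + A1 * A1 * A) = ?Y ^ 4 * (cst 3 * W * W + ?Y * A1 * A1 * A2)"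
        unfolding A2(1) unfolding power_as_product by (simp only: distrib_left mult_ac)
      show "mfps_nth (cst 3 * W * W + ?Y * A1 * A1 * A2) 0 \<noteq> 0"
        using three four False by (simp only: nth_add nth_mult_0 nth_cst_0 nth_var_0 W(2) mult_zero_left mult_zero_right add_0_left add_0_right mult_eq_0_iff simp_thms not_False_eq_True)
    qed
    then show ?thesis by (rule power_jid) simp
  next
    case b4: True
    note B5 = B5[OF b4]
    obtain W where W: "mfps_pderiv y B = ?Y ^ 4 * W" "mfps_nth W 0 = 5 * b5"
      using pderiv_shift_power[OF B(1), of 4] B5 unfolding s5 b5_def by auto
    show ?thesis
    proof (cases "a3 = 0")
      case False
      show ?thesis
      proof (rule E_kill[OF r1, of "?Y ^ 2" A1 "?Y ^ 2 * W" "?Y ^ 5" "cst 3 * ?Y * W * W + A1 * A1 * A2"])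
        have "?X * mfps_pderiv y A + mfps_pderiv y B = ?Y ^ 2 * (?X * A1 + ?Y ^ 2 * W)"
          unfolding A1(1) W(1) unfolding power_as_product by (simp only: distrib_left mult_ac)
        then show "?Y ^ 2 * (?X * A1 + ?Y ^ 2 * W) \<in> jid M g" using r2 by simp
        show "?Y ^ 2 * (cst 3 * (?Y ^ 2 * W) * (?Y ^ 2 * W) + A1 * A1 * A) = ?Y ^ 5 * (cst 3 * ?Y * W * W + A1 * A1 * A2)"
          unfolding A2(1) unfolding power_as_product by (simp only: distrib_left mult_ac)
        show "mfps_nth (cst 3 * ?Y * W * W + A1 * A1 * A2) 0 \<noteq> 0"
          using three False by (simp only: nth_add nth_mult_0 nth_cst_0 nth_var_0 A1(2) A2(2) mult_zero_left mult_zero_right add_0_left add_0_right mult_eq_0_iff simp_thms not_False_eq_True)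
      qed
    next
      case a3: True
      note A4 = A4[OF a3]
      show ?thesis
      proof (cases "b5 = 0")
        case True
        note B6 = B6[OF b4 True]
        have False
        proof (rule not_fin_near_J10[where \<sigma> = "\<lambda>i. i" and \<epsilon> = "\<lambda>i. hess i i g", OF inf near xy])
          fix i k l assume i: "i \<notin> {x, y}" and kl: "2 * k + l < (4::nat)"
          show "mfps_nth g (single x k + single y l + single i 1) = 0"
            by (rule out[OF i]) (use kl M in \<open>simp_all add: supported_add supported_single\<close>)
        next
          fix k l assume kl: "2 * k + l < (6::nat)"
          have "mfps_nth A (single y l) = 0" if "k = 1" by (rule mpowerD[OF A4]) (use kl that in simp)
          moreover have "mfps_nth B (single y l) = 0" if "k = 0" by (rule mpowerD[OF B6]) (use kl that in simp)
          ultimately show "mfps_nth g (single x k + single y l) = 0"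
            using ins[of k l] cF[of k l] kl M by auto
        next
          show "mfps_nth g (single x 3) \<noteq> 0"
            using ins[of 3 0] cF[of 3 0] M by simp
        qed (use dg in \<open>auto simp: diag_def\<close>)
        then show ?thesis ..
      next
        case b5: False
        show ?thesis
        proof (cases "p = 5")
          case True
          have False
          proof (rule no_A_perturbed[OF inf p(1,2) two near xy dg, of 4])
            fix i b assume i: "i \<noteq> y" "b < (4::nat)"
            show "mfps_nth g (single y b + single i 1) = 0"
            proof (cases "i = x")
              case True
              have "mfps_nth A (single y b) = 0" by (rule mpowerD[OF A4]) (use i in simp)
              then show ?thesis using ins[of 1 b] cF[of 1 b] i M unfolding True by (simp add: add.commute)
            next
              case False
              then show ?thesis by (intro out) (use i M in \<open>simp_all add: supported_single\<close>)
            qed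
          next
            fix j assume j: "j < p"
            have "mfps_nth B (single y j) = 0" by (rule mpowerD[OF B5]) (use j True in simp)
            then show "mfps_nth g (single y j) = 0" using ins[of 0 j] cF[of 0 j] j M by simp
          qed (use True in auto)
          then show ?thesis ..
        next
          case False
          have "p \<noteq> 5" by fact
          then have five: "(5 :: 'k) \<noteq> 0" using of_nat_nonzero[OF p(1), of 5] p(3) by simp
          obtain A1 where A1: "mfps_pderiv y A = ?Y ^ 3 * A1"
            using pderiv_shift_power[OF A(1), of 3] A4 unfolding s4 by auto
          obtain A2 where A2: "A = ?Y ^ 4 * A2" using shift_power[OF A(1) A4] by auto
          show ?thesis
          proof (rule E_kill[OF r1, of "?Y ^ 3" A1 "?Y * W" "?Y ^ 5" "cst 3 * W * W + ?Y * ?Y * A1 * A1 * A2"])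
            have "?X * mfps_pderiv y A + mfps_pderiv y B = ?Y ^ 3 * (?X * A1 + ?Y * W)"
              unfolding A1(1) W(1) unfolding power_as_product by (simp only: distrib_left mult_ac)
            then show "?Y ^ 3 * (?X * A1 + ?Y * W) \<in> jid M g" using r2 by simp
            show "?Y ^ 3 * (cst 3 * (?Y * W) * (?Y * W) + A1 * A1 * A) = ?Y ^ 5 * (cst 3 * W * W + ?Y * ?Y * A1 * A1 * A2)"
              unfolding A2(1) unfolding power_as_product by (simp only: distrib_left mult_ac)
            show "mfps_nth (cst 3 * W * W + ?Y * ?Y * A1 * A1 * A2) 0 \<noteq> 0"
              using three five b5 by (simp only: nth_add nth_mult_0 nth_cst_0 nth_var_0 W(2) mult_zero_left mult_zero_right add_0_left add_0_right mult_eq_0_iff simp_thms not_False_eq_True)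
          qed
        qed
      qed
    qed
  qed
  note Y = this
  \<comment> \<open>With y^5 in the ideal, so is A^2, and the relation 3x^2 + A then yields x^4.
    Every monomial in x and y of degree 8 or more contains x^4 or y^5.\<close>
  have "A * A = ?Y ^ 5 * (?Y * A2 * A2)"
    unfolding A2(1) unfolding power_as_product by (simp only: mult_ac)
  then have AA: "A * A \<in> jid M g" using jid_mult'[OF Y] by (simp only:)
  have "cst 3 * cst 3 * (?X * ?X * ?X * ?X) \<in> jid M g"
    unfolding E_relation_square[symmetric, of _ _ A] by (rule jid_add[OF jid_mult[OF r1] AA])
  then have "mfps_scale (3 * 3) (?X ^ 4) \<in> jid M g"
    unfolding scale_cst cst_mult power4_eq_xxxx .
  from jid_scale[OF this, of "inverse (3 * 3)"] have "mfps_scale (inverse (3 * 3) * (3 * 3)) (?X ^ 4) \<in> jid M g"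
    unfolding scale_scale .
  moreover have "inverse (3 * 3) * (3 * 3) = (1 :: 'k)" by (rule left_inverse) (simp only: mult_eq_0_iff three simp_thms not_False_eq_True)
  ultimately have X: "?X ^ 4 \<in> jid M g" by (simp only: scale_cst cst_one mult_1_left)
  show ?thesis
  proof (rule binary_covers[OF xy rel(1)])
    fix i j assume ij: "i + j = M"
    show "?X ^ i * ?Y ^ j \<in> jid M g"
    proof (cases "5 \<le> j")
      case True
      show ?thesis by (rule jid_mult[OF power_jid[OF Y True]])
    next
      case False
      then have "4 \<le> i" using ij M by simp
      then show ?thesis by (intro jid_mult' power_jid[OF X])
    qed
  qed
qed

text \<open>A zero cubic part leaves binary quartics, with 5 > 4 parameters; a cube leads to the E
  form and the remaining cubics to the D form. The truncation error of the normal form in the plane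
  is moved into the remainder by \<open>reduce\<close>.\<close>

lemma corank_2:
  fixes F R :: "('n::finite, 'k::alg_closed_field) mfps"
  assumes p: "CHAR('k) = p" "prime p" "5 \<le> p" and near: "fin_near f"
    and xy: "x \<noteq> y"
    and q: "\<And>i. i \<notin> {x, y} \<Longrightarrow> q i \<noteq> 0" and F: "psup {x, y} F" "F \<in> mpower 3" and R: "R \<in> mpower (Suc (Suc M))"
    and M: "p + 9 \<le> M" and f: "f \<sim>\<^sub>r qform {x, y} q + F + R"
  shows "\<exists>g :: ('n, 'k) mfps. f \<sim>\<^sub>r g \<and> g \<in> mpower 2 \<and> jac_covers M g"
proof -
  let ?X = "mfps_var x :: ('n, 'k) mfps" and ?Y = "mfps_var y :: ('n, 'k) mfps"
  have inf: "infinite (UNIV :: 'k set)" by (rule alg_closed_infinite)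
  have two: "(2 :: 'k) \<noteq> 0" using of_nat_nonzero[OF p(1), of 2] p(3) by simp
  have three: "(3 :: 'k) \<noteq> 0" using of_nat_nonzero[OF p(1), of 3] p(3) by simp
  have reduce: "\<exists>R'. f \<sim>\<^sub>r qform {x, y} q + G + R' \<and> R' \<in> mpower (Suc (Suc M))"
    if FH: "pequiv {x, y} F H" and GH: "H - G \<in> mpower (Suc (Suc M))" for G H
  proof -
    obtain R' where R': "R' \<in> mpower (Suc (Suc M))" "qform {x, y} q + F + R \<sim>\<^sub>r qform {x, y} q + H + R'"
      using pequiv_lift[OF FH R] by blast
    have "qform {x, y} q + H + R' = qform {x, y} q + G + (R' + (H - G))" by (simp add: algebra_simps)
    then show ?thesis using right_equiv_trans[OF f R'(2)] filt_add[OF R'(1) GH] by metis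
  qed
  have low: "G \<in> mpower 3" if FH: "pequiv {x, y} F H" and GH: "H - G \<in> mpower (Suc (Suc M))" for G H
    using filt_diff[OF pequiv_mpower[OF FH F(2)] mpower_mono[OF GH, of 3]] M by simp
  obtain F' where F': "pequiv {x, y} F F'"
    "has_cubic x y F' 0 0 0 0 \<or> has_cubic x y F' 1 0 0 0 \<or> (\<exists>\<gamma>. has_cubic x y F' 0 1 0 \<gamma>)"
    using cubic_normal_form[OF two xy F] by blast
  have qG: "qform {x, y} q + G + R' \<in> mpower 2" if "G \<in> mpower 3" "R' \<in> mpower (Suc (Suc M))" for G R'
    using that by (intro filt_add qform_mpower mpower_mono[OF that(1)] mpower_mono[OF that(2)]) simp_all
  from F'(2) consider "has_cubic x y F' 0 0 0 0" | "has_cubic x y F' 1 0 0 0" | \<gamma> where "has_cubic x y F' 0 1 0 \<gamma>" by blast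
  then show ?thesis
  proof cases
    case 1
    then have G: "psup {x, y} F'" "F' \<in> mpower 4" by (simp_all add: has_cubic_def cubic_def cst_zero)
    obtain R' where R': "f \<sim>\<^sub>r qform {x, y} q + F' + R'" "R' \<in> mpower (Suc (Suc M))"
      using reduce[OF F'(1), of F'] by auto
    define g where "g = qform {x, y} q + F' + R'"
    have near': "fin_near g" unfolding g_def by (rule fin_near_right_equiv[OF near R'(1)])
    have dg: "diag {x, y} g" unfolding g_def
      by (rule diag_qform[OF two q mpower_mono[OF G(2)] mpower_mono[OF R'(2)]]) (use M in simp_all)
    have False
    proof (rule not_fin_near_forms[where P = "{x, y}" and D = 4 and \<sigma> = "\<lambda>i. i" and \<epsilon> = "\<lambda>i. hess i i g", OF inf near'])
      show "card {x, y} * card {x, y} < card {a :: 'n \<Rightarrow>\<^sub>0 nat. supported_in {x, y} a \<and> mdeg a = 4}"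
        using card_binary_forms[OF xy, of 4] xy by simp
    next
      fix i b assume i: "i \<notin> {x, y}" and b: "supported_in {x, y} b" "mdeg b < 4 - 1"
      have "mfps_nth F' (b + single i 1) = 0"
        by (rule psupD[OF G(1)]) (use i in \<open>simp add: supported_add supported_single\<close>)
      moreover have "mfps_nth R' (b + single i 1) = 0"
        by (rule mpowerD[OF R'(2)]) (use b M in simp)
      ultimately show "mfps_nth g (b + single i 1) = 0"
        using qform_nth_mixed[OF i b(1), of q] by (simp add: g_def)
    next
      fix a assume a: "supported_in {x, y} a" "mdeg a < 4"
      have "mfps_nth F' a = 0" by (rule mpowerD[OF G(2) a(2)])
      moreover have "mfps_nth R' a = 0" by (rule mpowerD[OF R'(2)]) (use a M in simp)
      ultimately show "mfps_nth g a = 0" using qform_nth_supported[OF a(1), of q] by (simp add: g_def)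
    qed (use dg in \<open>auto simp: diag_def\<close>)
    then show ?thesis ..
  next
    case 2
    then have G: "psup {x, y} F'" "F' - ?X * ?X * ?X \<in> mpower 4" by (simp_all add: has_cubic_def cubic_def cst_zero cst_one)
    obtain F'' c d where F'': "pequiv {x, y} F' F''" "F'' - (?X * ?X * ?X + (\<Sum>j = 4..<Suc (Suc M).
        mfps_scale (c j) (?Y ^ j) + mfps_scale (d j) (?X * ?Y ^ (j - 1)))) \<in> mpower (Suc (Suc M))"
      using E_form[OF three xy G, of "Suc (Suc M)"] M by auto
    define A B where "A = (\<Sum>j = 4..<Suc (Suc M). mfps_scale (d j) (?Y ^ (j - 1)))"
      and "B = (\<Sum>j = 4..<Suc (Suc M). mfps_scale (c j) (?Y ^ j))"
    have sm: "?X * ?X * ?X + (\<Sum>j = 4..<Suc (Suc M). mfps_scale (c j) (?Y ^ j) + mfps_scale (d j) (?X * ?Y ^ (j - 1))) =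
        ?X * ?X * ?X + ?X * A + B"
      unfolding A_def B_def sum.distrib sum_distrib_left scale_cst by (simp only: mult_ac add_ac)
    have A: "psup {y} A" "A \<in> mpower 3"
    proof -
      show "psup {y} A" unfolding A_def by (intro psup_sum psup_scale psup_power psup_var) simp
      have "?Y ^ (j - 1) \<in> mpower 3" if "j \<in> {4..<Suc (Suc M)}" for j
        by (rule mpower_mono[OF var_power_mpower]) (use that in auto)
      then show "A \<in> mpower 3" unfolding A_def by (intro filt_sum filt_scale)
    qed
    have B: "psup {y} B" "B \<in> mpower 4"
    proof -
      show "psup {y} B" unfolding B_def by (intro psup_sum psup_scale psup_power psup_var) simp
      have "?Y ^ j \<in> mpower 4" if "j \<in> {4..<Suc (Suc M)}" for j
        by (rule mpower_mono[OF var_power_mpower]) (use that in auto)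
      then show "B \<in> mpower 4" unfolding B_def by (intro filt_sum filt_scale)
    qed
    note pe = pequiv_trans[OF F'(1) F''(1)]
    obtain R' where R': "f \<sim>\<^sub>r qform {x, y} q + (?X * ?X * ?X + ?X * A + B) + R'" "R' \<in> mpower (Suc (Suc M))"
      using reduce[OF pe F''(2)] unfolding sm by blast
    have "jac_covers M (qform {x, y} q + (?X * ?X * ?X + ?X * A + B) + R')"
      by (rule corank_2_E[OF inf p fin_near_right_equiv[OF near R'(1)] xy q A B R'(2) M refl])
    then show ?thesis using R'(1) qG[OF low[OF pe F''(2)] R'(2)] unfolding sm by blast
  next
    case 3
    then have G: "psup {x, y} F'" "F' - (?X * ?X * ?Y + mfps_scale \<gamma> (?Y * ?Y * ?Y)) \<in> mpower 4"
      by (simp_all add: has_cubic_def cubic_def cst_zero cst_one scale_cst)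
    obtain F'' c where F'': "pequiv {x, y} F' F''" "F'' - (?X * ?X * ?Y + mfps_scale \<gamma> (?Y * ?Y * ?Y) +
        (\<Sum>j = 4..<Suc (Suc M). mfps_scale (c j) (?Y ^ j))) \<in> mpower (Suc (Suc M))"
      using D_form[OF two xy G, of "Suc (Suc M)"] M by auto
    define H where "H = mfps_scale \<gamma> (?Y * ?Y * ?Y) + (\<Sum>j = 4..<Suc (Suc M). mfps_scale (c j) (?Y ^ j))"
    have sm: "?X * ?X * ?Y + mfps_scale \<gamma> (?Y * ?Y * ?Y) + (\<Sum>j = 4..<Suc (Suc M). mfps_scale (c j) (?Y ^ j)) = ?X * ?X * ?Y + H"
      by (simp only: H_def add.assoc)
    have H1: "psup {y} H" unfolding H_def
      by (intro psup_add psup_sum psup_scale psup_power psup_mult psup_var) simp_all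
    have "?Y * ?Y * ?Y \<in> mpower 3"
      by (rule filt_mult_le[OF filt_mult[OF var_mpower var_mpower] var_mpower]) simp
    moreover have "?Y ^ j \<in> mpower 3" if "j \<in> {4..<Suc (Suc M)}" for j
      by (rule mpower_mono[OF var_power_mpower]) (use that in simp)
    ultimately have H2: "H \<in> mpower 3" unfolding H_def by (intro filt_add filt_sum filt_scale)
    note pe = pequiv_trans[OF F'(1) F''(1)]
    obtain R' where R': "f \<sim>\<^sub>r qform {x, y} q + (?X * ?X * ?Y + H) + R'" "R' \<in> mpower (Suc (Suc M))"
      using reduce[OF pe F''(2)] unfolding sm by blast
    have "jac_covers M (qform {x, y} q + (?X * ?X * ?Y + H) + R')"
      by (rule corank_2_D[OF inf p fin_near_right_equiv[OF near R'(1)] xy q H1 H2 R'(2) _ refl]) (use M in auto)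
    then show ?thesis using R'(1) qG[OF low[OF pe F''(2)] R'(2)] unfolding sm by blast
  qed
qed

text \<open>The corank is at most 2, and at most 1 in characteristic 3. The bound p + 9 is common to
  all cases; corank 0 is covered because no monomial of positive degree is free of transversal
  variables.\<close>

theorem odd_normal_form:
  fixes f :: "('n::finite, 'k::alg_closed_field) mfps"
  assumes p: "CHAR('k) = p" "prime p" "p \<noteq> 2" and near: "fin_near f" and f: "f \<in> mpower 2"
  shows "\<exists>g :: ('n, 'k) mfps. f \<sim>\<^sub>r g \<and> g \<in> mpower 2 \<and> jac_covers (p + 9) g"
proof -
  have inf: "infinite (UNIV :: 'k set)" by (rule alg_closed_infinite)
  define M where "M = p + 9"
  have p3: "3 \<le> p" using p(2,3) prime_ge_2_nat[of p] by simp
  have two: "(2 :: 'k) \<noteq> 0" using of_nat_nonzero[OF p(1), of 2] p3 by simp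
  obtain f1 :: "('n, 'k) mfps" and P where f1: "f \<sim>\<^sub>r f1" "diag P f1" using diagonalise[OF f two] by blast
  have f12: "f1 \<in> mpower 2" by (rule right_equiv_mpower[OF f1(1) f])
  have near1: "fin_near f1" by (rule fin_near_right_equiv[OF near f1(1)])
  obtain q F R where F: "f1 \<sim>\<^sub>r qform P q + F + R" "\<And>i. i \<notin> P \<Longrightarrow> q i \<noteq> 0" "psup P F" "F \<in> mpower 3" "R \<in> mpower (Suc (Suc M))"
    using normal_form_squares[OF two f12 f1(2), of "Suc M"] by (auto simp: M_def)
  define g where "g = qform P q + F + R"
  have fg: "f \<sim>\<^sub>r g" unfolding g_def by (rule right_equiv_trans[OF f1(1) F(1)])
  have near_g: "fin_near g" by (rule fin_near_right_equiv[OF near fg])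
  have g2: "g \<in> mpower 2" by (rule right_equiv_mpower[OF fg f])
  have "card P < 3" using no_corank_3[OF inf two near1 f1(2) f12] by (cases "card P < 3") auto
  then consider "card P = 0" | "card P = 1" | "card P = 2" by linarith
  then show ?thesis
  proof cases
    case 1
    then have P: "P = {}" by simp
    have "jac_covers M g"
    proof (rule jac_covers_form[where P = P])
      show "mfps_var i \<in> jid M g" if "i \<notin> P" for i by (rule jid_form(1)[OF two F(2,3,5) g_def that])
      show "mon a \<in> jid M g" if "supported_in P a" "mdeg a = M" for a
      proof -
        have "a = 0" using that(1) unfolding P supported_in_def by (intro poly_mapping_eqI) simp
        then show ?thesis using that(2) by (simp add: M_def)
      qed
    qed
    then show ?thesis using fg g2 unfolding M_def by blast
  next
    case 2
    then obtain y where P: "P = {y}" by (metis card_1_singletonE)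
    have "jac_covers M g"
      by (rule corank_1[OF inf p near_g F(2,3,4,5)[unfolded P] _ g_def[unfolded P]]) (simp_all add: M_def)
    then show ?thesis using fg g2 unfolding M_def by blast
  next
    case 3
    then obtain x y where P: "P = {x, y}" "x \<noteq> y" by (metis card_2_iff)
    have "p \<noteq> 3" using no_corank_2_char_3[OF inf _ near1 f1(2) f12] p(1) 3 by auto
    moreover have "p \<noteq> 4" using p(2) by (metis even_numeral p(3) prime_odd_nat prime_nat_iff' primes_dvd_imp_eq two_is_prime_nat)
    ultimately have p5: "5 \<le> p" using p3 by simp
    show ?thesis unfolding M_def[symmetric]
      by (rule corank_2[OF p(1,2) p5 near P(2) F(2,3,4,5)[unfolded P] _ fg[unfolded g_def P]]) (simp_all add: M_def)
  qed
qed

section \<open>Simple singularities in characteristic two\<close>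

lemma pair_loc: "(if c then mfps_scale a (mfps_var k) + mfps_scale b (mfps_var l) else (mfps_var k :: ('n::finite, 'k::field) mfps)) \<in> mpower 1"
  by (cases c) (auto intro: filt_add filt_scale var_mpower)

lemma hess_permutation:
  fixes f :: "('n::finite, 'k::field) mfps"
  assumes f: "f \<in> mpower 2" and \<pi>: "\<And>k. \<pi> (\<pi> k) = k"
  shows "hess i j (subst (\<lambda>k. mfps_var (\<pi> k)) f) = hess (\<pi> i) (\<pi> j) f"
proof -
  have loc: "(mfps_var (\<pi> k) :: ('n, 'k) mfps) \<in> mpower 1" for k by (rule var_mpower)
  have A: "mfps_nth (mfps_var (\<pi> k) :: ('n, 'k) mfps) (single m 1) = (if k = \<pi> m then 1 else 0)" for k m
    using \<pi> by (auto simp: var_eq_mon nth_mon single_eq_iff)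
  have ind: "x * (if c then 1 else 0) = (if c then x else 0)" for x :: 'k and c by simp
  show ?thesis
    unfolding hess_lhom[OF lhom_subst[of "\<lambda>k. mfps_var (\<pi> k)", OF loc] f] subst_var[of "\<lambda>k. mfps_var (\<pi> k)", OF loc] A
    by (simp only: ind) simp
qed

text \<open>On the rows in \<open>S\<close> the Hessian is a hyperbolic pairing of i with
  \<open>\<sigma> i\<close>. The pairing is prescribed in advance, so that the resulting normal form
  does not depend on the series.\<close>

definition polar :: "('n \<Rightarrow> 'n) \<Rightarrow> 'n set \<Rightarrow> ('n::finite, 'k::comm_ring_1) mfps \<Rightarrow> bool" where
  "polar \<sigma> S g \<longleftrightarrow> (\<forall>i\<in>S. \<sigma> i \<in> S \<and> \<sigma> i \<noteq> i \<and> hess i (\<sigma> i) g \<noteq> 0 \<and> (\<forall>j. j \<noteq> \<sigma> i \<longrightarrow> hess i j g = 0))"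

lemma hess_char_2: "(2 :: 'k) = 0 \<Longrightarrow> hess i i (f :: ('n::finite, 'k::field) mfps) = 0"
  by (simp add: hess_eq)

text \<open>Symplectic Gram-Schmidt with the pivot h_ij, j = \<open>\<sigma> i\<close>: a shear of
  x_j clears row i, a shear of x_i clears row j. The quadratic correction in
  \<open>hess_shear\<close> drops out because diagonal entries vanish in characteristic 2.\<close>

lemma polar_extend:
  fixes f :: "('n::finite, 'k::field) mfps"
  assumes two: "(2 :: 'k) = 0" and f: "f \<in> mpower 2" and S: "polar \<sigma> S f" and i: "i \<notin> S" "\<sigma> i \<notin> S" "\<sigma> i \<noteq> i" "\<sigma> (\<sigma> i) = i"
    and h: "hess i (\<sigma> i) f \<noteq> 0"
  shows "\<exists>g :: ('n, 'k) mfps. f \<sim>\<^sub>r g \<and> polar \<sigma> (insert i (insert (\<sigma> i) S)) g"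
proof -
  define j where "j = \<sigma> i"
  define h where "h = hess i j f"
  have h0: "h \<noteq> 0" using assms(8) by (simp add: h_def j_def)
  have ij: "i \<noteq> j" "\<sigma> i = j" "\<sigma> j = i" using i by (simp_all add: j_def)
  have step: "\<exists>g. f \<sim>\<^sub>r g \<and> (\<forall>a b. hess a b g = hess a b f + c a * hess j b f + c b * hess a j f)"
    if "c j = 0" "f \<in> mpower 2" for c j and f :: "('n, 'k) mfps"
    using right_equivI[OF aut_shear[of c j, OF that(1)], of f] hess_shear[of f c j, OF that(2,1)] hess_char_2[OF two, of j f]
    by auto
  define c where "c l = (if l = i \<or> l = j then 0 else - hess i l f / h)" for l
  obtain g where g: "f \<sim>\<^sub>r g" "\<And>a b. hess a b g = hess a b f + c a * hess j b f + c b * hess a j f"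
    using step[of c j f] f by (auto simp: c_def)
  have g2: "g \<in> mpower 2" by (rule right_equiv_mpower[OF g(1) f])
  have gi: "hess i b g = (if b = j then h else 0)" for b
    using h0 ij hess_char_2[OF two, of i f] unfolding g(2) by (auto simp: c_def h_def)
  have Sf: "hess s b f = 0" if "s \<in> S" "b \<notin> S" for s b using S that unfolding polar_def by metis
  have gS: "hess s b g = hess s b f" if "s \<in> S" for s b
    unfolding g(2) using Sf[OF that] i that by (simp add: c_def j_def hess_sym[of i s])
  define d where "d l = (if l = i \<or> l = j then 0 else - hess j l g / h)" for l
  obtain g' where g': "g \<sim>\<^sub>r g'" "\<And>a b. hess a b g' = hess a b g + d a * hess i b g + d b * hess a i g"
    using step[of d i g] g2 by (auto simp: d_def)
  have g'i: "hess i b g' = (if b = j then h else 0)" for b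
    unfolding g'(2) using ij by (simp add: gi d_def)
  have g'j: "hess j b g' = (if b = i then h else 0)" for b
    unfolding g'(2) using ij h0 hess_char_2[OF two, of j g] by (simp add: gi d_def hess_sym[of j i])
  have g'S: "hess s b g' = hess s b f" if "s \<in> S" for s b
  proof -
    have "hess s j g = 0" "hess s i g = 0" using gS[OF that] Sf[OF that] i by (simp_all add: j_def)
    then have "hess j s g = 0" "hess s i g = 0" by (simp_all add: hess_sym[of j s])
    then show ?thesis unfolding g'(2) using gS[OF that] i that by (simp add: d_def)
  qed
  have "polar \<sigma> (insert i (insert j S)) g'"
    unfolding polar_def
  proof
    fix a assume "a \<in> insert i (insert j S)"
    then consider "a = i" | "a = j" | "a \<in> S" by blast
    then show "\<sigma> a \<in> insert i (insert j S) \<and> \<sigma> a \<noteq> a \<and> hess a (\<sigma> a) g' \<noteq> 0 \<and> (\<forall>b. b \<noteq> \<sigma> a \<longrightarrow> hess a b g' = 0)"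
    proof cases
      case 1 then show ?thesis using ij h0 by (simp add: g'i)
    next
      case 2 then show ?thesis using ij h0 by (simp add: g'j)
    next
      case 3 then show ?thesis using S g'S[OF 3] by (simp add: polar_def)
    qed
  qed
  then show ?thesis using right_equiv_trans[OF g(1) g'(1)] unfolding j_def by blast
qed

text \<open>A nonzero entry h_ij outside \<open>S\<close> need not sit at a prescribed pair;
  exchanging x_j with the partner of x_i moves it there. One of i and j has a partner, since they
  are distinct and \<sigma> has at most one fixed point.\<close>

lemma polar_maximal:
  fixes f :: "('n::finite, 'k::field) mfps"
  assumes two: "(2 :: 'k) = 0" and \<sigma>: "\<And>i. \<sigma> (\<sigma> i) = i" and fix1: "\<And>u v. \<sigma> u = u \<Longrightarrow> \<sigma> v = v \<Longrightarrow> u = v"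
    and "polar \<sigma> S f" "f \<in> mpower 2"
  shows "\<exists>(g :: ('n, 'k) mfps) S. f \<sim>\<^sub>r g \<and> polar \<sigma> S g \<and> (\<forall>i j. i \<notin> S \<longrightarrow> hess i j g = 0)"
  using assms(4,5)
proof (induction "card (- S)" arbitrary: f S rule: less_induct)
  case less
  note S = less.prems(1) and f = less.prems(2)
  have Sf: "hess s b f = 0" if "s \<in> S" "b \<notin> S" for s b using S that unfolding polar_def by metis
  show ?case
  proof (cases "\<forall>i j. i \<notin> S \<longrightarrow> j \<notin> S \<longrightarrow> hess i j f = 0")
    case True
    then have "\<forall>i j. i \<notin> S \<longrightarrow> hess i j f = 0" using Sf hess_sym by metis
    then show ?thesis using S right_equiv_refl[of f] by blast
  next
    case False
    have "\<exists>i j. i \<notin> S \<and> j \<notin> S \<and> hess i j f \<noteq> 0 \<and> \<sigma> i \<noteq> i"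
    proof -
      obtain i j where ij: "i \<notin> S" "j \<notin> S" "hess i j f \<noteq> 0" using False by blast
      then have "i \<noteq> j" using hess_char_2[OF two] by blast
      then have "\<sigma> i \<noteq> i \<or> \<sigma> j \<noteq> j" using fix1 by blast
      then show ?thesis using ij hess_sym[of i j f] by metis
    qed
    then obtain i j where ij: "i \<notin> S" "j \<notin> S" "hess i j f \<noteq> 0" "\<sigma> i \<noteq> i" by blast
    have ne: "i \<noteq> j" using ij(3) hess_char_2[OF two] by blast
    have \<sigma>i: "\<sigma> i \<notin> S" using S ij(1) \<sigma> unfolding polar_def by metis
    define \<pi> where "\<pi> k = (if k = j then \<sigma> i else if k = \<sigma> i then j else k)" for k
    have \<pi>: "\<pi> (\<pi> k) = k" for k by (simp add: \<pi>_def)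
    have \<pi>S: "\<pi> k = k" if "k \<in> S" for k using that ij(2) \<sigma>i by (auto simp: \<pi>_def)
    have bij: "bij \<pi>" by (rule o_bij[of \<pi>]) (auto simp: \<pi>)
    define f' where "f' = subst (\<lambda>k. mfps_var (\<pi> k)) f"
    have f': "f \<sim>\<^sub>r f'" unfolding f'_def by (rule right_equivI[OF aut_permutation[OF bij]])
    have H: "hess a b f' = hess (\<pi> a) (\<pi> b) f" for a b unfolding f'_def by (rule hess_permutation[OF f \<pi>])
    have S': "polar \<sigma> S f'" unfolding polar_def
    proof
      fix s assume s: "s \<in> S"
      then have \<sigma>s: "\<sigma> s \<in> S" using S by (simp add: polar_def)
      have "\<pi> b \<noteq> \<sigma> s" if "b \<noteq> \<sigma> s" for b using \<pi>S[OF \<sigma>s] \<pi>[of b] that by metis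
      then show "\<sigma> s \<in> S \<and> \<sigma> s \<noteq> s \<and> hess s (\<sigma> s) f' \<noteq> 0 \<and> (\<forall>b. b \<noteq> \<sigma> s \<longrightarrow> hess s b f' = 0)"
        unfolding H \<pi>S[OF s] \<pi>S[OF \<sigma>s] using S s by (simp add: polar_def)
    qed
    have "\<pi> i = i" using ne ij(4) by (auto simp: \<pi>_def)
    moreover have "\<pi> (\<sigma> i) = j" by (simp add: \<pi>_def)
    ultimately have "hess i (\<sigma> i) f' \<noteq> 0" using ij(3) by (simp add: H)
    then obtain g :: "('n, 'k) mfps" where g: "f' \<sim>\<^sub>r g" "polar \<sigma> (insert i (insert (\<sigma> i) S)) g"
      using polar_extend[OF two right_equiv_mpower[OF f' f] S' ij(1) \<sigma>i ij(4) \<sigma>] by blast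
    note fg = right_equiv_trans[OF f' g(1)]
    have "card (- insert i (insert (\<sigma> i) S)) < card (- S)"
      by (rule psubset_card_mono) (use ij in auto)
    from less.hyps[OF this g(2) right_equiv_mpower[OF fg f]] show ?thesis using right_equiv_trans[OF fg] by blast
  qed
qed

text \<open>Perturbation by the product of a pair shrinks the kernel of the Hessian until one pair
  or the unpaired variable is left. A kernel of dimension 2 is excluded by the count 6 > 4, one of
  dimension 1 by the A family with p = e = 2. In particular \<sigma> has no fixed point, so no such
  series exists in an odd number of variables.\<close>

lemma polar_nondegenerate:
  fixes f :: "('n::finite, 'k::field) mfps"
  assumes inf: "infinite (UNIV :: 'k set)" and p: "CHAR('k) = 2" and \<sigma>: "\<And>i. \<sigma> (\<sigma> i) = i"
    and fix1: "\<And>u v. \<sigma> u = u \<Longrightarrow> \<sigma> v = v \<Longrightarrow> u = v"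
    and "fin_near f" "f \<in> mpower 2" "polar \<sigma> S f" "\<And>i j. i \<notin> S \<Longrightarrow> hess i j f = 0"
  shows "S = UNIV"
  using assms(5-8)
proof (induction "card (- S)" arbitrary: f S rule: less_induct)
  case less
  note near = less.prems(1) and f = less.prems(2) and S = less.prems(3) and Z = less.prems(4)
  have two: "(2 :: 'k) = 0" using of_nat_CHAR[where 'a = 'k] p by simp
  have S\<sigma>: "\<sigma> j \<in> S \<longleftrightarrow> j \<in> S" for j using S \<sigma> unfolding polar_def by metis
  have A: "hess j i f = (if j = \<sigma> i then hess (\<sigma> i) i f else 0)" if "i \<in> S" for i j
    using S that hess_sym[of i j f] by (auto simp: polar_def)
  have A0: "hess (\<sigma> i) i f \<noteq> 0" if "i \<in> S" for i
    using S that hess_sym[of i "\<sigma> i" f] by (auto simp: polar_def)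
  show ?case
  proof (rule ccontr)
    assume "S \<noteq> UNIV"
    show False
    proof (cases "\<exists>i. i \<notin> S \<and> \<sigma> i \<noteq> i")
      case True
      then obtain i where i: "i \<notin> S" "\<sigma> i \<noteq> i" by blast
      have \<sigma>i: "\<sigma> i \<notin> S" using S\<sigma> i by simp
      show False
      proof (cases "- S = {i, \<sigma> i}")
        case True
        then have mem: "k \<notin> {i, \<sigma> i} \<longleftrightarrow> k \<in> S" for k by blast
        show False
        proof (rule not_fin_near_char_2[OF inf p near f, of i "\<sigma> i" \<sigma> "\<lambda>k. hess (\<sigma> k) k f"])
          show "i \<noteq> \<sigma> i" using i(2) by simp
          show "hess i (\<sigma> i) f = 0" by (rule Z[OF i(1)])
        qed (unfold mem, rule A, assumption, rule A0, assumption, simp add: S\<sigma>, rule \<sigma>)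
      next
        case False
        let ?e = "mfps_var i * mfps_var (\<sigma> i) :: ('n, 'k) mfps"
        have e2: "?e \<in> mpower 2" by (rule filt_mult_le[OF var_mpower var_mpower]) simp
        obtain c where c: "c \<noteq> 0" "fin_near (f + mfps_scale c ?e)"
          using fin_near_perturb[OF inf near mpower_mono[OF e2, of 1]] by auto
        have e: "hess a b ?e = (if a = i \<and> b = \<sigma> i \<or> a = \<sigma> i \<and> b = i then 1 else 0)" for a b
          unfolding hess_def pderiv_mult pderiv_var using i(2)
          by (auto simp: pderiv_add pderiv_mult pderiv_var nth_one)
        have H: "hess a b (f + mfps_scale c ?e) = hess a b f + (if a = i \<and> b = \<sigma> i \<or> a = \<sigma> i \<and> b = i then c else 0)" for a b
          unfolding hess_add hess_scale e by simp
        let ?S = "insert i (insert (\<sigma> i) S)"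
        have "?S = UNIV"
        proof (rule less.hyps[OF _ c(2)])
          show "card (- ?S) < card (- S)" by (rule psubset_card_mono) (use i in auto)
          show "f + mfps_scale c ?e \<in> mpower 2" by (intro filt_add filt_scale f e2)
          show "polar \<sigma> ?S (f + mfps_scale c ?e)" unfolding polar_def H
            using S Z[OF i(1)] Z[OF \<sigma>i] i \<sigma>i \<sigma> c(1) unfolding polar_def by auto
          show "hess a b (f + mfps_scale c ?e) = 0" if "a \<notin> ?S" for a b
            unfolding H using that Z by auto
        qed
        then show False using False i(1) \<sigma>i by blast
      qed
    next
      case False
      then obtain y where y: "y \<notin> S" "\<sigma> y = y" using \<open>S \<noteq> UNIV\<close> by blast
      have mem: "k \<noteq> y \<longleftrightarrow> k \<in> S" for k using y False fix1 by blast
      show False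
      proof (rule not_fin_near_A[OF inf p _ near, of 2 y \<sigma> "\<lambda>k. hess (\<sigma> k) k f"])
        show "hess j i f = (if j = \<sigma> i then hess (\<sigma> i) i f else 0)" if "i \<noteq> y" for i j using A that mem by blast
        show "hess (\<sigma> i) i f \<noteq> 0" if "i \<noteq> y" for i using A0 that mem by blast
        show "\<sigma> j \<noteq> y" if "j \<noteq> y" for j using S\<sigma> that mem by blast
        show "\<sigma> (\<sigma> j) = j" for j by (rule \<sigma>)
        show "mfps_nth f (single y b + single i 1) = 0" if i: "i \<noteq> y" and b: "b < 2" for i b
        proof (cases "b = 1")
          case True
          show ?thesis unfolding True using Z[OF y(1), of i] i by (simp add: hess_neq)
        next
          case False
          show ?thesis by (rule mpowerD[OF f]) (use False b in simp)
        qed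
        show "mfps_nth f (single y j) = 0" if "j < 2" for j
          by (rule mpowerD[OF f]) (use that in simp)
      qed simp_all
    qed
  qed
qed

text \<open>Minimality of the number of fixed points: two of them could be exchanged.\<close>

lemma involution_exists: "\<exists>\<sigma> :: 'n::finite \<Rightarrow> 'n. (\<forall>i. \<sigma> (\<sigma> i) = i) \<and> (\<forall>u v. \<sigma> u = u \<longrightarrow> \<sigma> v = v \<longrightarrow> u = v)"
proof -
  obtain \<sigma> :: "'n \<Rightarrow> 'n" where \<sigma>: "\<forall>i. \<sigma> (\<sigma> i) = i"
    and least: "\<And>\<tau> :: 'n \<Rightarrow> 'n. \<forall>i. \<tau> (\<tau> i) = i \<Longrightarrow> card {u. \<sigma> u = u} \<le> card {u. \<tau> u = u}"
    using ex_has_least_nat[of "\<lambda>\<tau> :: 'n \<Rightarrow> 'n. \<forall>i. \<tau> (\<tau> i) = i" "\<lambda>i. i" "\<lambda>\<tau>. card {u. \<tau> u = u}"] by auto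
  have "u = v" if "\<sigma> u = u" "\<sigma> v = v" for u v
  proof (rule ccontr)
    assume ne: "u \<noteq> v"
    let ?\<tau> = "\<sigma>(u := v, v := u)"
    have "\<forall>i. ?\<tau> (?\<tau> i) = i" using \<sigma> that ne by (auto simp: fun_upd_def)
    moreover have "card {w. ?\<tau> w = w} < card {w. \<sigma> w = w}"
      by (rule psubset_card_mono) (use that ne in auto)
    ultimately show False using least[of ?\<tau>] by simp
  qed
  then show ?thesis using \<sigma> by blast
qed

text \<open>The substitution is triangular: the partner of x_k lies outside \<open>T\<close> and
  stays fixed, so the inverse has the same shape.\<close>

lemma aut_pairs:
  fixes a b :: "'n::finite \<Rightarrow> 'k::field"
  assumes T: "\<And>k. k \<in> T \<Longrightarrow> \<sigma> k \<notin> T" and a: "\<And>k. a k \<noteq> 0"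
  shows "subst (\<lambda>k. if k \<in> T then mfps_scale (a k) (mfps_var k) + mfps_scale (b k) (mfps_var (\<sigma> k)) else mfps_var k) \<in> right_group"
proof -
  let ?\<phi> = "\<lambda>a b k. if k \<in> T then mfps_scale (a k) (mfps_var k) + mfps_scale (b k) (mfps_var (\<sigma> k)) else (mfps_var k :: ('n, 'k) mfps)"
  have L: "clin (subst (?\<phi> a b))" for a b by (rule clin_subst) (rule pair_loc)
  have V: "subst (?\<phi> a b) (mfps_var m) = ?\<phi> a b m" for a b m by (rule subst_var) (rule pair_loc)
  have inv: "subst (?\<phi> a b) (?\<phi> c d k) = mfps_var k" if "\<And>k. c k * a k = 1" "\<And>k. c k * b k + d k = 0" for a b c d :: "'n \<Rightarrow> 'k" and k
  proof (cases "k \<in> T")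
    case True
    have "subst (?\<phi> a b) (?\<phi> c d k) = mfps_scale (c k) (?\<phi> a b k) + mfps_scale (d k) (?\<phi> a b (\<sigma> k))"
      using True by (simp only: if_True clin_add[OF L] clin_scale[OF L] V)
    also have "\<dots> = mfps_scale (c k * a k) (mfps_var k) + mfps_scale (c k * b k + d k) (mfps_var (\<sigma> k))"
      using True T[OF True] by (intro mfps_eqI) (simp add: algebra_simps)
    also have "\<dots> = mfps_var k" unfolding that by (simp add: scale_cst cst_one cst_zero)
    finally show ?thesis .
  next
    case False
    then show ?thesis by (simp only: if_False V)
  qed
  show ?thesis
  proof (rule aut_inverse[where \<psi> = "?\<phi> (\<lambda>k. inverse (a k)) (\<lambda>k. - (inverse (a k) * b k))"], rule pair_loc, rule pair_loc)
    show "subst (?\<phi> a b) (?\<phi> (\<lambda>k. inverse (a k)) (\<lambda>k. - (inverse (a k) * b k)) k) = mfps_var k" for k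
      by (rule inv) (simp_all add: a)
    show "subst (?\<phi> (\<lambda>k. inverse (a k)) (\<lambda>k. - (inverse (a k) * b k))) (?\<phi> a b k) = mfps_var k" for k
      by (rule inv) (simp_all add: a)
  qed
qed

text \<open>The linear coefficient guarantees positive degree also when \<alpha> = 0.\<close>

lemma quadratic_root: "h \<noteq> 0 \<Longrightarrow> \<exists>l. \<alpha> * (l * l) + h * l + \<beta> = (0 :: 'k::alg_closed_field)"
proof -
  assume h: "h \<noteq> 0"
  have "degree [:\<beta>, h, \<alpha>:] > 0" using h by (simp add: degree_pCons_eq_if)
  then obtain l where "poly [:\<beta>, h, \<alpha>:] l = 0" using alg_closed_imp_poly_has_root by blast
  then show ?thesis by (intro exI[of _ l]) (simp add: algebra_simps)
qed

lemma pair_shear: "a * ((x + l * y) * (x + l * y)) + h * ((x + l * y) * y) + b * (y * y) =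
    a * (x * x) + h * (x * y) + (a * l * (x * y) + a * l * (x * y)) + (a * (l * l) + h * l + b) * (y * y :: 'a::comm_ring_1)"
  by (simp only: algebra_simps)

text \<open>On each pair, \<alpha>x^2 + hxy + \<beta>y^2 loses its y^2 under x \<mapsto> x + ly with
  l a root of the associated quadratic, the new mixed term 2\<alpha>l xy being zero. Then y
  \<mapsto> (y - \<alpha>x) / h turns x (\<alpha>x + hy) into xy.\<close>

lemma pair_normal_form:
  fixes \<alpha> \<beta> h :: "'n::finite \<Rightarrow> 'k::alg_closed_field"
  assumes two: "(2 :: 'k) = 0" and \<sigma>: "\<And>i. \<sigma> (\<sigma> i) = i" and T: "\<And>i. i \<in> T \<longleftrightarrow> \<sigma> i \<notin> T" and h: "\<And>i. h i \<noteq> 0"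
  shows "\<exists>\<Phi>\<in>right_group. \<Phi> (\<Sum>i\<in>T. cst (\<alpha> i) * (mfps_var i * mfps_var i) + cst (h i) * (mfps_var i * mfps_var (\<sigma> i))
      + cst (\<beta> i) * (mfps_var (\<sigma> i) * mfps_var (\<sigma> i))) = (\<Sum>i\<in>T. mfps_var i * mfps_var (\<sigma> i) :: ('n, 'k) mfps)"
proof -
  have "\<forall>i. \<exists>l. \<alpha> i * (l * l) + h i * l + \<beta> i = 0" using quadratic_root[OF h] by blast
  then obtain l where l: "\<And>i. \<alpha> i * (l i * l i) + h i * l i + \<beta> i = 0" by metis
  let ?\<phi> = "\<lambda>k. if k \<in> T then mfps_scale 1 (mfps_var k) + mfps_scale (l k) (mfps_var (\<sigma> k)) else (mfps_var k :: ('n, 'k) mfps)"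
  let ?\<psi> = "\<lambda>k. if k \<in> - T then mfps_scale (1 / h (\<sigma> k)) (mfps_var k) + mfps_scale (- (\<alpha> (\<sigma> k) / h (\<sigma> k))) (mfps_var (\<sigma> k)) else (mfps_var k :: ('n, 'k) mfps)"
  have loc1: "?\<phi> k \<in> mpower 1" and loc2: "?\<psi> k \<in> mpower 1" for k by (rule pair_loc)+
  have \<Phi>: "subst ?\<phi> \<in> right_group" by (rule aut_pairs[of T \<sigma> "\<lambda>_. 1"], use T in blast, simp)
  have \<Psi>: "subst ?\<psi> \<in> right_group"
    by (rule aut_pairs[of "- T" \<sigma> "\<lambda>k. 1 / h (\<sigma> k)" "\<lambda>k. - (\<alpha> (\<sigma> k) / h (\<sigma> k))"], use T in blast, simp add: h)
  have cs: "lhom \<Phi> \<Longrightarrow> \<Phi> (cst c) = (cst c :: ('n, 'k) mfps)" for \<Phi> and c :: 'k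
    unfolding cst_def by (simp add: clin_scale[OF lhom_clin] lhom_one)
  note l1 = lhom_subst[of ?\<phi>, OF loc1] and l2 = lhom_subst[of ?\<psi>, OF loc2]
  let ?x = "\<lambda>i. mfps_var i :: ('n, 'k) mfps"
  have 1: "subst ?\<phi> (cst (\<alpha> i) * (?x i * ?x i) + cst (h i) * (?x i * ?x (\<sigma> i)) + cst (\<beta> i) * (?x (\<sigma> i) * ?x (\<sigma> i))) =
      cst (\<alpha> i) * (?x i * ?x i) + cst (h i) * (?x i * ?x (\<sigma> i))" if i: "i \<in> T" for i
  proof -
    have ni: "\<sigma> i \<notin> T" using T i by blast
    have v: "?\<phi> i = ?x i + cst (l i) * ?x (\<sigma> i)" "?\<phi> (\<sigma> i) = ?x (\<sigma> i)"
      using i ni by (simp_all only: if_True if_False simp_thms scale_cst cst_one mult_1_left)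
    have dbl: "f + f = 0" for f :: "('n, 'k) mfps"
      using double_scale[of f] two by (simp only: scale_cst cst_zero mult_zero_left)
    have c0: "cst (\<alpha> i) * (cst (l i) * cst (l i)) + cst (h i) * cst (l i) + cst (\<beta> i) = (0 :: ('n, 'k) mfps)"
      unfolding cst_mult[symmetric] cst_add[symmetric] l by (rule cst_zero)
    show ?thesis
      unfolding clin_add[OF lhom_clin[OF l1]] lhom_mult[OF l1] cs[OF l1] subst_var[of ?\<phi>, OF loc1] v
        pair_shear dbl c0 by (simp only: mult_zero_left add_0_right)
  qed
  have 2: "subst ?\<psi> (cst (\<alpha> i) * (?x i * ?x i) + cst (h i) * (?x i * ?x (\<sigma> i))) = ?x i * ?x (\<sigma> i)" if i: "i \<in> T" for i
  proof -
    have ni: "\<sigma> i \<notin> T" using T i by blast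
    have v: "?\<psi> i = ?x i" "?\<psi> (\<sigma> i) = cst (1 / h i) * ?x (\<sigma> i) + cst (- (\<alpha> i / h i)) * ?x i"
      using i ni by (simp_all only: Compl_iff if_True if_False simp_thms scale_cst \<sigma>)
    have "cst (\<alpha> i) * (?x i * ?x i) + cst (h i) * (?x i * (cst (1 / h i) * ?x (\<sigma> i) + cst (- (\<alpha> i / h i)) * ?x i)) =
      cst (\<alpha> i + h i * (- (\<alpha> i / h i))) * (?x i * ?x i) + cst (h i * (1 / h i)) * (?x i * ?x (\<sigma> i))"
      unfolding cst_add cst_mult by (simp only: algebra_simps)
    also have "\<dots> = ?x i * ?x (\<sigma> i)" using h[of i] by (simp add: cst_zero cst_one)
    finally show ?thesis
      unfolding clin_add[OF lhom_clin[OF l2]] lhom_mult[OF l2] cs[OF l2] subst_var[of ?\<psi>, OF loc2] v .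
  qed
  show ?thesis
  proof (rule bexI[OF _ right_group_comp[OF \<Psi> \<Phi>]])
    show "subst ?\<psi> (subst ?\<phi> (\<Sum>i\<in>T. cst (\<alpha> i) * (?x i * ?x i) + cst (h i) * (?x i * ?x (\<sigma> i)) + cst (\<beta> i) * (?x (\<sigma> i) * ?x (\<sigma> i))))
      = (\<Sum>i\<in>T. ?x i * ?x (\<sigma> i))"
      unfolding clin_sum[OF lhom_clin[OF l1]] clin_sum[OF lhom_clin[OF l2]]
      by (rule sum.cong[OF refl]) (simp only: 1 2)
  qed
qed

lemma hess_product: "i \<noteq> j \<Longrightarrow> hess a b (mfps_var i * mfps_var j :: ('n::finite, 'k::field) mfps) =
    (if a = i \<and> b = j \<or> a = j \<and> b = i then 1 else 0)"
  unfolding hess_def pderiv_mult pderiv_var by (auto simp: pderiv_add pderiv_mult pderiv_var nth_one)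

lemma nth_product_square: "mfps_nth (mfps_var i * mfps_var j :: ('n::finite, 'k::field) mfps) (single a 2) =
    (if i = a \<and> j = a then 1 else 0)"
proof -
  have "single a 2 = single i 1 + single j (1 :: nat) \<longleftrightarrow> i = a \<and> j = a"
  proof
    assume eq: "single a 2 = single i 1 + single j (1 :: nat)"
    then have "lookup (single a (2 :: nat)) k = lookup (single i 1 + single j 1) k" for k
      by simp
    from this[of i] this[of j] show "i = a \<and> j = a"
      by (simp add: lookup_add lookup_single when_def split: if_splits)
  next
    assume "i = a \<and> j = a"
    then show "single a 2 = single i 1 + single j (1 :: nat)"
      by (metis one_add_one single_add)
  qed
  then show ?thesis unfolding var_eq_mon mon_mult nth_mon by auto
qed

lemma mdeg_2_cases:
  assumes "mdeg (a :: 'n::finite \<Rightarrow>\<^sub>0 nat) = 2"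
  obtains i where "a = single i 2" | i j where "i \<noteq> j" "a = single i 1 + single j 1"
proof -
  have "a \<noteq> 0" using assms by auto
  then obtain i where "lookup a i > 0" by (metis gr0I poly_mapping_eqI lookup_zero)
  then obtain b where b: "a = b + single i 1" using exists_single_add[of a i] by blast
  then have "mdeg b = 1" using assms by simp
  then obtain j where j: "b = single j 1" using mdeg_1_eq_single by blast
  have "single i 1 + single i 1 = single i (2::nat)"
    by (metis one_add_one single_add)
  then show thesis using that(1)[of i] that(2)[of j i] unfolding b j by (cases "i = j") auto
qed

text \<open>Squares are invisible to the Hessian in characteristic 2, so their coefficients are
  recorded separately in \<open>s\<close>. As \<open>T\<close> meets each pair once, every square
  and every product is counted once.\<close>

lemma polar_quadratic_part:
  fixes g :: "('n::finite, 'k::field) mfps"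
  assumes two: "(2 :: 'k) = 0" and g: "g \<in> mpower 2" and pol: "polar \<sigma> UNIV g" and \<sigma>: "\<And>i. \<sigma> (\<sigma> i) = i" and T: "\<And>i. i \<in> T \<longleftrightarrow> \<sigma> i \<notin> T"
  defines "s \<equiv> \<lambda>i. mfps_nth g (single i 2)"
  shows "g - (\<Sum>i\<in>T. cst (s i) * (mfps_var i * mfps_var i) + cst (hess i (\<sigma> i) g) * (mfps_var i * mfps_var (\<sigma> i))
      + cst (s (\<sigma> i)) * (mfps_var (\<sigma> i) * mfps_var (\<sigma> i))) \<in> mpower 3" (is "g - ?Q \<in> _")
proof (rule mpowerI)
  have ne: "\<sigma> i \<noteq> i" for i using pol by (simp add: polar_def)
  have vv: "mfps_var i * mfps_var j \<in> mpower 2" for i j by (rule filt_mult_le[OF var_mpower var_mpower]) simp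
  have Q2: "?Q \<in> mpower 2" by (intro filt_sum filt_add filt_mult_left vv)
  fix a :: "'n \<Rightarrow>\<^sub>0 nat" assume "mdeg a < 3"
  then consider "mdeg a < 2" | "mdeg a = 2" by linarith
  then have "mfps_nth ?Q a = mfps_nth g a"
  proof cases
    case 1
    show ?thesis using mpowerD[OF Q2 1] mpowerD[OF g 1] by simp
  next
    case 2
    then show ?thesis
    proof (cases rule: mdeg_2_cases)
      case (1 i)
      have "mfps_nth ?Q a = (\<Sum>j\<in>T. (if j = i then s i else 0) + (if j = \<sigma> i then s i else 0))"
        unfolding 1 nth_sum nth_add scale_cst[symmetric] nth_scale nth_product_square
        by (rule sum.cong) (use ne \<sigma> in auto)
      also have "\<dots> = s i" unfolding sum.distrib using T[of i] by (cases "i \<in> T") auto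
      finally show ?thesis by (simp add: s_def 1)
    next
      case (2 i j)
      have "mfps_nth ?Q a = hess i j ?Q" unfolding 2(2) by (rule hess_neq[OF 2(1), symmetric])
      also have "\<dots> = (\<Sum>k\<in>T. hess k (\<sigma> k) g * (if i = k \<and> j = \<sigma> k \<or> i = \<sigma> k \<and> j = k then 1 else 0))"
      proof -
        have hs: "hess i j (\<Sum>k\<in>T. F k) = (\<Sum>k\<in>T. hess i j (F k))" for F :: "'n \<Rightarrow> ('n, 'k) mfps"
          by (simp add: hess_def pderiv_sum nth_sum)
        have sq: "hess i j (mfps_var k * mfps_var k :: ('n, 'k) mfps) = 0" for k using 2(1) two by (simp add: hess_square)
        show ?thesis unfolding hs hess_add scale_cst[symmetric] hess_scale sq hess_product[OF ne[symmetric]] by simp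
      qed
      also have "\<dots> = hess i j g"
      proof (cases "j = \<sigma> i")
        case True
        define t where "t = (if i \<in> T then i else j)"
        have t: "t \<in> T" "hess t (\<sigma> t) g = hess i j g"
          using T[of i] True \<sigma> hess_sym[of i j g] by (auto simp: t_def)
        have "(\<Sum>k\<in>T. hess k (\<sigma> k) g * (if i = k \<and> j = \<sigma> k \<or> i = \<sigma> k \<and> j = k then 1 else 0)) =
            (\<Sum>k\<in>T. if k = t then hess i j g else 0)"
        proof (rule sum.cong)
          fix k assume k: "k \<in> T"
          have "i = k \<and> j = \<sigma> k \<or> i = \<sigma> k \<and> j = k \<longleftrightarrow> k = t"
            unfolding t_def using True k T \<sigma> by metis
          then show "hess k (\<sigma> k) g * (if i = k \<and> j = \<sigma> k \<or> i = \<sigma> k \<and> j = k then 1 else 0) = (if k = t then hess i j g else 0)"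
            using t(2) by auto
        qed simp
        then show ?thesis using t(1) by simp
      next
        case False
        then have "hess i j g = 0" using pol by (simp add: polar_def)
        moreover have "\<not> (i = k \<and> j = \<sigma> k \<or> i = \<sigma> k \<and> j = k)" for k using False \<sigma> by metis
        ultimately show ?thesis by (simp only: if_False mult_zero_right sum.neutral_const)
      qed
      finally show ?thesis unfolding 2(2) hess_neq[OF 2(1)] .
    qed
  qed
  then show "mfps_nth (g - ?Q) a = 0" by (simp only: nth_diff diff_self)
qed

section \<open>From normal forms to finitely many classes\<close>

lemma jet_eqD:
  fixes h g :: "('n::finite, 'k::field) mfps"
  assumes "h \<in> mpower 1" "g \<in> mpower 1" "jet k h = jet k g" shows "h - g \<in> mpower (Suc k)"
proof (rule mpowerI)
  fix a :: "'n \<Rightarrow>\<^sub>0 nat" assume a: "mdeg a < Suc k"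
  show "mfps_nth (h - g) a = 0"
  proof (cases "mdeg a = 0")
    case True
    then show ?thesis using mpowerD[OF assms(1), of a] mpowerD[OF assms(2), of a] by simp
  next
    case False
    then have "a \<in> jet_index k" using a by (simp add: jet_index_def)
    then show ?thesis using fun_cong[OF assms(3), of a] by (simp add: jet_def)
  qed
qed

lemma right_determined_right_equiv:
  fixes f g :: "('n::finite, 'k::field) mfps"
  assumes f: "f \<in> mpower 1" and det: "right_determined k f" and fg: "f \<sim>\<^sub>r g"
  shows "right_determined k g"
  unfolding right_determined_def
proof (intro ballI impI)
  fix h :: "('n, 'k) mfps" assume "h \<in> \<mm>" and j: "jet k h = jet k g"
  then have h: "h \<in> mpower 1" by (simp add: max_ideal_eq)
  obtain \<Psi> where \<Psi>: "\<Psi> \<in> right_group" "f = \<Psi> g" using right_equiv_sym[OF fg] unfolding right_equiv_def by blast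
  note lh = right_group_lhom[OF \<Psi>(1)]
  have g: "g \<in> mpower 1" by (rule right_equiv_mpower[OF fg f])
  have "\<Psi> (h - g) \<in> mpower (Suc k)" by (rule lhom_mem_mpower[OF lh jet_eqD[OF h g j]])
  then have "jet k (\<Psi> h) = jet k f" unfolding \<Psi>(2) clin_minus[OF lhom_clin[OF lh]] by (rule jet_eqI)
  moreover have "\<Psi> h \<in> \<mm>" unfolding max_ideal_eq by (rule lhom_mem_mpower[OF lh h])
  ultimately have "\<Psi> h \<sim>\<^sub>r f" using det by (simp add: right_determined_def)
  then show "h \<sim>\<^sub>r g" by (rule right_equiv_trans[OF right_equivI[OF \<Psi>(1)] right_equiv_trans[OF _ fg]])
qed

lemma char_2_unique:
  assumes p: "CHAR('k::alg_closed_field) = 2"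
  shows "\<exists>f0 :: ('n::finite, 'k) mfps. \<forall>f. f \<in> mpower 2 \<longrightarrow> fin_near f \<longrightarrow> (\<exists>k. right_determined k f) \<longrightarrow> f \<sim>\<^sub>r f0"
proof -
  have inf: "infinite (UNIV :: 'k set)" by (rule alg_closed_infinite)
  have two: "(2 :: 'k) = 0" using of_nat_CHAR[where 'a = 'k] p by simp
  obtain \<sigma> :: "'n \<Rightarrow> 'n" where \<sigma>: "\<And>i. \<sigma> (\<sigma> i) = i" and fix1: "\<And>u v. \<sigma> u = u \<Longrightarrow> \<sigma> v = v \<Longrightarrow> u = v"
    using involution_exists[where 'n = 'n] by blast
  \<comment> \<open>One index from each pair, fixed before any series is given, because f0 must not
    depend on the series. That no index is its own partner is known only in the presence of a
    suitable series.\<close>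
  define T where "T = {i. i = (SOME z. z \<in> {i, \<sigma> i})}"
  let ?f0 = "\<Sum>i\<in>T. mfps_var i * mfps_var (\<sigma> i) :: ('n, 'k) mfps"
  have "f \<sim>\<^sub>r ?f0" if f: "f \<in> mpower 2" and near: "fin_near f" and det: "right_determined k f" for f :: "('n, 'k) mfps" and k
  proof -
    have "polar \<sigma> {} f" by (simp add: polar_def)
    from polar_maximal[of \<sigma>, OF two \<sigma> fix1 this f] obtain g :: "('n, 'k) mfps" and S
      where g: "f \<sim>\<^sub>r g" "polar \<sigma> S g" "\<And>i j. i \<notin> S \<Longrightarrow> hess i j g = 0" by blast
    have g2: "g \<in> mpower 2" by (rule right_equiv_mpower[OF g(1) f])
    have S: "S = UNIV"
      by (rule polar_nondegenerate[of \<sigma>, OF inf p \<sigma> fix1 fin_near_right_equiv[OF near g(1)] g2 g(2,3)])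
    have pol: "polar \<sigma> UNIV g" using g(2) S by simp
    have ne: "\<sigma> i \<noteq> i" and h0: "hess i (\<sigma> i) g \<noteq> 0" for i using pol by (simp_all add: polar_def)
    have T: "i \<in> T \<longleftrightarrow> \<sigma> i \<notin> T" for i
    proof -
      define z where "z = (SOME z. z \<in> {i, \<sigma> i})"
      have "z \<in> {i, \<sigma> i}" unfolding z_def by (rule someI[of _ i]) simp
      moreover have "i \<in> T \<longleftrightarrow> i = z" by (simp add: T_def z_def)
      moreover have "\<sigma> i \<in> T \<longleftrightarrow> \<sigma> i = z" unfolding T_def mem_Collect_eq \<sigma> z_def insert_commute[of i] ..
      ultimately show ?thesis using ne[of i] by auto
    qed
    define Q where "Q = (\<Sum>i\<in>T. cst (mfps_nth g (single i 2)) * (mfps_var i * mfps_var i)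
      + cst (hess i (\<sigma> i) g) * (mfps_var i * mfps_var (\<sigma> i))
      + cst (mfps_nth g (single (\<sigma> i) 2)) * (mfps_var (\<sigma> i) * mfps_var (\<sigma> i)))"
    have gQ: "g - Q \<in> mpower 3" unfolding Q_def by (rule polar_quadratic_part[of g \<sigma> T, OF two g2 pol \<sigma> T])
    obtain \<Phi> where \<Phi>: "\<Phi> \<in> right_group" "\<Phi> Q = ?f0"
      unfolding Q_def using pair_normal_form[of \<sigma> T "\<lambda>i. hess i (\<sigma> i) g" "\<lambda>i. mfps_nth g (single i 2)"
        "\<lambda>i. mfps_nth g (single (\<sigma> i) 2)", OF two \<sigma> T h0] by blast
    note lh = right_group_lhom[OF \<Phi>(1)]
    define f1 where "f1 = \<Phi> g"
    have ff1: "f \<sim>\<^sub>r f1" unfolding f1_def by (rule right_equiv_trans[OF g(1) right_equivI[OF \<Phi>(1)]])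
    have f1: "f1 - ?f0 \<in> mpower 3" using lhom_mem_mpower[OF lh gQ]
      unfolding clin_minus[OF lhom_clin[OF lh]] \<Phi>(2) f1_def .
    have f12: "f1 \<in> mpower 2" by (rule right_equiv_mpower[OF ff1 f])
    have det1: "right_determined k f1"
      by (rule right_determined_right_equiv[OF mpower_mono[OF f] det ff1]) simp
    have df0: "mfps_pderiv k ?f0 = mfps_var (\<sigma> k)" for k
    proof -
      have "mfps_pderiv k ?f0 = (\<Sum>i\<in>T. (if i = k then mfps_var (\<sigma> k) else 0) + (if i = \<sigma> k then mfps_var (\<sigma> k) else 0))"
        unfolding pderiv_sum pderiv_mult pderiv_var by (rule sum.cong) (use \<sigma> ne ne[symmetric] in auto)
      also have "\<dots> = mfps_var (\<sigma> k)" unfolding sum.distrib using T[of k] by (cases "k \<in> T") auto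
      finally show ?thesis .
    qed
    have s3: "Suc (Suc 1) = (3 :: nat)" by simp
    have "jac_covers 1 f1"
    proof (rule jac_coversI)
      fix a :: "'n \<Rightarrow>\<^sub>0 nat" assume "mdeg a = 1"
      then obtain i where a: "a = single i 1" using mdeg_1_eq_single by blast
      have "mfps_pderiv (\<sigma> i) (f1 - ?f0) \<in> mpower (Suc 1)"
        by (rule pderiv_mem_mpower) (use f1 s3 in \<open>simp only:\<close>)
      then have "mfps_pderiv (\<sigma> i) f1 - mfps_var i \<in> mpower (Suc 1)"
        unfolding pderiv_diff df0 \<sigma> .
      from jid_diff[OF jid_pderiv[of "\<sigma> i" f1] jid_mpower[OF this]] show "mon a \<in> jid 1 f1"
        unfolding a var_eq_mon[symmetric] by (simp only: diff_diff_eq2 add_diff_cancel_left')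
    qed
    moreover have "?f0 - f1 \<in> mpower (Suc (2 * 1))" using filt_uminus[OF f1] by simp
    ultimately have "?f0 \<sim>\<^sub>r f1" using finitely_determined[OF f12 _ _ det1, of 1 ?f0] by simp
    then show ?thesis by (rule right_equiv_trans[OF ff1 right_equiv_sym])
  qed
  then show ?thesis by blast
qed

text \<open>All polynomials on the jet space whose nonvanishing locus meets finitely many classes
  are collected in \<open>F\<close>; by the basis theorem finitely many of them have the same common
  zeros. Every series in question is equivalent to its own jet, and that jet is not such a
  zero.\<close>

lemma finite_classes_odd:
  assumes p: "CHAR('k::alg_closed_field) = p" "prime p" "p \<noteq> 2"
  shows "\<exists>\<C> :: ('n::finite, 'k) mfps set. finite \<C> \<and>
    (\<forall>f. f \<in> mpower 2 \<longrightarrow> fin_near f \<longrightarrow> (\<exists>k. right_determined k f) \<longrightarrow> (\<exists>h\<in>\<C>. h \<sim>\<^sub>r f))"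
proof -
  define N where "N = 2 * (p + 9)"
  let ?D = "jet_index N :: ('n \<Rightarrow>\<^sub>0 nat) set"
  have jet_rep: "Abs_mfps (jet N f) \<sim>\<^sub>r f"
    if f: "f \<in> mpower 2" and near: "fin_near f" and det: "right_determined k f" for f :: "('n, 'k) mfps" and k
  proof -
    let ?f' = "Abs_mfps (jet N f) :: ('n, 'k) mfps"
    obtain g :: "('n, 'k) mfps" where g: "f \<sim>\<^sub>r g" "g \<in> mpower 2" "jac_covers (p + 9) g"
      using odd_normal_form[OF p near f] by blast
    obtain \<Phi> where \<Phi>: "\<Phi> \<in> right_group" "g = \<Phi> f" using g(1) unfolding right_equiv_def by blast
    note lh = right_group_lhom[OF \<Phi>(1)]
    have f1: "f \<in> mpower 1" by (rule mpower_mono[OF f]) simp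
    \<comment> \<open>The bound is available for the normal form g only. The automorphism leading to
      g preserves the order of the difference, so the jet can be compared with g after applying
      it.\<close>
    have "?f' - f \<in> mpower (Suc N)"
      by (rule jet_eqD[OF Abs_mem_max[OF jet_mem_affine] f1 jet_Abs_jet[OF jet_mem_affine]])
    from lhom_mem_mpower[OF lh this] have "\<Phi> ?f' - g \<in> mpower (Suc (2 * (p + 9)))"
      unfolding clin_minus[OF lhom_clin[OF lh]] \<Phi>(2) N_def .
    from finitely_determined[OF g(2) _ g(3) right_determined_right_equiv[OF f1 det g(1)] this]
    have "\<Phi> ?f' \<sim>\<^sub>r g" by simp
    then show ?thesis
      by (rule right_equiv_trans[OF right_equivI[OF \<Phi>(1)] right_equiv_trans[OF _ right_equiv_sym[OF g(1)]]])
  qed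
  define F where "F = {G \<in> polyfun. \<exists>\<C> :: ('n, 'k) mfps set. finite \<C> \<and> (\<forall>v\<in>affine_space ?D. G v \<noteq> 0 \<longrightarrow> (\<exists>h\<in>\<C>. h \<sim>\<^sub>r Abs_mfps v))}"
  have "F \<subseteq> polyfun" by (auto simp: F_def)
  from zero_locus_finite[OF finite_jet_index this, of N]
  obtain F0 where F0: "F0 \<subseteq> F" "finite F0" "zero_locus ?D F0 = zero_locus ?D F" by blast
  have "\<forall>G\<in>F0. \<exists>\<C> :: ('n, 'k) mfps set. finite \<C> \<and> (\<forall>v\<in>affine_space ?D. G v \<noteq> 0 \<longrightarrow> (\<exists>h\<in>\<C>. h \<sim>\<^sub>r Abs_mfps v))"
    using F0(1) by (auto simp: F_def)
  then obtain \<C> :: "((('n \<Rightarrow>\<^sub>0 nat) \<Rightarrow> 'k) \<Rightarrow> 'k) \<Rightarrow> ('n, 'k) mfps set"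
    where \<C>: "\<And>G. G \<in> F0 \<Longrightarrow> finite (\<C> G)" "\<And>G v. G \<in> F0 \<Longrightarrow> v \<in> affine_space ?D \<Longrightarrow> G v \<noteq> 0 \<Longrightarrow> \<exists>h\<in>\<C> G. h \<sim>\<^sub>r Abs_mfps v"
    by metis
  have "\<exists>h\<in>(\<Union>G\<in>F0. \<C> G). h \<sim>\<^sub>r f"
    if f: "f \<in> mpower 2" and near: "fin_near f" and det: "right_determined k f" for f :: "('n, 'k) mfps" and k
  proof -
    define v where "v = jet N f"
    have v: "v \<in> affine_space ?D" unfolding v_def by (rule jet_mem_affine)
    have rep: "Abs_mfps v \<sim>\<^sub>r f" unfolding v_def by (rule jet_rep[OF that])
    obtain l H \<D> where H: "H \<in> polyfun" "H (jet l (Abs_mfps v :: ('n, 'k) mfps)) \<noteq> 0" and \<D>: "finite \<D>"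
      "\<And>g :: ('n, 'k) mfps. g \<in> mpower 1 \<Longrightarrow> H (jet l g) \<noteq> 0 \<Longrightarrow> \<exists>h\<in>\<D>. h \<sim>\<^sub>r g"
      using fin_near_right_equiv[OF near right_equiv_sym[OF rep]] unfolding fin_near_def by blast
    \<comment> \<open>The neighbourhood of the jet may be given in another order l; composition with
      the polynomial representative turns its equation into one on jets of order N.\<close>
    define G where "G = (\<lambda>w. H (jet l (Abs_mfps w :: ('n, 'k) mfps)))"
    have "(\<lambda>w. jet l (Abs_mfps w :: ('n, 'k) mfps) a) \<in> polyfun" for a
      by (cases "a \<in> jet_index l") (simp_all add: jet_def polyfun.const polyfun.coord)
    then have "G \<in> polyfun" unfolding G_def by (rule polyfun_compose[OF H(1)])
    moreover have "\<forall>w\<in>affine_space ?D. G w \<noteq> 0 \<longrightarrow> (\<exists>h\<in>\<D>. h \<sim>\<^sub>r Abs_mfps w)"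
    proof (intro ballI impI)
      fix w assume w: "w \<in> affine_space ?D" "G w \<noteq> 0"
      show "\<exists>h\<in>\<D>. h \<sim>\<^sub>r Abs_mfps w" by (rule \<D>(2)[OF Abs_mem_max[OF w(1)] w(2)[unfolded G_def]])
    qed
    ultimately have "G \<in> F" unfolding F_def using \<D>(1) by blast
    moreover have "G v \<noteq> 0" unfolding G_def by (rule H(2))
    ultimately have "v \<notin> zero_locus ?D F" by (auto simp only: zero_locus_def)
    then have "v \<notin> zero_locus ?D F0" by (simp only: F0(3) not_False_eq_True)
    then obtain G' where G': "G' \<in> F0" "G' v \<noteq> 0" using v unfolding zero_locus_def by blast
    obtain h where h: "h \<in> \<C> G'" "h \<sim>\<^sub>r Abs_mfps v" using \<C>(2)[OF G'(1) v G'(2)] by (rule bexE)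
    have "h \<sim>\<^sub>r f" by (rule right_equiv_trans[OF h(2) rep])
    then show ?thesis using G'(1) h(1) by blast
  qed
  moreover have "finite (\<Union>G\<in>F0. \<C> G)" using F0(2) \<C>(1) by blast
  ultimately show ?thesis by blast
qed

lemma right_simple_singularity_near:
  fixes f :: "('n::finite, 'k::field) mfps"
  assumes "f \<in> right_simple_singularities"
  shows "f \<in> mpower 2" "fin_near f" "\<exists>k. right_determined k f"
proof -
  show f: "f \<in> mpower 2" using assms max_ideal_sq_subset by (auto simp: right_simple_singularities_def)
  have "f \<in> mpower 1" by (rule mpower_mono[OF f]) simp
  moreover have "right_simple f" using assms by (simp add: right_simple_singularities_def)
  ultimately show "fin_near f" "\<exists>k. right_determined k f" by (rule right_simple_fin_near)+
qed

text \<open>A member of the quotient is a full class among all series, hence determined by any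
  representative, wherever the representative comes from.\<close>

lemma right_simple_classes_subset:
  fixes \<C> :: "('n::finite, 'k::field) mfps set"
  assumes "\<And>f. f \<in> right_simple_singularities \<Longrightarrow> \<exists>h\<in>\<C>. h \<sim>\<^sub>r f"
  shows "right_simple_classes \<subseteq> (\<lambda>h. {g. h \<sim>\<^sub>r g}) ` \<C>"
proof
  fix C :: "('n, 'k) mfps set" assume "C \<in> right_simple_classes"
  then obtain f :: "('n, 'k) mfps" where f: "f \<in> right_simple_singularities" "C = {g. f \<sim>\<^sub>r g}"
    unfolding right_simple_classes_def quotient_def by auto
  obtain h where h: "h \<in> \<C>" "h \<sim>\<^sub>r f" using assms[OF f(1)] by blast
  have "C = {g. h \<sim>\<^sub>r g}" unfolding f(2)
    using right_equiv_trans[OF h(2)] right_equiv_trans[OF right_equiv_sym[OF h(2)]] by blast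
  then show "C \<in> (\<lambda>h. {g. h \<sim>\<^sub>r g}) ` \<C>" using h(1) by blast
qed

theorem corollary3p4:
  fixes p :: nat
  assumes "CHAR('k::alg_closed_field) = p" and "p > 0"
  shows "finite (right_simple_classes :: ('n::finite, 'k) mfps set set) \<and>
    (p = 2 \<longrightarrow>
       (right_simple_classes :: ('n, 'k) mfps set set) = {} \<or>
       (\<exists>!C. C \<in> (right_simple_classes :: ('n, 'k) mfps set set)))"
proof (cases "p = 2")
  case True
  then obtain f0 :: "('n, 'k) mfps" where f0: "\<And>f. f \<in> mpower 2 \<Longrightarrow> fin_near f \<Longrightarrow> \<exists>k. right_determined k f \<Longrightarrow> f \<sim>\<^sub>r f0"
    using char_2_unique assms(1) by blast
  have "f0 \<sim>\<^sub>r f" if "f \<in> right_simple_singularities" for f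
    by (rule right_equiv_sym[OF f0[OF right_simple_singularity_near[OF that]]])
  then have "(right_simple_classes :: ('n, 'k) mfps set set) \<subseteq> (\<lambda>h. {g. h \<sim>\<^sub>r g}) ` {f0}"
    by (intro right_simple_classes_subset) blast
  then have sub: "(right_simple_classes :: ('n, 'k) mfps set set) \<subseteq> {{g. f0 \<sim>\<^sub>r g}}" by simp
  then have "finite (right_simple_classes :: ('n, 'k) mfps set set)" by (rule finite_subset) simp
  with sub show ?thesis by blast
next
  case False
  have "prime p" using prime_CHAR_semidom[where 'a = 'k] assms by simp
  from finite_classes_odd[OF assms(1) this False] obtain \<C> :: "('n, 'k) mfps set" where \<C>: "finite \<C>"
    "\<And>f. f \<in> mpower 2 \<Longrightarrow> fin_near f \<Longrightarrow> \<exists>k. right_determined k f \<Longrightarrow> \<exists>h\<in>\<C>. h \<sim>\<^sub>r f" by blast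
  have "(right_simple_classes :: ('n, 'k) mfps set set) \<subseteq> (\<lambda>h. {g. h \<sim>\<^sub>r g}) ` \<C>"
    by (rule right_simple_classes_subset) (rule \<C>(2)[OF right_simple_singularity_near])
  then show ?thesis using False finite_subset \<C>(1) by blast
qed

end
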